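(* Let $m,n\geq 1$ be integers. (Direct part.) For every level $(m,n)$ Hermite I oscillator there is a ratio $f$ of two particular solutions which belongs to the family $F_1$, with $m=N_0(f)+1$ and $n=\mu(f)+1$. For every level $(m,n)$ Hermite II oscillator there is a ratio $h$ of two particular solutions such that $f(\lambda):=h(-i\lambda)$ belongs to the family $F_1$, with $m=\mu(f)+1$ and $n=N_0(f)+1$. (Converse part.) If $f$ belongs to the family $F_1$, then $-\frac12\mathcal{S}(f)(\lambda)$ is (the potential of) a level $(N_0(f)+1,\mu(f)+1)$ Hermite I oscillator, and $\frac12\mathcal{S}(f)(i\lambda)$ is (the potential of) a level $(\mu(f)+1,N_0(f)+1)$ Hermite II oscillator; in other words $f(\lambda)$ is the ratio of two solutions of such a Hermite I oscillator and $f(i\lambda)$ is the ratio of two solutions of such a Hermite II oscillator.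
   Context: Oscillators. For $a,b\in\mathbb{C}$, $\theta=(\theta_0,\theta_\infty)$, consider $\psi''=V\psi$ with $$V(\lambda;a,b,\theta)=\lambda^2+2a\lambda+a^2+2(1-\theta_\infty)-\left[b+\left(2\theta_\infty-\tfrac12\right)a\right]\lambda^{-1}+\left(\theta_0^2-\tfrac14\right)\lambda^{-2},$$ $g(\lambda,z)=\frac12\lambda^2+z\lambda$, Stokes sectors $\Omega_k=\{|\arg\lambda-\frac{k\pi}{2}|<\frac\pi4\}$ ($k$ mod 4, so $\Omega_{-1}=\Omega_3$). $\psi_k$ denotes a solution subdominant (exponentially decaying) at $\infty$ in $\Omega_k$, $\psi_+$ the solution subdominant at $0$, $\psi_+\sim\lambda^{\frac12+\theta_0}$ ($\theta_0>0$); $\equiv$ means linear dependence. For $\theta_0\in\frac12\{1,2,\dots\}$ the singularity $\lambda=0$ is apparent if the dominant Frobenius solution at $0$ (exponent $\frac12-\theta_0$) has no logarithmic term. For integers $m,n\ge1$: - the oscillator with $\theta_0=\frac n2$, $\theta_\infty=m+1+\frac n2$ is a level $(m,n)$ Hermite I oscillator if $\lambda=0$ is apparent and $\psi_0\equiv\psi_+$, and furthermore $\psi_0\equiv\psi_2\equiv\lambda^{\frac{n+1}{2}}e^{-g(\lambda,a)}p(\lambda)$ with $p$ a polynomial of degree $m-1$ without repeated roots and $p(0)\ne0$; - the oscillator with $\theta_0=\frac m2$, $\theta_\infty=1-\frac m2-n$ is a level $(m,n)$ Hermite II oscillator if $\lambda=0$ is apparent and $\psi_1\equiv\psi_+$,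 and furthermore $\psi_1\equiv\psi_3\equiv\lambda^{\frac{m+1}{2}}e^{g(\lambda,a)}p(\lambda)$ with $p$ a polynomial of degree $n-1$ without repeated roots and $p(0)\neq0$. Schwarzian derivative: $\mathcal{S}(f)=\frac{f'''}{f'}-\frac32\left(\frac{f''}{f'}\right)^2$. Family $F_1$. A meromorphic function $f:\mathbb{C}\to\mathbb{P}^1$ belongs to $F_1$ if it has a unique critical point and exactly four transcendental singularities (all direct), with two asymptotic values coinciding with the critical value, normalised so that: $\mathcal{S}(f)(\lambda)=-2\lambda^2+\mathcal{O}(\lambda)$ as $\lambda\to\infty$; the critical point is $\lambda=0$; and, denoting by $w_k$ the asymptotic value of $f$ in $\Omega_k$ (limit as $\lambda\to\infty$ in $\Omega_k$ along curves not tangential to the boundary), $w_0=w_2=f(0)=0$, $w_1=i$, $w_{-1}=-i$. The degenerate case in which $\lambda=0$ is a zero of multiplicity one (critical point "of multiplicity $0$", no other critical points) is included. For $f\in F_1$, $\mu(f)$ is the multiplicity of the critical point $\lambda=0$, i.e. $f$ has a zero of order exactly $\mu(f)+1$ at $0$, and $N_0(f)$ is the number of further solutions $\lambda\neq0$ of $f(\lambda)=0$ (all simple). *)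

theory Defs
  imports
    "HOL-Complex_Analysis.Complex_Analysis"
    "HOL-Computational_Algebra.Polynomial"
    "HOL-Library.Landau_Symbols"
begin

section \<open>Anharmonic oscillators\<close>

definition V :: "complex \<Rightarrow> complex \<Rightarrow> complex \<Rightarrow> complex \<Rightarrow> complex \<Rightarrow> complex" where
  "V a b \<theta>0 \<theta>inf z =
     z^2 + 2 * a * z + a^2 + 2 * (1 - \<theta>inf)
     - (b + (2 * \<theta>inf - 1/2) * a) / z + (\<theta>0^2 - 1/4) / z^2"

definition g :: "complex \<Rightarrow> complex \<Rightarrow> complex" where
  "g z c = z^2 / 2 + c * z"

text \<open>
  Solutions of \<open>\<psi>'' = V \<psi>\<close> are multivalued on the punctured plane. We cut the plane along the ray
  of argument \<open>5\<pi>/4\<close>, the common boundary of the Stokes sectors \<open>\<Omega>\<^sub>2\<close> and \<open>\<Omega>\<^sub>3\<close>. The slit plane is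
  simply connected and contains all four Stokes sectors, so that every local solution extends to it.
  When the singularity 0 is apparent and \<open>2 \<theta>\<^sub>0\<close> is an integer, the monodromy around 0 is
  multiplication by \<open>1\<close> or \<open>-1\<close>, and linear dependence does not depend on the choice of the cut.
\<close>

definition slit_plane :: "complex set" where
  "slit_plane = {z. z * cis (- pi / 4) \<notin> \<real>\<^sub>\<le>\<^sub>0}"

definition slit_pow :: "complex \<Rightarrow> complex \<Rightarrow> complex" where
  \<comment> \<open>the branch of \<open>z\<^sup>\<alpha>\<close> on the slit plane with \<open>-3\<pi>/4 < arg z < 5\<pi>/4\<close>\<close>
  "slit_pow z \<alpha> = exp (\<alpha> * (Ln (z * cis (- pi / 4)) + \<i> * of_real (pi / 4)))"

definition solution :: "(complex \<Rightarrow> complex) \<Rightarrow> (complex \<Rightarrow> complex) \<Rightarrow> bool" where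
  "solution W \<psi> \<longleftrightarrow> \<psi> holomorphic_on slit_plane \<and>
     (\<forall>z\<in>slit_plane. deriv (deriv \<psi>) z = W z * \<psi> z)"

definition lin_dep :: "(complex \<Rightarrow> complex) \<Rightarrow> (complex \<Rightarrow> complex) \<Rightarrow> bool" (infix "\<cong>\<^sub>l" 50) where
  "\<psi> \<cong>\<^sub>l \<phi> \<longleftrightarrow>
     (\<exists>c d. (c, d) \<noteq> (0, 0) \<and> (\<forall>z\<in>slit_plane. c * \<psi> z + d * \<phi> z = 0))"

text \<open>
  The Stokes sector \<open>\<Omega>\<^sub>k\<close> is the union of the closed subsectors below over \<open>0 < \<delta> < \<pi>/4\<close>. A curve
  tends to infinity in \<open>\<Omega>\<^sub>k\<close> without being tangential to the boundary iff it eventually stays in one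
  of these, so asymptotic statements in \<open>\<Omega>\<^sub>k\<close> are statements in every closed subsector.
\<close>

definition subsector :: "int \<Rightarrow> real \<Rightarrow> complex set" where
  "subsector k \<delta> = {rcis r t |r t. r > 0 \<and> \<bar>t - of_int k * pi / 2\<bar> \<le> \<delta>}"

definition at_inf_in :: "complex set \<Rightarrow> complex filter" where
  "at_inf_in S = inf at_infinity (principal S)"

definition subdominant_inf :: "(complex \<Rightarrow> complex) \<Rightarrow> int \<Rightarrow> (complex \<Rightarrow> complex) \<Rightarrow> bool" where
  "subdominant_inf W k \<psi> \<longleftrightarrow> solution W \<psi> \<and> (\<exists>z\<in>slit_plane. \<psi> z \<noteq> 0) \<and>
     (\<forall>\<delta>. 0 < \<delta> \<and> \<delta> < pi / 4 \<longrightarrow>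
        (\<exists>c>0. \<psi> \<in> O[at_inf_in (subsector k \<delta>)](\<lambda>z. of_real (exp (- c * norm z)))))"

definition subdominant_zero :: "(complex \<Rightarrow> complex) \<Rightarrow> complex \<Rightarrow> (complex \<Rightarrow> complex) \<Rightarrow> bool" where
  "subdominant_zero W \<theta>0 \<psi> \<longleftrightarrow> solution W \<psi> \<and>
     ((\<lambda>z. \<psi> z / slit_pow z (1/2 + \<theta>0)) \<longlongrightarrow> 1) (at 0 within slit_plane)"

definition apparent :: "(complex \<Rightarrow> complex) \<Rightarrow> complex \<Rightarrow> bool" where
  "apparent W \<theta>0 \<longleftrightarrow>
     (\<exists>\<psi> h r. solution W \<psi> \<and> r > 0 \<and> h holomorphic_on ball 0 r \<and> h 0 = 1 \<and>
        (\<forall>z\<in>slit_plane \<inter> ball 0 r. \<psi> z = slit_pow z (1/2 - \<theta>0) * h z))"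

definition V_I :: "nat \<Rightarrow> nat \<Rightarrow> complex \<Rightarrow> complex \<Rightarrow> complex \<Rightarrow> complex" where
  "V_I m n a b = V a b (of_nat n / 2) (of_nat m + 1 + of_nat n / 2)"

definition V_II :: "nat \<Rightarrow> nat \<Rightarrow> complex \<Rightarrow> complex \<Rightarrow> complex \<Rightarrow> complex" where
  "V_II m n a b = V a b (of_nat m / 2) (1 - of_nat m / 2 - of_nat n)"

definition hermite_I :: "nat \<Rightarrow> nat \<Rightarrow> complex \<Rightarrow> complex \<Rightarrow> bool" where
  "hermite_I m n a b \<longleftrightarrow>
     apparent (V_I m n a b) (of_nat n / 2) \<and>
     (\<exists>\<psi>0 \<psi>2 \<psi>plus p.
        subdominant_inf (V_I m n a b) 0 \<psi>0 \<and>
        subdominant_inf (V_I m n a b) 2 \<psi>2 \<and>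
        subdominant_zero (V_I m n a b) (of_nat n / 2) \<psi>plus \<and>
        \<psi>0 \<cong>\<^sub>l \<psi>plus \<and>
        \<psi>0 \<cong>\<^sub>l \<psi>2 \<and>
        \<psi>0 \<cong>\<^sub>l (\<lambda>z. slit_pow z ((of_nat n + 1) / 2) * exp (- g z a) * poly p z) \<and>
        degree p = m - 1 \<and> rsquarefree p \<and> poly p 0 \<noteq> 0)"

definition hermite_II :: "nat \<Rightarrow> nat \<Rightarrow> complex \<Rightarrow> complex \<Rightarrow> bool" where
  "hermite_II m n a b \<longleftrightarrow>
     apparent (V_II m n a b) (of_nat m / 2) \<and>
     (\<exists>\<psi>1 \<psi>3 \<psi>plus p.
        subdominant_inf (V_II m n a b) 1 \<psi>1 \<and>
        subdominant_inf (V_II m n a b) 3 \<psi>3 \<and>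
        subdominant_zero (V_II m n a b) (of_nat m / 2) \<psi>plus \<and>
        \<psi>1 \<cong>\<^sub>l \<psi>plus \<and>
        \<psi>1 \<cong>\<^sub>l \<psi>3 \<and>
        \<psi>1 \<cong>\<^sub>l (\<lambda>z. slit_pow z ((of_nat m + 1) / 2) * exp (g z a) * poly p z) \<and>
        degree p = n - 1 \<and> rsquarefree p \<and> poly p 0 \<noteq> 0)"

definition ratio_of_solutions :: "(complex \<Rightarrow> complex) \<Rightarrow> (complex \<Rightarrow> complex) \<Rightarrow> bool" where
  "ratio_of_solutions W f \<longleftrightarrow>
     (\<exists>\<psi> \<phi>. solution W \<psi> \<and> solution W \<phi> \<and> \<not> \<psi> \<cong>\<^sub>l \<phi> \<and>
        (\<forall>z\<in>slit_plane. \<phi> z \<noteq> 0 \<longrightarrow> f z = \<psi> z / \<phi> z))"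

section \<open>Meromorphic functions and transcendental singularities\<close>

text \<open>
  A meromorphic function from the plane to the Riemann sphere is a function that is
  \<^const>\<open>nicely_meromorphic_on\<close> \<open>UNIV\<close>; its value at a pole is by convention 0, so that zeros have to
  be distinguished from poles. The Riemann sphere is \<^typ>\<open>complex option\<close>, with \<open>None\<close> for \<open>\<infinity>\<close>.
\<close>

definition sphere_val :: "(complex \<Rightarrow> complex) \<Rightarrow> complex \<Rightarrow> complex option" where
  "sphere_val f z = (if is_pole f z then None else Some (f z))"

fun sphere_disc :: "complex option \<Rightarrow> real \<Rightarrow> complex option set" where
  "sphere_disc (Some w) r = Some ` ball w r"
| "sphere_disc None r = insert None (Some ` {w. norm w > 1 / r})"

text \<open>
  Transcendental singularities of the inverse of \<open>f\<close> in the sense of Iversen: a singularity over \<open>A\<close>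
  is a monotone choice \<open>r \<mapsto> U r\<close> of a component of the preimage of the disc of radius \<open>r\<close> about \<open>A\<close>,
  for all \<open>r > 0\<close>, with empty intersection. Discs are Euclidean (about \<open>\<infinity>\<close>: \<open>|w| > 1/r\<close>);
  any other basis of discs, such as the spherical one, gives corresponding singularities. The values
  of \<open>U\<close> at \<open>r \<le> 0\<close> are fixed so that distinct elements of the set are distinct singularities.
\<close>

definition transc_sings ::
    "(complex \<Rightarrow> complex) \<Rightarrow> (complex option \<times> (real \<Rightarrow> complex set)) set" where
  "transc_sings f = {(A, U).
     (\<forall>r\<le>0. U r = {}) \<and>
     (\<forall>r>0. U r \<in> components (sphere_val f -` sphere_disc A r)) \<and>
     (\<forall>r s. 0 < r \<and> r \<le> s \<longrightarrow> U r \<subseteq> U s) \<and>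
     (\<Inter>r\<in>{0<..}. U r) = {}}"

fun direct_sing :: "(complex \<Rightarrow> complex) \<Rightarrow> complex option \<times> (real \<Rightarrow> complex set) \<Rightarrow> bool" where
  "direct_sing f (A, U) \<longleftrightarrow> (\<exists>r>0. \<forall>z\<in>U r. sphere_val f z \<noteq> A)"

definition critical_points :: "(complex \<Rightarrow> complex) \<Rightarrow> complex set" where
  \<comment> \<open>critical points as a map to the sphere, hence including multiple poles\<close>
  "critical_points f =
     {z. if is_pole f z then zorder f z \<le> - 2 else deriv f z = 0}"

definition schwarzian :: "(complex \<Rightarrow> complex) \<Rightarrow> complex \<Rightarrow> complex" where
  \<comment> \<open>\<^const>\<open>remove_sings\<close> fills in the removable singularities at the simple poles of \<open>f\<close>\<close>
  "schwarzian f = remove_sings (\<lambda>z.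
     (deriv ^^ 3) f z / deriv f z - 3 / 2 * ((deriv ^^ 2) f z / deriv f z)^2)"

definition asymptotic_value :: "(complex \<Rightarrow> complex) \<Rightarrow> int \<Rightarrow> complex \<Rightarrow> bool" where
  "asymptotic_value f k w \<longleftrightarrow>
     (\<forall>\<delta>. 0 < \<delta> \<and> \<delta> < pi / 4 \<longrightarrow> (f \<longlongrightarrow> w) (at_inf_in (subsector k \<delta>)))"

definition F1 :: "(complex \<Rightarrow> complex) set" where
  "F1 = {f. f nicely_meromorphic_on UNIV \<and>
     \<not> is_pole f 0 \<and> f 0 = 0 \<and>
     (critical_points f = {0} \<or> critical_points f = {} \<and> zorder f 0 = 1) \<and>
     card (transc_sings f) = 4 \<and>
     (\<forall>s\<in>transc_sings f. direct_sing f s) \<and>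
     card {s \<in> transc_sings f. fst s = Some (f 0)} = 2 \<and>
     (\<lambda>z. schwarzian f z - (- 2 * z^2)) \<in> O[at_infinity](\<lambda>z. z) \<and>
     asymptotic_value f 0 0 \<and> asymptotic_value f 2 0 \<and>
     asymptotic_value f 1 \<i> \<and> asymptotic_value f (- 1) (- \<i>)}"

definition mu :: "(complex \<Rightarrow> complex) \<Rightarrow> nat" where
  "mu f = nat (zorder f 0) - 1"

definition other_zeros :: "(complex \<Rightarrow> complex) \<Rightarrow> complex set" where
  "other_zeros f = {z. z \<noteq> 0 \<and> \<not> is_pole f z \<and> f z = 0}"

definition N0 :: "(complex \<Rightarrow> complex) \<Rightarrow> nat" where
  "N0 f = card (other_zeros f)"

end

theory Submission
  imports Defs "HOL-Computational_Algebra.Computational_Algebra" "HOL-Real_Asymp.Real_Asymp"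
begin

text \<open>
  Both kinds of Hermite oscillators and the family of meromorphic functions are three views of one
  object: a pair \<open>(U, v)\<close> of entire functions with \<open>U = z\<^sup>n e\<^sup>-\<^sup>g p\<close>, where \<open>p\<close> is a polynomial and
  \<open>p(0) \<noteq> 0\<close>, whose Wronskian \<open>U' v - U v'\<close> is a nonzero multiple of \<open>z ^ (n - 1)\<close>. This is the locale
  \<open>hermite_pair\<close>, and the proof consists of passing from each view to pairs and back.

  The substitution \<open>\<psi> = z ^ ((1 - n) / 2) y\<close> turns \<open>\<psi>'' = V \<psi>\<close> with \<open>\<theta>\<^sub>0 = n / 2\<close> into
  \<open>z y'' = (n - 1) y' + \<Theta> y\<close> with a cubic polynomial \<open>\<Theta>\<close>. The branching disappears: the exponents
  at 0 become 0 and \<open>n\<close>, an apparent singularity is one for which all solutions \<open>y\<close> are entire, and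
  the Wronskian of two solutions is a multiple of \<open>z ^ (n - 1)\<close>. Conversely the Wronskian identity
  alone forces both members of a pair to solve such an equation: it shows that the roots of \<open>p\<close> are
  simple, that \<open>p\<close> divides the polynomial obtained by inserting \<open>U\<close> into the equation, and a
  comparison of leading coefficients leaves exactly the potentials of type I with
  \<open>m = degree p + 1\<close> (lemma \<open>residual_eq\<close>). Thus pairs and oscillators of type I correspond. The second
  member of the pair is \<open>v = U \<integral> z ^ (n - 1) / U\<^sup>2\<close>; the integral has no logarithm at the roots of \<open>p\<close>
  because \<open>U\<close> solves the equation, and none at 0 because 0 is apparent (theorem \<open>exists_hermite_pair\<close>).
  Oscillators of type II become those of type I, with \<open>m\<close> and \<open>n\<close> exchanged, under \<open>z \<mapsto> - i z\<close>.

  From a pair to the family: put \<open>f = U / v\<close>. Since \<open>f' = k z ^ (n - 1) / v\<^sup>2\<close>, the only critical point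
  can be 0, and the zeros of \<open>f\<close> are those of \<open>U\<close>. The reciprocal \<open>v / U\<close> is a primitive of
  \<open>exp ((z + a)\<^sup>2)\<close> times a rational function. In each of the half planes above and below \<open>- a\<close> it
  therefore differs from a constant by a quantity of exact size \<open>exp (Re ((z + a)\<^sup>2)) / |z + a| ^ d\<close>.
  This two-sided estimate (locale \<open>gaussian_ends\<close>) determines the asymptotic values and shows that
  there are exactly four transcendental singularities, all direct, two of them over 0. The two
  constants are different by Liouville's theorem, so replacing \<open>v\<close> by \<open>s v + t U\<close> moves them to
  \<open>- i\<close> and \<open>i\<close> (theorem \<open>hermite_pair_normalise\<close>).

  From the family to a pair: Weierstrass factorisation writes \<open>f = U / v\<close> with entire \<open>U\<close> and \<open>v\<close>. As 0
  is the only possible critical point, the Wronskian is \<open>z ^ (n - 1)\<close> times a function without zeros,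
  and dividing \<open>U\<close> and \<open>v\<close> by a square root of this function makes it equal to \<open>z ^ (n - 1)\<close>. Then
  \<open>U\<close> and \<open>v\<close> solve a common equation with an entire coefficient \<open>\<Theta>\<close>, and the growth of the
  Schwarzian makes \<open>\<Theta>\<close> a cubic polynomial. Because \<open>f\<close> tends to 0 in the sectors around the real
  axis, \<open>U\<close> cannot be exponentially large on a ray there (lemma \<open>small_on_even_ray\<close>). An energy
  estimate along rays then bounds \<open>U exp ((z + a)\<^sup>2 / 2)\<close> by a power of \<open>|z|\<close> in the whole plane
  (theorem \<open>recessive_imp_polynomial\<close>), so this function is a polynomial by Liouville's theorem.
\<close>

section \<open>The slit plane and the removal of the branching\<close>

text \<open>
  The logarithm behind \<^const>\<open>slit_pow\<close>; it turns the rules for powers into rules for \<open>exp\<close>.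
\<close>

definition slit_log :: "complex \<Rightarrow> complex" where
  "slit_log z = Ln (z * cis (- pi / 4)) + \<i> * of_real (pi / 4)"

lemma slit_pow_eq: "slit_pow z \<alpha> = exp (\<alpha> * slit_log z)"
  by (simp add: slit_pow_def slit_log_def)

lemma zero_notin_slit_plane: "0 \<notin> slit_plane"
  by (simp add: slit_plane_def)

lemma exp_slit_log:
  assumes "z \<noteq> 0" shows "exp (slit_log z) = z"
proof -
  have "exp (\<i> * of_real (pi / 4)) = cis (pi / 4)" by (simp add: cis_conv_exp)
  hence "exp (slit_log z) = z * (cis (- pi / 4) * cis (pi / 4))"
    using assms by (simp add: slit_log_def exp_add)
  thus ?thesis by (simp add: cis_mult)
qed

lemma open_slit_plane: "open slit_plane"
proof -
  have "slit_plane = (\<lambda>z. z * cis (- pi / 4)) -` (- \<real>\<^sub>\<le>\<^sub>0)"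
    by (auto simp: slit_plane_def)
  moreover have "open ((\<lambda>z. z * cis (- pi / 4)) -` (- \<real>\<^sub>\<le>\<^sub>0))"
    by (intro open_vimage continuous_intros) (simp add: closed_nonpos_Reals_complex open_Compl)
  ultimately show ?thesis by metis
qed

lemma one_in_slit_plane: "1 \<in> slit_plane"
proof -
  have "Re (cis (- pi / 4)) > 0" by (simp add: cos_45)
  thus ?thesis by (auto simp: slit_plane_def complex_nonpos_Reals_iff)
qed

lemma slit_log_deriv:
  assumes "z \<in> slit_plane" shows "(slit_log has_field_derivative 1 / z) (at z)"
proof -
  have "z \<noteq> 0" using assms zero_notin_slit_plane by auto
  thus ?thesis using assms unfolding slit_log_def slit_plane_def
    by (auto intro!: derivative_eq_intros simp: field_simps)
qed

lemma slit_pow_deriv: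
  assumes "z \<in> slit_plane"
  shows "((\<lambda>z. slit_pow z \<alpha>) has_field_derivative \<alpha> / z * slit_pow z \<alpha>) (at z)"
  unfolding slit_pow_eq using slit_log_deriv[OF assms]
  by (auto intro!: derivative_eq_intros)

lemma holomorphic_slit_pow: "(\<lambda>z. slit_pow z \<alpha>) holomorphic_on slit_plane"
  using slit_pow_deriv by (auto simp: holomorphic_on_def field_differentiable_def intro: has_field_derivative_at_within)

lemma slit_pow_nonzero [simp]: "slit_pow z \<alpha> \<noteq> 0"
  by (simp add: slit_pow_def)

lemma slit_pow_add: "slit_pow z (\<alpha> + \<beta>) = slit_pow z \<alpha> * slit_pow z \<beta>"
  by (simp add: slit_pow_eq exp_add distrib_right)

lemma slit_pow_of_nat: "z \<noteq> 0 \<Longrightarrow> slit_pow z (of_nat n) = z ^ n"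
  by (simp add: slit_pow_eq exp_of_nat_mult exp_slit_log)

lemma norm_slit_pow:
  assumes "z \<noteq> 0" shows "norm (slit_pow z (of_real x)) = norm z powr x"
proof -
  have "norm z = exp (Re (slit_log z))"
    using exp_slit_log[OF assms] by (metis norm_exp_eq_Re)
  thus ?thesis by (simp add: slit_pow_eq powr_def mult.commute)
qed

lemma deriv_slit_pow_mult:
  assumes y: "y holomorphic_on slit_plane" and z: "z \<in> slit_plane"
  shows "deriv (\<lambda>z. slit_pow z \<beta> * y z) z = slit_pow z \<beta> * (deriv y z + \<beta> / z * y z)"
proof -
  have "(y has_field_derivative deriv y z) (at z)"
    using y z open_slit_plane holomorphic_derivI by blast
  thus ?thesis
    by (intro DERIV_imp_deriv) (auto intro!: derivative_eq_intros slit_pow_deriv z simp: algebra_simps)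
qed

lemma deriv2_slit_pow_mult:
  assumes y: "y holomorphic_on slit_plane" and z: "z \<in> slit_plane"
  shows "deriv (deriv (\<lambda>z. slit_pow z \<beta> * y z)) z =
    slit_pow z \<beta> * (deriv (deriv y) z + 2 * \<beta> / z * deriv y z + \<beta> * (\<beta> - 1) / z^2 * y z)"
proof -
  let ?y1 = "\<lambda>z. deriv y z + \<beta> / z * y z"
  have z0: "z \<noteq> 0" using z zero_notin_slit_plane by auto
  have dy: "deriv y holomorphic_on slit_plane"
    using y open_slit_plane holomorphic_deriv by blast
  have y1: "?y1 holomorphic_on slit_plane"
    by (intro holomorphic_intros y dy) (use zero_notin_slit_plane in auto)
  have "eventually (\<lambda>z. z \<in> slit_plane) (nhds z)"
    using open_slit_plane z eventually_nhds by blast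
  then have "deriv (deriv (\<lambda>z. slit_pow z \<beta> * y z)) z = deriv (\<lambda>z. slit_pow z \<beta> * ?y1 z) z"
    by (intro deriv_cong_ev refl) (auto elim!: eventually_mono simp: deriv_slit_pow_mult[OF y])
  also have "\<dots> = slit_pow z \<beta> * (deriv ?y1 z + \<beta> / z * ?y1 z)"
    by (rule deriv_slit_pow_mult[OF y1 z])
  also have "deriv ?y1 z = deriv (deriv y) z + \<beta> / z * deriv y z - \<beta> / z^2 * y z"
  proof -
    have "(y has_field_derivative deriv y z) (at z)"
         "(deriv y has_field_derivative deriv (deriv y) z) (at z)"
      using y dy z open_slit_plane holomorphic_derivI by blast+
    thus ?thesis
      by (intro DERIV_imp_deriv) (use z0 in \<open>auto intro!: derivative_eq_intros simp: field_simps power2_eq_square\<close>)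
  qed
  also have "deriv (deriv y) z + \<beta> / z * deriv y z - \<beta> / z^2 * y z + \<beta> / z * (deriv y z + \<beta> / z * y z) =
      deriv (deriv y) z + 2 * \<beta> / z * deriv y z + \<beta> * (\<beta> - 1) / z^2 * y z"
    using z0 by (simp add: field_simps power2_eq_square)
  finally show ?thesis .
qed

text \<open>
  The exponent \<open>(1 - n) / 2\<close> is the smaller of the two exponents at 0 when \<open>\<theta>\<^sub>0 = n / 2\<close>.
  Factoring it out cancels the double pole of \<open>W\<close>, at the price of a first-order term.
\<close>

lemma solution_slit_pow_iff:
  assumes y: "y holomorphic_on slit_plane"
  shows "solution W (\<lambda>z. slit_pow z ((1 - of_nat n) / 2) * y z) \<longleftrightarrow>
    (\<forall>z\<in>slit_plane. deriv (deriv y) z =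
       (of_nat n - 1) / z * deriv y z + (W z - (of_nat n^2 - 1) / 4 / z^2) * y z)"
proof -
  define \<beta> :: complex where "\<beta> = (1 - of_nat n) / 2"
  have b: "2 * \<beta> = 1 - of_nat n" "\<beta> * (\<beta> - 1) = (of_nat n^2 - 1) / 4"
    by (auto simp: \<beta>_def field_simps power2_eq_square)
  have hol: "(\<lambda>z. slit_pow z \<beta> * y z) holomorphic_on slit_plane"
    by (intro holomorphic_intros holomorphic_slit_pow y)
  have "(deriv (deriv (\<lambda>z. slit_pow z \<beta> * y z)) z = W z * (slit_pow z \<beta> * y z)) \<longleftrightarrow>
     deriv (deriv y) z = (of_nat n - 1) / z * deriv y z + (W z - (of_nat n^2 - 1) / 4 / z^2) * y z"
    if z: "z \<in> slit_plane" for z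
  proof -
    have "(deriv (deriv (\<lambda>z. slit_pow z \<beta> * y z)) z = W z * (slit_pow z \<beta> * y z)) \<longleftrightarrow>
       slit_pow z \<beta> * (deriv (deriv y) z + 2 * \<beta> / z * deriv y z + \<beta> * (\<beta> - 1) / z^2 * y z)
         = slit_pow z \<beta> * (W z * y z)"
      unfolding deriv2_slit_pow_mult[OF y z] by (simp only: mult_ac)
    also have "\<dots> \<longleftrightarrow> deriv (deriv y) z + 2 * \<beta> / z * deriv y z + \<beta> * (\<beta> - 1) / z^2 * y z = W z * y z"
      by simp
    also have "\<dots> \<longleftrightarrow> deriv (deriv y) z = (of_nat n - 1) / z * deriv y z + (W z - (of_nat n^2 - 1) / 4 / z^2) * y z"
      unfolding b by (auto simp: algebra_simps diff_divide_distrib)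
    finally show ?thesis .
  qed
  with hol show ?thesis unfolding solution_def \<beta>_def[symmetric] by auto
qed

section \<open>Primitives of exponentials of quadratic polynomials\<close>

text \<open>
  A majorant \<open>\<phi>\<close> of the derivative along a segment bounds the increment. All later estimates of
  primitives along straight lines are instances.
\<close>

lemma norm_increment_le:
  fixes F F' :: "complex \<Rightarrow> complex"
  assumes t: "0 \<le> t"
    and der: "\<And>u. 0 \<le> u \<Longrightarrow> u \<le> t \<Longrightarrow> (F has_field_derivative F' (w + of_real u * e)) (at (w + of_real u * e))"
    and phi: "\<And>u. 0 \<le> u \<Longrightarrow> u \<le> t \<Longrightarrow> (\<phi> has_real_derivative \<phi>' u) (at u)"
    and bnd: "\<And>u. 0 \<le> u \<Longrightarrow> u \<le> t \<Longrightarrow> norm (F' (w + of_real u * e)) * norm e \<le> \<phi>' u"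
  shows "norm (F (w + of_real t * e) - F w) \<le> \<phi> t - \<phi> 0"
proof (cases "t = 0")
  case False
  have d: "((\<lambda>u. F (w + of_real u * e)) has_vector_derivative e * F' (w + of_real u * e)) (at u)"
    if "0 \<le> u" "u \<le> t" for u
  proof -
    have "((\<lambda>u. w + of_real u * e) has_vector_derivative e) (at u)"
      by (auto intro!: derivative_eq_intros)
    from field_vector_diff_chain_at[OF this der[OF that]] show ?thesis by (simp add: o_def)
  qed
  have "norm (F (w + of_real t * e) - F (w + of_real 0 * e)) \<le> \<phi> t - \<phi> 0"
  proof (rule differentiable_bound_general[where f = "\<lambda>u. F (w + of_real u * e)"])
    show "continuous_on {0..t} (\<lambda>u. F (w + of_real u * e))"
      using d by (intro continuous_at_imp_continuous_on ballI)
        (auto intro!: has_vector_derivative_continuous)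
    show "continuous_on {0..t} \<phi>"
      using phi by (intro continuous_at_imp_continuous_on ballI) (auto intro!: DERIV_isCont)
  next
    fix u assume "0 < u" "u < t"
    then show "((\<lambda>u. F (w + of_real u * e)) has_vector_derivative e * F' (w + of_real u * e)) (at u)"
      by (intro d) auto
    show "(\<phi> has_vector_derivative \<phi>' u) (at u)"
      using phi[of u] \<open>0 < u\<close> \<open>u < t\<close> has_real_derivative_iff_has_vector_derivative by auto
    show "norm (e * F' (w + of_real u * e)) \<le> \<phi>' u"
      using bnd[of u] \<open>0 < u\<close> \<open>u < t\<close> by (simp add: norm_mult mult.commute)
  qed (use False t in auto)
  then show ?thesis by simp
qed auto

lemma norm_le_norm_add_up:
  assumes "0 \<le> Im w" "0 \<le> u"
  shows "norm w \<le> norm (w + of_real u * \<i>)"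
proof -
  have "(Im w)^2 \<le> (Im w + u)^2" using assms by (intro power_mono) auto
  then show ?thesis by (simp add: cmod_def)
qed

text \<open>
  Moving up from \<open>w\<close> in the upper half plane, \<open>Re (w\<^sup>2)\<close> decreases quadratically, so the whole
  increment of \<open>F\<close> is controlled by the bound for its derivative at the starting point.
\<close>

lemma gauss_vertical_increment:
  fixes F F' :: "complex \<Rightarrow> complex"
  assumes \<rho>: "\<rho> > 0" and C: "C \<ge> 0"
    and der: "\<And>w. \<rho> \<le> norm w \<Longrightarrow> (F has_field_derivative F' w) (at w)"
    and bnd: "\<And>w. \<rho> \<le> norm w \<Longrightarrow> norm (F' w) \<le> C * exp (Re (w^2)) / norm w ^ e"
    and w: "\<rho> \<le> norm w" "0 \<le> Im w" and t: "0 \<le> t"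
  shows "norm (F (w + of_real t * \<i>) - F w) \<le> 3 * (C * exp (Re (w^2)) / norm w ^ e)"
proof -
  define B where "B = C * exp (Re (w^2)) / norm w ^ e"
  have B: "B \<ge> 0" using C by (simp add: B_def)
  \<comment> \<open>The majorant uses \<open>u - u\<^sup>2 \<le> 1\<close>, that is \<open>Re ((w + i u)\<^sup>2) \<le> Re (w\<^sup>2) + 1 - u\<close>.\<close>
  have "norm (F (w + of_real t * \<i>) - F w) \<le> (- B * exp (1 - t)) - (- B * exp (1 - 0))"
  proof (rule norm_increment_le[OF t])
    fix u assume u: "0 \<le> u" "u \<le> t"
    have n: "norm w \<le> norm (w + of_real u * \<i>)" by (rule norm_le_norm_add_up) (use w u in auto)
    then show "(F has_field_derivative F' (w + of_real u * \<i>)) (at (w + of_real u * \<i>))"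
      by (intro der) (use w in linarith)
    show "((\<lambda>u. - B * exp (1 - u)) has_real_derivative B * exp (1 - u)) (at u)"
      by (auto intro!: derivative_eq_intros)
    have "norm (F' (w + of_real u * \<i>)) \<le> C * exp (Re ((w + of_real u * \<i>)^2)) / norm (w + of_real u * \<i>) ^ e"
      using n w by (intro bnd) linarith
    also have "\<dots> \<le> C * exp (Re (w^2) + (1 - u)) / norm w ^ e"
    proof (intro frac_le mult_left_mono power_mono n)
      have "0 \<le> Im w * u" using w u by simp
      moreover have "u - u^2 \<le> 1" using zero_le_power2[of "u - 1"] u by (simp add: power2_eq_square algebra_simps)
      ultimately have "Re ((w + of_real u * \<i>)^2) \<le> Re (w^2) + (1 - u)"
        by (simp add: power2_eq_square algebra_simps)
      then show "exp (Re ((w + of_real u * \<i>)^2)) \<le> exp (Re (w^2) + (1 - u))" by simp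
      show "0 < norm w ^ e" using w \<rho> by (intro zero_less_power) linarith
    qed (use C in auto)
    finally show "norm (F' (w + of_real u * \<i>)) * norm \<i> \<le> B * exp (1 - u)"
      by (simp add: B_def exp_add)
  qed
  also have "\<dots> \<le> B * exp 1" using B by simp
  also have "\<dots> \<le> B * 3" by (intro mult_left_mono B exp_le)
  finally show ?thesis by (simp add: B_def mult_ac)
qed

text \<open>
  At height \<open>Y\<close> the integrand carries the factor \<open>exp (- Y\<^sup>2)\<close>, so far up it makes no difference
  on which vertical line one approaches infinity.
\<close>

lemma gauss_horizontal_increment:
  fixes F F' :: "complex \<Rightarrow> complex"
  assumes \<rho>: "\<rho> > 0" and C: "C \<ge> 0"
    and der: "\<And>w. \<rho> \<le> norm w \<Longrightarrow> (F has_field_derivative F' w) (at w)"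
    and bnd: "\<And>w. \<rho> \<le> norm w \<Longrightarrow> norm (F' w) \<le> C * exp (Re (w^2)) / norm w ^ e"
    and Y: "\<rho> \<le> Y"
  shows "norm (F (Complex x Y) - F (Complex 0 Y)) \<le> C * exp (x^2) / \<rho> ^ e * \<bar>x\<bar> * exp (- (Y^2))"
proof -
  define K where "K = C * exp (x^2) / \<rho> ^ e * \<bar>x\<bar> * exp (- (Y^2))"
  have eq: "Complex 0 Y + of_real u * of_real x = Complex (u * x) Y" for u
    by (simp add: complex_eq_iff)
  have "norm (F (Complex 0 Y + of_real 1 * of_real x) - F (Complex 0 Y)) \<le> K * 1 - K * 0"
  proof (rule norm_increment_le)
    fix u :: real assume u: "0 \<le> u" "u \<le> 1"
    have n: "\<rho> \<le> norm (Complex (u * x) Y)"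
      using abs_Im_le_cmod[of "Complex (u * x) Y"] Y \<rho> by simp
    show "(F has_field_derivative F' (Complex 0 Y + of_real u * of_real x)) (at (Complex 0 Y + of_real u * of_real x))"
      unfolding eq using n by (rule der)
    show "((\<lambda>u. K * u) has_real_derivative K) (at u)" by (auto intro!: derivative_eq_intros)
    have "norm (F' (Complex (u * x) Y)) \<le> C * exp (Re ((Complex (u * x) Y)^2)) / norm (Complex (u * x) Y) ^ e"
      by (rule bnd[OF n])
    also have "\<dots> \<le> C * exp (x^2 - Y^2) / \<rho> ^ e"
    proof (intro frac_le mult_left_mono power_mono n)
      have "u^2 * x^2 \<le> 1 * x^2" using u by (intro mult_right_mono) (auto simp: power_le_one)
      then show "exp (Re ((Complex (u * x) Y)^2)) \<le> exp (x^2 - Y^2)"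
        by (simp add: power2_eq_square algebra_simps)
    qed (use C \<rho> in auto)
    finally have "norm (F' (Complex (u * x) Y)) * \<bar>x\<bar> \<le> C * exp (x^2 - Y^2) / \<rho> ^ e * \<bar>x\<bar>"
      by (rule mult_right_mono) simp
    also have "\<dots> = K"
      unfolding K_def by (simp add: exp_diff exp_minus divide_inverse mult_ac)
    finally show "norm (F' (Complex 0 Y + of_real u * of_real x)) * norm (complex_of_real x) \<le> K"
      unfolding eq by simp
  qed auto
  then show ?thesis unfolding eq by (simp add: K_def)
qed

text \<open>
  The limit \<open>A\<close> is taken along the imaginary axis. Any other point is reached by going up to a
  great height, sideways to the axis, and up again; only the first piece contributes in the
  limit.
\<close>

lemma gauss_primitive_limit:
  fixes F F' :: "complex \<Rightarrow> complex"
  assumes \<rho>: "\<rho> > 0" and C: "C \<ge> 0"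
    and der: "\<And>w. \<rho> \<le> norm w \<Longrightarrow> (F has_field_derivative F' w) (at w)"
    and bnd: "\<And>w. \<rho> \<le> norm w \<Longrightarrow> norm (F' w) \<le> C * exp (Re (w^2)) / norm w ^ e"
  obtains A where
    "\<And>w. \<rho> \<le> norm w \<Longrightarrow> 0 \<le> Im w \<Longrightarrow> norm (F w - A) \<le> 3 * (C * exp (Re (w^2)) / norm w ^ e)"
proof -
  have lim0: "(\<lambda>N. exp (- (real N ^ 2))) \<longlonglongrightarrow> 0"
  proof (rule tendsto_sandwich[of "\<lambda>_. 0" _ _ "\<lambda>N. exp (- real N)"])
    show "\<forall>\<^sub>F N in sequentially. exp (- (real N ^ 2)) \<le> exp (- real N)"
    proof (intro always_eventually allI)
      fix N show "exp (- (real N ^ 2)) \<le> exp (- real N)"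
        by (cases N) (auto simp: power2_eq_square algebra_simps)
    qed
    show "(\<lambda>N. exp (- real N)) \<longlonglongrightarrow> 0"
      by (intro filterlim_compose[OF exp_at_bot] filterlim_compose[OF filterlim_uminus_at_bot_at_top] filterlim_real_sequentially)
  qed auto
  define X where "X = (\<lambda>N::nat. F (Complex 0 (real N)))"
  have "Cauchy X"
  proof (rule CauchyI')
    fix \<epsilon> :: real assume "\<epsilon> > 0"
    have "(\<lambda>N. 3 * (C / \<rho> ^ e) * exp (- (real N ^ 2))) \<longlonglongrightarrow> 3 * (C / \<rho> ^ e) * 0"
      by (intro tendsto_intros lim0)
    then have "\<forall>\<^sub>F N in sequentially. 3 * (C / \<rho> ^ e) * exp (- (real N ^ 2)) < \<epsilon>"
      using \<open>\<epsilon> > 0\<close> by (auto dest: order_tendstoD(2))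
    then obtain N0 where N0: "\<And>N. N \<ge> N0 \<Longrightarrow> 3 * (C / \<rho> ^ e) * exp (- (real N ^ 2)) < \<epsilon>"
      by (auto simp: eventually_sequentially)
    show "\<exists>M. \<forall>m\<ge>M. \<forall>n>m. dist (X m) (X n) < \<epsilon>"
    proof (intro exI allI impI)
      fix m n assume m: "m \<ge> max N0 (nat \<lceil>\<rho>\<rceil>)" and n: "n > m"
      have \<rho>m: "\<rho> \<le> real m" using m by linarith
      have nm: "norm (Complex 0 (real m)) = real m" by (simp add: cmod_def)
      have "norm (F (Complex 0 (real m) + of_real (real n - real m) * \<i>) - F (Complex 0 (real m)))
          \<le> 3 * (C * exp (Re ((Complex 0 (real m))^2)) / norm (Complex 0 (real m)) ^ e)"
        by (rule gauss_vertical_increment[OF \<rho> C der bnd]) (use \<rho>m n in \<open>auto simp: nm\<close>)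
      also have "Complex 0 (real m) + of_real (real n - real m) * \<i> = Complex 0 (real n)"
        by (simp add: complex_eq_iff)
      also have "3 * (C * exp (Re ((Complex 0 (real m))^2)) / norm (Complex 0 (real m)) ^ e) =
          3 * (C * exp (- (real m ^ 2)) / real m ^ e)"
        unfolding nm by (simp add: power2_eq_square)
      also have "\<dots> \<le> 3 * (C * exp (- (real m ^ 2)) / \<rho> ^ e)"
        by (intro mult_left_mono divide_left_mono power_mono) (use \<rho> \<rho>m C in auto)
      also have "\<dots> = 3 * (C / \<rho> ^ e) * exp (- (real m ^ 2))" by simp
      also have "\<dots> < \<epsilon>" using m by (intro N0) simp
      finally show "dist (X m) (X n) < \<epsilon>" by (simp add: X_def dist_norm norm_minus_commute)
    qed
  qed
  then obtain A where A: "X \<longlonglongrightarrow> A"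
    using Cauchy_convergent_iff convergent_def by blast
  show ?thesis
  proof (rule that[of A])
    fix w assume w: "\<rho> \<le> norm w" "0 \<le> Im w"
    let ?B = "3 * (C * exp (Re (w^2)) / norm w ^ e)"
    let ?K = "C * exp (Re w^2) / \<rho> ^ e * \<bar>Re w\<bar>"
    have ev: "\<forall>\<^sub>F N in sequentially. norm (F w - A) \<le> ?B + ?K * exp (- (real N ^ 2)) + norm (X N - A)"
      using eventually_ge_at_top[of "nat \<lceil>max \<rho> (Im w)\<rceil>"]
    proof eventually_elim
      case (elim N)
      then have N: "\<rho> \<le> real N" "Im w \<le> real N" by linarith+
      have e: "w + of_real (real N - Im w) * \<i> = Complex (Re w) (real N)"
        by (simp add: complex_eq_iff)
      have "norm (F (Complex (Re w) (real N)) - F w) \<le> ?B"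
        using gauss_vertical_increment[OF \<rho> C der bnd w, of "real N - Im w"] N unfolding e by simp
      moreover have "norm (F (Complex (Re w) (real N)) - X N) \<le> ?K * exp (- (real N ^ 2))"
        unfolding X_def by (rule gauss_horizontal_increment[OF \<rho> C der bnd N(1)])
      ultimately show ?case
        using norm_triangle_ineq[of "(F w - F (Complex (Re w) (real N))) + (F (Complex (Re w) (real N)) - X N)" "X N - A"]
          norm_triangle_ineq[of "F w - F (Complex (Re w) (real N))" "F (Complex (Re w) (real N)) - X N"]
        by (simp add: norm_minus_commute)
    qed
    have "(\<lambda>N. ?B + ?K * exp (- (real N ^ 2)) + norm (X N - A)) \<longlonglongrightarrow> ?B + ?K * 0 + norm (A - A)"
      by (intro tendsto_intros lim0 A)
    then show "norm (F w - A) \<le> ?B"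
      using tendsto_lowerbound[OF _ ev] by simp
  qed
qed

lemma eventually_at_inf_in:
  "eventually P (at_inf_in S) \<longleftrightarrow> (\<exists>\<rho>. \<forall>z\<in>S. \<rho> \<le> norm z \<longrightarrow> P z)"
  by (auto simp: at_inf_in_def eventually_inf_principal eventually_at_infinity)

lemma at_inf_in_le: "at_inf_in S \<le> at_infinity"
  by (simp add: at_inf_in_def)

text \<open>
  Integration by parts: \<open>exp (w\<^sup>2) / q\<close> is the derivative of \<open>exp (w\<^sup>2) / (2 w q)\<close> up to a term
  that is smaller by the factor \<open>1 / w\<^sup>2\<close>, to which the preceding estimate applies. The nonzero
  limit makes the result a two-sided estimate.
\<close>

lemma exp_square_primitive_asymptotics:
  fixes R :: "complex \<Rightarrow> complex" and q :: "complex poly"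
  assumes q: "q \<noteq> 0"
    and der: "\<And>w. \<rho>0 \<le> norm w \<Longrightarrow> (R has_field_derivative exp (w^2) / poly q w) (at w)"
  obtains A where
    "((\<lambda>w. (R w - A) * w ^ (degree q + 1) * exp (- (w^2))) \<longlongrightarrow> inverse (2 * lead_coeff q))
       (at_inf_in {w. 0 \<le> Im w})"
proof -
  \<comment> \<open>The denominator \<open>2 w q\<close> of the boundary term in the integration by parts.\<close>
  define s where "s = [:0, 2:] * q"
  define d where "d = degree q + 1"
  have s0: "s \<noteq> 0" using q by (simp add: s_def)
  have ds: "degree s = d" unfolding s_def using q by (subst degree_mult_eq) (auto simp: d_def)
  have lc: "lead_coeff s = 2 * lead_coeff q" unfolding s_def by (subst lead_coeff_mult) simp
  have ps: "poly s w = 2 * w * poly q w" for w by (simp add: s_def)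
  have dps: "degree (pderiv s) = d - 1" using ds by (simp add: degree_pderiv)
  have l1: "((\<lambda>w. poly s w / w ^ d) \<longlongrightarrow> lead_coeff s) at_infinity"
    using poly_divide_tendsto_aux[of s] ds by simp
  have l2: "((\<lambda>w. poly (pderiv s) w / w ^ (d - 1)) \<longlongrightarrow> lead_coeff (pderiv s)) at_infinity"
    using poly_divide_tendsto_aux[of "pderiv s"] dps by simp
  define L where "L = lead_coeff (pderiv s) / (lead_coeff s)^2"
  have "((\<lambda>w. (poly (pderiv s) w / w ^ (d - 1)) / (poly s w / w ^ d)^2) \<longlongrightarrow> L) at_infinity"
    unfolding L_def by (intro tendsto_intros l1 l2) (use s0 in auto)
  then have "((\<lambda>w. norm ((poly (pderiv s) w / w ^ (d - 1)) / (poly s w / w ^ d)^2)) \<longlongrightarrow> norm L) at_infinity"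
    by (rule tendsto_norm)
  then have "\<forall>\<^sub>F w::complex in at_infinity. norm ((poly (pderiv s) w / w ^ (d - 1)) / (poly s w / w ^ d)^2) < norm L + 1"
    by (rule order_tendstoD) simp
  then obtain \<rho>1 where \<rho>1: "\<And>w. \<rho>1 \<le> norm w \<Longrightarrow> norm ((poly (pderiv s) w / w ^ (d - 1)) / (poly s w / w ^ d)^2) < norm L + 1"
    unfolding eventually_at_infinity by auto
  have "\<forall>\<^sub>F w::complex in at_infinity. poly q w / w ^ degree q \<noteq> 0"
    using q by (intro tendsto_imp_eventually_ne[OF poly_divide_tendsto_aux]) auto
  then have "\<forall>\<^sub>F w::complex in at_infinity. poly q w \<noteq> 0"
    by (rule eventually_mono) auto
  then obtain \<rho>2 where \<rho>2: "\<And>w. \<rho>2 \<le> norm w \<Longrightarrow> poly q w \<noteq> 0"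
    unfolding eventually_at_infinity by auto
  define \<rho> where "\<rho> = Max {\<rho>0, \<rho>1, \<rho>2, 1}"
  have \<rho>: "\<rho> \<ge> \<rho>0" "\<rho> \<ge> \<rho>1" "\<rho> \<ge> \<rho>2" "\<rho> \<ge> 1" by (auto simp: \<rho>_def)
  define C where "C = norm L + 1"
  have sn0: "poly s w \<noteq> 0" and qn0: "poly q w \<noteq> 0" and wn0: "w \<noteq> 0" if "\<rho> \<le> norm w" for w :: complex
    using \<rho>2[of w] \<rho> that by (auto simp: ps)
  have bound: "norm (poly (pderiv s) w / (poly s w)^2) \<le> C / norm w ^ (d + 1)" if w: "\<rho> \<le> norm w" for w :: complex
  proof -
    have w0: "w \<noteq> 0" by (rule wn0[OF w])
    have "(poly (pderiv s) w / w ^ (d - 1)) / (poly s w / w ^ d)^2 = poly (pderiv s) w / (poly s w)^2 * w ^ (d + 1)"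
      using w0 sn0[OF w] by (simp add: d_def field_simps power2_eq_square power_add)
    then have "norm (poly (pderiv s) w / (poly s w)^2) * norm w ^ (d + 1) \<le> C"
      using \<rho>1[of w] \<rho> w by (simp add: C_def norm_mult norm_power norm_divide)
    then show ?thesis using w0 by (simp add: field_simps)
  qed
  define F where "F = (\<lambda>w. R w - exp (w^2) / poly s w)"
  define F' where "F' = (\<lambda>w. exp (w^2) * (poly (pderiv s) w / (poly s w)^2))"
  obtain A where A: "\<And>w. \<rho> \<le> norm w \<Longrightarrow> 0 \<le> Im w \<Longrightarrow>
      norm (F w - A) \<le> 3 * (C * exp (Re (w^2)) / norm w ^ (d + 1))"
  proof (rule gauss_primitive_limit[of \<rho> C F F' "d + 1"])
    fix w :: complex assume w: "\<rho> \<le> norm w"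
    have "(F has_field_derivative exp (w^2) / poly q w -
        (exp (w^2) * (2 * w) * poly s w - exp (w^2) * poly (pderiv s) w) / (poly s w * poly s w)) (at w)"
      unfolding F_def using sn0[OF w] \<rho> w
      by (auto intro!: derivative_eq_intros der poly_DERIV)
    also have "exp (w^2) / poly q w -
        (exp (w^2) * (2 * w) * poly s w - exp (w^2) * poly (pderiv s) w) / (poly s w * poly s w) = F' w"
      using qn0[OF w] wn0[OF w] unfolding F'_def ps by (simp add: field_simps power2_eq_square)
    finally show "(F has_field_derivative F' w) (at w)" .
    show "norm (F' w) \<le> C * exp (Re (w^2)) / norm w ^ (d + 1)"
      using mult_left_mono[OF bound[OF w] exp_ge_zero[of "Re (w^2)"]]
      unfolding F'_def norm_mult norm_exp_eq_Re
      by (simp only: times_divide_eq_right mult.commute[of C])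
  qed (use \<rho> in \<open>auto simp: C_def\<close>)
  have "((\<lambda>w. (F w - A) * w ^ d * exp (- (w^2))) \<longlongrightarrow> 0) (at_inf_in {w. 0 \<le> Im w})"
  proof (rule Lim_null_comparison)
    show "((\<lambda>w::complex. 3 * C * inverse (norm w)) \<longlongrightarrow> 0) (at_inf_in {w. 0 \<le> Im w})"
    proof -
      have "((\<lambda>w::complex. inverse (norm w)) \<longlongrightarrow> 0) at_infinity"
        by (intro tendsto_inverse_0_at_top filterlim_norm_at_top)
      then have "((\<lambda>w::complex. 3 * C * inverse (norm w)) \<longlongrightarrow> 3 * C * 0) at_infinity"
        by (intro tendsto_intros)
      then show ?thesis using tendsto_mono[OF at_inf_in_le] by simp
    qed
    show "\<forall>\<^sub>F w in at_inf_in {w. 0 \<le> Im w}. norm ((F w - A) * w ^ d * exp (- (w^2))) \<le> 3 * C * inverse (norm w)"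
      unfolding eventually_at_inf_in
    proof (intro exI[of _ \<rho>] ballI impI)
      fix w assume w: "w \<in> {w. 0 \<le> Im w}" "\<rho> \<le> norm w"
      have "norm ((F w - A) * w ^ d * exp (- (w^2))) = norm (F w - A) * (norm w ^ d * exp (- Re (w^2)))"
        by (simp add: norm_mult norm_power)
      also have "\<dots> \<le> 3 * (C * exp (Re (w^2)) / norm w ^ (d + 1)) * (norm w ^ d * exp (- Re (w^2)))"
        by (intro mult_right_mono A) (use w in auto)
      also have "\<dots> = 3 * C * inverse (norm w)"
        using wn0[OF w(2)] by (simp add: exp_minus field_simps)
      finally show "norm ((F w - A) * w ^ d * exp (- (w^2))) \<le> 3 * C * inverse (norm w)" .
    qed
  qed
  moreover have "((\<lambda>w. inverse (poly s w / w ^ d)) \<longlongrightarrow> inverse (lead_coeff s)) (at_inf_in {w. 0 \<le> Im w})"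
    using s0 by (intro tendsto_inverse tendsto_mono[OF at_inf_in_le l1]) auto
  ultimately have "((\<lambda>w. (F w - A) * w ^ d * exp (- (w^2)) + inverse (poly s w / w ^ d)) \<longlongrightarrow> 0 + inverse (lead_coeff s))
      (at_inf_in {w. 0 \<le> Im w})"
    by (rule tendsto_add)
  also have "(\<lambda>w. (F w - A) * w ^ d * exp (- (w^2)) + inverse (poly s w / w ^ d)) = (\<lambda>w. (R w - A) * w ^ d * exp (- (w^2)))"
    by (rule ext) (simp add: F_def exp_minus field_simps)
  finally show ?thesis using that[of A] by (simp add: d_def lc)
qed

text \<open>
  Completing the square moves the centre to \<open>- a\<close>.
\<close>

lemma exp_quadratic_primitive_asymptotics_up:
  fixes R :: "complex \<Rightarrow> complex" and q :: "complex poly"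
  assumes q: "q \<noteq> 0"
    and der: "\<And>z. \<rho>0 \<le> norm z \<Longrightarrow> (R has_field_derivative exp (2 * g z a) / poly q z) (at z)"
  obtains A \<kappa> where "\<kappa> \<noteq> 0"
    "((\<lambda>z. (R z - A) * (z + a) ^ (degree q + 1) * exp (- ((z + a)^2))) \<longlongrightarrow> \<kappa>)
       (at_inf_in {z. 0 \<le> Im (z + a)})"
proof -
  define q1 where "q1 = smult (exp (a^2)) (pcompose q [:- a, 1:])"
  have q1: "q1 \<noteq> 0" "degree q1 = degree q"
    using q by (auto simp: q1_def pcompose_eq_0_iff degree_pcompose)
  have d1: "((\<lambda>w. R (w - a)) has_field_derivative exp (w^2) / poly q1 w) (at w)"
    if "\<rho>0 + norm a \<le> norm w" for w
  proof -
    have "norm w \<le> norm (w - a) + norm a" using norm_triangle_ineq[of "w - a" a] by simp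
    then have "(R has_field_derivative exp (2 * g (w - a) a) / poly q (w - a)) (at (w - a))"
      using that by (intro der) simp
    from this have "((\<lambda>w. w - a) has_field_derivative 1) (at w) \<Longrightarrow> ((\<lambda>w. R (w - a)) has_field_derivative exp (2 * g (w - a) a) / poly q (w - a) * 1) (at w)"
      by (rule DERIV_chain2)
    then
    have "((\<lambda>w. R (w - a)) has_field_derivative exp (2 * g (w - a) a) / poly q (w - a)) (at w)"
      by (simp add: DERIV_ident DERIV_diff[OF DERIV_ident DERIV_const, simplified])
    moreover have "exp (2 * g (w - a) a) = exp (w^2) / exp (a^2)"
      by (simp add: g_def exp_diff[symmetric]) (simp add: algebra_simps power2_eq_square)
    ultimately show ?thesis by (simp add: q1_def poly_pcompose)
  qed
  obtain A where A: "((\<lambda>w. (R (w - a) - A) * w ^ (degree q + 1) * exp (- (w^2))) \<longlongrightarrow> inverse (2 * lead_coeff q1))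
       (at_inf_in {w. 0 \<le> Im w})"
    using exp_square_primitive_asymptotics[OF q1(1) d1] q1(2) by metis
  have "filterlim (\<lambda>z. z + a) (at_inf_in {w. 0 \<le> Im w}) (at_inf_in {z. 0 \<le> Im (z + a)})"
    unfolding filterlim_iff eventually_at_inf_in
  proof (intro allI impI)
    fix P assume "\<exists>\<rho>. \<forall>z\<in>{w. 0 \<le> Im w}. \<rho> \<le> norm z \<longrightarrow> P z"
    then obtain \<rho> where *: "\<And>z. 0 \<le> Im z \<Longrightarrow> \<rho> \<le> norm z \<Longrightarrow> P z" by auto
    show "\<exists>\<rho>. \<forall>z\<in>{z. 0 \<le> Im (z + a)}. \<rho> \<le> norm z \<longrightarrow> P (z + a)"
    proof (intro exI[of _ "\<rho> + norm a"] ballI impI)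
      fix z assume z: "z \<in> {z. 0 \<le> Im (z + a)}" "\<rho> + norm a \<le> norm z"
      have "norm z \<le> norm (z + a) + norm a" using norm_triangle_ineq4[of "z + a" a] by simp
      then show "P (z + a)" using z by (intro *) auto
    qed
  qed
  from filterlim_compose[OF A this]
  have "((\<lambda>z. (R z - A) * (z + a) ^ (degree q + 1) * exp (- ((z + a)^2))) \<longlongrightarrow> inverse (2 * lead_coeff q1))
       (at_inf_in {z. 0 \<le> Im (z + a)})" by simp
  moreover have "inverse (2 * lead_coeff q1) \<noteq> 0" using q1(1) by simp
  ultimately show ?thesis by (intro that)
qed

text \<open>
  The substitution \<open>z \<mapsto> - z\<close> exchanges the two half planes. The constant \<open>A\<close> here is in general
  not that of the upper half plane.
\<close>

lemma exp_quadratic_primitive_asymptotics_down: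
  fixes R :: "complex \<Rightarrow> complex" and q :: "complex poly"
  assumes q: "q \<noteq> 0"
    and der: "\<And>z. \<rho>0 \<le> norm z \<Longrightarrow> (R has_field_derivative exp (2 * g z a) / poly q z) (at z)"
  obtains A \<kappa> where "\<kappa> \<noteq> 0"
    "((\<lambda>z. (R z - A) * (z + a) ^ (degree q + 1) * exp (- ((z + a)^2))) \<longlongrightarrow> \<kappa>)
       (at_inf_in {z. Im (z + a) \<le> 0})"
proof -
  define q1 where "q1 = - pcompose q [:0, - 1:]"
  have q1: "q1 \<noteq> 0" "degree q1 = degree q"
    using q by (auto simp: q1_def pcompose_eq_0_iff degree_pcompose)
  have d1: "((\<lambda>z. R (- z)) has_field_derivative exp (2 * g z (- a)) / poly q1 z) (at z)"
    if "\<rho>0 \<le> norm z" for z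
  proof -
    have "(R has_field_derivative exp (2 * g (- z) a) / poly q (- z)) (at (- z))"
      using that by (intro der) simp
    from this have "((\<lambda>z. - z) has_field_derivative - 1) (at z) \<Longrightarrow> ((\<lambda>z. R (- z)) has_field_derivative exp (2 * g (- z) a) / poly q (- z) * (- 1)) (at z)"
      by (rule DERIV_chain2)
    then
    have "((\<lambda>z. R (- z)) has_field_derivative - (exp (2 * g (- z) a) / poly q (- z))) (at z)"
      using DERIV_minus[OF DERIV_ident, of z UNIV] by simp
    then show ?thesis by (simp add: q1_def poly_pcompose g_def)
  qed
  obtain A \<kappa> where A: "\<kappa> \<noteq> 0" "((\<lambda>z. (R (- z) - A) * (z + (- a)) ^ (degree q + 1) * exp (- ((z + (- a))^2))) \<longlongrightarrow> \<kappa>)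
       (at_inf_in {z. 0 \<le> Im (z + (- a))})"
    by (rule exp_quadratic_primitive_asymptotics_up[OF q1(1) d1, unfolded q1(2)])
  have "filterlim uminus (at_inf_in {z. 0 \<le> Im (z + (- a))}) (at_inf_in {z. Im (z + a) \<le> 0})"
    unfolding filterlim_iff eventually_at_inf_in
  proof (intro allI impI)
    fix P assume "\<exists>\<rho>. \<forall>z\<in>{z. 0 \<le> Im (z + (- a))}. \<rho> \<le> norm z \<longrightarrow> P z"
    then obtain \<rho> where *: "\<And>z. 0 \<le> Im (z + (- a)) \<Longrightarrow> \<rho> \<le> norm z \<Longrightarrow> P z" by auto
    show "\<exists>\<rho>. \<forall>z\<in>{z. Im (z + a) \<le> 0}. \<rho> \<le> norm z \<longrightarrow> P (- z)"
      by (intro exI[of _ \<rho>] ballI impI *) auto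
  qed
  from filterlim_compose[OF A(2) this]
  have "((\<lambda>z. (R z - A) * (- z + (- a)) ^ (degree q + 1) * exp (- ((- z + (- a))^2))) \<longlongrightarrow> \<kappa>)
       (at_inf_in {z. Im (z + a) \<le> 0})" by simp
  then have "((\<lambda>z. (-1) ^ (degree q + 1) * ((R z - A) * (- z + (- a)) ^ (degree q + 1) * exp (- ((- z + (- a))^2)))) \<longlongrightarrow> (-1) ^ (degree q + 1) * \<kappa>)
       (at_inf_in {z. Im (z + a) \<le> 0})" by (intro tendsto_intros)
  also have "(\<lambda>z. (-1) ^ (degree q + 1) * ((R z - A) * (- z + (- a)) ^ (degree q + 1) * exp (- ((- z + (- a))^2)))) =
     (\<lambda>z. (R z - A) * (z + a) ^ (degree q + 1) * exp (- ((z + a)^2)))"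
  proof
    fix z
    have "- z + - a = (-1) * (z + a)" by simp
    then show "(-1) ^ (degree q + 1) * ((R z - A) * (- z + (- a)) ^ (degree q + 1) * exp (- ((- z + (- a))^2))) =
       (R z - A) * (z + a) ^ (degree q + 1) * exp (- ((z + a)^2))"
      by (simp only: power_mult_distrib) (simp add: mult.assoc[symmetric] power_mult_distrib[symmetric])
  qed
  finally have "((\<lambda>z. (R z - A) * (z + a) ^ (degree q + 1) * exp (- ((z + a)^2))) \<longlongrightarrow> (-1) ^ (degree q + 1) * \<kappa>)
       (at_inf_in {z. Im (z + a) \<le> 0})" .
  moreover have "(-1) ^ (degree q + 1) * \<kappa> \<noteq> 0" using A(1) by simp
  ultimately show ?thesis by (intro that)
qed

section \<open>Transcendental singularities and tracts\<close>

text \<open>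
  The sets whose components define transcendental singularities over \<open>A\<close>.
\<close>

abbreviation near_value :: "(complex \<Rightarrow> complex) \<Rightarrow> complex option \<Rightarrow> real \<Rightarrow> complex set" where
  "near_value f A r \<equiv> sphere_val f -` sphere_disc A r"

lemma sphere_disc_mono: "0 < r \<Longrightarrow> r \<le> s \<Longrightarrow> sphere_disc A r \<subseteq> sphere_disc A s"
proof (cases A)
  case None
  assume "0 < r" "r \<le> s"
  then have "1 / s \<le> 1 / r" by (simp add: frac_le)
  then show ?thesis using None by (auto simp: image_iff)
qed auto

lemma near_value_mono: "0 < r \<Longrightarrow> r \<le> s \<Longrightarrow> near_value f A r \<subseteq> near_value f A s"
  using sphere_disc_mono by blast

lemma near_value_Some: "z \<in> near_value f (Some w) r \<longleftrightarrow> \<not> is_pole f z \<and> norm (f z - w) < r"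
  by (auto simp: sphere_val_def dist_norm norm_minus_commute)

lemma near_value_None: "z \<in> near_value f None r \<longleftrightarrow> is_pole f z \<or> 1 / r < norm (f z)"
  by (auto simp: sphere_val_def)

text \<open>
  Shrinking the radius by a factor separates the closure of the smaller set from the complement
  of the larger one. Poles need care because the value of the function there is set to 0.
\<close>

lemma near_value_closure:
  assumes f: "f nicely_meromorphic_on UNIV" and r: "0 < r"
    and z: "z \<in> closure (near_value f A (r / 2))"
  shows "z \<in> near_value f A r"
proof (cases "z \<in> near_value f A (r / 2)")
  case True
  then show ?thesis using near_value_mono[of "r / 2" r f A] r by auto
next
  case False
  then have "z islimpt near_value f A (r / 2)" using z by (simp add: closure_def)
  then have freq: "frequently (\<lambda>w. w \<in> near_value f A (r / 2)) (at z)"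
    by (simp add: islimpt_conv_frequently_at)
  show ?thesis
  proof (cases "is_pole f z")
    case pole: True
    show ?thesis
    proof (cases A)
      case None then show ?thesis using pole by (simp add: sphere_val_def)
    next
      case (Some w)
      have "LIM x at z. f x :> at_infinity" using pole by (simp add: is_pole_def)
      then have "eventually (\<lambda>x. norm w + r / 2 \<le> norm (f x)) (at z)"
        unfolding filterlim_at_infinity[OF order_refl] using r
        by (metis add_nonneg_pos half_gt_zero norm_ge_zero filterlim_at_infinity[OF order_refl])
      with freq have "frequently (\<lambda>x. x \<in> near_value f A (r / 2) \<and> norm w + r / 2 \<le> norm (f x)) (at z)"
        using frequently_eventually_conj by (fastforce simp: conj_commute)
      then obtain x where "x \<in> near_value f A (r / 2)" "norm w + r / 2 \<le> norm (f x)"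
        using frequently_ex by blast
      then have False
        using norm_triangle_ineq2[of "f x" w] unfolding Some near_value_Some by linarith
      then show ?thesis ..
    qed
  next
    case np: False
    have lim: "f \<midarrow>z\<rightarrow> f z" using f np by (auto simp: nicely_meromorphic_on_def)
    have fr: "frequently (\<lambda>x. x \<in> near_value f A (r / 2) \<and> norm (f x - f z) < \<epsilon>) (at z)" if "\<epsilon> > 0" for \<epsilon>
    proof -
      have "eventually (\<lambda>x. norm (f x - f z) < \<epsilon>) (at z)" using tendstoD[OF lim that] by (simp add: dist_norm)
      from frequently_eventually_conj[OF freq this] show ?thesis by (simp add: conj_commute)
    qed
    show ?thesis
    proof (cases A)
      case (Some w)
      obtain x where "x \<in> near_value f A (r / 2)" "norm (f x - f z) < r / 2"
        using frequently_ex[OF fr[of "r / 2"]] r by auto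
      then have "norm (f z - w) < r"
        using norm_triangle_ineq4[of "f x - w" "f x - f z"] unfolding Some near_value_Some by simp
      then show ?thesis using np unfolding Some near_value_Some by simp
    next
      case None
      have "eventually (\<lambda>x. f analytic_on {x}) (at z)"
      proof -
        obtain S where "open S" "z \<in> S" "f holomorphic_on S"
          using nicely_meromorphic_on_imp_analytic_at[OF f UNIV_I np] by (auto simp: analytic_at)
        then show ?thesis
          by (intro eventually_mono[OF eventually_at_in_open'[of S z]]) (auto simp: analytic_at)
      qed
      from frequently_ex[OF frequently_eventually_conj[OF fr[of "1 / r"] this]] r
      obtain x where x: "x \<in> near_value f A (r / 2)" "norm (f x - f z) < 1 / r" "f analytic_on {x}"
        by auto
      then have "2 / r < norm (f x)"
        using analytic_at_imp_no_pole unfolding None near_value_None by auto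
      then have "1 / r < norm (f z)"
        using norm_triangle_ineq2[of "f x" "f z"] x(2) by (simp add: field_simps)
      then show ?thesis unfolding None near_value_None by simp
    qed
  qed
qed

lemma transc_sings_component:
  assumes "(A, U) \<in> transc_sings f" "0 < r"
  shows "U r \<noteq> {}" "connected (U r)" "U r \<subseteq> near_value f A r"
    "\<And>x y. x \<in> U r \<Longrightarrow> connected_component (near_value f A r) x y \<Longrightarrow> y \<in> U r"
proof -
  have *: "U r \<in> components (near_value f A r)"
    using assms by (auto simp: transc_sings_def)
  then show "U r \<noteq> {}" "connected (U r)" "U r \<subseteq> near_value f A r"
    using in_components_nonempty in_components_connected in_components_subset by blast+
  show "y \<in> U r" if "x \<in> U r" "connected_component (near_value f A r) x y" for x y
  proof -
    obtain x0 where "U r = connected_component_set (near_value f A r) x0"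
      using * by (auto simp: components_iff)
    then show ?thesis using that by (auto intro: connected_component_trans)
  qed
qed

lemma transc_sings_mono:
  assumes "(A, U) \<in> transc_sings f" "0 < r" "r \<le> s"
  shows "U r \<subseteq> U s"
  using assms by (simp add: transc_sings_def)

text \<open>
  Otherwise the closures of the sets \<open>U r\<close> would meet a fixed disc in a nested family of
  nonempty compact sets. A common point would belong to every \<open>U r\<close> by the preceding separation
  of radii, against the requirement that their intersection is empty.
\<close>

lemma transc_sings_escapes:
  assumes f: "f nicely_meromorphic_on UNIV" and AU: "(A, U) \<in> transc_sings f"
  shows "\<exists>r>0. \<forall>z\<in>U r. \<rho> < norm z"
proof (rule ccontr)
  assume "\<not> ?thesis"
  then have ne: "\<exists>z\<in>U r. norm z \<le> \<rho>" if "r > 0" for r using that by (meson not_less)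
  define K where "K = (\<lambda>n::nat. closure (U (inverse (real (Suc n)))) \<inter> cball 0 \<rho>)"
  have "\<Inter> (range K) \<noteq> {}"
  proof (rule compact_nest)
    show "compact (K n)" for n unfolding K_def by (intro closed_Int_compact) auto
    show "K n \<noteq> {}" for n using ne[of "inverse (real (Suc n))"] closure_subset unfolding K_def by fastforce
    show "K n \<subseteq> K m" if "m \<le> n" for m n
      unfolding K_def by (intro Int_mono closure_mono transc_sings_mono[OF AU]) (use that in \<open>auto simp: field_simps\<close>)
  qed
  then obtain z where z: "\<And>n. z \<in> K n" by auto
  have "z \<in> U r" if r: "r > 0" for r
  proof -
    obtain n where n: "inverse (real (Suc n)) < r / 2"
      using reals_Archimedean[of "r / 2"] r by auto
    let ?r = "inverse (real (Suc n))"
    have zc: "z \<in> closure (U ?r)" using z[of n] by (simp add: K_def)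
    have sub: "U ?r \<subseteq> near_value f A (r / 2)"
      using transc_sings_component(3)[OF AU, of ?r] near_value_mono[of ?r "r / 2" f A] n by fastforce
    then have zr: "z \<in> near_value f A r"
      using near_value_closure[OF f r] zc closure_mono by blast
    have con: "connected (insert z (U ?r))"
      by (rule connected_intermediate_closure[of "U ?r"])
         (use transc_sings_component(2)[OF AU, of ?r] zc closure_subset in auto)
    obtain x where x: "x \<in> U ?r" using transc_sings_component(1)[OF AU, of ?r] by auto
    have "insert z (U ?r) \<subseteq> near_value f A r"
      using zr sub near_value_mono[of "r / 2" r f A] r by auto
    then have "connected_component (near_value f A r) x z"
      unfolding connected_component_def using con x by blast
    moreover have "x \<in> U r" using transc_sings_mono[OF AU, of ?r r] n r x by auto
    ultimately show ?thesis using transc_sings_component(4)[OF AU r] by blast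
  qed
  then have "z \<in> (\<Inter>r\<in>{0<..}. U r)" by auto
  then show False using AU by (auto simp: transc_sings_def)
qed

text \<open>
  The singularity that a curve \<open>\<gamma>\<close> with asymptotic value \<open>A\<close> defines: for each radius the
  component containing the end of the curve.
\<close>

definition tract :: "(complex \<Rightarrow> complex) \<Rightarrow> complex option \<Rightarrow> (real \<Rightarrow> complex) \<Rightarrow> real \<Rightarrow> complex set" where
  "tract f A \<gamma> r = (if r \<le> 0 then {} else
     {z. \<exists>X. \<forall>t\<ge>X. connected_component (near_value f A r) z (\<gamma> t)})"

lemma tract_tail:
  assumes "z \<in> tract f A \<gamma> r"
  obtains t where "t \<ge> X" "connected_component (near_value f A r) z (\<gamma> t)"
proof -
  from assms obtain Y where "\<And>t. t \<ge> Y \<Longrightarrow> connected_component (near_value f A r) z (\<gamma> t)"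
    by (auto simp: tract_def split: if_splits)
  then show ?thesis using that[of "max X Y"] by simp
qed

text \<open>
  A singularity is determined by any curve whose end lies in all its components.
\<close>

lemma tract_unique:
  assumes AU: "(A, U) \<in> transc_sings f"
    and tail: "\<And>r. 0 < r \<Longrightarrow> \<exists>X. \<forall>t\<ge>X. \<gamma> t \<in> U r"
  shows "U = tract f A \<gamma>"
proof
  fix r show "U r = tract f A \<gamma> r"
  proof (cases "r \<le> 0")
    case True then show ?thesis using AU by (auto simp: transc_sings_def tract_def)
  next
    case False
    then have r: "0 < r" by simp
    obtain X where X: "\<And>t. t \<ge> X \<Longrightarrow> \<gamma> t \<in> U r" using tail[OF r] by auto
    note c = transc_sings_component[OF AU r]
    have "connected_component (near_value f A r) x y" if "x \<in> U r" "y \<in> U r" for x y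
      using c that by (auto simp: connected_component_def)
    then have "U r \<subseteq> tract f A \<gamma> r" using X r by (auto simp: tract_def)
    moreover have "tract f A \<gamma> r \<subseteq> U r"
    proof
      fix z assume "z \<in> tract f A \<gamma> r"
      then obtain t where "t \<ge> X" "connected_component (near_value f A r) z (\<gamma> t)"
        by (rule tract_tail)
      then show "z \<in> U r" using c(4)[of "\<gamma> t" z] X[of t] connected_component_sym by auto
    qed
    ultimately show ?thesis by blast
  qed
qed

text \<open>
  A connected set that enters \<open>D\<close> without meeting its frontier stays in \<open>D\<close>. This confines a
  tract once the values of \<open>f\<close> on the frontier of \<open>D\<close> are known to be away from \<open>A\<close>.
\<close>

lemma tract_subset:
  assumes r: "0 < r" and fr: "near_value f A r \<inter> frontier D = {}"
    and X: "\<And>t. t \<ge> X \<Longrightarrow> \<gamma> t \<in> D"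
  shows "tract f A \<gamma> r \<subseteq> D"
proof
  fix z assume "z \<in> tract f A \<gamma> r"
  then obtain t where t: "t \<ge> X" "connected_component (near_value f A r) z (\<gamma> t)"
    by (rule tract_tail)
  then obtain T where T: "connected T" "T \<subseteq> near_value f A r" "z \<in> T" "\<gamma> t \<in> T"
    by (auto simp: connected_component_def)
  show "z \<in> D"
  proof (rule ccontr)
    assume "z \<notin> D"
    then have "T \<inter> frontier D \<noteq> {}"
      using T X[OF t(1)] by (intro connected_Int_frontier) auto
    then show False using T fr by auto
  qed
qed

text \<open>
  The escape condition \<open>esc\<close> is what makes the intersection of the components empty.
\<close>

lemma tract_in_transc_sings:
  assumes cont: "continuous_on UNIV \<gamma>"
    and tail: "\<And>r. 0 < r \<Longrightarrow> \<exists>X. \<forall>t\<ge>X. \<gamma> t \<in> near_value f A r"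
    and esc: "\<And>\<rho>. \<exists>r>0. \<forall>z\<in>tract f A \<gamma> r. \<rho> < norm z"
  shows "(A, tract f A \<gamma>) \<in> transc_sings f"
  unfolding transc_sings_def
proof (clarsimp, intro conjI allI impI)
  show "tract f A \<gamma> r = {}" if "r \<le> 0" for r using that by (simp add: tract_def)
  show "tract f A \<gamma> r \<in> components (near_value f A r)" if r: "0 < r" for r
  proof -
    obtain X where X: "\<And>t. t \<ge> X \<Longrightarrow> \<gamma> t \<in> near_value f A r" using tail[OF r] by auto
    have cc: "connected_component (near_value f A r) (\<gamma> s) (\<gamma> t)" if "s \<ge> X" "t \<ge> X" for s t
    proof -
      have "connected (\<gamma> ` {X..})"
        by (intro connected_continuous_image continuous_on_subset[OF cont]) auto
      moreover have "\<gamma> ` {X..} \<subseteq> near_value f A r" using X by auto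
      ultimately show ?thesis using that by (auto simp: connected_component_def)
    qed
    have "tract f A \<gamma> r = connected_component_set (near_value f A r) (\<gamma> X)"
    proof (intro equalityI subsetI CollectI)
      fix z assume "z \<in> tract f A \<gamma> r"
      then obtain t where "t \<ge> X" "connected_component (near_value f A r) z (\<gamma> t)"
        by (rule tract_tail)
      then show "connected_component (near_value f A r) (\<gamma> X) z"
        using cc[of X t] by (meson connected_component_sym connected_component_trans order_refl)
    next
      fix z assume "z \<in> connected_component_set (near_value f A r) (\<gamma> X)"
      then show "z \<in> tract f A \<gamma> r"
        using cc[OF order_refl] r
        by (auto simp: tract_def intro!: exI[of _ X] intro: connected_component_trans[OF connected_component_sym])
    qed
    then show ?thesis using X by (auto simp: components_iff)
  qed
  show "tract f A \<gamma> r \<subseteq> tract f A \<gamma> s" if rs: "0 < r \<and> r \<le> s" for r s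
  proof
    fix z assume "z \<in> tract f A \<gamma> r"
    then obtain X where X: "\<And>t. t \<ge> X \<Longrightarrow> connected_component (near_value f A r) z (\<gamma> t)"
      using rs by (auto simp: tract_def)
    have "connected_component (near_value f A s) z (\<gamma> t)" if "t \<ge> X" for t
      by (rule connected_component_of_subset[OF X[OF that]]) (use near_value_mono rs in blast)
    then show "z \<in> tract f A \<gamma> s" using rs by (auto simp: tract_def)
  qed
  show "(\<Inter>r\<in>{0<..}. tract f A \<gamma> r) = {}"
  proof (rule equals0I)
    fix z assume z: "z \<in> (\<Inter>r\<in>{0<..}. tract f A \<gamma> r)"
    obtain r where "r > 0" "\<forall>x\<in>tract f A \<gamma> r. norm z < norm x" using esc[of "norm z"] by auto
    then show False using z by blast
  qed
qed

lemma segment_connected_component: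
  fixes x y :: complex
  assumes "closed_segment x y \<subseteq> S" shows "connected_component S x y"
  using assms connected_segment[of x y] ends_in_segment[of x y] unfolding connected_component_def by blast

section \<open>Functions with four Gaussian ends\<close>

text \<open>
  The exact order of magnitude of the deviation of \<open>v / U\<close> from its limit at \<open>z = w - a\<close>.
\<close>

definition gauss_size :: "nat \<Rightarrow> complex \<Rightarrow> real" where
  "gauss_size d w = exp (Re (w^2)) / norm w ^ d"

lemma gauss_size_pos: "w \<noteq> 0 \<Longrightarrow> 0 < gauss_size d w"
  by (simp add: gauss_size_def)

lemma Re_square: "Re (w^2) = (Re w)^2 - (Im w)^2"
  by (simp add: power2_eq_square)

text \<open>
  Vertical motion towards the real axis increases the size. Together with the next monotonicity
  on the real axis this provides paths along which \<open>f\<close> stays near an asymptotic value.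
\<close>

lemma gauss_size_mono_Im:
  assumes "w' \<noteq> 0" "Re w' = Re w" "\<bar>Im w'\<bar> \<le> \<bar>Im w\<bar>"
  shows "gauss_size d w \<le> gauss_size d w'"
  unfolding gauss_size_def
proof (intro frac_le power_mono)
  have sq: "(Im w')^2 \<le> (Im w)^2" using assms(3) by (simp add: abs_le_square_iff)
  then show "exp (Re (w^2)) \<le> exp (Re (w'^2))" using assms(2) by (simp add: Re_square)
  show "norm w' \<le> norm w" using sq assms(2) by (simp add: cmod_def)
qed (use assms in auto)

lemma power_mult_exp_le:
  fixes x :: real
  assumes "real d + 1 \<le> x" shows "x ^ d * exp x \<le> exp (x^2)"
proof -
  have "x \<le> exp x" using exp_ge_add_one_self[of x] by linarith
  then have "x ^ d \<le> exp x ^ d" using assms by (intro power_mono) auto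
  then have "x ^ d * exp x \<le> exp x ^ d * exp x" by simp
  also have "\<dots> = exp ((real d + 1) * x)" by (simp add: exp_of_nat_mult exp_add distrib_right)
  also have "\<dots> \<le> exp (x^2)" using assms mult_right_mono[OF assms, of x] by (simp add: power2_eq_square)
  finally show ?thesis .
qed

lemma gauss_size_real_ge:
  fixes x :: real
  assumes "real d + 1 \<le> \<bar>x\<bar>" shows "exp \<bar>x\<bar> \<le> gauss_size d (of_real x)"
  using power_mult_exp_le[OF assms] assms
  by (simp add: gauss_size_def field_simps power2_eq_square)

text \<open>
  On the real axis the exponential beats the power as soon as \<open>d < 2 x\<^sup>2\<close>; the hypothesis is a
  convenient sufficient condition.
\<close>

lemma gauss_size_real_mono:
  fixes x y :: real
  assumes "real d + 1 \<le> \<bar>x\<bar>" "\<bar>x\<bar> \<le> \<bar>y\<bar>"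
  shows "gauss_size d (of_real x) \<le> gauss_size d (of_real y)"
proof -
  define s t where "s = \<bar>x\<bar>" and "t = \<bar>y\<bar>"
  have s: "real d + 1 \<le> s" "s \<le> t" using assms by (auto simp: s_def t_def)
  have s0: "s > 0" using s by linarith
  have "t / s \<le> exp (t / s - 1)" using exp_ge_add_one_self[of "t / s - 1"] by simp
  then have "(t / s) ^ d \<le> exp (t / s - 1) ^ d" using s s0 by (intro power_mono) auto
  also have "\<dots> = exp (real d * (t / s - 1))" by (simp add: exp_of_nat_mult)
  also have "\<dots> \<le> exp (t^2 - s^2)"
  proof -
    have "real d * (t / s - 1) = (real d / s) * (t - s)" using s0 by (simp add: field_simps)
    also have "\<dots> \<le> (t + s) * (t - s)"
    proof (intro mult_right_mono)
      have "real d / s \<le> 1" using s s0 by simp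
      then show "real d / s \<le> t + s" using s by linarith
    qed (use s in auto)
    finally show ?thesis by (simp add: power2_eq_square algebra_simps)
  qed
  finally have "(t / s) ^ d \<le> exp (t^2 - s^2)" .
  then have "exp (s^2) / s ^ d \<le> exp (t^2) / t ^ d"
    using s s0 by (simp add: field_simps power_divide exp_diff)
  then show ?thesis by (simp add: gauss_size_def s_def t_def power2_eq_square)
qed

lemma gauss_size_le_exp: "1 \<le> norm w \<Longrightarrow> gauss_size d w \<le> exp (Re (w^2))"
  unfolding gauss_size_def by (simp add: divide_le_eq mult_le_cancel_left1)

text \<open>
  A connected set of reals avoiding all points of an arithmetic progression lies in one of its
  gaps.
\<close>

lemma connected_avoiding_progression_bounded:
  fixes S :: "real set"
  assumes S: "connected S" and av: "\<And>k::int. \<theta> + 2 * pi * of_int k \<notin> S"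
  shows "bounded S"
proof (cases "S = {}")
  case False
  then obtain s where s: "s \<in> S" by auto
  define k where "k = \<lfloor>(s - \<theta>) / (2 * pi)\<rfloor>"
  have k: "\<theta> + 2 * pi * of_int k \<le> s" "s \<le> \<theta> + 2 * pi * of_int (k + 1)"
  proof -
    have "of_int k \<le> (s - \<theta>) / (2 * pi)" "(s - \<theta>) / (2 * pi) \<le> of_int (k + 1)"
      unfolding k_def by linarith+
    then show "\<theta> + 2 * pi * of_int k \<le> s" "s \<le> \<theta> + 2 * pi * of_int (k + 1)"
      by (simp_all add: field_simps)
  qed
  have "S \<subseteq> {\<theta> + 2 * pi * of_int k .. \<theta> + 2 * pi * of_int (k + 1)}"
  proof
    fix t assume t: "t \<in> S"
    have "\<not> t < \<theta> + 2 * pi * of_int k"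
      using connectedD_interval[OF S t s, of "\<theta> + 2 * pi * of_int k"] k(1) av[of k] by auto
    moreover have "\<not> \<theta> + 2 * pi * of_int (k + 1) < t"
      using connectedD_interval[OF S s t, of "\<theta> + 2 * pi * of_int (k + 1)"] k(2) av[of "k + 1"] by auto
    ultimately show "t \<in> {\<theta> + 2 * pi * of_int k .. \<theta> + 2 * pi * of_int (k + 1)}" by auto
  qed
  then show ?thesis using bounded_subset bounded_closed_interval by blast
qed auto

text \<open>
  If \<open>exp \<zeta>\<close> stays close to a nonzero constant, \<open>\<zeta>\<close> stays close to one of its logarithms: the
  real part is bounded directly, and the imaginary part cannot jump between the branches on a
  connected set since it never hits the midpoints between them.
\<close>

lemma log_branch_bounded:
  fixes \<zeta> :: "complex \<Rightarrow> complex"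
  assumes U: "connected U" and cont: "continuous_on U \<zeta>"
    and b: "b \<noteq> 0" and \<kappa>: "\<kappa> \<noteq> 0"
    and E: "\<And>z. z \<in> U \<Longrightarrow> norm (E z - b) < norm b / 2"
    and h: "\<And>z. z \<in> U \<Longrightarrow> norm (h z - \<kappa>) < norm \<kappa> / 2"
    and eq: "\<And>z. z \<in> U \<Longrightarrow> exp (\<zeta> z) * h z = E z"
  shows "bounded (\<zeta> ` U)"
proof -
  define l where "l = Ln (b / \<kappa>)"
  have el: "exp l = b / \<kappa>" using b \<kappa> by (simp add: l_def)
  have "connected ((\<lambda>z. Im (\<zeta> z)) ` U)"
    by (intro connected_continuous_image U continuous_intros cont)
  moreover have "Im l + pi + 2 * pi * of_int k \<notin> (\<lambda>z. Im (\<zeta> z)) ` U" for k :: int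
  proof
    assume "Im l + pi + 2 * pi * of_int k \<in> (\<lambda>z. Im (\<zeta> z)) ` U"
    then obtain z where z: "z \<in> U" "Im (\<zeta> z) = Im l + pi + 2 * pi * of_int k" by auto
    define t where "t = exp (Re (\<zeta> z - l))"
    have t: "t > 0" by (simp add: t_def)
    have "exp (\<zeta> z - l) = of_real t * cis (Im (\<zeta> z - l))"
      by (simp add: exp_eq_polar t_def)
    also have "cis (Im (\<zeta> z - l)) = - 1"
    proof -
      have "cis (2 * pi * of_int k) = 1" using cis_multiple_2pi by auto
      moreover have "Im (\<zeta> z - l) = pi + 2 * pi * of_int k" using z by simp
      ultimately show ?thesis by (simp only: cis_mult[symmetric]) simp
    qed
    finally have ez: "exp (\<zeta> z) = - of_real t * exp l" by (simp add: exp_diff field_simps)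
    have "E z / b = - of_real t * exp l * h z / b" using eq[OF z(1)] unfolding ez by simp
    also have "\<dots> = - of_real t * (h z / \<kappa>)" using b by (simp add: el)
    finally have "E z / b = - of_real t * (h z / \<kappa>)" .
    moreover have "Re (- of_real t * q) = - t * Re q" for q by simp
    ultimately have R: "Re (E z / b) = - t * Re (h z / \<kappa>)" by metis
    have "E z / b - 1 = (E z - b) / b" "h z / \<kappa> - 1 = (h z - \<kappa>) / \<kappa>"
      using b \<kappa> by (simp_all add: diff_divide_distrib)
    then have "norm (E z / b - 1) < 1 / 2" "norm (h z / \<kappa> - 1) < 1 / 2"
      using E[OF z(1)] h[OF z(1)] b \<kappa> by (simp_all add: norm_divide field_simps)
    moreover have "0 < Re x" if "norm (x - 1) < 1 / 2" for x
    proof -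
      have "\<bar>Re x - 1\<bar> < 1 / 2" using abs_Re_le_cmod[of "x - 1"] that by simp
      then show ?thesis by linarith
    qed
    ultimately have "Re (E z / b) > 0" "Re (h z / \<kappa>) > 0" by blast+
    then show False using R mult_pos_pos[OF t, of "Re (h z / \<kappa>)"] by simp
  qed
  ultimately have "bounded ((\<lambda>z. Im (\<zeta> z)) ` U)" by (rule connected_avoiding_progression_bounded)
  then obtain K where K: "\<And>z. z \<in> U \<Longrightarrow> \<bar>Im (\<zeta> z)\<bar> \<le> K" by (auto simp: bounded_iff)
  have Re_bd: "\<bar>Re (\<zeta> z)\<bar> \<le> \<bar>ln (norm b / norm \<kappa> / 3)\<bar> + \<bar>ln (norm b / norm \<kappa> * 3)\<bar>" if z: "z \<in> U" for z
  proof -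
    have e: "norm b / 2 \<le> norm (E z)" "norm (E z) \<le> 3 / 2 * norm b"
      using E[OF z] norm_triangle_ineq2[of b "E z"] norm_triangle_ineq2[of "E z" b]
      by (auto simp: norm_minus_commute)
    have hh: "norm \<kappa> / 2 \<le> norm (h z)" "norm (h z) \<le> 3 / 2 * norm \<kappa>"
      using h[OF z] norm_triangle_ineq2[of \<kappa> "h z"] norm_triangle_ineq2[of "h z" \<kappa>]
      by (auto simp: norm_minus_commute)
    have hp: "norm (h z) > 0" using hh(1) \<kappa> by (smt (verit) zero_less_norm_iff half_gt_zero)
    have ex: "exp (Re (\<zeta> z)) = norm (E z) / norm (h z)"
      using arg_cong[OF eq[OF z], of norm] hp by (simp add: norm_mult field_simps)
    have "(norm b / 2) / (3 / 2 * norm \<kappa>) \<le> exp (Re (\<zeta> z))"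
      unfolding ex using e hh hp by (intro frac_le) auto
    then have "ln (norm b / norm \<kappa> / 3) \<le> ln (exp (Re (\<zeta> z)))"
      using b \<kappa> by (subst ln_le_cancel_iff) (auto simp: field_simps)
    then have lo: "ln (norm b / norm \<kappa> / 3) \<le> Re (\<zeta> z)" by simp
    have "exp (Re (\<zeta> z)) \<le> (3 / 2 * norm b) / (norm \<kappa> / 2)"
      unfolding ex using e hh hp \<kappa> by (intro frac_le) auto
    then have hi: "Re (\<zeta> z) \<le> ln (norm b / norm \<kappa> * 3)"
      using b \<kappa> by (subst ln_ge_iff) (auto simp: field_simps)
    show ?thesis using lo hi by linarith
  qed
  have "norm (\<zeta> z) \<le> \<bar>ln (norm b / norm \<kappa> / 3)\<bar> + \<bar>ln (norm b / norm \<kappa> * 3)\<bar> + K" if "z \<in> U" for z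
    using cmod_le[of "\<zeta> z"] Re_bd[OF that] K[OF that] by linarith
  then show ?thesis by (auto simp: bounded_iff)
qed

text \<open>
  The asymptotic shape shared by all quotients \<open>f = U / v\<close> of a pair, with \<open>R = v / U\<close>: outside
  a disc about \<open>- a\<close>, the function \<open>f\<close> is \<open>1 / R\<close>, and \<open>R\<close> deviates from the constant \<open>A \<sigma>\<close> of
  the half plane \<open>\<sigma>\<close> (upper for \<open>\<sigma> = 1\<close>, lower for \<open>\<sigma> = - 1\<close>) by an amount that is known up to a
  bounded factor. Near the real directions the deviation is huge, so \<open>f\<close> is close to 0; near the
  imaginary directions it is tiny, so \<open>f\<close> is close to \<open>1 / A \<sigma>\<close>.
\<close>

locale gaussian_ends =
  fixes f R :: "complex \<Rightarrow> complex" and a :: complex and A \<kappa> :: "real \<Rightarrow> complex"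
    and d :: nat and \<rho> :: real
  assumes f: "f nicely_meromorphic_on UNIV"
    and \<rho>: "real d + 1 \<le> \<rho>"
    and sv: "\<And>z. \<rho> \<le> norm (z + a) \<Longrightarrow> sphere_val f z = (if R z = 0 then None else Some (1 / R z))"
    and near: "\<And>\<sigma> z. \<sigma> \<in> {1, -1} \<Longrightarrow> 0 \<le> \<sigma> * Im (z + a) \<Longrightarrow> \<rho> \<le> norm (z + a) \<Longrightarrow>
        norm ((R z - A \<sigma>) * (z + a) ^ d * exp (- ((z + a)^2)) - \<kappa> \<sigma>) < norm (\<kappa> \<sigma>) / 2"
    and \<kappa>: "\<And>\<sigma>. \<sigma> \<in> {1, -1} \<Longrightarrow> \<kappa> \<sigma> \<noteq> 0"
    and A: "\<And>\<sigma>. \<sigma> \<in> {1, -1} \<Longrightarrow> A \<sigma> \<noteq> 0" "A 1 \<noteq> A (-1)"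
begin

definition c where "c = min (norm (\<kappa> 1)) (norm (\<kappa> (-1))) / 2"
definition C where "C = 2 * max (norm (\<kappa> 1)) (norm (\<kappa> (-1)))"
definition K where "K = max (norm (A 1)) (norm (A (-1)))"

lemma constants: "c > 0" "C > 0" "K \<ge> 0" "\<rho> \<ge> 1"
  using \<kappa>[of 1] \<kappa>[of "-1"] \<rho> by (auto simp: c_def C_def K_def less_max_iff_disj le_max_iff_disj)

lemma A_le_K: "\<sigma> \<in> {1, -1} \<Longrightarrow> norm (A \<sigma>) \<le> K"
  by (auto simp: K_def)

text \<open>
  Closeness to \<open>\<kappa> \<sigma>\<close> within half its modulus gives bounds from both sides.
\<close>

lemma deviation_bounds:
  assumes \<sigma>: "\<sigma> \<in> {1, -1}" "0 \<le> \<sigma> * Im (z + a)" and z: "\<rho> \<le> norm (z + a)"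
  shows "c * gauss_size d (z + a) \<le> norm (R z - A \<sigma>)" "norm (R z - A \<sigma>) \<le> C * gauss_size d (z + a)"
proof -
  let ?w = "z + a" let ?h = "(R z - A \<sigma>) * ?w ^ d * exp (- (?w^2))"
  have w0: "?w \<noteq> 0" using z constants by auto
  note n = near[OF \<sigma> z]
  have h: "norm (\<kappa> \<sigma>) / 2 \<le> norm ?h" "norm ?h \<le> 2 * norm (\<kappa> \<sigma>)"
    using n norm_triangle_ineq2[of "\<kappa> \<sigma>" ?h] norm_triangle_ineq2[of ?h "\<kappa> \<sigma>"] norm_ge_zero[of "\<kappa> \<sigma>"]
    unfolding norm_minus_commute[of "\<kappa> \<sigma>" ?h] by linarith+
  have cC: "c \<le> norm (\<kappa> \<sigma>) / 2" "2 * norm (\<kappa> \<sigma>) \<le> C" using \<sigma> by (auto simp: c_def C_def)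
  have e: "norm ?h * gauss_size d ?w = norm (R z - A \<sigma>)"
  proof -
    have "norm ?h = norm (R z - A \<sigma>) * norm ?w ^ d * exp (- Re (?w^2))"
      by (simp only: norm_mult norm_power norm_exp_eq_Re uminus_complex.simps)
    then show ?thesis using w0 by (simp add: gauss_size_def exp_minus)
  qed
  have g: "0 \<le> gauss_size d ?w" using gauss_size_pos[OF w0] by (rule less_imp_le)
  show "c * gauss_size d ?w \<le> norm (R z - A \<sigma>)"
    unfolding e[symmetric] using h cC by (intro mult_right_mono g) linarith
  show "norm (R z - A \<sigma>) \<le> C * gauss_size d ?w"
    unfolding e[symmetric] using h cC by (intro mult_right_mono g) linarith
qed

lemma sign_cases:
  obtains \<sigma> :: real where "\<sigma> \<in> {1, -1}" "0 \<le> \<sigma> * x"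
  by (cases "0 \<le> x") (use that[of 1] that[of "-1"] in auto)

lemma R_bounds:
  assumes z: "\<rho> \<le> norm (z + a)"
  shows "c * gauss_size d (z + a) - K \<le> norm (R z)" "norm (R z) \<le> C * gauss_size d (z + a) + K"
proof -
  obtain \<sigma> :: real where \<sigma>: "\<sigma> \<in> {1, -1}" "0 \<le> \<sigma> * Im (z + a)" by (rule sign_cases)
  show "c * gauss_size d (z + a) - K \<le> norm (R z)" "norm (R z) \<le> C * gauss_size d (z + a) + K"
    using deviation_bounds[OF \<sigma> z] A_le_K[OF \<sigma>(1)] norm_triangle_ineq4[of "R z" "A \<sigma>"]
      norm_triangle_ineq2[of "R z" "A \<sigma>"] by linarith+
qed

lemma near_zero_iff:
  assumes "\<rho> \<le> norm (z + a)" "0 < r"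
  shows "z \<in> near_value f (Some 0) r \<longleftrightarrow> 1 / r < norm (R z)"
  using sv[OF assms(1)] assms(2) by (auto simp: dist_norm norm_divide field_simps)

text \<open>
  Over a value other than 0 it is easier to work with \<open>R = 1 / f\<close>, which stays finite; here \<open>\<infinity>\<close>
  becomes 0. At \<open>Some 0\<close> division by zero gives the default value 0.
\<close>

definition recip :: "complex option \<Rightarrow> complex" where
  "recip B = (case B of None \<Rightarrow> 0 | Some \<alpha> \<Rightarrow> 1 / \<alpha>)"

lemma near_value_imp_near_recip:
  assumes B: "B \<noteq> Some 0" and \<eta>: "\<eta> > 0"
  shows "\<exists>r>0. \<forall>z. \<rho> \<le> norm (z + a) \<longrightarrow> z \<in> near_value f B r \<longrightarrow> norm (R z - recip B) < \<eta>"
proof (cases B)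
  case None
  show ?thesis
  proof (intro exI[of _ \<eta>] conjI allI impI \<eta>)
    fix z assume z: "\<rho> \<le> norm (z + a)" "z \<in> near_value f B \<eta>"
    then show "norm (R z - recip B) < \<eta>"
      using sv[OF z(1)] \<eta> by (auto simp: None recip_def norm_divide field_simps split: if_splits)
  qed
next
  case (Some \<alpha>)
  then have \<alpha>: "\<alpha> \<noteq> 0" using B by auto
  have "isCont (\<lambda>x::complex. 1 / x) \<alpha>" using \<alpha> by (intro continuous_intros) auto
  then obtain r where r: "r > 0" "\<And>x. norm (x - \<alpha>) < r \<Longrightarrow> norm (1 / x - 1 / \<alpha>) < \<eta>"
    using \<eta> unfolding continuous_at_eps_delta dist_norm by metis
  show ?thesis
  proof (intro exI[of _ r] conjI allI impI r(1))
    fix z assume z: "\<rho> \<le> norm (z + a)" "z \<in> near_value f B r"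
    then have "norm (1 / R z - \<alpha>) < r"
      using sv[OF z(1)] by (auto simp: Some dist_norm norm_minus_commute split: if_splits)
    from r(2)[OF this] show "norm (R z - recip B) < \<eta>" by (simp add: Some recip_def)
  qed
qed

lemma near_recip_imp_near_value:
  assumes \<alpha>: "\<alpha> \<noteq> 0" and r: "r > 0"
  shows "\<exists>\<eta>>0. \<forall>z. \<rho> \<le> norm (z + a) \<longrightarrow> norm (R z - 1 / \<alpha>) < \<eta> \<longrightarrow> z \<in> near_value f (Some \<alpha>) r"
proof -
  have "isCont (\<lambda>x::complex. 1 / x) (1 / \<alpha>)" using \<alpha> by (intro continuous_intros) auto
  then obtain \<eta> where \<eta>0: "\<eta> > 0" "\<And>x. norm (x - 1 / \<alpha>) < \<eta> \<Longrightarrow> norm (1 / x - 1 / (1 / \<alpha>)) < r"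
    using r unfolding continuous_at_eps_delta dist_norm by metis
  then have \<eta>: "\<eta> > 0" "\<And>x. norm (x - 1 / \<alpha>) < \<eta> \<Longrightarrow> norm (1 / x - \<alpha>) < r" by simp_all
  show ?thesis
  proof (intro exI[of _ "min \<eta> (norm (1 / \<alpha>))"] conjI allI impI)
    fix z assume z: "\<rho> \<le> norm (z + a)" "norm (R z - 1 / \<alpha>) < min \<eta> (norm (1 / \<alpha>))"
    then have "R z \<noteq> 0" by auto
    then show "z \<in> near_value f (Some \<alpha>) r"
      using sv[OF z(1)] \<eta>(2)[of "R z"] z(2) by (simp add: dist_norm norm_minus_commute)
  qed (use \<eta> \<alpha> in auto)
qed

text \<open>
  The ray with direction \<open>e\<close> starting at the centre \<open>- a\<close>.
\<close>

definition ray :: "complex \<Rightarrow> real \<Rightarrow> complex" where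
  "ray e t = of_real t * e - a"

lemma continuous_ray: "continuous_on UNIV (ray e)"
  unfolding ray_def by (intro continuous_intros)

lemma frontier_half_disc:
  fixes \<phi> :: "complex \<Rightarrow> real"
  assumes \<phi>: "continuous_on UNIV \<phi>" and D: "D = {z. \<rho>' < norm (z + a) \<and> 0 < \<phi> z}"
    and z: "z \<in> frontier D"
  shows "\<rho>' \<le> norm (z + a)" "0 \<le> \<phi> z" "norm (z + a) = \<rho>' \<or> \<phi> z = 0"
proof -
  have o: "open D" unfolding D
    by (intro open_Collect_conj open_Collect_less continuous_intros \<phi>)
  have "closed {z. \<rho>' \<le> norm (z + a) \<and> 0 \<le> \<phi> z}"
    by (intro closed_Collect_conj closed_Collect_le continuous_intros \<phi>)
  moreover have "D \<subseteq> {z. \<rho>' \<le> norm (z + a) \<and> 0 \<le> \<phi> z}" unfolding D by auto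
  ultimately have "closure D \<subseteq> {z. \<rho>' \<le> norm (z + a) \<and> 0 \<le> \<phi> z}" by (rule closure_minimal[rotated])
  then show 1: "\<rho>' \<le> norm (z + a)" "0 \<le> \<phi> z" using z by (auto simp: frontier_def)
  have "z \<notin> D" using z o by (simp add: frontier_def interior_open)
  then show "norm (z + a) = \<rho>' \<or> \<phi> z = 0" using 1 unfolding D by auto
qed

text \<open>
  On the line through \<open>- a\<close> parallel to the imaginary axis and on the circle the deviation is
  bounded, hence \<open>f\<close> is bounded away from 0, and the tract over 0 cannot cross from one side to
  the other.
\<close>

lemma zero_tract_subset:
  assumes \<epsilon>: "\<epsilon> \<in> {1, -1}" and \<rho>': "\<rho> \<le> \<rho>'"
  shows "\<exists>r>0. tract f (Some 0) (ray (of_real \<epsilon>)) r \<subseteq> {z. \<rho>' < norm (z + a) \<and> 0 < \<epsilon> * Re (z + a)}"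
proof -
  define D where "D = {z. \<rho>' < norm (z + a) \<and> 0 < \<epsilon> * Re (z + a)}"
  have cont: "continuous_on UNIV (\<lambda>z. \<epsilon> * Re (z + a))" by (intro continuous_intros)
  define B where "B = C * exp (\<rho>'^2) + K + 1"
  have B: "B > 0" using constants by (auto simp: B_def intro!: add_nonneg_pos)
  have "near_value f (Some 0) (1 / B) \<inter> frontier D = {}"
  proof (rule equals0I)
    fix z assume z: "z \<in> near_value f (Some 0) (1 / B) \<inter> frontier D"
    have fr: "\<rho>' \<le> norm (z + a)" "norm (z + a) = \<rho>' \<or> \<epsilon> * Re (z + a) = 0"
      using frontier_half_disc[OF cont D_def, of z] z by blast+
    have "Re ((z + a)^2) \<le> \<rho>'^2"
    proof (cases "norm (z + a) = \<rho>'")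
      case True
      then show ?thesis using complex_Re_le_cmod[of "(z + a)^2"] by (simp add: norm_power)
    next
      case False
      then have "Re (z + a) = 0" using fr \<epsilon> by auto
      then show ?thesis unfolding Re_square by (simp add: le_diff_eq add_nonneg_nonneg)
    qed
    then have "gauss_size d (z + a) \<le> exp (\<rho>'^2)"
      using gauss_size_le_exp[of "z + a" d] fr(1) \<rho>' constants(4) by (smt (verit) exp_le_cancel_iff)
    then have "C * gauss_size d (z + a) \<le> C * exp (\<rho>'^2)" using constants by simp
    then have "norm (R z) < B" using R_bounds(2)[of z] fr(1) \<rho>' by (simp add: B_def)
    then show False using z near_zero_iff[of z "1 / B"] fr(1) \<rho>' B by auto
  qed
  moreover have "ray (of_real \<epsilon>) t \<in> D" if "t \<ge> \<rho>' + 1" for t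
    using that \<rho>' constants(4) \<epsilon> by (auto simp: D_def ray_def)
  ultimately have "tract f (Some 0) (ray (of_real \<epsilon>)) (1 / B) \<subseteq> D"
    using B by (intro tract_subset) auto
  then show ?thesis using B unfolding D_def by (intro exI[of _ "1 / B"]) simp
qed

lemma gauss_size_of_real_ray: "\<epsilon> \<in> {1, -1} \<Longrightarrow> gauss_size d (of_real t * of_real \<epsilon>) = gauss_size d (of_real t)"
  by (auto simp: gauss_size_def)

lemma zero_tract_tail:
  assumes \<epsilon>: "\<epsilon> \<in> {1, -1}" and r: "0 < r"
  shows "\<exists>X. \<forall>t\<ge>X. ray (of_real \<epsilon>) t \<in> near_value f (Some 0) r"
proof (intro exI[of _ "max \<rho> ((1 / r + K + 1) / c)"] allI impI)
  fix t assume t: "max \<rho> ((1 / r + K + 1) / c) \<le> t"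
  let ?z = "ray (of_real \<epsilon>) t"
  have w: "?z + a = of_real t * of_real \<epsilon>" by (simp add: ray_def)
  have nw: "\<rho> \<le> norm (?z + a)" using t \<epsilon> unfolding w by auto
  have "t \<le> exp t" using exp_ge_add_one_self[of t] by linarith
  also have "exp t \<le> gauss_size d (?z + a)"
    using gauss_size_real_ge[of d t] t \<rho> constants(4) unfolding w gauss_size_of_real_ray[OF \<epsilon>] by auto
  finally have "(1 / r + K + 1) / c \<le> gauss_size d (?z + a)" using t by simp
  then have "1 / r + K + 1 \<le> c * gauss_size d (?z + a)" using constants(1) by (simp add: field_simps)
  then have "1 / r < norm (R ?z)" using R_bounds(1)[OF nw] by linarith
  then show "?z \<in> near_value f (Some 0) r" using near_zero_iff[OF nw r] by blast
qed

text \<open>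
  The singularity is direct because \<open>f = 1 / R\<close> has no zeros far out.
\<close>

lemma zero_tract_sing:
  assumes \<epsilon>: "\<epsilon> \<in> {1, -1}"
  shows "(Some 0, tract f (Some 0) (ray (of_real \<epsilon>))) \<in> transc_sings f"
    and "direct_sing f (Some 0, tract f (Some 0) (ray (of_real \<epsilon>)))"
proof -
  show "(Some 0, tract f (Some 0) (ray (of_real \<epsilon>))) \<in> transc_sings f"
  proof (intro tract_in_transc_sings continuous_ray zero_tract_tail[OF \<epsilon>])
    fix \<rho>'
    obtain r where "r > 0" "tract f (Some 0) (ray (of_real \<epsilon>)) r \<subseteq> {z. max \<rho> (\<rho>' + norm a) < norm (z + a) \<and> 0 < \<epsilon> * Re (z + a)}"
      using zero_tract_subset[OF \<epsilon>, of "max \<rho> (\<rho>' + norm a)"] by auto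
    moreover have "\<rho>' < norm z" if "max \<rho> (\<rho>' + norm a) < norm (z + a)" for z
      using that norm_triangle_ineq[of z a] by linarith
    ultimately show "\<exists>r>0. \<forall>z\<in>tract f (Some 0) (ray (of_real \<epsilon>)) r. \<rho>' < norm z" by blast
  qed
  obtain r where r: "r > 0" "tract f (Some 0) (ray (of_real \<epsilon>)) r \<subseteq> {z. \<rho> < norm (z + a) \<and> 0 < \<epsilon> * Re (z + a)}"
    using zero_tract_subset[OF \<epsilon> order_refl] by auto
  have "sphere_val f z \<noteq> Some 0" if "z \<in> tract f (Some 0) (ray (of_real \<epsilon>)) r" for z
  proof -
    have "\<rho> \<le> norm (z + a)" using r(2) that by auto
    then show ?thesis using sv by auto
  qed
  then show "direct_sing f (Some 0, tract f (Some 0) (ray (of_real \<epsilon>)))" using r(1) by auto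
qed

text \<open>
  On the line through \<open>- a\<close> parallel to the real axis the deviation is bounded below, which
  separates the tracts over \<open>1 / A \<sigma>\<close> in the upper and lower half planes.
\<close>

lemma limit_tract_subset:
  assumes \<sigma>: "\<sigma> \<in> {1, -1}" and \<rho>': "\<rho> \<le> \<rho>'"
  shows "\<exists>r>0. tract f (Some (1 / A \<sigma>)) (ray (of_real \<sigma> * \<i>)) r \<subseteq> {z. \<rho>' < norm (z + a) \<and> 0 < \<sigma> * Im (z + a)}"
proof -
  define D where "D = {z. \<rho>' < norm (z + a) \<and> 0 < \<sigma> * Im (z + a)}"
  have cont: "continuous_on UNIV (\<lambda>z. \<sigma> * Im (z + a))" by (intro continuous_intros)
  have \<rho>'1: "1 \<le> \<rho>'" using \<rho>' constants by simp
  define \<eta> where "\<eta> = c * (exp (- (\<rho>'^2)) / \<rho>' ^ d)"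
  have \<eta>0: "\<eta> > 0" using constants \<rho>'1 by (simp add: \<eta>_def)
  obtain r where r: "r > 0" "\<And>z. \<rho> \<le> norm (z + a) \<Longrightarrow> z \<in> near_value f (Some (1 / A \<sigma>)) r \<Longrightarrow> norm (R z - A \<sigma>) < \<eta>"
    using near_value_imp_near_recip[of "Some (1 / A \<sigma>)" \<eta>] \<eta>0 A(1)[OF \<sigma>] by (auto simp: recip_def)
  have "near_value f (Some (1 / A \<sigma>)) r \<inter> frontier D = {}"
  proof (rule equals0I)
    fix z assume z: "z \<in> near_value f (Some (1 / A \<sigma>)) r \<inter> frontier D"
    have fr: "\<rho>' \<le> norm (z + a)" "0 \<le> \<sigma> * Im (z + a)" "norm (z + a) = \<rho>' \<or> \<sigma> * Im (z + a) = 0"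
      using frontier_half_disc[OF cont D_def, of z] z by blast+
    have "exp (- (\<rho>'^2)) / \<rho>' ^ d \<le> gauss_size d (z + a)"
    proof (cases "norm (z + a) = \<rho>'")
      case True
      have "- (\<rho>'^2) \<le> Re ((z + a)^2)"
        using abs_Re_le_cmod[of "(z + a)^2"] True by (simp add: norm_power)
      then show ?thesis unfolding gauss_size_def True using \<rho>'1 by (intro divide_right_mono) auto
    next
      case False
      then have im: "Im (z + a) = 0" using fr \<sigma> by auto
      then have e: "z + a = of_real (Re (z + a))" by (simp add: complex_eq_iff)
      then have n: "norm (z + a) = \<bar>Re (z + a)\<bar>" by (metis norm_of_real)
      have "exp (- (\<rho>'^2)) / \<rho>' ^ d \<le> 1 / 1"
        using \<rho>'1 by (intro frac_le) auto
      also have "1 / 1 \<le> exp \<bar>Re (z + a)\<bar>" by simp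
      also have "\<dots> \<le> gauss_size d (z + a)"
        using gauss_size_real_ge[of d "Re (z + a)"] e n fr(1) \<rho>' \<rho> by simp
      finally show ?thesis .
    qed
    then have "\<eta> \<le> c * gauss_size d (z + a)" unfolding \<eta>_def using constants(1) by (intro mult_left_mono) auto
    also have "\<dots> \<le> norm (R z - A \<sigma>)" using deviation_bounds(1)[OF \<sigma> fr(2)] fr(1) \<rho>' by simp
    finally show False using r(2)[of z] z fr(1) \<rho>' by auto
  qed
  moreover have "ray (of_real \<sigma> * \<i>) t \<in> D" if "t \<ge> \<rho>' + 1" for t
    using that \<rho>'1 \<sigma> by (auto simp: D_def ray_def norm_mult)
  ultimately have "tract f (Some (1 / A \<sigma>)) (ray (of_real \<sigma> * \<i>)) r \<subseteq> D"
    by (rule tract_subset[OF r(1)])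
  then show ?thesis using r(1) unfolding D_def by blast
qed

lemma limit_tract_tail:
  assumes \<sigma>: "\<sigma> \<in> {1, -1}" and r: "0 < r"
  shows "\<exists>X. \<forall>t\<ge>X. ray (of_real \<sigma> * \<i>) t \<in> near_value f (Some (1 / A \<sigma>)) r"
proof -
  obtain \<eta> where \<eta>: "\<eta> > 0" "\<And>z. \<rho> \<le> norm (z + a) \<Longrightarrow> norm (R z - A \<sigma>) < \<eta> \<Longrightarrow> z \<in> near_value f (Some (1 / A \<sigma>)) r"
    using near_recip_imp_near_value[of "1 / A \<sigma>" r] A(1)[OF \<sigma>] r by auto
  show ?thesis
  proof (intro exI[of _ "max \<rho> (1 + C / \<eta>)"] allI impI)
    fix t assume t: "max \<rho> (1 + C / \<eta>) \<le> t"
    let ?z = "ray (of_real \<sigma> * \<i>) t"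
    have t1: "1 \<le> t" using t constants by auto
    have w: "?z + a = of_real t * (of_real \<sigma> * \<i>)" by (simp add: ray_def)
    have nw: "norm (?z + a) = t" using t1 \<sigma> unfolding w by (auto simp: norm_mult)
    have im: "0 \<le> \<sigma> * Im (?z + a)" using t1 \<sigma> unfolding w by auto
    have "gauss_size d (?z + a) \<le> exp (Re ((?z + a)^2))"
      using gauss_size_le_exp nw t1 by simp
    also have "Re ((?z + a)^2) = - (t^2)" using \<sigma> unfolding Re_square w by auto
    also have "exp (- (t^2)) \<le> exp (- t)" using t1 by (simp add: power2_eq_square mult_le_cancel_left1)
    finally have "C * gauss_size d (?z + a) \<le> C * exp (- t)" using constants by simp
    also have "\<dots> < \<eta>"
    proof -
      have "C / \<eta> < exp t" using t exp_ge_add_one_self[of t] by linarith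
      then show ?thesis using \<eta>(1) by (simp add: exp_minus field_simps)
    qed
    finally have "norm (R ?z - A \<sigma>) < \<eta>" using deviation_bounds(2)[OF \<sigma> im] nw t by simp
    then show "?z \<in> near_value f (Some (1 / A \<sigma>)) r" using \<eta>(2) nw t by simp
  qed
qed

text \<open>
  The singularity is direct because the lower bound for the deviation is positive, so \<open>R\<close> never
  equals its limit.
\<close>

lemma limit_tract_sing:
  assumes \<sigma>: "\<sigma> \<in> {1, -1}"
  shows "(Some (1 / A \<sigma>), tract f (Some (1 / A \<sigma>)) (ray (of_real \<sigma> * \<i>))) \<in> transc_sings f"
    and "direct_sing f (Some (1 / A \<sigma>), tract f (Some (1 / A \<sigma>)) (ray (of_real \<sigma> * \<i>)))"
proof -
  let ?T = "tract f (Some (1 / A \<sigma>)) (ray (of_real \<sigma> * \<i>))"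
  show "(Some (1 / A \<sigma>), ?T) \<in> transc_sings f"
  proof (intro tract_in_transc_sings continuous_ray limit_tract_tail[OF \<sigma>])
    fix \<rho>'
    obtain r where "r > 0" "?T r \<subseteq> {z. max \<rho> (\<rho>' + norm a) < norm (z + a) \<and> 0 < \<sigma> * Im (z + a)}"
      using limit_tract_subset[OF \<sigma>, of "max \<rho> (\<rho>' + norm a)"] by auto
    moreover have "\<rho>' < norm z" if "max \<rho> (\<rho>' + norm a) < norm (z + a)" for z
      using that norm_triangle_ineq[of z a] by linarith
    ultimately show "\<exists>r>0. \<forall>z\<in>?T r. \<rho>' < norm z" by blast
  qed
  obtain r where r: "r > 0" "?T r \<subseteq> {z. \<rho> < norm (z + a) \<and> 0 < \<sigma> * Im (z + a)}"
    using limit_tract_subset[OF \<sigma> order_refl] by auto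
  have "sphere_val f z \<noteq> Some (1 / A \<sigma>)" if z: "z \<in> ?T r" for z
  proof -
    have z': "\<rho> \<le> norm (z + a)" "0 \<le> \<sigma> * Im (z + a)" using r(2) z by auto
    have "z + a \<noteq> 0" using z' constants by auto
    then have "0 < c * gauss_size d (z + a)" using constants gauss_size_pos by simp
    then have "R z \<noteq> A \<sigma>" using deviation_bounds(1)[OF \<sigma> z'(2,1)] by auto
    then show ?thesis using sv[OF z'(1)] by auto
  qed
  then show "direct_sing f (Some (1 / A \<sigma>), ?T)" using r(1) by auto
qed

lemma norm_shift: "norm z - norm a \<le> norm (z + a)"
  using norm_triangle_ineq4[of "z + a" a] by simp

text \<open>
  The escape to infinity, measured from the centre \<open>- a\<close>.
\<close>

lemma transc_sings_far:
  assumes "(B, U) \<in> transc_sings f"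
  shows "\<exists>r>0. \<forall>z\<in>U r. \<rho>' < norm (z + a)"
proof -
  obtain r where "r > 0" "\<forall>z\<in>U r. \<rho>' + norm a < norm z"
    using transc_sings_escapes[OF f assms, of "\<rho>' + norm a"] by auto
  moreover have "\<rho>' < norm (z + a)" if "\<rho>' + norm a < norm z" for z
    using that norm_shift[of z] by linarith
  ultimately show ?thesis by blast
qed

text \<open>
  From a point where \<open>f\<close> is small one moves vertically to the real direction and then outwards
  along the ray. The size of the deviation never decreases on the way, so \<open>f\<close> stays small.
\<close>

lemma zero_tract_point:
  assumes z: "2 * \<rho> < norm (z + a)" and r: "0 < r"
    and M: "1 \<le> gauss_size d (z + a)" "(1 / r + K + 1) / c \<le> gauss_size d (z + a)"
  shows "\<exists>\<epsilon>\<in>{1, -1}. \<exists>X. \<forall>t\<ge>X. connected_component (near_value f (Some 0) r) z (ray (of_real \<epsilon>) t)"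
proof -
  define x y where "x = Re (z + a)" and "y = Im (z + a)"
  have w: "z + a = Complex x y" by (simp add: x_def y_def complex_eq_iff)
  have far: "z' \<in> near_value f (Some 0) r"
    if "gauss_size d (z + a) \<le> gauss_size d (z' + a)" "\<rho> \<le> norm (z' + a)" for z'
  proof -
    have "(1 / r + K + 1) / c \<le> gauss_size d (z' + a)" using that M by linarith
    then have "1 / r + K + 1 \<le> c * gauss_size d (z' + a)" using constants(1) by (simp add: field_simps)
    then have "1 / r < norm (R z')" using R_bounds(1)[OF that(2)] by linarith
    then show ?thesis using near_zero_iff[OF that(2) r] by blast
  qed
  have xy: "y^2 \<le> x^2"
  proof -
    have "1 \<le> norm (z + a)" using z constants by linarith
    then have "1 \<le> exp (Re ((z + a)^2))" using gauss_size_le_exp[of "z + a" d] M by linarith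
    then have "0 \<le> Re ((z + a)^2)" by simp
    then show ?thesis unfolding Re_square by (simp add: x_def y_def)
  qed
  have xr: "\<rho> \<le> \<bar>x\<bar>"
  proof (rule ccontr)
    assume "\<not> \<rho> \<le> \<bar>x\<bar>"
    then have "\<bar>x\<bar>^2 < \<rho>^2" by (intro power_strict_mono) auto
    moreover have "(2 * \<rho>)^2 = 4 * \<rho>^2" by (simp add: power_mult_distrib)
    ultimately have "x^2 + y^2 < (2 * \<rho>)^2" using xy zero_le_power2[of \<rho>] unfolding power2_abs by linarith
    moreover have "(2 * \<rho>)^2 < (norm (z + a))^2" using z constants(4) by (intro power_strict_mono) auto
    ultimately show False by (simp add: w cmod_def)
  qed
  have x0: "x \<noteq> 0" using xr constants by auto
  define \<epsilon> where "\<epsilon> = sgn x"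
  have \<epsilon>: "\<epsilon> \<in> {1, -1}" "x = \<bar>x\<bar> * \<epsilon>" using x0 by (auto simp: \<epsilon>_def sgn_if)
  define z1 where "z1 = of_real x - a"
  have z1: "z1 = ray (of_real \<epsilon>) \<bar>x\<bar>" using arg_cong[OF \<epsilon>(2), of complex_of_real] by (simp add: z1_def ray_def)
  have c1: "connected_component (near_value f (Some 0) r) z z1"
  proof (rule segment_connected_component, rule subsetI)
    fix z' assume "z' \<in> closed_segment z z1"
    then obtain u where u: "0 \<le> u" "u \<le> 1" "z' = (1 - u) *\<^sub>R z + u *\<^sub>R z1" by (auto simp: in_segment)
    have w': "z' + a = Complex x ((1 - u) * y)"
    proof -
      have "z' + a = (1 - u) *\<^sub>R (z + a) + u *\<^sub>R (z1 + a)"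
        unfolding u(3) by (simp add: scaleR_conv_of_real algebra_simps)
      then show ?thesis unfolding w by (simp add: z1_def complex_eq_iff algebra_simps)
    qed
    have "z' + a \<noteq> 0" using x0 unfolding w' by (simp add: complex_eq_iff)
    moreover have "\<bar>(1 - u) * y\<bar> \<le> \<bar>y\<bar>" using u by (simp add: abs_mult mult_left_le_one_le)
    ultimately show "z' \<in> near_value f (Some 0) r"
      using xr abs_Re_le_cmod[of "z' + a"] by (intro far gauss_size_mono_Im) (auto simp: w w')
  qed
  have M1: "gauss_size d (z + a) \<le> gauss_size d (of_real x)"
    using x0 by (intro gauss_size_mono_Im) (auto simp: w)
  have "connected_component (near_value f (Some 0) r) z1 (ray (of_real \<epsilon>) t)" if t: "t \<ge> \<bar>x\<bar>" for t
  proof (rule segment_connected_component, rule subsetI)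
    fix z' assume "z' \<in> closed_segment z1 (ray (of_real \<epsilon>) t)"
    then obtain u where u: "0 \<le> u" "u \<le> 1" "z' = (1 - u) *\<^sub>R z1 + u *\<^sub>R ray (of_real \<epsilon>) t" by (auto simp: in_segment)
    define s where "s = \<bar>x\<bar> + u * (t - \<bar>x\<bar>)"
    have s: "\<bar>x\<bar> \<le> s" using u t by (simp add: s_def)
    have w': "z' + a = of_real s * of_real \<epsilon>"
      unfolding u(3) z1 by (simp add: ray_def s_def scaleR_conv_of_real algebra_simps)
    have "\<rho> \<le> norm (z' + a)" unfolding w' using s xr \<epsilon>(1) by (auto simp: norm_mult)
    moreover have "gauss_size d (z + a) \<le> gauss_size d (z' + a)"
      unfolding w' gauss_size_of_real_ray[OF \<epsilon>(1)]
      using M1 gauss_size_real_mono[of d x s] s xr \<rho> by linarith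
    ultimately show "z' \<in> near_value f (Some 0) r" by (intro far)
  qed
  then have "connected_component (near_value f (Some 0) r) z (ray (of_real \<epsilon>) t)" if "t \<ge> \<bar>x\<bar>" for t
    using c1 that connected_component_trans by blast
  then show ?thesis using \<epsilon>(1) by blast
qed

text \<open>
  Every component over 0 contains the end of one of the two horizontal rays. The choice of the
  ray might depend on the radius; if one ray fails for some radius, the other serves for all
  smaller ones, hence for all.
\<close>

lemma zero_sing_cases:
  assumes U: "(Some 0, U) \<in> transc_sings f"
  shows "\<exists>\<epsilon>\<in>{1, -1}. U = tract f (Some 0) (ray (of_real \<epsilon>))"
proof -
  obtain r0 where r0: "r0 > 0" "\<And>z. z \<in> U r0 \<Longrightarrow> 2 * \<rho> < norm (z + a)"
    using transc_sings_far[OF U] by blast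
  have ends: "\<exists>\<epsilon>\<in>{1, -1}. \<exists>X. \<forall>t\<ge>X. ray (of_real \<epsilon>) t \<in> U r" if r: "r > 0" for r
  proof -
    \<comment> \<open>A value of \<open>|R|\<close> above this bound forces the deviation to be large enough for the path.\<close>
    define B where "B = K + C * max 1 ((1 / r + K + 1) / c)"
    have B: "B > 0" using constants by (auto simp: B_def intro!: add_nonneg_pos mult_pos_pos)
    define r' where "r' = min r0 (min r (1 / B))"
    have r': "r' > 0" "r' \<le> r0" "r' \<le> r" "r' \<le> 1 / B" using r0 r B by (auto simp: r'_def)
    obtain z where z: "z \<in> U r'" using transc_sings_component(1)[OF U r'(1)] by auto
    have zf: "2 * \<rho> < norm (z + a)" using r0(2) transc_sings_mono[OF U r'(1,2)] z by auto
    then have zf': "\<rho> \<le> norm (z + a)" using constants by linarith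
    have "1 / r' < norm (R z)"
      using transc_sings_component(3)[OF U r'(1)] z near_zero_iff[OF zf' r'(1)] by blast
    moreover have "B \<le> 1 / r'" using r' B by (simp add: field_simps)
    ultimately have "B < C * gauss_size d (z + a) + K" using R_bounds(2)[OF zf'] by linarith
    then have "max 1 ((1 / r + K + 1) / c) \<le> gauss_size d (z + a)"
      using constants(2) by (simp add: B_def)
    then have "\<exists>\<epsilon>\<in>{1, -1}. \<exists>X. \<forall>t\<ge>X. connected_component (near_value f (Some 0) r) z (ray (of_real \<epsilon>) t)"
      by (intro zero_tract_point[OF zf r]) auto
    moreover have "z \<in> U r" using transc_sings_mono[OF U r'(1,3)] z by auto
    ultimately show ?thesis using transc_sings_component(4)[OF U r] by blast
  qed
  show ?thesis
  proof (cases "\<forall>r>0. \<exists>X. \<forall>t\<ge>X. ray (of_real 1) t \<in> U r")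
    case True
    then show ?thesis by (intro bexI[of _ 1] tract_unique[OF U]) auto
  next
    case False
    then obtain r1 where r1: "r1 > 0" "\<not> (\<exists>X. \<forall>t\<ge>X. ray (of_real 1) t \<in> U r1)" by auto
    have "\<exists>X. \<forall>t\<ge>X. ray (of_real (-1)) t \<in> U r" if r: "r > 0" for r
    proof -
      have m: "min r r1 > 0" using r r1 by simp
      have "U (min r r1) \<subseteq> U r1" "U (min r r1) \<subseteq> U r"
        by (auto intro!: transc_sings_mono[OF U m])
      then show ?thesis using ends[OF m] r1(2) by fast
    qed
    then show ?thesis by (intro bexI[of _ "-1"] tract_unique[OF U]) auto
  qed
qed

text \<open>
  On the real direction \<open>f\<close> is close to 0, so a singularity over another value cannot cross it.
\<close>

lemma far_half_plane:
  assumes U: "(B, U) \<in> transc_sings f" and B: "B \<noteq> Some 0"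
  shows "\<exists>r>0. \<exists>\<sigma>\<in>{1, -1}. \<forall>z\<in>U r. \<rho> \<le> norm (z + a) \<and> 0 < \<sigma> * Im (z + a)"
proof -
  define L where "L = norm (recip B) + 1"
  define \<rho>' where "\<rho>' = max \<rho> ((L + K) / c)"
  obtain r1 where r1: "r1 > 0" "\<And>z. z \<in> U r1 \<Longrightarrow> \<rho>' < norm (z + a)"
    using transc_sings_far[OF U] by blast
  obtain r2 where r2: "r2 > 0" "\<And>z. \<rho> \<le> norm (z + a) \<Longrightarrow> z \<in> near_value f B r2 \<Longrightarrow> norm (R z - recip B) < 1"
    using near_value_imp_near_recip[OF B, of 1] by auto
  define r where "r = min r1 r2"
  have r: "r > 0" "r \<le> r1" "r \<le> r2" using r1 r2 by (auto simp: r_def)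
  have zr: "\<rho>' < norm (z + a)" if "z \<in> U r" for z
    using r1 transc_sings_mono[OF U r(1,2)] that by blast
  have Im0: "Im (z + a) \<noteq> 0" if z: "z \<in> U r" for z
  proof
    assume im: "Im (z + a) = 0"
    then have e: "z + a = of_real (Re (z + a))" by (simp add: complex_eq_iff)
    then have n: "norm (z + a) = \<bar>Re (z + a)\<bar>" by (metis norm_of_real)
    have z': "\<rho> \<le> norm (z + a)" using zr[OF z] by (simp add: \<rho>'_def)
    have "z \<in> near_value f B r2"
      using transc_sings_component(3)[OF U r(1)] near_value_mono[OF r(1,3)] z by blast
    then have "norm (R z - recip B) < 1" using r2(2) z' by blast
    then have "norm (R z) < L" using norm_triangle_ineq2[of "R z" "recip B"] by (simp add: L_def)
    have "(L + K) / c \<le> norm (z + a)" using zr[OF z] by (simp add: \<rho>'_def)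
    also have "\<dots> \<le> exp (norm (z + a))" using exp_ge_add_one_self[of "norm (z + a)"] by linarith
    also have "\<dots> \<le> gauss_size d (z + a)"
      using gauss_size_real_ge[of d "Re (z + a)"] e n z' \<rho> by simp
    finally have "L + K \<le> c * gauss_size d (z + a)" using constants(1) by (simp add: field_simps)
    then show False using R_bounds(1)[OF z'] \<open>norm (R z) < L\<close> by linarith
  qed
  obtain z0 where z0: "z0 \<in> U r" using transc_sings_component(1)[OF U r(1)] by auto
  define \<sigma> where "\<sigma> = sgn (Im (z0 + a))"
  have \<sigma>: "\<sigma> \<in> {1, -1}" "0 < \<sigma> * Im (z0 + a)" using Im0[OF z0] by (auto simp: \<sigma>_def sgn_if)
  have con: "connected ((\<lambda>z. \<sigma> * Im (z + a)) ` U r)"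
    by (intro connected_continuous_image transc_sings_component(2)[OF U r(1)] continuous_intros)
  have "0 < \<sigma> * Im (z + a)" if z: "z \<in> U r" for z
  proof (rule ccontr)
    assume "\<not> 0 < \<sigma> * Im (z + a)"
    then have "0 \<in> (\<lambda>z. \<sigma> * Im (z + a)) ` U r"
      using \<sigma>(2) by (intro connectedD_interval[OF con imageI[OF z] imageI[OF z0]]) auto
    then show False using Im0 \<sigma>(1) by fastforce
  qed
  moreover have "\<rho> \<le> norm (z + a)" if "z \<in> U r" for z using zr[OF that] by (simp add: \<rho>'_def)
  ultimately show ?thesis using r(1) \<sigma>(1) by blast
qed

text \<open>
  If \<open>R\<close> stays near a value \<open>\<beta>\<close> other than its limit, then \<open>exp ((z + a)\<^sup>2) / (z + a) ^ d\<close> stays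
  near a nonzero constant. Its logarithm \<open>(z + a)\<^sup>2 - d log (z + a)\<close> is then bounded on a
  connected set, and so is \<open>z\<close>. Hence no singularity lies over \<open>1 / \<beta>\<close>.
\<close>

lemma off_limit_bounded:
  assumes \<sigma>: "\<sigma> \<in> {1, -1}" and U: "connected U" and \<beta>: "\<beta> \<noteq> A \<sigma>"
    and half: "\<And>z. z \<in> U \<Longrightarrow> \<rho> \<le> norm (z + a) \<and> 0 < \<sigma> * Im (z + a)"
    and R: "\<And>z. z \<in> U \<Longrightarrow> norm (R z - \<beta>) < norm (\<beta> - A \<sigma>) / 2"
  shows "bounded U"
proof -
  \<comment> \<open>A continuous logarithm of \<open>z + a\<close> on the half plane, which avoids the cut after the
    rotation.\<close>
  define l where "l = (\<lambda>z. Ln (- (\<i> * of_real \<sigma>) * (z + a)) + \<i> * of_real (\<sigma> * pi / 2))"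
  define \<zeta> where "\<zeta> = (\<lambda>z. (z + a)^2 - of_nat d * l z)"
  have Re_pos: "0 < Re (- (\<i> * of_real \<sigma>) * (z + a))" if "z \<in> U" for z
    using half[OF that] by (simp add: algebra_simps)
  have nz: "z + a \<noteq> 0" if "z \<in> U" for z using half[OF that] constants by auto
  have cl: "continuous_on U l"
    unfolding l_def using Re_pos
    by (intro continuous_intros) (force simp: complex_nonpos_Reals_iff)
  have el: "exp (l z) = z + a" if "z \<in> U" for z
  proof -
    have "exp (\<i> * complex_of_real (\<sigma> * pi / 2)) = \<i> * of_real \<sigma>"
      unfolding cis_conv_exp[symmetric] using \<sigma> by (auto simp: complex_eq_iff)
    then have "exp (l z) = - (\<i> * of_real \<sigma>) * (z + a) * (\<i> * of_real \<sigma>)"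
      using nz[OF that] \<sigma> unfolding l_def exp_add by (subst exp_Ln) auto
    also have "\<dots> = z + a" using \<sigma> by (auto simp: algebra_simps)
    finally show ?thesis .
  qed
  have "bounded (\<zeta> ` U)"
  proof (rule log_branch_bounded[where b = "\<beta> - A \<sigma>" and \<kappa> = "\<kappa> \<sigma>" and E = "\<lambda>z. R z - A \<sigma>"
        and h = "\<lambda>z. (R z - A \<sigma>) * (z + a) ^ d * exp (- ((z + a)^2))", OF U])
    show "continuous_on U \<zeta>" unfolding \<zeta>_def by (intro continuous_intros cl)
    show "\<beta> - A \<sigma> \<noteq> 0" using \<beta> by simp
    show "\<kappa> \<sigma> \<noteq> 0" by (rule \<kappa>[OF \<sigma>])
    show "norm ((R z - A \<sigma>) - (\<beta> - A \<sigma>)) < norm (\<beta> - A \<sigma>) / 2" if "z \<in> U" for z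
      using R[OF that] by simp
    show "norm ((R z - A \<sigma>) * (z + a) ^ d * exp (- ((z + a)^2)) - \<kappa> \<sigma>) < norm (\<kappa> \<sigma>) / 2" if "z \<in> U" for z
      using half[OF that] by (intro near \<sigma>) auto
    show "exp (\<zeta> z) * ((R z - A \<sigma>) * (z + a) ^ d * exp (- ((z + a)^2))) = R z - A \<sigma>" if "z \<in> U" for z
      using nz[OF that] unfolding \<zeta>_def
      by (simp add: exp_diff exp_of_nat_mult el[OF that] exp_minus)
  qed
  then obtain B where B: "\<And>z. z \<in> U \<Longrightarrow> norm (\<zeta> z) \<le> B" by (auto simp: bounded_iff)
  have "norm z \<le> \<bar>B\<bar> + real d * 8 + 1 + norm a" if z: "z \<in> U" for z
  proof -
    let ?n = "norm (z + a)"
    have n1: "1 \<le> ?n" using half[OF z] constants by auto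
    have "norm (l z) \<le> norm (Ln (- (\<i> * of_real \<sigma>) * (z + a))) + norm (\<i> * complex_of_real (\<sigma> * pi / 2))"
      unfolding l_def by (rule norm_triangle_ineq)
    also have "norm (\<i> * complex_of_real (\<sigma> * pi / 2)) \<le> 2"
      using \<sigma> pi_less_4 by (auto simp: norm_mult)
    also have "norm (Ln (- (\<i> * of_real \<sigma>) * (z + a))) \<le> \<bar>ln ?n\<bar> + pi"
    proof -
      have "norm (- (\<i> * of_real \<sigma>) * (z + a)) = ?n" using \<sigma> by (auto simp: norm_mult)
      moreover have "- (\<i> * of_real \<sigma>) * (z + a) \<noteq> 0" using nz[OF z] \<sigma> by auto
      ultimately have "Re (Ln (- (\<i> * of_real \<sigma>) * (z + a))) = ln ?n"
        "\<bar>Im (Ln (- (\<i> * of_real \<sigma>) * (z + a)))\<bar> \<le> pi"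
        using mpi_less_Im_Ln[of "- (\<i> * of_real \<sigma>) * (z + a)"] Im_Ln_le_pi[of "- (\<i> * of_real \<sigma>) * (z + a)"]
        by (simp_all add: Re_Ln abs_le_iff)
      then show ?thesis using cmod_le[of "Ln (- (\<i> * of_real \<sigma>) * (z + a))"] by simp
    qed
    also have "\<bar>ln ?n\<bar> \<le> ?n"
    proof -
      have "0 < ?n" "0 \<le> ln ?n" using n1 by auto
      then show ?thesis using ln_le_minus_one[of ?n] by linarith
    qed
    finally have "norm (l z) \<le> ?n + 6" using pi_less_4 by linarith
    also have "\<dots> \<le> 7 * ?n" using n1 by linarith
    finally have "real d * norm (l z) \<le> real d * (7 * ?n)" by (intro mult_left_mono) auto
    moreover have "?n^2 \<le> norm (\<zeta> z) + real d * norm (l z)"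
      using norm_triangle_ineq[of "\<zeta> z" "of_nat d * l z"] by (simp add: \<zeta>_def norm_mult norm_power)
    ultimately have "?n * ?n \<le> \<bar>B\<bar> * ?n + real d * 7 * ?n"
      using B[OF z] n1 mult_left_mono[OF n1, of "\<bar>B\<bar>"] by (simp add: power2_eq_square)
    then have "?n * ?n \<le> (\<bar>B\<bar> + real d * 7) * ?n" by (simp add: distrib_right)
    moreover have "0 < ?n" using n1 by linarith
    ultimately have "?n \<le> \<bar>B\<bar> + real d * 7" by (rule mult_right_le_imp_le)
    then show ?thesis using norm_shift[of z] by simp
  qed
  then show ?thesis by (auto simp: bounded_iff)
qed

text \<open>
  The path goes up vertically and then sideways to the vertical ray at a great height; the
  deviation stays below the bound on both pieces.
\<close>

lemma limit_tract_point:
  assumes \<sigma>: "\<sigma> \<in> {1, -1}" and z: "\<rho> \<le> norm (z + a)" "0 < \<sigma> * Im (z + a)"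
    and \<eta>: "\<eta> > 0" and S: "\<And>z. \<rho> \<le> norm (z + a) \<Longrightarrow> norm (R z - A \<sigma>) < \<eta> \<Longrightarrow> z \<in> S"
    and M: "gauss_size d (z + a) < \<eta> / C"
  shows "\<exists>X. \<forall>t\<ge>X. connected_component S z (ray (of_real \<sigma> * \<i>) t)"
proof -
  define x y where "x = Re (z + a)" and "y = \<sigma> * Im (z + a)"
  have y: "y > 0" using z by (simp add: y_def)
  have \<sigma>y: "\<sigma> * y = Im (z + a)" using \<sigma> by (auto simp: y_def)
  have small: "z' \<in> S" if "gauss_size d (z' + a) < \<eta> / C" "\<rho> \<le> norm (z' + a)" "0 \<le> \<sigma> * Im (z' + a)" for z'
  proof -
    have "C * gauss_size d (z' + a) < \<eta>" using that(1) constants(2) by (simp add: field_simps)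
    then show ?thesis using S[OF that(2)] deviation_bounds(2)[OF \<sigma> that(3,2)] by linarith
  qed
  define X where "X = max (max \<rho> y) (x^2 + C / \<eta>)"
  have "connected_component S z (ray (of_real \<sigma> * \<i>) t)" if t: "t \<ge> X" for t
  proof -
    have t': "\<rho> \<le> t" "y \<le> t" "x^2 + C / \<eta> \<le> t" "1 \<le> t" using t constants by (auto simp: X_def)
    define z1 where "z1 = Complex x (\<sigma> * t) - a"
    have "connected_component S z z1"
    proof (rule segment_connected_component, rule subsetI)
      fix z' assume "z' \<in> closed_segment z z1"
      then obtain u where u: "0 \<le> u" "u \<le> 1" "z' = (1 - u) *\<^sub>R z + u *\<^sub>R z1" by (auto simp: in_segment)
      define s where "s = y + u * (t - y)"
      have s: "y \<le> s" using u t' by (simp add: s_def)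
      have w': "z' + a = Complex x (\<sigma> * s)"
      proof -
        have "z' + a = (1 - u) *\<^sub>R (z + a) + u *\<^sub>R (z1 + a)"
          unfolding u(3) by (simp add: scaleR_conv_of_real algebra_simps)
        also have "z + a = Complex x (\<sigma> * y)" by (simp add: complex_eq_iff x_def \<sigma>y)
        finally show ?thesis by (simp add: z1_def s_def complex_eq_iff algebra_simps)
      qed
      have im: "\<bar>Im (z + a)\<bar> \<le> \<bar>Im (z' + a)\<bar>" using s y \<sigma> \<sigma>y[symmetric] unfolding w' by auto
      have re: "Re (z + a) = Re (z' + a)" by (simp add: w' x_def)
      have "(Im (z + a))^2 \<le> (Im (z' + a))^2" using im by (simp add: abs_le_square_iff)
      then have "norm (z + a) \<le> norm (z' + a)" unfolding cmod_def re by simp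
      then have n: "\<rho> \<le> norm (z' + a)" using z by linarith
      have "gauss_size d (z' + a) \<le> gauss_size d (z + a)"
        using z constants im re by (intro gauss_size_mono_Im) auto
      then show "z' \<in> S" using M n s y \<sigma> by (intro small) (auto simp: w')
    qed
    moreover have "connected_component S z1 (ray (of_real \<sigma> * \<i>) t)"
    proof (rule segment_connected_component, rule subsetI)
      fix z' assume "z' \<in> closed_segment z1 (ray (of_real \<sigma> * \<i>) t)"
      then obtain u where u: "0 \<le> u" "u \<le> 1" "z' = (1 - u) *\<^sub>R z1 + u *\<^sub>R ray (of_real \<sigma> * \<i>) t" by (auto simp: in_segment)
      have w': "z' + a = Complex ((1 - u) * x) (\<sigma> * t)"
        unfolding u(3) by (simp add: z1_def ray_def complex_eq_iff algebra_simps)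
      have n: "t \<le> norm (z' + a)" using abs_Im_le_cmod[of "z' + a"] t' \<sigma> unfolding w' by auto
      have "gauss_size d (z' + a) \<le> exp (Re ((z' + a)^2))" using n t' by (intro gauss_size_le_exp) auto
      also have "Re ((z' + a)^2) \<le> x^2 - t"
      proof -
        have "((1 - u) * x)^2 \<le> x^2" using u by (simp add: power_mult_distrib mult_left_le_one_le power_le_one)
        moreover have "(\<sigma> * t)^2 \<ge> t" using \<sigma> t' by (auto simp: power2_eq_square)
        ultimately show ?thesis unfolding Re_square by (simp add: w')
      qed
      also have "exp (x^2 - t) < \<eta> / C"
      proof -
        have "C / \<eta> < exp (t - x^2)" using t'(3) exp_ge_add_one_self[of "t - x^2"] by linarith
        then show ?thesis using \<eta> constants(2) by (simp add: exp_diff field_simps)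
      qed
      finally show "z' \<in> S" using n t' \<sigma> by (intro small) (auto simp: w')
    qed
    ultimately show ?thesis using connected_component_trans by blast
  qed
  then show ?thesis by blast
qed

text \<open>
  A singularity lives in one half plane. Its value must be \<open>1 / A \<sigma>\<close>, as components for any
  other value are bounded, and then all its components contain the end of the vertical ray.
\<close>

lemma nonzero_sing_cases:
  assumes U: "(B, U) \<in> transc_sings f" and B: "B \<noteq> Some 0"
  shows "\<exists>\<sigma>\<in>{1, -1}. B = Some (1 / A \<sigma>) \<and> U = tract f B (ray (of_real \<sigma> * \<i>))"
proof -
  obtain r1 \<sigma> where r1: "r1 > 0" and \<sigma>: "\<sigma> \<in> {1, -1}"
    and half: "\<And>z. z \<in> U r1 \<Longrightarrow> \<rho> \<le> norm (z + a) \<and> 0 < \<sigma> * Im (z + a)"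
    using far_half_plane[OF U B] by blast
  have close: "\<exists>r2>0. r2 \<le> r1 \<and> (\<forall>z\<in>U r2. norm (R z - recip B) < \<eta>)" if \<eta>: "\<eta> > 0" for \<eta>
  proof -
    obtain r where r: "r > 0" "\<And>z. \<rho> \<le> norm (z + a) \<Longrightarrow> z \<in> near_value f B r \<Longrightarrow> norm (R z - recip B) < \<eta>"
      using near_value_imp_near_recip[OF B \<eta>] by auto
    have m: "min r r1 > 0" using r r1 by simp
    have "norm (R z - recip B) < \<eta>" if "z \<in> U (min r r1)" for z
    proof (rule r(2))
      show "\<rho> \<le> norm (z + a)" using half transc_sings_mono[OF U m, of r1] that by auto
      show "z \<in> near_value f B r"
        using transc_sings_component(3)[OF U m] near_value_mono[OF m, of r f B] that by auto
    qed
    then show ?thesis using m by (intro exI[of _ "min r r1"]) auto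
  qed
  have eq: "recip B = A \<sigma>"
  proof (rule ccontr)
    assume ne: "recip B \<noteq> A \<sigma>"
    then obtain r2 where r2: "r2 > 0" "r2 \<le> r1" "\<And>z. z \<in> U r2 \<Longrightarrow> norm (R z - recip B) < norm (recip B - A \<sigma>) / 2"
      using close[of "norm (recip B - A \<sigma>) / 2"] by auto
    have "bounded (U r2)"
      using half transc_sings_mono[OF U r2(1,2)]
      by (intro off_limit_bounded[OF \<sigma> transc_sings_component(2)[OF U r2(1)] ne] r2) auto
    then obtain L where L: "\<And>z. z \<in> U r2 \<Longrightarrow> norm z \<le> L" by (auto simp: bounded_iff)
    obtain r3 where r3: "r3 > 0" "\<And>z. z \<in> U r3 \<Longrightarrow> L < norm z"
      using transc_sings_escapes[OF f U] by blast
    have m: "min r2 r3 > 0" using r2 r3 by simp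
    obtain z where "z \<in> U (min r2 r3)" using transc_sings_component(1)[OF U m] by auto
    then have "z \<in> U r2" "z \<in> U r3"
      using transc_sings_mono[OF U m, of r2] transc_sings_mono[OF U m, of r3] by auto
    then show False using L r3(2) by fastforce
  qed
  then obtain \<alpha> where \<alpha>: "B = Some \<alpha>" "1 / \<alpha> = A \<sigma>" "\<alpha> \<noteq> 0"
    using A(1)[OF \<sigma>] B by (cases B) (auto simp: recip_def)
  then have B': "B = Some (1 / A \<sigma>)" by (metis divide_divide_eq_right div_by_1 mult_1)
  have "\<exists>X. \<forall>t\<ge>X. ray (of_real \<sigma> * \<i>) t \<in> U r" if r: "r > 0" for r
  proof -
    obtain \<eta> where \<eta>: "\<eta> > 0" "\<And>z. \<rho> \<le> norm (z + a) \<Longrightarrow> norm (R z - A \<sigma>) < \<eta> \<Longrightarrow> z \<in> near_value f B r"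
      using near_recip_imp_near_value[OF \<alpha>(3) r] \<alpha> by auto
    obtain r2 where r2: "r2 > 0" "r2 \<le> r1" "\<And>z. z \<in> U r2 \<Longrightarrow> norm (R z - A \<sigma>) < c * (\<eta> / C)"
      using close[of "c * (\<eta> / C)"] \<eta>(1) constants eq by auto
    have m: "min r r2 > 0" using r r2 by simp
    obtain z where z: "z \<in> U (min r r2)" using transc_sings_component(1)[OF U m] by auto
    then have zU: "z \<in> U r" "z \<in> U r2" "z \<in> U r1"
      using transc_sings_mono[OF U m, of r] transc_sings_mono[OF U m, of r2] transc_sings_mono[OF U r2(1,2)] by auto
    have "c * gauss_size d (z + a) < c * (\<eta> / C)"
      using deviation_bounds(1)[OF \<sigma>, of z] half[OF zU(3)] r2(3)[OF zU(2)] by auto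
    then have "gauss_size d (z + a) < \<eta> / C"
      by (rule mult_left_less_imp_less) (use constants in auto)
    then have "\<exists>X. \<forall>t\<ge>X. connected_component (near_value f B r) z (ray (of_real \<sigma> * \<i>) t)"
      using half[OF zU(3)] by (intro limit_tract_point[OF \<sigma> _ _ \<eta>]) auto
    then show ?thesis using transc_sings_component(4)[OF U r zU(1)] by blast
  qed
  then have "U = tract f B (ray (of_real \<sigma> * \<i>))" by (rule tract_unique[OF U])
  then show ?thesis using \<sigma> B' by blast
qed

theorem transc_sings_eq:
  "transc_sings f = (\<lambda>\<epsilon>. (Some 0, tract f (Some 0) (ray (of_real \<epsilon>)))) ` {1, -1} \<union>
     (\<lambda>\<sigma>. (Some (1 / A \<sigma>), tract f (Some (1 / A \<sigma>)) (ray (of_real \<sigma> * \<i>)))) ` {1, -1}"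
proof (intro equalityI subsetI)
  fix s assume s: "s \<in> transc_sings f"
  obtain B U where BU: "s = (B, U)" by (cases s)
  show "s \<in> (\<lambda>\<epsilon>. (Some 0, tract f (Some 0) (ray (of_real \<epsilon>)))) ` {1, -1} \<union>
     (\<lambda>\<sigma>. (Some (1 / A \<sigma>), tract f (Some (1 / A \<sigma>)) (ray (of_real \<sigma> * \<i>)))) ` {1, -1}"
    using zero_sing_cases[of U] nonzero_sing_cases[of B U] s unfolding BU by (cases "B = Some 0") blast+
qed (use zero_tract_sing(1) limit_tract_sing(1) in blast)

text \<open>
  Both tracts lie over the same value, so only their position, in the right and in the left half
  plane, distinguishes them.
\<close>

lemma zero_tracts_differ: "tract f (Some 0) (ray (of_real 1)) \<noteq> tract f (Some 0) (ray (of_real (-1)))"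
proof
  let ?T = "\<lambda>\<epsilon>. tract f (Some 0) (ray (of_real \<epsilon>))"
  assume eq: "?T 1 = ?T (-1)"
  have sing: "(Some 0, ?T 1) \<in> transc_sings f" "(Some 0, ?T (-1)) \<in> transc_sings f"
    using zero_tract_sing(1)[of 1] zero_tract_sing(1)[of "-1"] by simp_all
  obtain r where r: "r > 0" "?T 1 r \<subseteq> {z. \<rho> < norm (z + a) \<and> 0 < 1 * Re (z + a)}"
    using zero_tract_subset[of 1 \<rho>] by auto
  obtain s where s: "s > 0" "?T (-1) s \<subseteq> {z. \<rho> < norm (z + a) \<and> 0 < -1 * Re (z + a)}"
    using zero_tract_subset[of "-1" \<rho>] by auto
  have m: "min r s > 0" using r s by simp
  obtain z where z: "z \<in> ?T 1 (min r s)" using transc_sings_component(1)[OF sing(1) m] by auto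
  have "z \<in> ?T 1 r" "z \<in> ?T (-1) s"
    using z transc_sings_mono[OF sing(1) m, of r] transc_sings_mono[OF sing(2) m, of s] eq by auto
  then show False using r(2) s(2) by force
qed

theorem transc_sings_count:
  "card (transc_sings f) = 4" "\<forall>s\<in>transc_sings f. direct_sing f s"
  "card {s \<in> transc_sings f. fst s = Some 0} = 2"
proof -
  have ne: "1 / A 1 \<noteq> 1 / A (-1)" using A by (metis div_by_1 divide_divide_eq_right mult_1)
  have nz: "1 / A 1 \<noteq> 0" "1 / A (-1) \<noteq> 0" using A(1) by auto
  show "card (transc_sings f) = 4" unfolding transc_sings_eq
    using ne nz zero_tracts_differ by simp
  show "\<forall>s\<in>transc_sings f. direct_sing f s" unfolding transc_sings_eq
    using zero_tract_sing(2) limit_tract_sing(2) by blast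
  have "{s \<in> transc_sings f. fst s = Some 0} = (\<lambda>\<epsilon>. (Some 0, tract f (Some 0) (ray (of_real \<epsilon>)))) ` {1, -1}"
    unfolding transc_sings_eq using nz by auto
  then show "card {s \<in> transc_sings f. fst s = Some 0} = 2"
    using zero_tracts_differ by simp
qed

end

section \<open>Recessive solutions of perturbed oscillators\<close>

text \<open>
  The function \<open>F\<close> divided by the explicit solution of the linear equation with equality is
  monotone.
\<close>

lemma weighted_nonincreasing:
  fixes F F' :: "real \<Rightarrow> real"
  assumes r0: "0 < r0" "r0 \<le> r"
    and d: "\<And>t. r0 \<le> t \<Longrightarrow> (F has_real_derivative F' t) (at t)"
    and le: "\<And>t. r0 \<le> t \<Longrightarrow> F' t \<le> (2 * t * c + real N / t) * F t"
  shows "F r \<le> F r0 * (r / r0) ^ N * exp (c * (r^2 - r0^2))"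
proof -
  define G where "G = (\<lambda>t. F t * exp (- c * t^2) / t ^ N)"
  have "G r \<le> G r0"
  proof (rule DERIV_nonpos_imp_nonincreasing[OF r0(2)])
    fix t assume t: "r0 \<le> t" "t \<le> r"
    have t0: "t > 0" using t r0 by simp
    have "(G has_real_derivative ((F' t * exp (- c * t^2) + F t * (exp (- c * t^2) * (- c * (2 * t)))) * t ^ N
        - F t * exp (- c * t^2) * (real N * t ^ (N - 1))) / (t ^ N * t ^ N)) (at t)"
      unfolding G_def using t0 by (auto intro!: derivative_eq_intros d t)
    also have "((F' t * exp (- c * t^2) + F t * (exp (- c * t^2) * (- c * (2 * t)))) * t ^ N
        - F t * exp (- c * t^2) * (real N * t ^ (N - 1))) / (t ^ N * t ^ N) =
        (F' t - (2 * t * c + real N / t) * F t) * exp (- c * t^2) / t ^ N"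
    proof (cases N)
      case 0 then show ?thesis by (simp add: algebra_simps)
    next
      case (Suc k)
      then show ?thesis using t0 by (simp add: field_simps)
    qed
    finally have "(G has_real_derivative (F' t - (2 * t * c + real N / t) * F t) * exp (- c * t^2) / t ^ N) (at t)" .
    moreover have "(F' t - (2 * t * c + real N / t) * F t) * exp (- c * t^2) / t ^ N \<le> 0"
      using le[OF t(1)] t0 by (intro divide_nonpos_pos mult_nonpos_nonneg) auto
    ultimately show "\<exists>y. (G has_real_derivative y) (at t) \<and> y \<le> 0" by blast
  qed
  then show ?thesis
    using r0 by (simp add: G_def field_simps exp_diff exp_minus power_divide right_diff_distrib)
qed

lemma weighted_nondecreasing:
  fixes F F' :: "real \<Rightarrow> real"
  assumes r0: "0 < r0" "r0 \<le> r"
    and d: "\<And>t. r0 \<le> t \<Longrightarrow> (F has_real_derivative F' t) (at t)"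
    and ge: "\<And>t. r0 \<le> t \<Longrightarrow> (2 * t * c - real N / t) * F t \<le> F' t"
  shows "F r0 * r0 ^ N * exp (c * (r^2 - r0^2)) \<le> F r * r ^ N"
proof -
  define G where "G = (\<lambda>t. F t * exp (- c * t^2) * t ^ N)"
  have "G r0 \<le> G r"
  proof (rule DERIV_nonneg_imp_nondecreasing[OF r0(2)])
    fix t assume t: "r0 \<le> t" "t \<le> r"
    have t0: "t > 0" using t r0 by simp
    have "(G has_real_derivative (F' t * exp (- c * t^2) + F t * (exp (- c * t^2) * (- c * (2 * t)))) * t ^ N
        + F t * exp (- c * t^2) * (real N * t ^ (N - 1))) (at t)"
      unfolding G_def using t0 by (auto intro!: derivative_eq_intros d t)
    also have "(F' t * exp (- c * t^2) + F t * (exp (- c * t^2) * (- c * (2 * t)))) * t ^ N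
        + F t * exp (- c * t^2) * (real N * t ^ (N - 1)) =
        (F' t - (2 * t * c - real N / t) * F t) * exp (- c * t^2) * t ^ N"
    proof (cases N)
      case 0 then show ?thesis by (simp add: algebra_simps)
    next
      case (Suc k)
      then show ?thesis using t0 by (simp add: field_simps)
    qed
    finally have "(G has_real_derivative (F' t - (2 * t * c - real N / t) * F t) * exp (- c * t^2) * t ^ N) (at t)" .
    moreover have "0 \<le> (F' t - (2 * t * c - real N / t) * F t) * exp (- c * t^2) * t ^ N"
      using ge[OF t(1)] t0 by (intro mult_nonneg_nonneg) auto
    ultimately show "\<exists>y. (G has_real_derivative y) (at t) \<and> 0 \<le> y" by blast
  qed
  then show ?thesis
    by (simp add: G_def field_simps exp_diff exp_minus right_diff_distrib)
qed

text \<open>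
  A model of a recessive component \<open>X\<close> and a dominant component \<open>Z\<close> along a ray, squared:
  unperturbed, \<open>X\<close> behaves like \<open>exp (- c t\<^sup>2)\<close> and \<open>Z\<close> like \<open>exp (c t\<^sup>2)\<close>. The coupling of
  relative size \<open>C / t\<close> costs powers of \<open>t\<close> only, because \<open>\<integral> C / t\<close> is logarithmic. The constant
  \<open>c\<close> depends on the direction of the ray and may have either sign.
\<close>

locale ray_energies =
  fixes X Z X' Z' :: "real \<Rightarrow> real" and C c r0 :: real
  assumes r0: "1 \<le> r0" and C: "0 \<le> C"
    and dX: "\<And>t. r0 \<le> t \<Longrightarrow> (X has_real_derivative X' t) (at t)"
    and dZ: "\<And>t. r0 \<le> t \<Longrightarrow> (Z has_real_derivative Z' t) (at t)"
    and X0: "\<And>t. r0 \<le> t \<Longrightarrow> 0 \<le> X t" and Z0: "\<And>t. r0 \<le> t \<Longrightarrow> 0 \<le> Z t"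
    and X': "\<And>t. r0 \<le> t \<Longrightarrow> \<bar>X' t + 2 * t * c * X t\<bar> \<le> C / t * (X t + Z t)"
    and Z': "\<And>t. r0 \<le> t \<Longrightarrow> \<bar>Z' t - 2 * t * c * Z t\<bar> \<le> C / t * (X t + Z t)"
begin

lemma total_growth:
  assumes N: "2 * C \<le> real N" and r: "r0 \<le> r1" "r1 \<le> r"
  shows "X r + Z r \<le> (X r1 + Z r1) * (r / r1) ^ N * exp (\<bar>c\<bar> * (r^2 - r1^2))"
proof (rule weighted_nonincreasing[where F = "\<lambda>t. X t + Z t" and F' = "\<lambda>t. X' t + Z' t"])
  show "((\<lambda>t. X t + Z t) has_real_derivative X' t + Z' t) (at t)" if "r1 \<le> t" for t
    using that r by (intro DERIV_add dX dZ) auto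
  show "X' t + Z' t \<le> (2 * t * \<bar>c\<bar> + real N / t) * (X t + Z t)" if t: "r1 \<le> t" for t
  proof -
    have t0: "r0 \<le> t" "0 < t" using t r r0 by auto
    have "- (2 * t * c * X t) \<le> 2 * t * \<bar>c\<bar> * X t" "2 * t * c * Z t \<le> 2 * t * \<bar>c\<bar> * Z t"
      using t0 X0[of t] Z0[of t] mult_right_mono[of "- c" "\<bar>c\<bar>" "2 * t * X t"] mult_right_mono[of c "\<bar>c\<bar>" "2 * t * Z t"]
      by (auto simp: mult_ac)
    moreover have "2 * (C / t * (X t + Z t)) \<le> real N / t * (X t + Z t)"
    proof -
      have "2 * C / t * (X t + Z t) \<le> real N / t * (X t + Z t)"
        using N t0 X0[of t] Z0[of t] by (intro mult_right_mono divide_right_mono) auto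
      then show ?thesis by simp
    qed
    ultimately have "X' t + Z' t \<le> 2 * t * \<bar>c\<bar> * X t + 2 * t * \<bar>c\<bar> * Z t + real N / t * (X t + Z t)"
      using X'[OF t0(1)] Z'[OF t0(1)] by linarith
    then show ?thesis by (simp add: algebra_simps)
  qed
qed (use r r0 in auto)

text \<open>
  Once the dominant component exceeds four times the recessive one it does so forever, provided
  that the coupling is small compared with \<open>c t\<close>.
\<close>

lemma dominance_persists:
  assumes c: "0 < c" and r: "r0 \<le> r1" "r1 \<le> r" and th: "5 * C \<le> 2 * c * r1^2"
    and dom: "4 * X r1 \<le> Z r1"
  shows "4 * X r \<le> Z r"
proof -
  have "Z r1 - 4 * X r1 \<le> Z r - 4 * X r"
  proof (rule DERIV_nonneg_imp_nondecreasing[where f = "\<lambda>t. Z t - 4 * X t", OF r(2)])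
    fix t assume t: "r1 \<le> t" "t \<le> r"
    have t0: "r0 \<le> t" "0 < t" using t r r0 by auto
    have "((\<lambda>t. Z t - 4 * X t) has_real_derivative Z' t - 4 * X' t) (at t)"
      using t0 by (intro DERIV_diff dZ DERIV_cmult dX)
    moreover have "0 \<le> Z' t - 4 * X' t"
    proof -
      have "r1^2 \<le> t^2" using t r r0 by (intro power_mono) auto
      then have "2 * c * r1^2 \<le> 2 * c * t^2" using c by (intro mult_left_mono) auto
      then have "5 * C \<le> 2 * c * t^2" using th by linarith
      then have "5 * (C / t) \<le> 2 * t * c" using t0 by (simp add: field_simps power2_eq_square)
      then have "5 * (C / t) * (X t + Z t) \<le> 2 * t * c * (X t + Z t)"
        using X0[OF t0(1)] Z0[OF t0(1)] by (intro mult_right_mono) auto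
      moreover have "0 \<le> 2 * t * c * X t" using t0 c X0[OF t0(1)] by simp
      moreover have "2 * t * c * (X t + Z t) = 2 * t * c * X t + 2 * t * c * Z t"
        by (rule distrib_left)
      ultimately have "5 * (C / t * (X t + Z t)) \<le> 2 * t * c * Z t + 4 * (2 * t * c * X t)"
        unfolding mult.assoc[of 5 "C / t"] by linarith
      then show ?thesis using X'[OF t0(1)] Z'[OF t0(1)] by linarith
    qed
    ultimately show "\<exists>y. ((\<lambda>t. Z t - 4 * X t) has_real_derivative y) (at t) \<and> 0 \<le> y" by blast
  qed
  then show ?thesis using dom by simp
qed

lemma dominant_growth:
  assumes N: "2 * C \<le> real N" and c: "0 < c" and r: "r0 \<le> r1" "r1 \<le> r" and th: "5 * C \<le> 2 * c * r1^2"
    and dom: "4 * X r1 \<le> Z r1"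
  shows "Z r1 * r1 ^ N * exp (c * (r^2 - r1^2)) \<le> Z r * r ^ N"
proof (rule weighted_nondecreasing)
  show "(Z has_real_derivative Z' t) (at t)" if "r1 \<le> t" for t using that r by (intro dZ) auto
  show "(2 * t * c - real N / t) * Z t \<le> Z' t" if t: "r1 \<le> t" for t
  proof -
    have t0: "r0 \<le> t" "0 < t" using t r r0 by auto
    have "4 * X t \<le> Z t" by (rule dominance_persists[OF c r(1) t th dom])
    then have "C / t * (X t + Z t) \<le> C / t * (2 * Z t)"
      using C t0 X0[OF t0(1)] by (intro mult_left_mono) auto
    also have "\<dots> \<le> real N / t * Z t"
    proof -
      have "2 * C / t * Z t \<le> real N / t * Z t"
        using N t0 Z0[of t] by (intro mult_right_mono divide_right_mono) auto
      then show ?thesis by (simp add: field_simps)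
    qed
    finally show ?thesis using Z'[OF t0(1)] by (simp add: left_diff_distrib)
  qed
qed (use r r0 in auto)

text \<open>
  If the dominant component never takes over, it is slaved to the recessive one and decays with
  it.
\<close>

lemma recessive_decay:
  assumes N: "5 * C \<le> real N" and r: "r0 \<le> r1" "r1 \<le> r"
    and rec: "\<And>t. r1 \<le> t \<Longrightarrow> Z t \<le> 4 * X t"
  shows "X r + Z r \<le> 5 * X r1 * (r / r1) ^ N * exp (- c * (r^2 - r1^2))"
proof -
  have "X r \<le> X r1 * (r / r1) ^ N * exp (- c * (r^2 - r1^2))"
  proof (rule weighted_nonincreasing)
    show "(X has_real_derivative X' t) (at t)" if "r1 \<le> t" for t using that r by (intro dX) auto
    show "X' t \<le> (2 * t * (- c) + real N / t) * X t" if t: "r1 \<le> t" for t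
    proof -
      have t0: "r0 \<le> t" "0 < t" using t r r0 by auto
      have "C / t * (X t + Z t) \<le> C / t * (5 * X t)"
        using C t0 rec[OF t] by (intro mult_left_mono) auto
      also have "\<dots> \<le> real N / t * X t"
      proof -
        have "5 * C / t * X t \<le> real N / t * X t"
          using N t0 X0[of t] by (intro mult_right_mono divide_right_mono) auto
        then show ?thesis by (simp add: field_simps)
      qed
      finally show ?thesis using X'[OF t0(1)] by (simp add: algebra_simps)
    qed
  qed (use r r0 in auto)
  then show ?thesis using rec[OF r(2)] by simp
qed

end

text \<open>
  The bound has to be uniform in the direction of the ray, also when \<open>c\<close> tends to 0 through
  positive values. Up to the radius where \<open>2 c r\<^sup>2\<close> equals \<open>5 C + 2 r\<^sub>0\<^sup>2\<close> the growth by
  \<open>exp (|c| r\<^sup>2)\<close> exceeds the claimed bound by a constant factor only; beyond it, the decay of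
  the recessive component sets in. For \<open>c \<le> 0\<close> the general growth bound is the claim.
\<close>

lemma (in ray_energies) uniform_bound:
  assumes N: "5 * C \<le> real N"
    and S: "X r0 + Z r0 \<le> S"
    and c1: "\<bar>c\<bar> \<le> 1"
    and rec: "\<And>r1. 0 < c \<Longrightarrow> r0 \<le> r1 \<Longrightarrow> 5 * C \<le> 2 * c * r1^2 \<Longrightarrow> Z r1 < 4 * X r1"
    and r: "r0 \<le> r"
  shows "X r + Z r \<le> 5 * S * exp (5 * C + 2 * r0^2) * r ^ N * exp (- c * r^2)"
proof -
  have N2: "2 * C \<le> real N" using N C by linarith
  have S0: "0 \<le> S" using S X0[of r0] Z0[of r0] by simp
  have r00: "0 < r0" using r0 by simp
  have gen: "X t + Z t \<le> S * t ^ N * exp (\<bar>c\<bar> * t^2)" if t: "r0 \<le> t" for t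
  proof -
    have "X t + Z t \<le> (X r0 + Z r0) * (t / r0) ^ N * exp (\<bar>c\<bar> * (t^2 - r0^2))"
      by (rule total_growth[OF N2 order_refl t])
    also have "\<dots> \<le> S * t ^ N * exp (\<bar>c\<bar> * t^2)"
    proof (intro mult_mono S power_mono)
      show "t / r0 \<le> t" using t r0 by (simp add: divide_le_eq mult_le_cancel_left1)
      show "exp (\<bar>c\<bar> * (t^2 - r0^2)) \<le> exp (\<bar>c\<bar> * t^2)" by (simp add: right_diff_distrib)
    qed (use S0 t r0 X0[of r0] Z0[of r0] in auto)
    finally show ?thesis .
  qed
  have weak: "S * t ^ N * exp (\<bar>c\<bar> * t^2) \<le> 5 * S * exp (5 * C + 2 * r0^2) * t ^ N * exp (- c * t^2)"
    if "r0 \<le> t" "c \<le> 0 \<or> 2 * c * t^2 \<le> 5 * C + 2 * r0^2" for t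
  proof -
    have "\<bar>c\<bar> * t^2 \<le> (5 * C + 2 * r0^2) + - c * t^2"
      using that(2) C by (cases "c \<le> 0") (auto simp: algebra_simps)
    then have "exp (\<bar>c\<bar> * t^2) \<le> exp (5 * C + 2 * r0^2) * exp (- c * t^2)"
      by (simp add: exp_add[symmetric])
    then have "S * t ^ N * exp (\<bar>c\<bar> * t^2) \<le> (5 * S) * t ^ N * (exp (5 * C + 2 * r0^2) * exp (- c * t^2))"
      using S0 that r0 by (intro mult_mono) auto
    then show ?thesis by (simp only: mult_ac)
  qed
  show ?thesis
  proof (cases "c \<le> 0 \<or> 2 * c * r^2 \<le> 5 * C + 2 * r0^2")
    case True
    show ?thesis using gen[OF r] weak[OF r True] by linarith
  next
    case False
    then have c: "0 < c" and big: "5 * C + 2 * r0^2 < 2 * c * r^2" by auto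
    \<comment> \<open>The radius where the coupling has become weak; it is at least \<open>r0\<close> because \<open>c \<le> 1\<close>.\<close>
    define r1 where "r1 = sqrt ((5 * C + 2 * r0^2) / (2 * c))"
    have r1s: "2 * c * r1^2 = 5 * C + 2 * r0^2" using c C by (simp add: r1_def)
    have r10: "0 \<le> r1" using c C by (simp add: r1_def)
    have "r0^2 \<le> r1^2"
    proof -
      have "2 * r0^2 * c \<le> 2 * r0^2 * 1" using c1 by (intro mult_left_mono) auto
      then have "2 * c * r0^2 \<le> 2 * c * r1^2" using r1s C by (simp add: mult_ac)
      then show ?thesis using c by simp
    qed
    then have r01: "r0 \<le> r1" by (rule power2_le_imp_le[OF _ r10])
    have "2 * c * r1^2 < 2 * c * r^2" using r1s big by linarith
    then have "r1^2 < r^2" using c by simp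
    then have r1r: "r1 \<le> r" by (intro power2_le_imp_le[of r1 r] less_imp_le[of "r1^2"] less_imp_le[OF less_le_trans[OF r00 r]])
    have rc: "Z t \<le> 4 * X t" if t: "r1 \<le> t" for t
    proof -
      have "r1^2 \<le> t^2" by (rule power_mono[OF t r10])
      then have "2 * c * r1^2 \<le> 2 * c * t^2" using c by simp
      then have "5 * C \<le> 2 * c * t^2" using r1s zero_le_power2[of r0] by linarith
      then show ?thesis using rec[OF c, of t] t r01 by simp
    qed
    have "X r + Z r \<le> 5 * X r1 * (r / r1) ^ N * exp (- c * (r^2 - r1^2))"
      by (rule recessive_decay[OF N r01 r1r rc])
    also have "\<dots> \<le> 5 * (S * r1 ^ N * exp (\<bar>c\<bar> * r1^2)) * (r / r1) ^ N * exp (- c * (r^2 - r1^2))"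
      using gen[OF r01] Z0[OF r01] r r00 r10 by (intro mult_right_mono mult_left_mono) auto
    also have "\<dots> = 5 * S * exp (2 * c * r1^2) * r ^ N * exp (- c * r^2)"
    proof -
      have "r1 ^ N * (r / r1) ^ N = r ^ N" using r01 r00 by (simp add: power_divide)
      moreover have "exp (\<bar>c\<bar> * r1^2) * exp (- c * (r^2 - r1^2)) = exp (2 * c * r1^2) * exp (- c * r^2)"
        using c by (simp add: exp_add[symmetric] algebra_simps)
      moreover have "5 * (S * r1 ^ N * exp (\<bar>c\<bar> * r1^2)) * (r / r1) ^ N * exp (- c * (r^2 - r1^2)) =
          5 * S * (r1 ^ N * (r / r1) ^ N) * (exp (\<bar>c\<bar> * r1^2) * exp (- c * (r^2 - r1^2)))"
        by (simp only: mult_ac)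
      ultimately show ?thesis by (simp only: mult_ac)
    qed
    also have "\<dots> \<le> 5 * S * exp (5 * C + 2 * r0^2) * r ^ N * exp (- c * r^2)"
      unfolding r1s ..
    finally show ?thesis .
  qed
qed

text \<open>
  A function with logarithmic derivative close to \<open>s w\<close> has a modulus square with logarithmic
  derivative close to \<open>2 s t Re (e\<^sup>2)\<close> along the ray of direction \<open>e\<close>.
\<close>

lemma norm_square_ray_derivative:
  fixes F :: "complex \<Rightarrow> complex"
  assumes e: "norm e = 1" and t: "0 < t"
    and F: "(F has_field_derivative of_real s * (of_real t * e) * F (of_real t * e) + \<epsilon>) (at (of_real t * e))"
    and \<epsilon>: "norm \<epsilon> \<le> E / t * (norm (F (of_real t * e)) + G)" and G: "0 \<le> G" and E: "0 \<le> E"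
  shows "\<exists>T. ((\<lambda>r. norm (F (of_real r * e))^2) has_real_derivative T) (at t) \<and>
    \<bar>T - s * (2 * t * Re (e^2) * norm (F (of_real t * e))^2)\<bar> \<le> 3 * E / t * (norm (F (of_real t * e))^2 + G^2)"
proof -
  let ?w = "of_real t * e" let ?h = "F (of_real t * e)"
  define h' where "h' = e * (of_real s * ?w * ?h + \<epsilon>)"
  have "((\<lambda>r. of_real r * e) has_vector_derivative e) (at t)"
    by (auto intro!: derivative_eq_intros)
  from field_vector_diff_chain_at[OF this F]
  have d: "((\<lambda>r. F (of_real r * e)) has_vector_derivative h') (at t)" by (simp only: o_def h'_def)
  have dR: "((\<lambda>r. Re (F (of_real r * e))) has_real_derivative Re h') (at t)"
    using bounded_linear.has_vector_derivative[OF bounded_linear_Re d]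
    by (simp add: has_real_derivative_iff_has_vector_derivative)
  have dI: "((\<lambda>r. Im (F (of_real r * e))) has_real_derivative Im h') (at t)"
    using bounded_linear.has_vector_derivative[OF bounded_linear_Im d]
    by (simp add: has_real_derivative_iff_has_vector_derivative)
  define T where "T = 2 * Re (cnj ?h * h')"
  have "((\<lambda>r. (Re (F (of_real r * e)))^2 + (Im (F (of_real r * e)))^2) has_real_derivative T) (at t)"
    using DERIV_add[OF DERIV_power[OF dR, where n = 2] DERIV_power[OF dI, where n = 2]]
    by (simp add: T_def distrib_left mult_ac)
  then have D: "((\<lambda>r. norm (F (of_real r * e))^2) has_real_derivative T) (at t)"
    by (simp add: cmod_power2)
  have "cnj ?h * h' = of_real (s * t * norm ?h ^ 2) * e^2 + cnj ?h * e * \<epsilon>"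
  proof -
    have "cnj ?h * ?h = of_real (norm ?h ^ 2)"
      by (metis complex_norm_square mult.commute)
    then show ?thesis unfolding h'_def by (simp add: algebra_simps power2_eq_square)
  qed
  then have "T - s * (2 * t * Re (e^2) * norm ?h^2) = 2 * Re (cnj ?h * e * \<epsilon>)"
    by (simp add: T_def del: of_real_mult)
  then have "\<bar>T - s * (2 * t * Re (e^2) * norm ?h^2)\<bar> \<le> 2 * (norm ?h * norm \<epsilon>)"
    using abs_Re_le_cmod[of "cnj ?h * e * \<epsilon>"] e by (simp add: norm_mult)
  also have "\<dots> \<le> 2 * (norm ?h * (E / t * (norm ?h + G)))"
    by (intro mult_left_mono \<epsilon>) auto
  also have "\<dots> = E / t * (2 * norm ?h^2 + 2 * norm ?h * G)" by (simp add: algebra_simps power2_eq_square)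
  also have "\<dots> \<le> E / t * (3 * (norm ?h^2 + G^2))"
  proof (intro mult_left_mono)
    have "0 \<le> (norm ?h - G)^2 + 2 * G^2" by simp
    then show "2 * norm ?h^2 + 2 * norm ?h * G \<le> 3 * (norm ?h^2 + G^2)"
      by (simp add: power2_diff)
  qed (use E t in auto)
  also have "\<dots> = 3 * E / t * (norm ?h^2 + G^2)" by simp
  finally have "\<bar>T - s * (2 * t * Re (e^2) * norm ?h^2)\<bar> \<le> 3 * E / t * (norm ?h^2 + G^2)" .
  with D show ?thesis by blast
qed

text \<open>
  The harmonic oscillator \<open>Y'' = w\<^sup>2 Y\<close> with perturbations of the size that occurs for the
  equation \<open>z y'' = (n - 1) y' + \<Theta> y\<close> after centring it at \<open>- a\<close>.
\<close>

locale perturbed_oscillator =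
  fixes Y \<alpha> \<beta> :: "complex \<Rightarrow> complex" and D r0 :: real
  assumes Y: "Y holomorphic_on UNIV" and r0: "1 \<le> r0" and D: "0 \<le> D"
    and ode: "\<And>w. r0 \<le> norm w \<Longrightarrow> deriv (deriv Y) w = \<alpha> w * deriv Y w + \<beta> w * Y w"
    and \<alpha>: "\<And>w. r0 \<le> norm w \<Longrightarrow> norm (\<alpha> w) \<le> D / norm w"
    and \<beta>: "\<And>w. r0 \<le> norm w \<Longrightarrow> norm (\<beta> w - w^2) \<le> D"
begin

definition P where "P w = w * Y w - deriv Y w"
definition M where "M w = w * Y w + deriv Y w"
definition E where "E = (1 + 2 * D) / 2"

lemma E: "0 \<le> E" using D by (simp add: E_def)

text \<open>
  The combinations \<open>P\<close> and \<open>M\<close> are the components along the unperturbed solutions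
  \<open>exp (- w\<^sup>2 / 2)\<close> and \<open>exp (w\<^sup>2 / 2)\<close>, up to their leading factors.
\<close>

lemma Y_eq: "w \<noteq> 0 \<Longrightarrow> Y w = (P w + M w) / (2 * w)" and dY_eq: "deriv Y w = (M w - P w) / 2"
  by (simp_all add: P_def M_def field_simps)

lemma perturbation_bound:
  assumes w: "r0 \<le> norm w" and u: "norm u \<le> 1 + D"
    and v: "norm v \<le> D / norm w"
  shows "norm (u * Y w + v * deriv Y w) \<le> E / norm w * (norm (P w) + norm (M w))"
proof -
  have w0: "0 < norm w" "w \<noteq> 0" using w r0 by auto
  let ?S = "norm (P w) + norm (M w)"
  have Yb: "norm (Y w) \<le> ?S / (2 * norm w)"
    unfolding Y_eq[OF w0(2)] norm_divide
    using w0 norm_triangle_ineq[of "P w" "M w"] by (simp add: norm_mult divide_right_mono)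
  have dYb: "norm (deriv Y w) \<le> ?S / 2"
    unfolding dY_eq using norm_triangle_ineq4[of "M w" "P w"] by (simp add: norm_divide)
  have "norm (u * Y w + v * deriv Y w) \<le> norm u * norm (Y w) + norm v * norm (deriv Y w)"
    by (metis norm_triangle_ineq norm_mult)
  also have "\<dots> \<le> (1 + D) * (?S / (2 * norm w)) + D / norm w * (?S / 2)"
    using D w0 by (intro add_mono mult_mono u v Yb dYb) auto
  also have "\<dots> = E / norm w * ?S" using w0 by (simp add: E_def field_simps)
  finally show ?thesis .
qed

lemma PM_derivatives:
  assumes w: "r0 \<le> norm w"
  shows "\<exists>\<epsilon>. (P has_field_derivative of_real (-1) * w * P w + \<epsilon>) (at w) \<and> norm \<epsilon> \<le> E / norm w * (norm (P w) + norm (M w))"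
    and "\<exists>\<epsilon>. (M has_field_derivative of_real 1 * w * M w + \<epsilon>) (at w) \<and> norm \<epsilon> \<le> E / norm w * (norm (P w) + norm (M w))"
proof -
  have dY: "deriv Y holomorphic_on UNIV" using Y by (intro holomorphic_deriv) auto
  have d: "(Y has_field_derivative deriv Y w) (at w)" "(deriv Y has_field_derivative deriv (deriv Y) w) (at w)"
    using Y dY by (auto intro: holomorphic_derivI)
  have "(P has_field_derivative Y w + w * deriv Y w - deriv (deriv Y) w) (at w)"
    unfolding P_def[abs_def] by (auto intro!: derivative_eq_intros d)
  moreover have "Y w + w * deriv Y w - deriv (deriv Y) w =
      of_real (-1) * w * P w + ((1 - (\<beta> w - w^2)) * Y w + (- \<alpha> w) * deriv Y w)"
    unfolding ode[OF w] P_def by (simp add: algebra_simps power2_eq_square)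
  moreover have "norm (1 - (\<beta> w - w^2)) \<le> 1 + D"
    using norm_triangle_ineq4[of 1 "\<beta> w - w^2"] \<beta>[OF w] by simp
  ultimately show "\<exists>\<epsilon>. (P has_field_derivative of_real (-1) * w * P w + \<epsilon>) (at w) \<and> norm \<epsilon> \<le> E / norm w * (norm (P w) + norm (M w))"
    using perturbation_bound[OF w, of "1 - (\<beta> w - w^2)" "- \<alpha> w"] \<alpha>[OF w] by (metis norm_minus_cancel)
  have "(M has_field_derivative Y w + w * deriv Y w + deriv (deriv Y) w) (at w)"
    unfolding M_def[abs_def] by (auto intro!: derivative_eq_intros d)
  moreover have "Y w + w * deriv Y w + deriv (deriv Y) w =
      of_real 1 * w * M w + ((1 + (\<beta> w - w^2)) * Y w + \<alpha> w * deriv Y w)"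
    unfolding ode[OF w] M_def by (simp add: algebra_simps power2_eq_square)
  moreover have "norm (1 + (\<beta> w - w^2)) \<le> 1 + D"
    using norm_triangle_ineq[of 1 "\<beta> w - w^2"] \<beta>[OF w] by simp
  ultimately show "\<exists>\<epsilon>. (M has_field_derivative of_real 1 * w * M w + \<epsilon>) (at w) \<and> norm \<epsilon> \<le> E / norm w * (norm (P w) + norm (M w))"
    using perturbation_bound[OF w, of "1 + (\<beta> w - w^2)" "\<alpha> w"] \<alpha>[OF w] by metis
qed

text \<open>
  Along the ray with direction \<open>e\<close> the rate \<open>c\<close> is \<open>Re (e\<^sup>2)\<close>: positive around the real axis,
  negative around the imaginary axis.
\<close>

lemma ray_energies_exist:
  assumes e: "norm e = 1"
  shows "\<exists>X' Z'. ray_energies (\<lambda>t. norm (P (of_real t * e))^2) (\<lambda>t. norm (M (of_real t * e))^2) X' Z' (3 * E) (Re (e^2)) r0"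
proof -
  let ?X = "\<lambda>t. norm (P (of_real t * e))^2" and ?Z = "\<lambda>t. norm (M (of_real t * e))^2"
  have nw: "norm (of_real t * e) = t" if "r0 \<le> t" for t using that r0 e by (simp add: norm_mult)
  have "\<exists>T. (?X has_real_derivative T) (at t) \<and> \<bar>T - (-1) * (2 * t * Re (e^2) * ?X t)\<bar> \<le> 3 * E / t * (?X t + ?Z t)"
    if t: "r0 \<le> t" for t
  proof -
    have w: "r0 \<le> norm (of_real t * e)" using nw[OF t] t by simp
    obtain \<epsilon> where "(P has_field_derivative of_real (-1) * (of_real t * e) * P (of_real t * e) + \<epsilon>) (at (of_real t * e))"
      "norm \<epsilon> \<le> E / t * (norm (P (of_real t * e)) + norm (M (of_real t * e)))"
      using PM_derivatives(1)[OF w] unfolding nw[OF t] by blast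
    then show ?thesis using t r0 E by (intro norm_square_ray_derivative[OF e]) auto
  qed
  then obtain X' where X': "\<And>t. r0 \<le> t \<Longrightarrow> (?X has_real_derivative X' t) (at t) \<and> \<bar>X' t - (-1) * (2 * t * Re (e^2) * ?X t)\<bar> \<le> 3 * E / t * (?X t + ?Z t)"
    by metis
  have "\<exists>T. (?Z has_real_derivative T) (at t) \<and> \<bar>T - 1 * (2 * t * Re (e^2) * ?Z t)\<bar> \<le> 3 * E / t * (?Z t + ?X t)"
    if t: "r0 \<le> t" for t
  proof -
    have w: "r0 \<le> norm (of_real t * e)" using nw[OF t] t by simp
    obtain \<epsilon> where "(M has_field_derivative of_real 1 * (of_real t * e) * M (of_real t * e) + \<epsilon>) (at (of_real t * e))"
      "norm \<epsilon> \<le> E / t * (norm (P (of_real t * e)) + norm (M (of_real t * e)))"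
      using PM_derivatives(2)[OF w] unfolding nw[OF t] by blast
    then show ?thesis using t r0 E by (intro norm_square_ray_derivative[OF e]) (auto simp: add.commute)
  qed
  then obtain Z' where Z': "\<And>t. r0 \<le> t \<Longrightarrow> (?Z has_real_derivative Z' t) (at t) \<and> \<bar>Z' t - 1 * (2 * t * Re (e^2) * ?Z t)\<bar> \<le> 3 * E / t * (?Z t + ?X t)"
    by metis
  have "ray_energies ?X ?Z X' Z' (3 * E) (Re (e^2)) r0"
    by unfold_locales (use r0 E X' Z' in \<open>auto simp: add.commute\<close>)
  then show ?thesis by blast
qed

text \<open>
  If \<open>Y\<close> is not exponentially large along any ray of the sectors \<open>Re (w\<^sup>2) > 0\<close>, then the
  dominant component never takes over there. The energy bound, uniform in the direction, gives
  \<open>|Y|\<^sup>2 \<le> B |w| ^ N exp (- Re (w\<^sup>2))\<close> in all directions, and Liouville's theorem applies to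
  \<open>Y exp (w\<^sup>2 / 2)\<close>.
\<close>

theorem recessive_imp_polynomial:
  assumes nz: "\<And>w. r0 \<le> norm w \<Longrightarrow> Y w \<noteq> 0 \<or> deriv Y w \<noteq> 0"
    and nd: "\<And>e K N r1. norm e = 1 \<Longrightarrow> 0 < Re (e^2) \<Longrightarrow> 0 < K \<Longrightarrow>
       \<exists>r\<ge>r1. norm (Y (of_real r * e))^2 * r ^ N < K * exp (Re (e^2) * r^2)"
  obtains p where "\<And>w. Y w = exp (- (w^2) / 2) * poly p w"
proof -
  have dY: "deriv Y holomorphic_on UNIV" using Y by (intro holomorphic_deriv) auto
  have "continuous_on UNIV (\<lambda>w. norm (P w)^2 + norm (M w)^2)"
    unfolding P_def M_def using Y dY by (intro continuous_intros holomorphic_on_imp_continuous_on)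
  then have "compact ((\<lambda>w. norm (P w)^2 + norm (M w)^2) ` sphere 0 r0)"
    by (intro compact_continuous_image) (auto intro: continuous_on_subset)
  then obtain S where S: "\<And>w. norm w = r0 \<Longrightarrow> norm (P w)^2 + norm (M w)^2 \<le> S"
    by (metis (no_types, lifting) compact_imp_bounded bounded_imp_bdd_above bdd_above.E image_eqI mem_sphere_0)
  define N where "N = nat \<lceil>5 * (3 * E)\<rceil>"
  have N: "5 * (3 * E) \<le> real N" unfolding N_def by linarith
  define B where "B = 5 * S * exp (5 * (3 * E) + 2 * r0^2)"
  have bound: "norm (P w)^2 + norm (M w)^2 \<le> B * norm w ^ N * exp (- Re (w^2))" if w: "r0 \<le> norm w" for w
  proof -
    define r where "r = norm w"
    define e where "e = w / of_real r"
    have rp: "0 < r" "r0 \<le> r" using w r0 by (auto simp: r_def)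
    have e: "norm e = 1" "w = of_real r * e" using rp by (auto simp: e_def r_def norm_divide)
    obtain X' Z' where "ray_energies (\<lambda>t. norm (P (of_real t * e))^2) (\<lambda>t. norm (M (of_real t * e))^2) X' Z' (3 * E) (Re (e^2)) r0"
      using ray_energies_exist[OF e(1)] by blast
    then interpret ray_energies "\<lambda>t. norm (P (of_real t * e))^2" "\<lambda>t. norm (M (of_real t * e))^2" X' Z' "3 * E" "Re (e^2)" r0 .
    have "norm (P (of_real r * e))^2 + norm (M (of_real r * e))^2 \<le> B * r ^ N * exp (- Re (e^2) * r^2)"
      unfolding B_def
    proof (rule uniform_bound[OF N _ _ _ rp(2)])
      show "norm (P (of_real r0 * e))^2 + norm (M (of_real r0 * e))^2 \<le> S"
        using e r0 by (intro S) (simp add: norm_mult)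
      show "\<bar>Re (e^2)\<bar> \<le> 1" using abs_Re_le_cmod[of "e^2"] e by (simp add: norm_power)
      fix r1 assume c: "0 < Re (e^2)" and r1: "r0 \<le> r1" and th: "5 * (3 * E) \<le> 2 * Re (e^2) * r1^2"
      show "norm (M (of_real r1 * e))^2 < 4 * norm (P (of_real r1 * e))^2"
      proof (rule ccontr)
        assume "\<not> ?thesis"
        then have dom: "4 * norm (P (of_real r1 * e))^2 \<le> norm (M (of_real r1 * e))^2" by simp
        have r1p: "0 < r1" using r1 r0 by simp
        let ?w1 = "of_real r1 * e"
        have n1: "r0 \<le> norm ?w1" using e r1 r1p by (simp add: norm_mult)
        have "M ?w1 \<noteq> 0"
        proof
          assume "M ?w1 = 0"
          then have "P ?w1 = 0" using dom by simp
          moreover have "?w1 \<noteq> 0" using n1 r0 by auto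
          ultimately show False using nz[OF n1] \<open>M ?w1 = 0\<close> Y_eq[of ?w1] dY_eq[of ?w1] by simp
        qed
        \<comment> \<open>The growth of the dominant component contradicts \<open>nd\<close> for this constant: dominance
          gives \<open>|M| \<le> 2 |P + M| = 4 r |Y|\<close>, whence the factor 16 and the two extra powers of
          \<open>r\<close>.\<close>
        define K where "K = norm (M ?w1)^2 * r1 ^ N * exp (- Re (e^2) * r1^2) / 16"
        have K: "0 < K" using \<open>M ?w1 \<noteq> 0\<close> r1p by (simp add: K_def)
        obtain r where r: "r \<ge> r1" "norm (Y (of_real r * e))^2 * r ^ (N + 2) < K * exp (Re (e^2) * r^2)"
          using nd[OF e(1) c K, of r1 "N + 2"] by blast
        let ?w = "of_real r * e"
        have rpos: "0 < r" using r r1p by simp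
        have nw: "norm ?w = r" using e rpos by (simp add: norm_mult)
        have "4 * norm (P ?w)^2 \<le> norm (M ?w)^2" by (rule dominance_persists[OF c r1 r(1) th dom])
        then have "(2 * norm (P ?w))^2 \<le> norm (M ?w)^2" by (simp add: power_mult_distrib)
        then have PM: "2 * norm (P ?w) \<le> norm (M ?w)" by (rule power2_le_imp_le) simp
        have "norm (M ?w) \<le> norm (P ?w + M ?w) + norm (P ?w)"
          using norm_triangle_ineq4[of "P ?w + M ?w" "P ?w"] by simp
        then have "norm (M ?w) \<le> 2 * norm (P ?w + M ?w)" using PM by linarith
        also have "norm (P ?w + M ?w) = 2 * r * norm (Y ?w)"
        proof -
          have "P ?w + M ?w = 2 * ?w * Y ?w" by (simp add: P_def M_def)
          then have "norm (P ?w + M ?w) = 2 * norm ?w * norm (Y ?w)" by (simp only: norm_mult) simp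
          then show ?thesis unfolding nw .
        qed
        finally have "norm (M ?w)^2 \<le> (2 * (2 * r * norm (Y ?w)))^2" by (intro power_mono) auto
        then have "norm (M ?w)^2 * r ^ N \<le> (2 * (2 * r * norm (Y ?w)))^2 * r ^ N"
          using rpos by (intro mult_right_mono) auto
        also have "\<dots> = 16 * (norm (Y ?w)^2 * r ^ (N + 2))" by (simp add: power_mult_distrib power_add power2_eq_square)
        also have "\<dots> < 16 * (K * exp (Re (e^2) * r^2))" using r(2) by simp
        also have "\<dots> = norm (M ?w1)^2 * r1 ^ N * exp (Re (e^2) * (r^2 - r1^2))"
          by (simp add: K_def right_diff_distrib exp_diff exp_minus field_simps)
        also have "\<dots> \<le> norm (M ?w)^2 * r ^ N"
          using N E by (intro dominant_growth[OF _ c r1 r(1) th dom]) linarith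
        finally show False by simp
      qed
    qed
    moreover have "Re (w^2) = Re (e^2) * r^2"
    proof -
      have "w^2 = of_real (r^2) * e^2" unfolding e(2) by (simp add: power_mult_distrib)
      then show ?thesis by (simp del: of_real_power)
    qed
    ultimately show ?thesis by (simp add: e(2)[symmetric] r_def[symmetric])
  qed
  define u where "u = (\<lambda>w. Y w * exp (w^2 / 2))"
  have u: "u holomorphic_on UNIV" unfolding u_def by (intro holomorphic_intros Y) auto
  have ub: "norm (u w) \<le> sqrt \<bar>B\<bar> * norm w ^ N" if w: "r0 \<le> norm w" for w
  proof (rule power2_le_imp_le)
    have w1: "1 \<le> norm w" using w r0 by simp
    then have w0: "w \<noteq> 0" by auto
    have "norm (Y w) \<le> norm (P w + M w) / 2"
    proof -
      have "norm (P w + M w) = 2 * norm w * norm (Y w)"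
        using Y_eq[OF w0] w0 by (simp add: norm_divide norm_mult)
      then show ?thesis using mult_right_mono[OF w1, of "norm (Y w)"] by simp
    qed
    also have "\<dots> \<le> (norm (P w) + norm (M w)) / 2"
      using norm_triangle_ineq[of "P w" "M w"] by simp
    finally have "norm (Y w)^2 \<le> ((norm (P w) + norm (M w)) / 2)^2" by (intro power_mono) auto
    also have "\<dots> \<le> norm (P w)^2 + norm (M w)^2"
    proof -
      have "0 \<le> (norm (P w) - norm (M w))^2 + 2 * norm (P w)^2 + 2 * norm (M w)^2" by simp
      then show ?thesis by (simp add: power2_eq_square algebra_simps)
    qed
    finally have Yb: "norm (Y w)^2 \<le> B * norm w ^ N * exp (- Re (w^2))" using bound[OF w] by linarith
    have "norm (u w)^2 = norm (Y w)^2 * exp (Re (w^2))"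
    proof -
      have "norm (exp (w^2 / 2))^2 = exp (Re (w^2))"
        by (simp add: power2_eq_square exp_add[symmetric])
      then show ?thesis by (simp add: u_def norm_mult power_mult_distrib)
    qed
    also have "\<dots> \<le> B * norm w ^ N * exp (- Re (w^2)) * exp (Re (w^2))"
      by (intro mult_right_mono Yb) simp
    also have "\<dots> = B * norm w ^ N" by (simp add: exp_minus)
    also have "\<dots> \<le> \<bar>B\<bar> * (norm w ^ N)^2"
    proof (intro mult_mono)
      show "norm w ^ N \<le> (norm w ^ N)^2" using mult_right_mono[OF one_le_power[OF w1, of N], of "norm w ^ N"] by (simp add: power2_eq_square)
    qed auto
    also have "\<dots> = (sqrt \<bar>B\<bar> * norm w ^ N)^2" by (simp add: power_mult_distrib)
    finally show "norm (u w)^2 \<le> (sqrt \<bar>B\<bar> * norm w ^ N)^2" .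
  qed auto
  define p where "p = (\<Sum>k\<le>N. monom ((deriv ^^ k) u 0 / fact k) k)"
  have "u w = poly p w" for w
    using Liouville_polynomial[where f = u and A = r0 and B = "sqrt \<bar>B\<bar>" and n = N and \<xi> = w, OF u ub] by (simp add: p_def poly_sum poly_monom)
  then have "Y w = exp (- (w^2) / 2) * poly p w" for w
    by (metis (no_types, lifting) u_def exp_minus_inverse mult.assoc mult.commute mult.right_neutral minus_divide_left)
  then show ?thesis by (rule that)
qed

end

section \<open>Quasi-polynomials with a Wronskian partner\<close>

definition hermite_fun :: "nat \<Rightarrow> complex \<Rightarrow> complex poly \<Rightarrow> complex \<Rightarrow> complex" where
  "hermite_fun n a p z = z ^ n * exp (- g z a) * poly p z"

definition hermite_deriv :: "nat \<Rightarrow> complex \<Rightarrow> complex poly \<Rightarrow> complex poly" where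
  "hermite_deriv n a p = smult (of_nat n) p + [:0, 1:] * pderiv p - [:0, a, 1:] * p"

lemma hermite_fun_has_derivative:
  assumes "n \<ge> 1"
  shows "(hermite_fun n a p has_field_derivative
     z ^ (n - 1) * exp (- g z a) * poly (hermite_deriv n a p) z) (at z)"
proof -
  obtain k where k: "n = Suc k" using assms by (cases n) auto
  have "(hermite_fun n a p has_field_derivative
     (of_nat n * z ^ (n - 1)) * exp (- g z a) * poly p z
     + z ^ n * (exp (- g z a) * (- (z + a))) * poly p z
     + z ^ n * exp (- g z a) * poly (pderiv p) z) (at z)"
    unfolding hermite_fun_def[abs_def] g_def
    by (rule derivative_eq_intros refl | simp)+ (simp add: algebra_simps k)
  moreover have "(of_nat n * z ^ (n - 1)) * exp (- g z a) * poly p z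
     + z ^ n * (exp (- g z a) * (- (z + a))) * poly p z
     + z ^ n * exp (- g z a) * poly (pderiv p) z
     = z ^ (n - 1) * exp (- g z a) * poly (hermite_deriv n a p) z"
    by (simp add: hermite_deriv_def k algebra_simps power2_eq_square)
  ultimately show ?thesis by simp
qed

lemma deriv_hermite_fun:
  "n \<ge> 1 \<Longrightarrow> deriv (hermite_fun n a p) z = z ^ (n - 1) * exp (- g z a) * poly (hermite_deriv n a p) z"
  by (rule DERIV_imp_deriv[OF hermite_fun_has_derivative])

lemma holomorphic_hermite_fun: "hermite_fun n a p holomorphic_on S"
  unfolding hermite_fun_def[abs_def] g_def by (intro holomorphic_intros) auto

lemma hermite_fun_eq_0_iff:
  "n \<ge> 1 \<Longrightarrow> hermite_fun n a p z = 0 \<longleftrightarrow> z = 0 \<or> poly p z = 0"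
  by (auto simp: hermite_fun_def)

text \<open>
  What remains of the polynomial factor after the first-order part of the equation is removed.
  The quasi-polynomial solves the equation with coefficient \<open>\<Theta>\<close> iff this is \<open>\<Theta> p\<close>.
\<close>

definition hermite_residual :: "nat \<Rightarrow> complex \<Rightarrow> complex poly \<Rightarrow> complex poly" where
  "hermite_residual n a p = pderiv (hermite_deriv n a p) - [:a, 1:] * hermite_deriv n a p"

lemma hermite_fun_second_order:
  assumes n: "n \<ge> 1"
  shows "z * deriv (deriv (hermite_fun n a p)) z =
    (of_nat n - 1) * deriv (hermite_fun n a p) z + z ^ n * exp (- g z a) * poly (hermite_residual n a p) z"
proof -
  obtain k where k: "n = Suc k" using n by (cases n) auto
  let ?q = "hermite_deriv n a p"
  have eq: "deriv (hermite_fun n a p) = (\<lambda>z. z ^ k * exp (- g z a) * poly ?q z)"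
    using deriv_hermite_fun[OF n] by (simp add: k fun_eq_iff)
  have d: "((\<lambda>z. z ^ k * exp (- g z a) * poly ?q z) has_field_derivative
      (of_nat k * z ^ (k - 1)) * exp (- g z a) * poly ?q z
     + z ^ k * (exp (- g z a) * (- (z + a))) * poly ?q z
     + z ^ k * exp (- g z a) * poly (pderiv ?q) z) (at z)"
    unfolding g_def by (rule derivative_eq_intros refl | simp)+ (simp add: algebra_simps)
  have d2: "deriv (deriv (hermite_fun n a p)) z = (of_nat k * z ^ (k - 1)) * exp (- g z a) * poly ?q z
     + z ^ k * (exp (- g z a) * (- (z + a))) * poly ?q z
     + z ^ k * exp (- g z a) * poly (pderiv ?q) z"
    unfolding eq by (rule DERIV_imp_deriv[OF d])
  have "z * deriv (deriv (hermite_fun n a p)) z = of_nat k * (z * z ^ (k - 1)) * exp (- g z a) * poly ?q z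
     + z ^ n * exp (- g z a) * poly (hermite_residual n a p) z"
    unfolding d2 by (simp add: hermite_residual_def k algebra_simps)
  also have "of_nat k * (z * z ^ (k - 1)) * exp (- g z a) * poly ?q z = (of_nat n - 1) * deriv (hermite_fun n a p) z"
    unfolding deriv_hermite_fun[OF n] unfolding k by (cases k) auto
  finally show ?thesis .
qed

lemma hermite_fun_ode_iff:
  assumes n: "n \<ge> 1" and z: "z \<noteq> 0"
  shows "z * deriv (deriv (hermite_fun n a p)) z =
      (of_nat n - 1) * deriv (hermite_fun n a p) z + \<theta> * hermite_fun n a p z
    \<longleftrightarrow> poly (hermite_residual n a p) z = \<theta> * poly p z"
  unfolding hermite_fun_second_order[OF n] using z by (auto simp: hermite_fun_def)

lemma hermite_fun_ode:
  assumes n: "n \<ge> 1" and "hermite_residual n a p = \<Theta> * p"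
  shows "z * deriv (deriv (hermite_fun n a p)) z =
      (of_nat n - 1) * deriv (hermite_fun n a p) z + poly \<Theta> z * hermite_fun n a p z"
  unfolding hermite_fun_second_order[OF n] assms(2) by (simp add: hermite_fun_def)

text \<open>
  The polynomial \<open>\<Theta>\<close> of the equation \<open>z y'' = (n - 1) y' + \<Theta> y\<close> for the potential of type I.
\<close>

definition pot_poly :: "nat \<Rightarrow> nat \<Rightarrow> complex \<Rightarrow> complex \<Rightarrow> complex poly" where
  "pot_poly m n a b = [: - (b + (2 * (of_nat m + 1 + of_nat n / 2) - 1/2) * a), a^2 - 2 * of_nat m - of_nat n, 2 * a, 1 :]"

lemma V_I_eq:
  assumes "z \<noteq> 0"
  shows "V_I m n a b z = poly (pot_poly m n a b) z / z + (of_nat n^2 - 1) / 4 / z^2"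
  using assms by (simp add: V_I_def V_def pot_poly_def field_simps power2_eq_square)

lemma poly_eq_of_infinite:
  fixes p q :: "complex poly"
  assumes "infinite S" "\<And>z. z \<in> S \<Longrightarrow> poly p z = poly q z" shows "p = q"
proof (rule ccontr)
  assume "p \<noteq> q"
  then have "finite {z. poly (p - q) z = 0}" by (intro poly_roots_finite) simp
  moreover have "S \<subseteq> {z. poly (p - q) z = 0}" using assms(2) by auto
  ultimately show False using assms(1) finite_subset by blast
qed

lemma card_roots_rsquarefree:
  fixes p :: "complex poly"
  assumes "rsquarefree p" shows "card {z. poly p z = 0} = degree p"
proof -
  have p0: "p \<noteq> 0" using assms by (simp add: rsquarefree_def)
  have "degree p = degree (smult (lead_coeff p) (\<Prod>z|poly p z = 0. [:- z, 1:]))"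
    using complex_poly_decompose_rsquarefree[OF assms] by simp
  also have "\<dots> = degree (\<Prod>z|poly p z = 0. [:- z, 1:])" using p0 by simp
  also have "\<dots> = (\<Sum>z|poly p z = 0. degree [:- z, 1:])"
    by (intro degree_prod_sum_eq) auto
  also have "\<dots> = card {z. poly p z = 0}" by simp
  finally show ?thesis by simp
qed

lemma rsquarefree_dvd:
  fixes p q :: "complex poly"
  assumes p: "rsquarefree p" and r: "\<And>z. poly p z = 0 \<Longrightarrow> poly q z = 0"
  shows "p dvd q"
proof -
  have p0: "p \<noteq> 0" using p by (simp add: rsquarefree_def)
  have "q mod p = 0"
  proof (rule ccontr)
    assume nz: "q mod p \<noteq> 0"
    have "poly (q mod p) z = 0" if "poly p z = 0" for z
    proof -
      have "poly q z = poly (q div p) z * poly p z + poly (q mod p) z"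
        by (metis div_mult_mod_eq poly_add poly_mult)
      then show ?thesis using r[OF that] that by simp
    qed
    then have "card {z. poly p z = 0} \<le> card {z. poly (q mod p) z = 0}"
      using nz by (intro card_mono poly_roots_finite) auto
    also have "\<dots> \<le> degree (q mod p)" using nz by (rule card_poly_roots_bound)
    finally have "degree p \<le> degree (q mod p)" using card_roots_rsquarefree[OF p] by simp
    then show False using degree_mod_less[OF p0, of q] nz by simp
  qed
  then show ?thesis by (simp add: mod_eq_0_iff_dvd)
qed

lemma continuous_zero_off_finite:
  fixes F :: "complex \<Rightarrow> complex"
  assumes "continuous_on UNIV F" "finite S" "\<And>z. z \<notin> S \<Longrightarrow> F z = 0"
  shows "F z = 0"
proof -
  have "F \<midarrow>z\<rightarrow> F z" using assms(1) by (simp add: continuous_on_eq_continuous_at isContD)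
  moreover have "\<forall>\<^sub>F w in at z. F w = 0"
  proof -
    have "open (- (S - {z}))" using assms(2) by (intro open_Compl finite_imp_closed) auto
    then have "\<forall>\<^sub>F w in at z. w \<in> - (S - {z}) - {z}" by (intro eventually_at_in_open) auto
    then show ?thesis by eventually_elim (use assms(3) in auto)
  qed
  then have "F \<midarrow>z\<rightarrow> 0" using tendsto_eventually by blast
  ultimately show ?thesis using tendsto_unique[OF at_neq_bot] by blast
qed

text \<open>
  Differentiating the Wronskian identity and using it once more to remove the monomial. The
  result says that \<open>U\<close> and \<open>v\<close> solve the same equation wherever one can divide.
\<close>

lemma wronskian_second_order:
  assumes U: "U holomorphic_on UNIV" and v: "v holomorphic_on UNIV"
    and W: "\<And>z. deriv U z * v z - U z * deriv v z = k * z ^ (n - 1)" and n: "n \<ge> 1"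
  shows "(z * deriv (deriv U) z - (of_nat n - 1) * deriv U z) * v z =
     U z * (z * deriv (deriv v) z - (of_nat n - 1) * deriv v z)"
proof -
  have dU: "deriv U holomorphic_on UNIV" and dv: "deriv v holomorphic_on UNIV"
    using U v by (auto intro: holomorphic_deriv)
  have d: "(U has_field_derivative deriv U z) (at z)" "(deriv U has_field_derivative deriv (deriv U) z) (at z)"
     "(v has_field_derivative deriv v z) (at z)" "(deriv v has_field_derivative deriv (deriv v) z) (at z)"
    using U v dU dv by (auto intro: holomorphic_derivI)
  have "((\<lambda>z. deriv U z * v z - U z * deriv v z) has_field_derivative
      deriv (deriv U) z * v z - U z * deriv (deriv v) z) (at z)"
    by (auto intro!: derivative_eq_intros d simp: algebra_simps)
  moreover have "((\<lambda>z. k * z ^ (n - 1)) has_field_derivative k * (of_nat (n - 1) * z ^ (n - 1 - 1))) (at z)"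
    by (auto intro!: derivative_eq_intros)
  ultimately have e: "deriv (deriv U) z * v z - U z * deriv (deriv v) z = k * (of_nat (n - 1) * z ^ (n - 1 - 1))"
    unfolding W using DERIV_unique by blast
  have "z * (of_nat (n - 1) * z ^ (n - 1 - 1)) = (of_nat n - 1) * z ^ (n - 1)"
  proof (cases "n - 1")
    case 0 then show ?thesis using n by (cases n) auto
  next
    case (Suc j) then show ?thesis using n by (cases n) auto
  qed
  then have "z * (deriv (deriv U) z * v z - U z * deriv (deriv v) z) = (of_nat n - 1) * (deriv U z * v z - U z * deriv v z)"
    unfolding e W by (metis mult.left_commute)
  then show ?thesis by (simp add: algebra_simps)
qed

text \<open>
  The normal form common to the oscillators and the meromorphic functions: \<open>U\<close> is the solution
  that is recessive at 0 and in both directions of the real axis, \<open>v\<close> is any other solution of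
  the equation.
\<close>

locale hermite_pair =
  fixes n :: nat and a :: complex and p :: "complex poly" and v :: "complex \<Rightarrow> complex" and k :: complex
  assumes n: "n \<ge> 1" and p0: "poly p 0 \<noteq> 0" and v: "v holomorphic_on UNIV" and k: "k \<noteq> 0"
    and W: "\<And>z. deriv (hermite_fun n a p) z * v z - hermite_fun n a p z * deriv v z = k * z ^ (n - 1)"
begin

abbreviation "U \<equiv> hermite_fun n a p"

lemma pnz: "p \<noteq> 0" using p0 by auto

lemma finite_zeros: "finite {z. U z = 0}"
proof -
  have "{z. U z = 0} = insert 0 {z. poly p z = 0}" using n by (auto simp: hermite_fun_eq_0_iff)
  then show ?thesis using poly_roots_finite[OF pnz] by simp
qed

text \<open>
  The Wronskian identity with \<open>z ^ (n - 1)\<close> cancelled, hence informative at 0 as well.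
\<close>

lemma wronskian_reduced:
  "exp (- g z a) * (poly (hermite_deriv n a p) z * v z - z * poly p z * deriv v z) = k"
proof -
  define F where "F = (\<lambda>z. exp (- g z a) * (poly (hermite_deriv n a p) z * v z - z * poly p z * deriv v z) - k)"
  have "F z = 0"
  proof (rule continuous_zero_off_finite[of F "{0}"])
    have "deriv v holomorphic_on UNIV" using v by (auto intro: holomorphic_deriv)
    then show "continuous_on UNIV F"
      unfolding F_def g_def using v by (intro continuous_intros holomorphic_on_imp_continuous_on) auto
    fix z :: complex assume z: "z \<notin> {0}"
    have "z ^ n = z ^ (n - 1) * z" using n by (cases n) auto
    then have "z ^ (n - 1) * F z = 0"
      using W[of z] n by (simp add: F_def deriv_hermite_fun hermite_fun_def algebra_simps)
    then show "F z = 0" using z by simp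
  qed auto
  then show ?thesis by (simp add: F_def)
qed

lemma v_nonzero: "U z = 0 \<Longrightarrow> v z \<noteq> 0"
  using wronskian_reduced[of z] k n by (auto simp: hermite_fun_eq_0_iff)

text \<open>
  At a multiple root both terms of the reduced Wronskian would vanish.
\<close>

lemma rsquarefree: "rsquarefree p"
  unfolding rsquarefree_roots
proof safe
  fix z assume z: "poly p z = 0" "poly (pderiv p) z = 0"
  then have "poly (hermite_deriv n a p) z = 0" by (simp add: hermite_deriv_def)
  then show False using wronskian_reduced[of z] z k by simp
qed

text \<open>
  At a root of \<open>p\<close> the identity \<open>wronskian_second_order\<close> shows that the residual vanishes. As
  the roots are simple, \<open>p\<close> divides the residual, and the quotient is a cubic polynomial. Its
  top coefficients are those of every potential of type I; the linear one is fixed by the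
  leading coefficient of \<open>p\<close>, which brings in the degree, and the constant one is matched by
  choosing \<open>b\<close>.
\<close>

lemma residual_eq: obtains b where "hermite_residual n a p = pot_poly (degree p + 1) n a b * p"
proof -
  \<comment> \<open>The part of the residual that is not a multiple of \<open>p\<close> from the outset.\<close>
  define N where "N = smult (of_nat n + 1) (pderiv p) + [:0, 1:] * pderiv (pderiv p) - [:0, 2 * a, 2:] * pderiv p"
  have res: "hermite_residual n a p = [: - a - of_nat n * a, a^2 - 2 - of_nat n, 2 * a, 1:] * p + N"
    by (rule poly_eq_poly_eq_iff[THEN iffD1], rule ext) (simp add: hermite_residual_def hermite_deriv_def N_def pderiv_add pderiv_diff pderiv_mult
        pderiv_smult pderiv_pCons algebra_simps power2_eq_square power3_eq_cube)
  have "p dvd N"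
  proof (rule rsquarefree_dvd[OF rsquarefree])
    fix z assume z: "poly p z = 0"
    then have Uz: "U z = 0" and z0: "z \<noteq> 0" using p0 by (auto simp: hermite_fun_def)
    have "(z * deriv (deriv U) z - (of_nat n - 1) * deriv U z) * v z = 0"
      using wronskian_second_order[OF holomorphic_hermite_fun v W n, of z] Uz by simp
    then have "z * deriv (deriv U) z = (of_nat n - 1) * deriv U z + 0 * U z"
      using v_nonzero[OF Uz] by simp
    then have "poly (hermite_residual n a p) z = 0 * poly p z"
      by (rule hermite_fun_ode_iff[OF n z0, THEN iffD1])
    then show "poly N z = 0" unfolding res using z by simp
  qed
  then obtain s where s: "N = p * s" by (auto elim: dvdE)
  let ?d = "degree p"
  have cN: "coeff N (Suc j) = (of_nat n + 1) * (of_nat (Suc (Suc j)) * coeff p (Suc (Suc j)))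
     + of_nat (Suc j) * (of_nat (Suc (Suc j)) * coeff p (Suc (Suc j)))
     - 2 * a * (of_nat (Suc j) * coeff p (Suc j)) - 2 * (of_nat j * coeff p j)" for j
    by (cases j) (simp_all add: N_def coeff_pderiv algebra_simps)
  have hi: "coeff N (Suc j) = 0" if "j > ?d" for j
    using that by (simp add: cN coeff_eq_0)
  have "degree N \<le> Suc ?d"
  proof (rule degree_le, safe)
    fix i assume "i > Suc ?d"
    then show "coeff N i = 0" using hi[of "i - 1"] by (cases i) auto
  qed
  then have "degree s \<le> 1"
    using s pnz by (cases "s = 0") (auto simp: degree_mult_eq)
  then have s_eq: "s = [: coeff s 0, coeff s 1 :]"
  proof -
    assume "degree s \<le> 1"
    then show ?thesis by (intro poly_eqI) (auto simp: coeff_pCons coeff_eq_0 split: nat.split)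
  qed
  \<comment> \<open>The coefficient of degree \<open>degree p + 1\<close> in \<open>N = p s\<close>, computed in two ways.\<close>
  have "coeff N (Suc ?d) = lead_coeff p * coeff s 1"
  proof -
    have "N = smult (coeff s 0) p + pCons 0 (smult (coeff s 1) p)"
      unfolding s by (subst s_eq) (simp add: mult.commute)
    then show ?thesis by (simp add: coeff_eq_0)
  qed
  moreover have "coeff N (Suc ?d) = - 2 * of_nat ?d * lead_coeff p" by (simp add: cN coeff_eq_0)
  ultimately have "lead_coeff p * coeff s 1 = lead_coeff p * (- 2 * of_nat ?d)"
    by (metis mult.commute)
  moreover have "lead_coeff p \<noteq> 0" using pnz by simp
  ultimately have c1: "coeff s 1 = - 2 * of_nat ?d" using mult_left_cancel by blast
  define m where "m = ?d + 1"
  define b where "b = - (- a - of_nat n * a + coeff s 0) - (2 * (of_nat m + 1 + of_nat n / 2) - 1/2) * a"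
  have "hermite_residual n a p = ([: - a - of_nat n * a, a^2 - 2 - of_nat n, 2 * a, 1:] + s) * p"
    unfolding res s by (simp add: algebra_simps)
  also have "[: - a - of_nat n * a, a^2 - 2 - of_nat n, 2 * a, 1:] + s = pot_poly m n a b"
    by (subst s_eq) (simp add: pot_poly_def b_def c1[unfolded One_nat_def] m_def algebra_simps)
  finally show ?thesis using that[of b] by (simp add: m_def)
qed

lemma ode_v:
  assumes U: "\<And>z. z * deriv (deriv U) z = (of_nat n - 1) * deriv U z + poly \<Theta> z * U z"
  shows "z * deriv (deriv v) z = (of_nat n - 1) * deriv v z + poly \<Theta> z * v z"
proof -
  define F where "F = (\<lambda>z. z * deriv (deriv v) z - (of_nat n - 1) * deriv v z - poly \<Theta> z * v z)"
  have "F z = 0"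
  proof (rule continuous_zero_off_finite[of F, OF _ finite_zeros])
    have h: "deriv v holomorphic_on UNIV" "deriv (deriv v) holomorphic_on UNIV"
      using v by (auto intro!: holomorphic_deriv)
    show "continuous_on UNIV F"
      unfolding F_def using v h by (intro continuous_intros holomorphic_on_imp_continuous_on) auto
    fix z assume z: "z \<notin> {z. U z = 0}"
    have "U z * F z = 0"
      using wronskian_second_order[OF holomorphic_hermite_fun v W n, of z] U[of z]
      by (simp add: F_def algebra_simps)
    then show "F z = 0" using z by simp
  qed
  then show ?thesis by (simp add: F_def algebra_simps)
qed

end

section \<open>The quotient of a Wronskian pair\<close>

text \<open>
  The part of the structure that does not depend on \<open>U\<close> being a quasi-polynomial. It serves for
  the quotients of pairs as well as for a function of the family before \<open>U\<close> is known to be one.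
\<close>

locale wronskian_pair =
  fixes U v :: "complex \<Rightarrow> complex" and k :: complex and n :: nat
  assumes U: "U holomorphic_on UNIV" and v: "v holomorphic_on UNIV" and k: "k \<noteq> 0" and n: "n \<ge> 1"
    and v0: "v 0 \<noteq> 0"
    and W: "\<And>z. deriv U z * v z - U z * deriv v z = k * z ^ (n - 1)"
begin

definition quot :: "complex \<Rightarrow> complex" where "quot z = U z / v z"

lemma pair_derivatives: "(U has_field_derivative deriv U z) (at z)" "(v has_field_derivative deriv v z) (at z)"
    "(deriv v has_field_derivative deriv (deriv v) z) (at z)"
    "(deriv U has_field_derivative deriv (deriv U) z) (at z)"
proof -
  have "deriv v holomorphic_on UNIV" "deriv U holomorphic_on UNIV" using U v by (auto intro: holomorphic_deriv)
  then show "(U has_field_derivative deriv U z) (at z)" "(v has_field_derivative deriv v z) (at z)"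
    "(deriv v has_field_derivative deriv (deriv v) z) (at z)"
    "(deriv U has_field_derivative deriv (deriv U) z) (at z)"
    using U v by (auto intro: holomorphic_derivI)
qed

lemma zero_of_v:
  assumes "v z = 0" shows "z \<noteq> 0" "U z \<noteq> 0" "deriv v z \<noteq> 0"
proof -
  show z: "z \<noteq> 0" using assms v0 by auto
  have "U z * deriv v z \<noteq> 0" using W[of z] assms z k by auto
  then show "U z \<noteq> 0" "deriv v z \<noteq> 0" by auto
qed

lemma eventually_v_nonzero: "\<forall>\<^sub>F w in at z. v w \<noteq> 0"
  using non_zero_neighbour_alt[OF v open_UNIV connected_UNIV UNIV_I UNIV_I v0, of z] by auto

lemma isCont_U: "isCont U z" and isCont_v: "isCont v z"
  using pair_derivatives DERIV_isCont by blast+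

lemma quot_has_derivative:
  assumes "v z \<noteq> 0" shows "(quot has_field_derivative k * z ^ (n - 1) / (v z)^2) (at z)"
proof -
  have "(quot has_field_derivative (deriv U z * v z - U z * deriv v z) / (v z * v z)) (at z)"
    unfolding quot_def[abs_def] using assms by (auto intro!: derivative_eq_intros pair_derivatives)
  then show ?thesis unfolding W by (simp add: power2_eq_square)
qed

lemma open_v: "open {z. v z \<noteq> 0}"
proof -
  have "{z. v z \<noteq> 0} = v -` (- {0})" by auto
  then show ?thesis
    using holomorphic_on_imp_continuous_on[OF v] by (simp add: continuous_on_open_vimage open_Compl)
qed

lemma is_pole_quot_iff: "is_pole quot z \<longleftrightarrow> v z = 0"
proof
  assume p: "is_pole quot z"
  show "v z = 0"
  proof (rule ccontr)
    assume "v z \<noteq> 0"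
    then have "quot holomorphic_on {z. v z \<noteq> 0}"
      unfolding quot_def[abs_def] using U v by (intro holomorphic_intros) (auto intro: holomorphic_on_subset)
    then show False
      using not_is_pole_holomorphic[OF open_v, of z quot] \<open>v z \<noteq> 0\<close> p by simp
  qed
next
  assume z: "v z = 0"
  have "filterlim v (at 0) (at z)"
    unfolding filterlim_at using isContD[OF isCont_v, of z] z eventually_v_nonzero by (simp add: eventually_conj_iff)
  then show "is_pole quot z"
    unfolding quot_def[abs_def] using isCont_U zero_of_v[OF z] by (intro is_pole_divide) auto
qed

lemma zorder_pole:
  assumes z: "v z = 0" shows "zorder quot z = -1"
proof -
  have "zorder v z = 1"
    by (rule zorder_zero_eqI[OF v open_UNIV UNIV_I]) (use z zero_of_v[OF z] in auto)
  moreover have "zorder U z = 0"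
    by (rule zorder_zero_eqI[OF U open_UNIV UNIV_I]) (use zero_of_v[OF z] in auto)
  moreover have "zorder quot z = zorder U z - zorder v z"
  proof -
    have an: "U analytic_on {z}" "v analytic_on {z}"
      using U v by (auto simp: analytic_at)
    have "\<forall>\<^sub>F w in at z. U w \<noteq> 0"
      using tendsto_imp_eventually_ne[OF isContD[OF isCont_U]] zero_of_v(2)[OF z] by blast
    then have "\<exists>\<^sub>F w in at z. U w \<noteq> 0" "\<exists>\<^sub>F w in at z. v w \<noteq> 0"
      using eventually_v_nonzero by (auto intro!: eventually_frequently)
    then show ?thesis
      unfolding quot_def[abs_def] by (intro zorder_divide analytic_on_imp_meromorphic_on an)
  qed
  ultimately show ?thesis by simp
qed

lemma quot_nicely_meromorphic: "quot nicely_meromorphic_on UNIV"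
proof -
  have "quot meromorphic_on UNIV"
    unfolding quot_def[abs_def] using U v
    by (intro meromorphic_on_divide analytic_on_imp_meromorphic_on) (simp_all add: analytic_on_open)
  moreover have "(is_pole quot z \<and> quot z = 0) \<or> quot \<midarrow>z\<rightarrow> quot z" for z
  proof (cases "v z = 0")
    case True then show ?thesis using is_pole_quot_iff[of z] by (simp add: quot_def)
  next
    case False
    then show ?thesis using DERIV_isCont[OF quot_has_derivative] isContD by blast
  qed
  ultimately show ?thesis by (simp add: nicely_meromorphic_on_def)
qed

lemma critical_points_quot: "critical_points quot = (if n = 1 then {} else {0})"
proof -
  have "z \<in> critical_points quot \<longleftrightarrow> z = 0 \<and> n \<noteq> 1" for z
  proof (cases "v z = 0")
    case True
    then show ?thesis using zorder_pole[OF True] zero_of_v(1)[OF True] is_pole_quot_iff[of z]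
      by (simp add: critical_points_def)
  next
    case False
    have "deriv quot z = k * z ^ (n - 1) / (v z)^2" by (rule DERIV_imp_deriv[OF quot_has_derivative[OF False]])
    then show ?thesis using False k n is_pole_quot_iff[of z] by (auto simp: critical_points_def)
  qed
  then show ?thesis by auto
qed

text \<open>
  The Schwarzian before its removable singularities at the poles are filled in.
\<close>

definition schwarz_expr :: "complex \<Rightarrow> complex" where
  "schwarz_expr z = (deriv ^^ 3) quot z / deriv quot z - 3 / 2 * ((deriv ^^ 2) quot z / deriv quot z)^2"

text \<open>
  From \<open>f' = F\<close> with logarithmic derivative \<open>L\<close> the Schwarzian is \<open>L' - L\<^sup>2 / 2\<close>, where
  \<open>L = (n - 1) / z - 2 v' / v\<close>.
\<close>

lemma schwarz_expr_eq:
  assumes vz: "v z \<noteq> 0" and z: "z \<noteq> 0"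
  shows "schwarz_expr z = - 2 * (deriv (deriv v) z / v z - (of_nat n - 1) * deriv v z / (z * v z)) - (of_nat n^2 - 1) / (2 * z^2)"
proof -
  define S where "S = {z. v z \<noteq> 0} - {0}"
  have S: "open S" unfolding S_def by (intro open_Diff open_v) auto
  have zS: "z \<in> S" using assms by (simp add: S_def)
  define F where "F = (\<lambda>z. k * z ^ (n - 1) / (v z)^2)"
  define L where "L = (\<lambda>z. (of_nat n - 1) / z - 2 * deriv v z / v z)"
  define L' where "L' = (\<lambda>z. - (of_nat n - 1) / z^2 - 2 * deriv (deriv v) z / v z + 2 * (deriv v z / v z)^2)"
  have dF: "(F has_field_derivative F z * L z) (at z)" if "z \<in> S" for z
  proof -
    have z: "v z \<noteq> 0" "z \<noteq> 0" using that by (auto simp: S_def)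
    have "(F has_field_derivative (k * (of_nat (n - 1) * z ^ (n - 1 - 1)) * (v z)^2 - k * z ^ (n - 1) * (2 * v z * deriv v z)) / ((v z)^2 * (v z)^2)) (at z)"
      unfolding F_def using z by (auto intro!: derivative_eq_intros pair_derivatives)
    moreover have "of_nat (n - 1) * z ^ (n - 1 - 1) = (of_nat n - 1) / z * z ^ (n - 1)"
    proof (cases "n - 1")
      case 0 then show ?thesis using n by (cases n) auto
    next
      case (Suc j) then show ?thesis using n z by (cases n) auto
    qed
    ultimately have "(F has_field_derivative (k * ((of_nat n - 1) / z * z ^ (n - 1)) * (v z)^2 - k * z ^ (n - 1) * (2 * v z * deriv v z)) / ((v z)^2 * (v z)^2)) (at z)"
      by simp
    also have "(k * ((of_nat n - 1) / z * z ^ (n - 1)) * (v z)^2 - k * z ^ (n - 1) * (2 * v z * deriv v z)) / ((v z)^2 * (v z)^2) = F z * L z"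
      using z by (simp add: F_def L_def field_simps power2_eq_square)
    finally show ?thesis .
  qed
  have dL: "(L has_field_derivative L' z) (at z)" if "z \<in> S" for z
  proof -
    have z: "v z \<noteq> 0" "z \<noteq> 0" using that by (auto simp: S_def)
    show ?thesis unfolding L_def L'_def using z
      by (auto intro!: derivative_eq_intros pair_derivatives simp: field_simps power2_eq_square)
  qed
  have d1: "deriv quot z = F z" if "z \<in> S" for z
    using that quot_has_derivative by (auto simp: S_def F_def intro!: DERIV_imp_deriv)
  have ev: "\<forall>\<^sub>F w in nhds z. w \<in> S" if "z \<in> S" for z using S that eventually_nhds by blast
  have d2: "(deriv ^^ 2) quot z = F z * L z" if "z \<in> S" for z
  proof -
    have "deriv (deriv quot) z = deriv F z"
      by (intro deriv_cong_ev refl) (rule eventually_mono[OF ev[OF that] d1])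
    then show ?thesis using DERIV_imp_deriv[OF dF[OF that]] by (simp add: numeral_2_eq_2)
  qed
  have d3: "(deriv ^^ 3) quot z = F z * L z * L z + F z * L' z" if "z \<in> S" for z
  proof -
    have "deriv ((deriv ^^ 2) quot) z = deriv (\<lambda>z. F z * L z) z"
      by (intro deriv_cong_ev refl) (rule eventually_mono[OF ev[OF that] d2])
    also have "\<dots> = F z * L z * L z + F z * L' z"
      by (rule DERIV_imp_deriv) (auto intro!: derivative_eq_intros dF dL that)
    finally show ?thesis by (simp add: numeral_2_eq_2 numeral_3_eq_3)
  qed
  have F0: "F z \<noteq> 0" using assms k by (simp add: F_def)
  have "schwarz_expr z = L' z - (L z)^2 / 2"
    unfolding schwarz_expr_def d1[OF zS] d2[OF zS] d3[OF zS] using F0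
    by (simp add: field_simps power2_eq_square)
  also have "\<dots> = - 2 * (deriv (deriv v) z / v z - (of_nat n - 1) * deriv v z / (z * v z)) - (of_nat n^2 - 1) / (2 * z^2)"
    using assms unfolding L_def L'_def by (simp add: field_simps power2_eq_square)
  finally show ?thesis .
qed

text \<open>
  The equation for \<open>v\<close> removes the poles at the zeros of \<open>v\<close>; the value there follows by
  continuity.
\<close>

lemma schwarzian_quot:
  assumes z: "z \<noteq> 0" and T: "isCont T z"
    and ode: "\<And>z. z * deriv (deriv v) z = (of_nat n - 1) * deriv v z + T z * v z"
  shows "schwarzian quot z = - 2 * (T z / z + (of_nat n^2 - 1) / 4 / z^2)"
proof -
  define G where "G = (\<lambda>z. - 2 * (T z / z + (of_nat n^2 - 1) / 4 / z^2))"
  have "\<forall>\<^sub>F w in at z. w \<noteq> 0" using z by (intro tendsto_imp_eventually_ne[OF tendsto_ident_at])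
  then have "\<forall>\<^sub>F w in at z. G w = schwarz_expr w"
    using eventually_v_nonzero
  proof eventually_elim
    case (elim w)
    have "deriv (deriv v) w = ((of_nat n - 1) * deriv v w + T w * v w) / w"
      using ode[of w] elim by (simp add: field_simps)
    then show ?case unfolding schwarz_expr_eq[OF elim(2,1)] G_def
      using elim by (simp add: field_simps power2_eq_square)
  qed
  moreover have "isCont G z" unfolding G_def using z by (intro continuous_intros T) auto
  then have "G \<midarrow>z\<rightarrow> G z" by (rule isContD)
  ultimately have "schwarz_expr \<midarrow>z\<rightarrow> G z" using Lim_transform_eventually by blast
  then have "remove_sings schwarz_expr z = G z" by (rule remove_sings_eqI)
  then show ?thesis by (simp add: schwarzian_def schwarz_expr_def[abs_def] G_def)
qed

end

context hermite_pair begin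

sublocale wronskian_pair "hermite_fun n a p" v k n
  by unfold_locales (use holomorphic_hermite_fun v k n W v_nonzero[of 0] in \<open>auto simp: hermite_fun_eq_0_iff\<close>)

lemma hermite_quot_eq: "quot z = z ^ n * (exp (- g z a) * poly p z / v z)"
  by (simp add: quot_def hermite_fun_def)

lemma zorder_quot_0: "zorder quot 0 = int n"
proof (rule zorder_eqI[OF open_v])
  show "0 \<in> {z. v z \<noteq> 0}" using v0 by simp
  show "(\<lambda>z. exp (- g z a) * poly p z / v z) holomorphic_on {z. v z \<noteq> 0}"
    unfolding g_def using v by (intro holomorphic_intros) (auto intro: holomorphic_on_subset)
  show "exp (- g 0 a) * poly p 0 / v 0 \<noteq> 0" using v0 p0 by simp
  show "quot w = exp (- g w a) * poly p w / v w * (w - 0) powi int n" for w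
    by (simp add: hermite_quot_eq)
qed

lemma mu_quot: "mu quot + 1 = n"
  using n by (simp add: mu_def zorder_quot_0)

lemma other_zeros_quot: "other_zeros quot = {z. poly p z = 0}"
proof -
  have "z \<in> other_zeros quot \<longleftrightarrow> poly p z = 0" for z
  proof
    assume "z \<in> other_zeros quot"
    then show "poly p z = 0" by (auto simp: other_zeros_def is_pole_quot_iff hermite_quot_eq)
  next
    assume p: "poly p z = 0"
    then have "z \<noteq> 0" "v z \<noteq> 0" using p0 v_nonzero[of z] by (auto simp: hermite_fun_def)
    then show "z \<in> other_zeros quot" using p by (simp add: other_zeros_def is_pole_quot_iff hermite_quot_eq)
  qed
  then show ?thesis by auto
qed

lemma N0_quot: "finite (other_zeros quot)" "N0 quot = degree p"
  using poly_roots_finite[OF pnz] card_roots_rsquarefree[OF rsquarefree] by (simp_all add: other_zeros_quot N0_def)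

lemma schwarzian_hermite:
  assumes "hermite_residual n a p = pot_poly (degree p + 1) n a b * p" and z: "z \<noteq> 0"
  shows "schwarzian quot z = - 2 * V_I (degree p + 1) n a b z"
proof -
  have "schwarzian quot z = - 2 * (poly (pot_poly (degree p + 1) n a b) z / z + (of_nat n^2 - 1) / 4 / z^2)"
    by (rule schwarzian_quot[OF z poly_isCont ode_v]) (rule hermite_fun_ode[OF n assms(1)])
  then show ?thesis by (simp add: V_I_eq[OF z])
qed

end

section \<open>Limits in the Stokes sectors\<close>

text \<open>
  In closed subsectors of the even and odd Stokes sectors \<open>Re (z\<^sup>2)\<close> is comparable with \<open>|z|\<^sup>2\<close>
  and \<open>- |z|\<^sup>2\<close>, respectively.
\<close>

lemma subsector_Re_square:
  assumes z: "z \<in> subsector k \<delta>" and \<delta>: "0 < \<delta>" "\<delta> < pi / 4"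
  shows "k \<in> {0, 2} \<Longrightarrow> cos (2 * \<delta>) * norm z^2 \<le> Re (z^2)"
    and "k \<in> {1, -1} \<Longrightarrow> Re (z^2) \<le> - cos (2 * \<delta>) * norm z^2"
    and "k \<in> {1, -1} \<Longrightarrow> cos \<delta> * norm z \<le> of_int k * Im z"
proof -
  obtain r t where z: "z = rcis r t" "r > 0" "\<bar>t - of_int k * pi / 2\<bar> \<le> \<delta>"
    using z by (auto simp: subsector_def)
  define s where "s = t - of_int k * pi / 2"
  have s: "\<bar>s\<bar> \<le> \<delta>" "t = of_int k * pi / 2 + s" using z by (auto simp: s_def)
  have n: "norm z = r" using z by simp
  have "z^2 = of_real (r^2) * cis (2 * t)"
    unfolding z by (simp add: rcis_def power2_eq_square cis_mult mult_ac)
  then have R: "Re (z^2) = r^2 * cos (2 * t)"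
    by (simp del: of_real_power)
  have c2: "cos (2 * \<delta>) \<le> cos (2 * s)"
  proof -
    have "cos (2 * \<delta>) \<le> cos \<bar>2 * s\<bar>" using s \<delta> by (intro cos_monotone_0_pi_le) auto
    then show ?thesis by simp
  qed
  have c1: "cos \<delta> \<le> cos s"
  proof -
    have "cos \<delta> \<le> cos \<bar>s\<bar>" using s \<delta> by (intro cos_monotone_0_pi_le) auto
    then show ?thesis by simp
  qed
  show "cos (2 * \<delta>) * norm z^2 \<le> Re (z^2)" if "k \<in> {0, 2}"
  proof -
    have "cos (2 * t) = cos (2 * s)"
      using that cos_periodic[of "2 * s"] by (auto simp: s(2) algebra_simps)
    then show ?thesis using mult_right_mono[OF c2, of "r^2"] unfolding R n by (simp add: mult.commute)
  qed
  show "Re (z^2) \<le> - cos (2 * \<delta>) * norm z^2" if "k \<in> {1, -1}"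
  proof -
    have "cos (2 * t) = - cos (2 * s)"
      using that by (auto simp: s(2) algebra_simps cos_diff cos_add)
    then show ?thesis using mult_right_mono[OF c2, of "r^2"] unfolding R n by (simp add: mult.commute)
  qed
  show "cos \<delta> * norm z \<le> of_int k * Im z" if "k \<in> {1, -1}"
  proof -
    have "of_int k * sin t = cos s"
      using that by (auto simp: s(2) sin_add sin_diff)
    then have "of_int k * Im z = r * cos s" unfolding z by (simp add: rcis_def mult.left_commute)
    then show ?thesis using mult_right_mono[OF c1, of r] z(2) unfolding n by (simp add: mult.commute)
  qed
qed

lemma cos_double_pos: "0 < \<delta> \<Longrightarrow> \<delta> < pi / 4 \<Longrightarrow> 0 < cos (2 * \<delta>)"
  by (intro cos_gt_zero) auto

lemma shifted_Re_square:
  "\<bar>Re ((z + a)^2) - Re (z^2)\<bar> \<le> 2 * norm a * norm z + norm a^2"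
proof -
  have "Re ((z + a)^2) - Re (z^2) = Re (2 * a * z + a^2)" by (simp add: power2_eq_square algebra_simps)
  also have "\<bar>\<dots>\<bar> \<le> norm (2 * a * z + a^2)" by (rule abs_Re_le_cmod)
  also have "\<dots> \<le> 2 * norm a * norm z + norm a^2"
    using norm_triangle_ineq[of "2 * a * z" "a^2"] by (simp add: norm_mult norm_power)
  finally show ?thesis .
qed

lemma filterlim_norm_at_inf_in: "filterlim norm at_top (at_inf_in S)"
  by (rule filterlim_mono[OF filterlim_norm_at_top order_refl at_inf_in_le])

lemma gauss_size_even_sector:
  assumes k: "k \<in> {0, 2}" and \<delta>: "0 < \<delta>" "\<delta> < pi / 4"
  shows "filterlim (\<lambda>z. gauss_size d (z + a)) at_top (at_inf_in (subsector k \<delta>))"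
proof -
  define c where "c = cos (2 * \<delta>)"
  have c: "c > 0" using cos_double_pos[OF \<delta>] by (simp add: c_def)
  define \<alpha> where "\<alpha> = norm a"
  have "filterlim (\<lambda>r. exp (c * r^2 - (2 * \<alpha> * r + \<alpha>^2) - real d * (r + \<alpha>))) at_top at_top"
    using c by real_asymp
  from filterlim_compose[OF this filterlim_norm_at_inf_in]
  have lim: "filterlim (\<lambda>z. exp (c * norm z^2 - (2 * \<alpha> * norm z + \<alpha>^2) - real d * (norm z + \<alpha>))) at_top (at_inf_in (subsector k \<delta>))" .
  have "\<forall>\<^sub>F z in at_inf_in (subsector k \<delta>). exp (c * norm z^2 - (2 * \<alpha> * norm z + \<alpha>^2) - real d * (norm z + \<alpha>)) \<le> gauss_size d (z + a)"
    unfolding eventually_at_inf_in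
  proof (intro exI[of _ "\<alpha> + 1"] ballI impI)
    fix z assume z: "z \<in> subsector k \<delta>" "\<alpha> + 1 \<le> norm z"
    have "1 \<le> norm (z + a)" using z(2) norm_triangle_ineq4[of "z + a" a] by (simp add: \<alpha>_def)
    then have w0: "0 < norm (z + a)" by linarith
    have "norm (z + a) \<le> exp (norm (z + a))" using exp_ge_add_one_self[of "norm (z + a)"] by linarith
    also have "\<dots> \<le> exp (norm z + \<alpha>)" using norm_triangle_ineq[of z a] by (simp add: \<alpha>_def)
    finally have "norm (z + a) ^ d \<le> exp (norm z + \<alpha>) ^ d" by (intro power_mono) auto
    then have "norm (z + a) ^ d \<le> exp (real d * (norm z + \<alpha>))" by (simp add: exp_of_nat_mult)
    moreover have "exp (c * norm z^2 - (2 * \<alpha> * norm z + \<alpha>^2)) \<le> exp (Re ((z + a)^2))"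
      using subsector_Re_square(1)[OF z(1) \<delta> k] shifted_Re_square[of z a]
      by (simp add: c_def \<alpha>_def)
    ultimately have "exp (c * norm z^2 - (2 * \<alpha> * norm z + \<alpha>^2)) / exp (real d * (norm z + \<alpha>)) \<le> gauss_size d (z + a)"
      unfolding gauss_size_def using w0 by (intro frac_le) auto
    then show "exp (c * norm z^2 - (2 * \<alpha> * norm z + \<alpha>^2) - real d * (norm z + \<alpha>)) \<le> gauss_size d (z + a)"
      by (simp only: exp_diff)
  qed
  then show ?thesis by (rule filterlim_at_top_mono[OF lim])
qed

lemma gauss_size_odd_sector:
  assumes k: "k \<in> {1, -1}" and \<delta>: "0 < \<delta>" "\<delta> < pi / 4"
  shows "((\<lambda>z. gauss_size d (z + a)) \<longlongrightarrow> 0) (at_inf_in (subsector k \<delta>))"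
proof -
  define c where "c = cos (2 * \<delta>)"
  have c: "c > 0" using cos_double_pos[OF \<delta>] by (simp add: c_def)
  define \<alpha> where "\<alpha> = norm a"
  have "((\<lambda>r. exp (- c * r^2 + (2 * \<alpha> * r + \<alpha>^2))) \<longlongrightarrow> 0) at_top"
    using c by real_asymp
  from filterlim_compose[OF this filterlim_norm_at_inf_in]
  have lim: "((\<lambda>z. exp (- c * norm z^2 + (2 * \<alpha> * norm z + \<alpha>^2))) \<longlongrightarrow> 0) (at_inf_in (subsector k \<delta>))" .
  have "\<forall>\<^sub>F z in at_inf_in (subsector k \<delta>). norm (gauss_size d (z + a)) \<le> exp (- c * norm z^2 + (2 * \<alpha> * norm z + \<alpha>^2))"
    unfolding eventually_at_inf_in
  proof (intro exI[of _ "\<alpha> + 1"] ballI impI)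
    fix z assume z: "z \<in> subsector k \<delta>" "\<alpha> + 1 \<le> norm z"
    have w1: "1 \<le> norm (z + a)" using z(2) norm_triangle_ineq4[of "z + a" a] by (simp add: \<alpha>_def)
    then have "gauss_size d (z + a) \<le> exp (Re ((z + a)^2))" by (rule gauss_size_le_exp)
    also have "\<dots> \<le> exp (- c * norm z^2 + (2 * \<alpha> * norm z + \<alpha>^2))"
      using subsector_Re_square(2)[OF z(1) \<delta> k] shifted_Re_square[of z a] by (simp add: c_def \<alpha>_def)
    finally show "norm (gauss_size d (z + a)) \<le> exp (- c * norm z^2 + (2 * \<alpha> * norm z + \<alpha>^2))"
      by (simp add: gauss_size_def)
  qed
  then show ?thesis by (rule Lim_null_comparison[OF _ lim])
qed

lemma odd_sector_half_plane:
  assumes k: "k \<in> {1, -1}" and \<delta>: "0 < \<delta>" "\<delta> < pi / 4"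
  shows "\<forall>\<^sub>F z in at_inf_in (subsector k \<delta>). 0 \<le> of_int k * Im (z + a)"
proof -
  have c: "0 < cos \<delta>" using \<delta> by (intro cos_gt_zero) auto
  show ?thesis unfolding eventually_at_inf_in
  proof (intro exI[of _ "norm a / cos \<delta>"] ballI impI)
    fix z assume z: "z \<in> subsector k \<delta>" "norm a / cos \<delta> \<le> norm z"
    have "norm a \<le> cos \<delta> * norm z" using z(2) c by (simp add: field_simps)
    also have "\<dots> \<le> of_int k * Im z" by (rule subsector_Re_square(3)[OF z(1) \<delta> k])
    finally show "0 \<le> of_int k * Im (z + a)"
      using abs_Im_le_cmod[of a] k by auto
  qed
qed

lemma (in gaussian_ends) even_sector_limit:
  assumes k: "k \<in> {0, 2}" and f_eq: "\<And>z. \<rho> \<le> norm (z + a) \<Longrightarrow> f z = 1 / R z"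
  shows "asymptotic_value f k 0"
  unfolding asymptotic_value_def
proof (intro allI impI)
  fix \<delta> :: real assume \<delta>: "0 < \<delta> \<and> \<delta> < pi / 4"
  have lim: "filterlim (\<lambda>z. c * gauss_size d (z + a) + (- K)) at_top (at_inf_in (subsector k \<delta>))"
  proof (rule filterlim_compose[where g = "\<lambda>x. c * x + (- K)"])
    have "filterlim (\<lambda>x. c' * x + (- K')) at_top at_top" if "c' > 0" for c' K' :: real
      using that by real_asymp
    then show "filterlim (\<lambda>x. c * x + (- K)) at_top at_top" using constants(1) by blast
  qed (use \<delta> gauss_size_even_sector[OF k] in auto)
  have far: "\<forall>\<^sub>F z in at_inf_in (subsector k \<delta>). \<rho> \<le> norm (z + a)"
    unfolding eventually_at_inf_in
  proof (intro exI[of _ "\<rho> + norm a"] ballI impI)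
    fix z :: complex assume "\<rho> + norm a \<le> norm z" then show "\<rho> \<le> norm (z + a)" using norm_shift[of z] by linarith
  qed
  have ev: "\<forall>\<^sub>F z in at_inf_in (subsector k \<delta>). c * gauss_size d (z + a) + (- K) \<le> norm (R z)"
    using far by eventually_elim (use R_bounds(1) in auto)
  have "filterlim (\<lambda>z. norm (R z)) at_top (at_inf_in (subsector k \<delta>))"
    by (rule filterlim_at_top_mono[OF lim ev])
  then have "filterlim R at_infinity (at_inf_in (subsector k \<delta>))" by (rule filterlim_norm_at_top_imp_at_infinity)
  then have "((\<lambda>z. inverse (R z)) \<longlongrightarrow> 0) (at_inf_in (subsector k \<delta>))"
    by (rule filterlim_compose[OF tendsto_inverse_0])
  then show "(f \<longlongrightarrow> 0) (at_inf_in (subsector k \<delta>))"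
    by (rule Lim_transform_eventually) (use far in eventually_elim, simp add: f_eq field_simps)
qed

lemma (in gaussian_ends) odd_sector_limit:
  assumes k: "k \<in> {1, -1}" and f_eq: "\<And>z. \<rho> \<le> norm (z + a) \<Longrightarrow> f z = 1 / R z"
  shows "asymptotic_value f k (1 / A (of_int k))"
  unfolding asymptotic_value_def
proof (intro allI impI)
  fix \<delta> :: real assume \<delta>: "0 < \<delta> \<and> \<delta> < pi / 4"
  have k': "of_int k \<in> {1, -1 :: real}" using k by auto
  have far: "\<forall>\<^sub>F z in at_inf_in (subsector k \<delta>). \<rho> \<le> norm (z + a)"
    unfolding eventually_at_inf_in
  proof (intro exI[of _ "\<rho> + norm a"] ballI impI)
    fix z :: complex assume "\<rho> + norm a \<le> norm z" then show "\<rho> \<le> norm (z + a)" using norm_shift[of z] by linarith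
  qed
  have half: "\<forall>\<^sub>F z in at_inf_in (subsector k \<delta>). 0 \<le> of_int k * Im (z + a)"
    using odd_sector_half_plane[OF k] \<delta> by auto
  have lim: "((\<lambda>z. C * gauss_size d (z + a)) \<longlongrightarrow> C * 0) (at_inf_in (subsector k \<delta>))"
    using \<delta> by (intro tendsto_intros gauss_size_odd_sector[OF k]) auto
  have ev: "\<forall>\<^sub>F z in at_inf_in (subsector k \<delta>). norm (R z - A (of_int k)) \<le> C * gauss_size d (z + a)"
    using far half by eventually_elim (use deviation_bounds(2)[OF k'] in auto)
  have "((\<lambda>z. R z - A (of_int k)) \<longlongrightarrow> 0) (at_inf_in (subsector k \<delta>))"
    by (rule Lim_null_comparison[OF ev lim[unfolded mult_zero_right]])
  then have "(R \<longlongrightarrow> A (of_int k)) (at_inf_in (subsector k \<delta>))" by (simp add: Lim_null[symmetric])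
  then have "((\<lambda>z. 1 / R z) \<longlongrightarrow> 1 / A (of_int k)) (at_inf_in (subsector k \<delta>))"
    by (intro tendsto_intros A(1)[OF k'])
  then show "(f \<longlongrightarrow> 1 / A (of_int k)) (at_inf_in (subsector k \<delta>))"
    by (rule Lim_transform_eventually) (use far in eventually_elim, simp add: f_eq)
qed

section \<open>Normalised pairs and the family of functions\<close>

context hermite_pair begin

definition recip_quot :: "complex \<Rightarrow> complex" where "recip_quot z = v z / U z"

text \<open>
  The Wronskian identity divided by \<open>U\<^sup>2\<close>: an exponential of a quadratic polynomial over a
  polynomial, as required by the asymptotics of primitives.
\<close>

lemma recip_quot_derivative:
  assumes "U z \<noteq> 0"
  shows "(recip_quot has_field_derivative exp (2 * g z a) / poly (smult (- 1 / k) (monom 1 (n + 1) * p^2)) z) (at z)"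
proof -
  have "(recip_quot has_field_derivative (deriv v z * U z - v z * deriv U z) / (U z * U z)) (at z)"
    unfolding recip_quot_def[abs_def] using assms by (auto intro!: derivative_eq_intros pair_derivatives)
  also have "deriv v z * U z - v z * deriv U z = - (k * z ^ (n - 1))" using W[of z] by (simp add: algebra_simps)
  also have "- (k * z ^ (n - 1)) / (U z * U z) = exp (2 * g z a) / poly (smult (- 1 / k) (monom 1 (n + 1) * p^2)) z"
  proof -
    have "z \<noteq> 0" "poly p z \<noteq> 0" using assms n by (auto simp: hermite_fun_eq_0_iff)
    moreover have "z ^ n = z ^ (n - 1) * z" using n by (cases n) auto
    moreover have "exp (2 * g z a) = inverse (exp (- g z a) * exp (- g z a))"
      by (simp add: exp_add[symmetric] exp_minus)
    ultimately show ?thesis using k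
      by (simp add: hermite_fun_def poly_monom field_simps power2_eq_square)
  qed
  finally show ?thesis .
qed

text \<open>
  One more than the degree \<open>n + 1 + 2 degree p\<close> of the denominator in the preceding lemma; the
  integration by parts contributes the additional factor.
\<close>

definition decay_degree :: nat where "decay_degree = n + 2 * degree p + 2"

lemma recip_quot_limits:
  obtains A1 A2 \<kappa>1 \<kappa>2 where "\<kappa>1 \<noteq> 0" "\<kappa>2 \<noteq> 0"
    "((\<lambda>z. (recip_quot z - A1) * (z + a) ^ decay_degree * exp (- ((z + a)^2))) \<longlongrightarrow> \<kappa>1) (at_inf_in {z. 0 \<le> Im (z + a)})"
    "((\<lambda>z. (recip_quot z - A2) * (z + a) ^ decay_degree * exp (- ((z + a)^2))) \<longlongrightarrow> \<kappa>2) (at_inf_in {z. Im (z + a) \<le> 0})"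
proof -
  define q where "q = smult (- 1 / k) (monom 1 (n + 1) * p^2)"
  have q: "q \<noteq> 0" using k pnz by (simp add: q_def monom_eq_0_iff)
  have dq: "degree q + 1 = decay_degree"
    using k pnz by (simp add: q_def decay_degree_def degree_mult_eq degree_power_eq degree_monom_eq monom_eq_0_iff)
  obtain \<rho>0 where \<rho>0: "\<And>z. z \<in> {z. U z = 0} \<Longrightarrow> norm z \<le> \<rho>0"
    using finite_imp_bounded[OF finite_zeros] by (auto simp: bounded_iff)
  have der: "(recip_quot has_field_derivative exp (2 * g z a) / poly q z) (at z)" if "\<rho>0 + 1 \<le> norm z" for z
    unfolding q_def using \<rho>0[of z] that by (intro recip_quot_derivative) auto
  obtain A1 \<kappa>1 where 1: "\<kappa>1 \<noteq> 0" "((\<lambda>z. (recip_quot z - A1) * (z + a) ^ decay_degree * exp (- ((z + a)^2))) \<longlongrightarrow> \<kappa>1) (at_inf_in {z. 0 \<le> Im (z + a)})"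
    by (rule exp_quadratic_primitive_asymptotics_up[OF q der, unfolded dq])
  obtain A2 \<kappa>2 where 2: "\<kappa>2 \<noteq> 0" "((\<lambda>z. (recip_quot z - A2) * (z + a) ^ decay_degree * exp (- ((z + a)^2))) \<longlongrightarrow> \<kappa>2) (at_inf_in {z. Im (z + a) \<le> 0})"
    by (rule exp_quadratic_primitive_asymptotics_down[OF q der, unfolded dq])
  show ?thesis by (rule that[OF 1(1) 2(1) 1(2) 2(2)])
qed

text \<open>
  If \<open>v / U\<close> had the same limit \<open>A\<close> in both half planes, then \<open>v - A U\<close> would be of the order of
  \<open>exp g\<close> times a negative power of \<open>z\<close> in all directions. The entire function
  \<open>(v - A U) exp (- g)\<close> would tend to 0 at infinity and vanish, but its value at 0 is \<open>v 0\<close>.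
\<close>

lemma limits_differ:
  assumes up: "((\<lambda>z. (recip_quot z - A) * (z + a) ^ decay_degree * exp (- ((z + a)^2))) \<longlongrightarrow> \<kappa>1) (at_inf_in {z. 0 \<le> Im (z + a)})"
    and down: "((\<lambda>z. (recip_quot z - A) * (z + a) ^ decay_degree * exp (- ((z + a)^2))) \<longlongrightarrow> \<kappa>2) (at_inf_in {z. Im (z + a) \<le> 0})"
  shows False
proof -
  \<comment> \<open>Up to the constant \<open>exp (a\<^sup>2)\<close>, \<open>G\<close> is the convergent expression times the polynomial
    \<open>z ^ n p\<close> over the polynomial \<open>(z + a) ^ decay_degree\<close> of larger degree.\<close>
  define G where "G = (\<lambda>z. (v z - A * U z) * exp (- g z a))"
  have G: "G holomorphic_on UNIV" unfolding G_def g_def using v U by (intro holomorphic_intros) auto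
  define r where "r = monom 1 n * p"
  have "degree ([:a, 1:] ^ decay_degree) = decay_degree" by (simp add: degree_power_eq)
  then have "degree r < degree ([:a, 1:] ^ decay_degree)"
    using pnz by (simp add: r_def decay_degree_def degree_mult_eq degree_monom_eq monom_eq_0_iff)
  then have rat: "((\<lambda>z. poly r z / poly ([:a, 1:] ^ decay_degree) z) \<longlongrightarrow> 0) at_infinity"
    by (rule poly_divide_tendsto_0_at_infinity)
  obtain \<rho>0 where \<rho>0: "\<And>z. z \<in> {z. U z = 0} \<Longrightarrow> norm z \<le> \<rho>0"
    using finite_imp_bounded[OF finite_zeros] by (auto simp: bounded_iff)
  have lim: "(G \<longlongrightarrow> 0) (at_inf_in S)"
    if l: "((\<lambda>z. (recip_quot z - A) * (z + a) ^ decay_degree * exp (- ((z + a)^2))) \<longlongrightarrow> \<kappa>) (at_inf_in S)" for S \<kappa>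
  proof -
    have "((\<lambda>z. (recip_quot z - A) * (z + a) ^ decay_degree * exp (- ((z + a)^2)) * (poly r z / poly ([:a, 1:] ^ decay_degree) z) * exp (a^2)) \<longlongrightarrow> \<kappa> * 0 * exp (a^2)) (at_inf_in S)"
      by (intro tendsto_intros l tendsto_mono[OF at_inf_in_le rat])
    moreover have "\<forall>\<^sub>F z in at_inf_in S. (recip_quot z - A) * (z + a) ^ decay_degree * exp (- ((z + a)^2)) * (poly r z / poly ([:a, 1:] ^ decay_degree) z) * exp (a^2) = G z"
      unfolding eventually_at_inf_in
    proof (intro exI[of _ "max (\<rho>0 + 1) (norm a + 1)"] ballI impI)
      fix z :: complex assume z: "max (\<rho>0 + 1) (norm a + 1) \<le> norm z"
      have Uz: "U z \<noteq> 0" using \<rho>0[of z] z by auto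
      have za: "z + a \<noteq> 0"
      proof
        assume "z + a = 0" then have "z = - a" by (simp add: eq_neg_iff_add_eq_0)
        then show False using z by simp
      qed
      have e: "exp (- ((z + a)^2)) * exp (a^2) = exp (- g z a) * exp (- g z a)"
      proof -
        have "- ((z + a)^2) + a^2 = - g z a + - g z a" by (simp add: g_def power2_eq_square algebra_simps)
        then show ?thesis by (simp only: exp_add[symmetric])
      qed
      have pz: "poly ([:a, 1:] ^ decay_degree) z = (z + a) ^ decay_degree" by (simp add: poly_power add.commute)
      have "(recip_quot z - A) * (z + a) ^ decay_degree * exp (- ((z + a)^2)) * (poly r z / poly ([:a, 1:] ^ decay_degree) z) * exp (a^2)
        = (recip_quot z - A) * poly r z * (exp (- ((z + a)^2)) * exp (a^2))"
        unfolding pz using za by simp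
      also have "\<dots> = (recip_quot z - A) * (poly r z * exp (- g z a)) * exp (- g z a)" unfolding e by (simp only: mult_ac)
      also have "poly r z * exp (- g z a) = U z" by (simp add: r_def poly_monom hermite_fun_def)
      also have "(recip_quot z - A) * U z = v z - A * U z" using Uz by (simp add: recip_quot_def left_diff_distrib)
      finally show "(recip_quot z - A) * (z + a) ^ decay_degree * exp (- ((z + a)^2)) * (poly r z / poly ([:a, 1:] ^ decay_degree) z) * exp (a^2) = G z" by (simp add: G_def)
    qed
    ultimately have "(G \<longlongrightarrow> \<kappa> * 0 * exp (a^2)) (at_inf_in S)" by (rule Lim_transform_eventually)
    then show ?thesis by simp
  qed
  have "(G \<longlongrightarrow> 0) at_infinity"
  proof (rule tendstoI)
    fix \<epsilon> :: real assume \<epsilon>: "0 < \<epsilon>"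
    obtain \<rho>1 where \<rho>1: "\<And>z. 0 \<le> Im (z + a) \<Longrightarrow> \<rho>1 \<le> norm z \<Longrightarrow> dist (G z) 0 < \<epsilon>"
      using tendstoD[OF lim[OF up] \<epsilon>] unfolding eventually_at_inf_in by blast
    obtain \<rho>2 where \<rho>2: "\<And>z. Im (z + a) \<le> 0 \<Longrightarrow> \<rho>2 \<le> norm z \<Longrightarrow> dist (G z) 0 < \<epsilon>"
      using tendstoD[OF lim[OF down] \<epsilon>] unfolding eventually_at_inf_in by blast
    have "dist (G z) 0 < \<epsilon>" if "max \<rho>1 \<rho>2 \<le> norm z" for z
      using \<rho>1[of z] \<rho>2[of z] that by (cases "0 \<le> Im (z + a)") auto
    then show "\<forall>\<^sub>F z in at_infinity. dist (G z) 0 < \<epsilon>" unfolding eventually_at_infinity by blast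
  qed
  then have "G 0 = 0" by (rule Liouville_weak_0[OF G])
  then show False using v0 n by (simp add: G_def g_def hermite_fun_def)
qed

lemma affine_change:
  assumes s: "s \<noteq> 0"
  shows "hermite_pair n a p (\<lambda>z. s * v z + t * U z) (s * k)"
proof
  show "(\<lambda>z. s * v z + t * U z) holomorphic_on UNIV" using v U by (intro holomorphic_intros)
  have d: "deriv (\<lambda>z. s * v z + t * U z) z = s * deriv v z + t * deriv U z" for z
    by (rule DERIV_imp_deriv) (auto intro!: derivative_eq_intros pair_derivatives)
  show "deriv U z * (s * v z + t * U z) - U z * deriv (\<lambda>z. s * v z + t * U z) z = s * k * z ^ (n - 1)" for z
  proof -
    have "deriv U z * (s * v z + t * U z) - U z * deriv (\<lambda>z. s * v z + t * U z) z = s * (deriv U z * v z - U z * deriv v z)"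
      unfolding d by (simp add: algebra_simps)
    then show ?thesis unfolding W by simp
  qed
qed (use s n p0 k in auto)

text \<open>
  The remaining conditions of \<open>gaussian_ends\<close> hold outside a disc that contains all zeros of
  \<open>U\<close>.
\<close>

lemma asymptotic_ends:
  assumes up: "((\<lambda>z. (recip_quot z - A 1) * (z + a) ^ decay_degree * exp (- ((z + a)^2))) \<longlongrightarrow> \<kappa> 1) (at_inf_in {z. 0 \<le> Im (z + a)})"
    and down: "((\<lambda>z. (recip_quot z - A (-1)) * (z + a) ^ decay_degree * exp (- ((z + a)^2))) \<longlongrightarrow> \<kappa> (-1)) (at_inf_in {z. Im (z + a) \<le> 0})"
    and \<kappa>: "\<kappa> 1 \<noteq> 0" "\<kappa> (-1 :: real) \<noteq> 0"
    and A: "A 1 \<noteq> 0" "A (-1) \<noteq> 0" "A 1 \<noteq> A (-1 :: real)"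
  obtains \<rho> where "gaussian_ends quot recip_quot a A \<kappa> decay_degree \<rho>"
    "\<And>z. \<rho> \<le> norm (z + a) \<Longrightarrow> quot z = 1 / recip_quot z"
proof -
  obtain \<rho>0 where \<rho>0: "\<And>z. z \<in> {z. U z = 0} \<Longrightarrow> norm z \<le> \<rho>0"
    using finite_imp_bounded[OF finite_zeros] by (auto simp: bounded_iff)
  obtain \<rho>1 where \<rho>1: "\<And>z. 0 \<le> Im (z + a) \<Longrightarrow> \<rho>1 \<le> norm z \<Longrightarrow>
      norm ((recip_quot z - A 1) * (z + a) ^ decay_degree * exp (- ((z + a)^2)) - \<kappa> 1) < norm (\<kappa> 1) / 2"
    using tendstoD[OF up, of "norm (\<kappa> 1) / 2"] \<kappa> unfolding eventually_at_inf_in dist_norm by auto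
  obtain \<rho>2 where \<rho>2: "\<And>z. Im (z + a) \<le> 0 \<Longrightarrow> \<rho>2 \<le> norm z \<Longrightarrow>
      norm ((recip_quot z - A (-1)) * (z + a) ^ decay_degree * exp (- ((z + a)^2)) - \<kappa> (-1)) < norm (\<kappa> (-1)) / 2"
    using tendstoD[OF down, of "norm (\<kappa> (-1)) / 2"] \<kappa> unfolding eventually_at_inf_in dist_norm by auto
  define \<rho> where "\<rho> = Max {\<rho>0 + 1 + norm a, \<rho>1 + norm a, \<rho>2 + norm a, real decay_degree + 1}"
  have \<rho>: "\<rho>0 + 1 + norm a \<le> \<rho>" "\<rho>1 + norm a \<le> \<rho>" "\<rho>2 + norm a \<le> \<rho>" "real decay_degree + 1 \<le> \<rho>"
    by (auto simp: \<rho>_def)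
  have far: "\<rho>0 < norm z" "\<rho>1 \<le> norm z" "\<rho>2 \<le> norm z" if "\<rho> \<le> norm (z + a)" for z
    using that \<rho> norm_triangle_ineq[of z a] by linarith+
  have Unz: "U z \<noteq> 0" if "\<rho> \<le> norm (z + a)" for z using far(1)[OF that] \<rho>0[of z] by auto
  show ?thesis
  proof (rule that)
    show "gaussian_ends quot recip_quot a A \<kappa> decay_degree \<rho>"
    proof
      show "quot nicely_meromorphic_on UNIV" by (rule quot_nicely_meromorphic)
      show "real decay_degree + 1 \<le> \<rho>" by (rule \<rho>)
      show "sphere_val quot z = (if recip_quot z = 0 then None else Some (1 / recip_quot z))"
        if "\<rho> \<le> norm (z + a)" for z
        using Unz[OF that] by (simp add: sphere_val_def is_pole_quot_iff quot_def recip_quot_def)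
      show "norm ((recip_quot z - A \<sigma>) * (z + a) ^ decay_degree * exp (- ((z + a)^2)) - \<kappa> \<sigma>) < norm (\<kappa> \<sigma>) / 2"
        if "\<sigma> \<in> {1, -1}" "0 \<le> \<sigma> * Im (z + a)" "\<rho> \<le> norm (z + a)" for \<sigma> z
        using that(1,2) \<rho>1[of z] \<rho>2[of z] far(2,3)[OF that(3)] by auto
    qed (use \<kappa> A in auto)
    show "quot z = 1 / recip_quot z" if "\<rho> \<le> norm (z + a)" for z
      by (simp add: quot_def recip_quot_def)
  qed
qed

text \<open>
  The potential is \<open>z\<^sup>2\<close> up to linear terms.
\<close>

lemma schwarzian_growth: "(\<lambda>z. schwarzian quot z - (- 2 * z^2)) \<in> O[at_infinity](\<lambda>z. z)"
proof -
  obtain b where b: "hermite_residual n a p = pot_poly (degree p + 1) n a b * p" by (rule residual_eq)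
  define m where "m = degree p + 1"
  define c0 c1 where "c0 = a^2 - 2 * of_nat m - of_nat n"
    and "c1 = - (b + (2 * (of_nat m + 1 + of_nat n / 2) - 1/2) * a)"
  define \<gamma> :: complex where "\<gamma> = (of_nat n^2 - 1) / 4"
  define B where "B = 2 * (norm (2 * a) + norm c0 + norm c1 + norm \<gamma>)"
  show ?thesis
  proof (rule bigoI)
    show "\<forall>\<^sub>F z in at_infinity. norm (schwarzian quot z - (- 2 * z^2)) \<le> B * norm z"
      unfolding eventually_at_infinity
    proof (intro exI[of _ 1] allI impI)
      fix z :: complex assume z1: "1 \<le> norm z"
      then have z: "z \<noteq> 0" by auto
      have "schwarzian quot z - (- 2 * z^2) = - 2 * (2 * a * z + c0 + c1 / z + \<gamma> / z^2)"
        unfolding schwarzian_hermite[OF b z] V_I_eq[OF z] pot_poly_def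
        using z by (simp add: c0_def c1_def m_def \<gamma>_def field_simps power2_eq_square)
      moreover have "norm (- 2 * x) = 2 * norm x" for x :: complex by (simp add: norm_mult)
      ultimately have "norm (schwarzian quot z - (- 2 * z^2)) = 2 * norm (2 * a * z + c0 + c1 / z + \<gamma> / z^2)"
        by (simp only:)
      also have "norm (2 * a * z + c0 + c1 / z + \<gamma> / z^2) \<le> norm (2 * a * z) + norm c0 + norm (c1 / z) + norm (\<gamma> / z^2)"
        by (intro order_trans[OF norm_triangle_ineq] add_mono order_refl)
      also have "\<dots> \<le> norm (2 * a) * norm z + norm c0 * norm z + norm c1 * norm z + norm \<gamma> * norm z"
      proof (intro add_mono)
        show "norm (2 * a * z) \<le> norm (2 * a) * norm z" by (simp add: norm_mult)
        show "norm c0 \<le> norm c0 * norm z" using mult_left_mono[OF z1, of "norm c0"] by simp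
        have "norm c1 / norm z \<le> norm c1 / 1" using z1 by (intro divide_left_mono) auto
        then show "norm (c1 / z) \<le> norm c1 * norm z" using mult_left_mono[OF z1, of "norm c1"] by (simp add: norm_divide)
        have "norm \<gamma> / norm z^2 \<le> norm \<gamma> / 1" using z1 by (intro divide_left_mono) (auto simp: one_le_power)
        then show "norm (\<gamma> / z^2) \<le> norm \<gamma> * norm z" using mult_left_mono[OF z1, of "norm \<gamma>"] by (simp add: norm_divide norm_power)
      qed
      finally show "norm (schwarzian quot z - (- 2 * z^2)) \<le> B * norm z" by (simp add: B_def algebra_simps)
    qed
  qed
qed

theorem quot_in_F1:
  assumes up: "((\<lambda>z. (recip_quot z - (- \<i>)) * (z + a) ^ decay_degree * exp (- ((z + a)^2))) \<longlongrightarrow> \<kappa>1) (at_inf_in {z. 0 \<le> Im (z + a)})"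
    and down: "((\<lambda>z. (recip_quot z - \<i>) * (z + a) ^ decay_degree * exp (- ((z + a)^2))) \<longlongrightarrow> \<kappa>2) (at_inf_in {z. Im (z + a) \<le> 0})"
    and \<kappa>: "\<kappa>1 \<noteq> 0" "\<kappa>2 \<noteq> 0"
  shows "quot \<in> F1"
proof -
  define A :: "real \<Rightarrow> complex" where "A = (\<lambda>\<sigma>. if \<sigma> = 1 then - \<i> else \<i>)"
  define \<kappa> where "\<kappa> = (\<lambda>\<sigma>::real. if \<sigma> = 1 then \<kappa>1 else \<kappa>2)"
  obtain \<rho> where ends: "gaussian_ends quot recip_quot a A \<kappa> decay_degree \<rho>"
    and eq: "\<And>z. \<rho> \<le> norm (z + a) \<Longrightarrow> quot z = 1 / recip_quot z"
  proof (rule asymptotic_ends[of A \<kappa>])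
    show "A 1 \<noteq> A (-1)" by (simp add: A_def complex_eq_iff)
  qed (use assms in \<open>auto simp: A_def \<kappa>_def\<close>)
  interpret gaussian_ends quot recip_quot a A \<kappa> decay_degree \<rho> by (rule ends)
  have q0: "quot 0 = 0" using n by (simp add: hermite_quot_eq)
  have "asymptotic_value quot 0 0" "asymptotic_value quot 2 0"
    using even_sector_limit[of 0] even_sector_limit[of 2] eq by auto
  moreover have "asymptotic_value quot 1 \<i>" "asymptotic_value quot (-1) (- \<i>)"
    using odd_sector_limit[of 1] odd_sector_limit[of "-1"] eq by (auto simp: A_def)
  moreover have "critical_points quot = {0} \<or> critical_points quot = {} \<and> zorder quot 0 = 1"
    unfolding critical_points_quot zorder_quot_0 by auto
  ultimately show ?thesis
    unfolding F1_def using quot_nicely_meromorphic q0 is_pole_quot_iff[of 0] v0 transc_sings_count schwarzian_growth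
    by auto
qed

end

text \<open>
  Adding a multiple of \<open>U\<close> to a multiple of \<open>v\<close> acts on \<open>v / U\<close> as an affine map, and the two
  different limits can be moved to \<open>- i = 1 / i\<close> above and \<open>i = 1 / (- i)\<close> below.
\<close>

theorem hermite_pair_normalise:
  assumes "hermite_pair n a p v k"
  obtains s t where "s \<noteq> 0" "hermite_pair n a p (\<lambda>z. s * v z + t * hermite_fun n a p z) (s * k)"
    "(\<lambda>z. hermite_fun n a p z / (s * v z + t * hermite_fun n a p z)) \<in> F1"
proof -
  interpret hermite_pair n a p v k by (rule assms)
  obtain A1 A2 \<kappa>1 \<kappa>2 where \<kappa>: "\<kappa>1 \<noteq> 0" "\<kappa>2 \<noteq> 0" and
    l1: "((\<lambda>z. (recip_quot z - A1) * (z + a) ^ decay_degree * exp (- ((z + a)^2))) \<longlongrightarrow> \<kappa>1) (at_inf_in {z. 0 \<le> Im (z + a)})" and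
    l2: "((\<lambda>z. (recip_quot z - A2) * (z + a) ^ decay_degree * exp (- ((z + a)^2))) \<longlongrightarrow> \<kappa>2) (at_inf_in {z. Im (z + a) \<le> 0})"
    by (rule recip_quot_limits)
  have ne: "A1 \<noteq> A2" using limits_differ l1 l2 by blast
  \<comment> \<open>The affine map \<open>x \<mapsto> s x + t\<close> sends \<open>A1\<close> to \<open>- i\<close> and \<open>A2\<close> to \<open>i\<close>.\<close>
  define s where "s = - 2 * \<i> / (A1 - A2)"
  define t where "t = - \<i> - s * A1"
  have s: "s \<noteq> 0" using ne by (simp add: s_def)
  have sA: "s * A1 + t = - \<i>" "s * A2 + t = \<i>"
  proof -
    have "s * (A1 - A2) = - 2 * \<i>" using ne by (simp add: s_def)
    then show "s * A1 + t = - \<i>" "s * A2 + t = \<i>" by (simp_all add: t_def algebra_simps)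
  qed
  define v' where "v' = (\<lambda>z. s * v z + t * U z)"
  have hp: "hermite_pair n a p v' (s * k)" unfolding v'_def by (rule affine_change[OF s])
  interpret H: hermite_pair n a p v' "s * k" by (rule hp)
  obtain \<rho>0 where \<rho>0: "\<And>z. z \<in> {z. U z = 0} \<Longrightarrow> norm z \<le> \<rho>0"
    using finite_imp_bounded[OF finite_zeros] by (auto simp: bounded_iff)
  have tr: "((\<lambda>z. (H.recip_quot z - (s * A + t)) * (z + a) ^ H.decay_degree * exp (- ((z + a)^2))) \<longlongrightarrow> s * \<kappa>) (at_inf_in S)"
    if "((\<lambda>z. (recip_quot z - A) * (z + a) ^ decay_degree * exp (- ((z + a)^2))) \<longlongrightarrow> \<kappa>) (at_inf_in S)" for A \<kappa> S
  proof (rule Lim_transform_eventually)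
    show "((\<lambda>z. s * ((recip_quot z - A) * (z + a) ^ decay_degree * exp (- ((z + a)^2)))) \<longlongrightarrow> s * \<kappa>) (at_inf_in S)"
      by (intro tendsto_intros that)
    show "\<forall>\<^sub>F z in at_inf_in S. s * ((recip_quot z - A) * (z + a) ^ decay_degree * exp (- ((z + a)^2))) = (H.recip_quot z - (s * A + t)) * (z + a) ^ H.decay_degree * exp (- ((z + a)^2))"
      unfolding eventually_at_inf_in
    proof (intro exI[of _ "\<rho>0 + 1"] ballI impI)
      fix z :: complex assume z: "\<rho>0 + 1 \<le> norm z"
      then have "U z \<noteq> 0" using \<rho>0[of z] by auto
      moreover have "v' z = s * v z + t * U z" by (simp add: v'_def)
      ultimately have "H.recip_quot z - (s * A + t) = s * (recip_quot z - A)"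
        unfolding H.recip_quot_def recip_quot_def by (simp add: field_simps)
      then show "s * ((recip_quot z - A) * (z + a) ^ decay_degree * exp (- ((z + a)^2))) = (H.recip_quot z - (s * A + t)) * (z + a) ^ H.decay_degree * exp (- ((z + a)^2))"
        by (simp add: H.decay_degree_def decay_degree_def)
    qed
  qed
  have "H.quot \<in> F1"
    using H.quot_in_F1[OF tr[OF l1, unfolded sA] tr[OF l2, unfolded sA]] \<kappa> s by simp
  moreover have "H.quot = (\<lambda>z. hermite_fun n a p z / v' z)" by (rule ext) (simp add: H.quot_def)
  ultimately show ?thesis using that[OF s] hp by (simp add: v'_def)
qed

section \<open>Reduction of order without logarithms\<close>

text \<open>
  Separates the part of \<open>H\<close> that produces the principal part of \<open>H / (z - s) ^ N\<close>.
\<close>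

lemma taylor_split:
  assumes "H holomorphic_on ball s r" "r > 0"
  shows "\<exists>T K. K holomorphic_on ball s r \<and> (\<forall>z\<in>ball s r. H z = poly T z + (z - s) ^ N * K z)"
proof (induction N)
  case 0
  show ?case using assms by (intro exI[of _ 0] exI[of _ H]) auto
next
  case (Suc N)
  then obtain T K where K: "K holomorphic_on ball s r" "\<And>z. z \<in> ball s r \<Longrightarrow> H z = poly T z + (z - s) ^ N * K z" by blast
  define K' where "K' = (\<lambda>z. if z = s then deriv K s else (K z - K s) / (z - s))"
  have "K' holomorphic_on ball s r" unfolding K'_def by (rule pole_lemma_open[OF K(1)]) auto
  moreover have "H z = poly (T + smult (K s) ([:- s, 1:] ^ N)) z + (z - s) ^ Suc N * K' z" if "z \<in> ball s r" for z
  proof -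
    have "K z = K s + (z - s) * K' z" by (simp add: K'_def)
    then have "H z = poly T z + (z - s) ^ N * (K s + (z - s) * K' z)" using K(2)[OF that] by simp
    moreover have "poly [:- s, 1:] z = z - s" by simp
    ultimately show ?thesis
      by (simp only: poly_add poly_smult poly_power) (simp add: algebra_simps)
  qed
  ultimately show ?case by blast
qed

text \<open>
  Near each singularity \<open>G\<close> has a single-valued meromorphic primitive, so its principal parts
  are derivatives of rational functions \<open>P s\<close>. Subtracting these derivatives leaves an entire
  function, which has a primitive.
\<close>

lemma primitive_of_local_primitives:
  fixes G :: "complex \<Rightarrow> complex" and H :: "complex \<Rightarrow> complex \<Rightarrow> complex" and N :: "complex \<Rightarrow> nat"
  assumes Z: "finite Z" and G: "G holomorphic_on - Z"
    and r: "\<And>s. s \<in> Z \<Longrightarrow> r s > 0" and H: "\<And>s. s \<in> Z \<Longrightarrow> H s holomorphic_on ball s (r s)"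
    and loc: "\<And>s z. s \<in> Z \<Longrightarrow> z \<in> ball s (r s) - {s} \<Longrightarrow> ((\<lambda>z. H s z / (z - s) ^ N s) has_field_derivative G z) (at z)"
  obtains F where "\<And>z. z \<notin> Z \<Longrightarrow> (F has_field_derivative G z) (at z)"
    "\<And>s. s \<in> Z \<Longrightarrow> \<exists>L. isCont L s \<and> (\<forall>\<^sub>F z in at s. F z = H s z / (z - s) ^ N s + L z)"
proof -
  have "\<forall>s\<in>Z. \<exists>T K. K holomorphic_on ball s (r s) \<and> (\<forall>z\<in>ball s (r s). H s z = poly T z + (z - s) ^ N s * K z)"
    using taylor_split[OF H r] by blast
  then obtain T K where K: "\<And>s. s \<in> Z \<Longrightarrow> K s holomorphic_on ball s (r s)"
    and T: "\<And>s z. s \<in> Z \<Longrightarrow> z \<in> ball s (r s) \<Longrightarrow> H s z = poly (T s) z + (z - s) ^ N s * K s z" by metis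
  define P where "P = (\<lambda>s z. poly (T s) z / (z - s) ^ N s)"
  have Phol: "P s holomorphic_on - {s}" for s unfolding P_def by (intro holomorphic_intros) auto
  have dPhol: "deriv (P s) holomorphic_on - {s}" for s using Phol by (intro holomorphic_deriv) auto
  have dP: "(P s has_field_derivative deriv (P s) z) (at z)" if "z \<noteq> s" for s z
    using that by (intro holomorphic_derivI[OF Phol]) auto
  have Peq: "P s z = H s z / (z - s) ^ N s - K s z" if "s \<in> Z" "z \<in> ball s (r s) - {s}" for s z
    using T[of s z] that by (simp add: P_def field_simps)
  have nb: "\<forall>\<^sub>F z in at s. z \<in> ball s (r s) - {s} \<and> z \<notin> Z" if s: "s \<in> Z" for s
  proof -
    have "open (ball s (r s) - (Z - {s}))" using Z by (intro open_Diff finite_imp_closed) auto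
    then have "\<forall>\<^sub>F z in at s. z \<in> (ball s (r s) - (Z - {s})) - {s}"
      using r[OF s] s by (intro eventually_at_in_open) auto
    then show ?thesis by eventually_elim auto
  qed
  define E0 where "E0 = (\<lambda>z. G z - (\<Sum>s\<in>Z. deriv (P s) z))"
  have "E0 holomorphic_on UNIV - Z"
    unfolding E0_def using G by (intro holomorphic_intros holomorphic_on_subset[OF dPhol]) (auto simp: Compl_eq_Diff_UNIV)
  moreover have "E0 \<in> O[at s](\<lambda>_. 1)" if s: "s \<in> Z" for s
  proof -
    define J where "J = (\<lambda>z. deriv (K s) z - (\<Sum>s'\<in>Z - {s}. deriv (P s') z))"
    have "isCont J s"
    proof -
      have "isCont (deriv (K s)) s"
        using holomorphic_deriv[OF K[OF s] open_ball] r[OF s]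
        by (metis centre_in_ball continuous_on_eq_continuous_at holomorphic_on_imp_continuous_on open_ball)
      moreover have "isCont (deriv (P s')) s" if "s' \<in> Z - {s}" for s'
        using that continuous_on_eq_continuous_at[of "- {s'}" "deriv (P s')"] holomorphic_on_imp_continuous_on[OF dPhol[of s']]
        by auto
      ultimately show ?thesis unfolding J_def by (intro continuous_intros) auto
    qed
    then have bigJ: "J \<in> O[at s](\<lambda>_. 1)" by (rule continuous_imp_bigo_1)
    have ev: "\<forall>\<^sub>F z in at s. E0 z = J z"
      using nb[OF s]
    proof eventually_elim
      case (elim z)
      have "(K s has_field_derivative deriv (K s) z) (at z)"
        using elim by (intro holomorphic_derivI[OF K[OF s]]) auto
      then have "((\<lambda>z. H s z / (z - s) ^ N s - K s z) has_field_derivative G z - deriv (K s) z) (at z)"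
        using loc[OF s] elim by (intro DERIV_diff) auto
      then have "(P s has_field_derivative G z - deriv (K s) z) (at z)"
        by (rule has_field_derivative_transform_within_open[of _ _ _ "ball s (r s) - {s}"])
           (use elim Peq[OF s] in auto)
      then have "deriv (P s) z = G z - deriv (K s) z" by (rule DERIV_imp_deriv)
      then show ?case using Z s by (simp add: E0_def J_def sum.remove)
    qed
    show ?thesis using landau_o.big.in_cong[OF ev] bigJ by blast
  qed
  ultimately obtain E where E: "E holomorphic_on UNIV" "\<And>z. z \<notin> Z \<Longrightarrow> E z = E0 z"
    using removable_singularities[of Z UNIV E0] Z by auto
  obtain F0 where F0: "\<And>z. (F0 has_field_derivative E z) (at z)"
    using holomorphic_convex_primitive'[OF convex_UNIV open_UNIV E(1)] by auto
  define F where "F = (\<lambda>z. F0 z + (\<Sum>s\<in>Z. P s z))"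
  show ?thesis
  proof (rule that[of F])
    fix z assume z: "z \<notin> Z"
    have "(F has_field_derivative E z + (\<Sum>s\<in>Z. deriv (P s) z)) (at z)"
      unfolding F_def using z by (intro DERIV_add F0 DERIV_sum dP) auto
    then show "(F has_field_derivative G z) (at z)" using E(2)[OF z] by (simp add: E0_def)
  next
    fix s assume s: "s \<in> Z"
    define L where "L = (\<lambda>z. F0 z + (\<Sum>s'\<in>Z - {s}. P s' z) - K s z)"
    have "isCont L s"
    proof -
      have "isCont (K s) s"
        using K[OF s] r[OF s]
        by (metis centre_in_ball continuous_on_eq_continuous_at holomorphic_on_imp_continuous_on open_ball)
      moreover have "isCont (P s') s" if "s' \<in> Z - {s}" for s'
        using that DERIV_isCont[OF dP] by auto
      ultimately show ?thesis unfolding L_def by (intro continuous_intros DERIV_isCont[OF F0]) auto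
    qed
    moreover have "\<forall>\<^sub>F z in at s. F z = H s z / (z - s) ^ N s + L z"
      using nb[OF s]
    proof eventually_elim
      case (elim z)
      then show ?case using Peq[OF s, of z] Z s by (simp add: F_def L_def sum.remove)
    qed
    ultimately show "\<exists>L. isCont L s \<and> (\<forall>\<^sub>F z in at s. F z = H s z / (z - s) ^ N s + L z)" by blast
  qed
qed

text \<open>
  Reduction of order: \<open>v = U F\<close> with \<open>F' = C / U\<^sup>2\<close>. The poles of \<open>F\<close> are cancelled by the zeros
  of \<open>U\<close>, so \<open>v\<close> extends to an entire function.
\<close>

lemma wronskian_partner:
  assumes U: "U holomorphic_on UNIV" and Z: "finite {z. U z = 0}" and C: "C holomorphic_on UNIV"
    and r: "\<And>s. U s = 0 \<Longrightarrow> r s > 0" and H: "\<And>s. U s = 0 \<Longrightarrow> H s holomorphic_on ball s (r s)"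
    and loc: "\<And>s z. U s = 0 \<Longrightarrow> z \<in> ball s (r s) - {s} \<Longrightarrow> ((\<lambda>z. H s z / (z - s) ^ N s) has_field_derivative C z / (U z)^2) (at z)"
    and ord: "\<And>s. U s = 0 \<Longrightarrow> \<exists>V. isCont V s \<and> (\<forall>z. U z = (z - s) ^ N s * V z)"
  obtains v where "v holomorphic_on UNIV" "\<And>z. deriv U z * v z - U z * deriv v z = - C z"
proof -
  let ?Z = "{z. U z = 0}"
  have "(\<lambda>z. C z / (U z)^2) holomorphic_on - ?Z"
    by (intro holomorphic_intros holomorphic_on_subset[OF U] holomorphic_on_subset[OF C]) auto
  then obtain F where F: "\<And>z. U z \<noteq> 0 \<Longrightarrow> (F has_field_derivative C z / (U z)^2) (at z)"
    and Fl: "\<And>s. U s = 0 \<Longrightarrow> \<exists>L. isCont L s \<and> (\<forall>\<^sub>F z in at s. F z = H s z / (z - s) ^ N s + L z)"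
    using primitive_of_local_primitives[OF Z, of "\<lambda>z. C z / (U z)^2" r H N] r H loc by auto
  have Ud: "(U has_field_derivative deriv U z) (at z)" for z using U by (auto intro: holomorphic_derivI)
  have FU: "((\<lambda>z. U z * F z) has_field_derivative deriv U z * F z + U z * (C z / (U z)^2)) (at z)" if "U z \<noteq> 0" for z
    by (auto intro!: derivative_eq_intros Ud F that)
  have "(\<lambda>z. U z * F z) holomorphic_on UNIV - ?Z"
    using FU by (auto simp: holomorphic_on_def field_differentiable_def intro: has_field_derivative_at_within)
  moreover have "(\<lambda>z. U z * F z) \<in> O[at s](\<lambda>_. 1)" if s: "s \<in> ?Z" for s
  proof -
    obtain L where L: "isCont L s" "\<forall>\<^sub>F z in at s. F z = H s z / (z - s) ^ N s + L z" using Fl s by blast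
    obtain V where V: "isCont V s" "\<And>z. U z = (z - s) ^ N s * V z" using ord s by blast
    have "isCont (H s) s"
      using H[of s] r[of s] s
      by (metis (mono_tags) mem_Collect_eq centre_in_ball continuous_on_eq_continuous_at holomorphic_on_imp_continuous_on open_ball)
    moreover have "isCont U s" using Ud DERIV_isCont by blast
    ultimately have "isCont (\<lambda>z. V z * H s z + U z * L z) s" using L V by (intro continuous_intros) auto
    then have bigV: "(\<lambda>z. V z * H s z + U z * L z) \<in> O[at s](\<lambda>_. 1)" by (rule continuous_imp_bigo_1)
    have ev: "\<forall>\<^sub>F z in at s. U z * F z = V z * H s z + U z * L z"
      using L(2) eventually_neq_at_within[of s s]
    proof eventually_elim
      case (elim z)
      have "U z * F z = U z * (H s z / (z - s) ^ N s) + U z * L z" using elim by (simp add: distrib_left)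
      also have "U z * (H s z / (z - s) ^ N s) = V z * H s z" using V(2)[of z] elim by simp
      finally show ?case .
    qed
    show ?thesis using landau_o.big.in_cong[OF ev] bigV by blast
  qed
  ultimately obtain v where v: "v holomorphic_on UNIV" "\<And>z. U z \<noteq> 0 \<Longrightarrow> v z = U z * F z"
    using removable_singularities[of ?Z UNIV "\<lambda>z. U z * F z"] Z by auto
  define W where "W = (\<lambda>z. deriv U z * v z - U z * deriv v z + C z)"
  have "W z = 0" for z
  proof (rule continuous_zero_off_finite[of W, OF _ Z])
    have "deriv U holomorphic_on UNIV" "deriv v holomorphic_on UNIV" using U v by (auto intro: holomorphic_deriv)
    then show "continuous_on UNIV W" unfolding W_def using U v C
      by (intro continuous_intros holomorphic_on_imp_continuous_on)
    fix z assume "z \<notin> ?Z"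
    then have z: "U z \<noteq> 0" by simp
    have "open (- ?Z)" using Z by (intro open_Compl finite_imp_closed)
    then have "\<forall>\<^sub>F w in nhds z. w \<in> - ?Z" using z by (intro eventually_nhds_in_open) auto
    then have "\<forall>\<^sub>F w in nhds z. v w = U w * F w" by eventually_elim (use v in auto)
    then have "deriv v z = deriv (\<lambda>z. U z * F z) z" by (rule deriv_cong_ev) simp
    also have "\<dots> = deriv U z * F z + U z * (C z / (U z)^2)" by (rule DERIV_imp_deriv[OF FU[OF z]])
    finally show "W z = 0" using z v(2)[OF z] by (simp add: W_def power2_eq_square algebra_simps)
  qed
  then have "deriv U z * v z - U z * deriv v z = - C z" for z
    by (simp add: W_def add_eq_0_iff2)
  then show ?thesis using that v(1) by blast
qed

text \<open>
  At a simple root \<open>\<alpha>\<close> of \<open>p\<close> the integrand has a double pole, and its residue is the derivative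
  at \<open>\<alpha>\<close> of \<open>G1 = z ^ (n - 1) / V\<^sup>2\<close>, where \<open>U = (z - \<alpha>) V\<close>. The equation for \<open>U\<close> at \<open>\<alpha>\<close> says
  exactly that this derivative is 0.
\<close>

lemma local_primitive_at_root:
  assumes n: "n \<ge> 1" and p: "rsquarefree p" and p0: "poly p 0 \<noteq> 0"
    and res: "hermite_residual n a p = \<Theta> * p" and \<alpha>: "poly p \<alpha> = 0"
  obtains r H V where "r > 0" "H holomorphic_on ball \<alpha> r" "isCont V \<alpha>"
    "\<And>z. hermite_fun n a p z = (z - \<alpha>) * V z"
    "\<And>z. z \<in> ball \<alpha> r - {\<alpha>} \<Longrightarrow> ((\<lambda>z. H z / (z - \<alpha>)) has_field_derivative z ^ (n - 1) / (hermite_fun n a p z)^2) (at z)"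
proof -
  let ?U = "hermite_fun n a p"
  have \<alpha>0: "\<alpha> \<noteq> 0" using \<alpha> p0 by auto
  obtain q where q: "p = [:- \<alpha>, 1:] * q" using \<alpha> by (auto simp: poly_eq_0_iff_dvd elim: dvdE)
  have q0: "poly q \<alpha> \<noteq> 0"
  proof
    assume "poly q \<alpha> = 0"
    then have "poly (pderiv p) \<alpha> = 0" by (simp only: q pderiv_mult poly_add poly_mult) simp
    then show False using p \<alpha> by (simp add: rsquarefree_roots)
  qed
  define V where "V = (\<lambda>z. z ^ n * exp (- g z a) * poly q z)"
  have V: "V holomorphic_on UNIV" unfolding V_def g_def by (intro holomorphic_intros) auto
  have dV: "deriv V holomorphic_on UNIV" using V by (intro holomorphic_deriv) auto
  have Vd: "(V has_field_derivative deriv V z) (at z)" "(deriv V has_field_derivative deriv (deriv V) z) (at z)" for z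
    using V dV by (auto intro: holomorphic_derivI)
  have UV: "?U z = (z - \<alpha>) * V z" for z by (simp add: hermite_fun_def V_def q algebra_simps)
  have V\<alpha>: "V \<alpha> \<noteq> 0" using \<alpha>0 q0 by (simp add: V_def)
  have contV: "isCont V \<alpha>" using Vd DERIV_isCont by blast
  obtain r where r: "r > 0" "\<And>z. z \<in> ball \<alpha> r \<Longrightarrow> V z \<noteq> 0"
  proof -
    have "\<forall>\<^sub>F z in nhds \<alpha>. V z \<noteq> 0"
      using tendsto_imp_eventually_ne[OF contV[unfolded continuous_at] ] V\<alpha>
      by (simp add: eventually_nhds_conv_at isContD[OF contV] tendsto_imp_eventually_ne)
    then show ?thesis using that by (auto simp: eventually_nhds_metric dist_commute)
  qed
  have dU: "deriv ?U z = V z + (z - \<alpha>) * deriv V z" for z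
  proof (rule DERIV_imp_deriv)
    show "(?U has_field_derivative V z + (z - \<alpha>) * deriv V z) (at z)"
      unfolding UV[abs_def] by (auto intro!: derivative_eq_intros Vd)
  qed
  have ddU: "deriv (deriv ?U) \<alpha> = 2 * deriv V \<alpha>"
  proof (rule DERIV_imp_deriv)
    show "(deriv ?U has_field_derivative 2 * deriv V \<alpha>) (at \<alpha>)"
      unfolding dU[abs_def] by (auto intro!: derivative_eq_intros Vd)
  qed
  \<comment> \<open>The equation at \<open>\<alpha>\<close>, where \<open>U = 0\<close>, \<open>U' = V\<close> and \<open>U'' = 2 V'\<close>.\<close>
  have key: "2 * \<alpha> * deriv V \<alpha> = (of_nat n - 1) * V \<alpha>"
    using hermite_fun_ode[OF n res, of \<alpha>] \<alpha> by (simp add: ddU dU hermite_fun_def mult_ac)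
  define G1 where "G1 = (\<lambda>z. z ^ (n - 1) / (V z)^2)"
  have G1: "G1 holomorphic_on ball \<alpha> r"
    unfolding G1_def using r by (intro holomorphic_intros holomorphic_on_subset[OF V]) auto
  have dG1: "deriv G1 \<alpha> = 0"
  proof (rule DERIV_imp_deriv)
    have "(G1 has_field_derivative ((of_nat (n - 1) * \<alpha> ^ (n - 1 - 1)) * (V \<alpha>)^2 - \<alpha> ^ (n - 1) * (2 * V \<alpha> * deriv V \<alpha>)) / ((V \<alpha>)^2 * (V \<alpha>)^2)) (at \<alpha>)"
      unfolding G1_def using V\<alpha> by (auto intro!: derivative_eq_intros Vd)
    moreover have "(of_nat (n - 1) * \<alpha> ^ (n - 1 - 1)) * (V \<alpha>)^2 - \<alpha> ^ (n - 1) * (2 * V \<alpha> * deriv V \<alpha>) = 0"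
    proof -
      have "\<alpha> * ((of_nat (n - 1) * \<alpha> ^ (n - 1 - 1)) * (V \<alpha>)^2) = (of_nat n - 1) * \<alpha> ^ (n - 1) * (V \<alpha>)^2"
      proof (cases "n - 1")
        case 0 then show ?thesis using n by (cases n) auto
      next
        case (Suc j) then show ?thesis using n by (cases n) auto
      qed
      also have "\<dots> = \<alpha> ^ (n - 1) * V \<alpha> * ((of_nat n - 1) * V \<alpha>)" by (simp add: power2_eq_square)
      also have "\<dots> = \<alpha> * (\<alpha> ^ (n - 1) * (2 * V \<alpha> * deriv V \<alpha>))" unfolding key[symmetric] by simp
      finally show ?thesis using \<alpha>0 by simp
    qed
    ultimately show "(G1 has_field_derivative 0) (at \<alpha>)" by simp
  qed
  define D1 where "D1 = (\<lambda>z. if z = \<alpha> then deriv G1 \<alpha> else (G1 z - G1 \<alpha>) / (z - \<alpha>))"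
  have D1: "D1 holomorphic_on ball \<alpha> r" unfolding D1_def by (rule pole_lemma_open[OF G1 open_ball])
  define D2 where "D2 = (\<lambda>z. if z = \<alpha> then deriv D1 \<alpha> else (D1 z - D1 \<alpha>) / (z - \<alpha>))"
  have D2: "D2 holomorphic_on ball \<alpha> r" unfolding D2_def by (rule pole_lemma_open[OF D1 open_ball])
  have D2_eq: "D2 z = (G1 z - G1 \<alpha>) / (z - \<alpha>)^2" if "z \<noteq> \<alpha>" for z
    using that dG1 by (simp add: D2_def D1_def power2_eq_square)
  obtain H1 where H1: "\<And>z. z \<in> ball \<alpha> r \<Longrightarrow> (H1 has_field_derivative D2 z) (at z within ball \<alpha> r)"
    using holomorphic_convex_primitive'[OF convex_ball open_ball D2] by blast
  have H1': "(H1 has_field_derivative D2 z) (at z)" if "z \<in> ball \<alpha> r" for z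
    using H1[OF that] that by (simp add: at_within_open[OF _ open_ball])
  define H where "H = (\<lambda>z. - G1 \<alpha> + (z - \<alpha>) * H1 z)"
  show ?thesis
  proof (rule that[of r H V])
    show "r > 0" by (rule r)
    have "H1 holomorphic_on ball \<alpha> r" unfolding holomorphic_on_def field_differentiable_def using H1 by blast
    then show "H holomorphic_on ball \<alpha> r" unfolding H_def by (intro holomorphic_intros)
    show "isCont V \<alpha>" by (rule contV)
    show "?U z = (z - \<alpha>) * V z" for z by (rule UV)
    fix z assume z: "z \<in> ball \<alpha> r - {\<alpha>}"
    have "((\<lambda>z. H1 z - G1 \<alpha> / (z - \<alpha>)) has_field_derivative D2 z + G1 \<alpha> / (z - \<alpha>)^2) (at z)"
      using z by (auto intro!: derivative_eq_intros H1' simp: power2_eq_square)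
    also have "D2 z + G1 \<alpha> / (z - \<alpha>)^2 = G1 z / (z - \<alpha>)^2" using D2_eq[of z] z by (simp add: add_divide_distrib[symmetric])
    also have "G1 z / (z - \<alpha>)^2 = z ^ (n - 1) / (?U z)^2" by (simp add: G1_def UV power_mult_distrib)
    finally show "((\<lambda>z. H z / (z - \<alpha>)) has_field_derivative z ^ (n - 1) / (?U z)^2) (at z)"
    proof (rule has_field_derivative_transform_within_open[of _ _ _ "- {\<alpha>}"])
      show "H1 w - G1 \<alpha> / (w - \<alpha>) = H w / (w - \<alpha>)" if "w \<in> - {\<alpha>}" for w
        using that by (simp add: H_def field_simps)
    qed (use z in auto)
  qed
qed

text \<open>
  An apparent singularity provides a solution \<open>h\<close> that is holomorphic at 0 with \<open>h 0 \<noteq> 0\<close>. Its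
  Wronskian with \<open>U\<close> is a nonzero multiple \<open>C\<close> of \<open>z ^ (n - 1)\<close>, so \<open>- h / (C U)\<close> is a primitive
  without a logarithm. The equation is only assumed on an open set \<open>T\<close>, since an oscillator
  provides it on the slit plane.
\<close>

lemma local_primitive_at_zero:
  assumes n: "n \<ge> 1" and p0: "poly p 0 \<noteq> 0" and res: "hermite_residual n a p = \<Theta> * p"
    and r: "r > 0" and h: "h holomorphic_on ball 0 r" and h0: "h 0 \<noteq> 0"
    and T: "open T" "T \<noteq> {}" "T \<subseteq> ball 0 r"
    and ode: "\<And>z. z \<in> T \<Longrightarrow> z * deriv (deriv h) z = (of_nat n - 1) * deriv h z + poly \<Theta> z * h z"
  obtains r' H where "r' > 0" "H holomorphic_on ball 0 r'"
    "\<And>z. z \<in> ball 0 r' - {0} \<Longrightarrow> ((\<lambda>z. H z / z ^ n) has_field_derivative z ^ (n - 1) / (hermite_fun n a p z)^2) (at z)"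
proof -
  let ?U = "hermite_fun n a p"
  have dh: "deriv h holomorphic_on ball 0 r" and ddh: "deriv (deriv h) holomorphic_on ball 0 r"
    using h by (auto intro!: holomorphic_deriv)
  have hd: "(h has_field_derivative deriv h z) (at z)" "(deriv h has_field_derivative deriv (deriv h) z) (at z)"
    if "z \<in> ball 0 r" for z
    using that h dh by (auto intro: holomorphic_derivI)
  have U: "?U holomorphic_on UNIV" by (rule holomorphic_hermite_fun)
  have dU: "deriv ?U holomorphic_on UNIV" using U by (intro holomorphic_deriv) auto
  have Ud: "(?U has_field_derivative deriv ?U z) (at z)" "(deriv ?U has_field_derivative deriv (deriv ?U) z) (at z)" for z
    using U dU by (auto intro: holomorphic_derivI)
  have ode': "z * deriv (deriv h) z = (of_nat n - 1) * deriv h z + poly \<Theta> z * h z" if "z \<in> ball 0 r" for z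
    by (rule analytic_continuation_open[OF T(1) open_ball T(2) connected_ball T(3) _ _ ode that])
       (use h dh ddh in \<open>auto intro!: holomorphic_intros\<close>)
  define w where "w = (\<lambda>z. deriv ?U z * h z - ?U z * deriv h z)"
  \<comment> \<open>The Wronskian \<open>w\<close> divided by \<open>z ^ (n - 1)\<close>; it is constant by the equation and nonzero at
    0.\<close>
  define c where "c = (\<lambda>z. exp (- g z a) * (poly (hermite_deriv n a p) z * h z - z * poly p z * deriv h z))"
  have zn: "z ^ n = z ^ (n - 1) * z" for z :: complex using n by (cases n) auto
  have wc: "w z = z ^ (n - 1) * c z" for z
    unfolding w_def c_def deriv_hermite_fun[OF n] hermite_fun_def zn by (simp add: algebra_simps)
  have dw: "(w has_field_derivative deriv (deriv ?U) z * h z - ?U z * deriv (deriv h) z) (at z)"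
    if "z \<in> ball 0 r" for z
    unfolding w_def by (auto intro!: derivative_eq_intros Ud hd that simp: algebra_simps)
  have zw: "z * (deriv (deriv ?U) z * h z - ?U z * deriv (deriv h) z) = (of_nat n - 1) * w z" if "z \<in> ball 0 r" for z
  proof -
    have "z * (deriv (deriv ?U) z * h z - ?U z * deriv (deriv h) z) =
       (z * deriv (deriv ?U) z) * h z - ?U z * (z * deriv (deriv h) z)" by (simp add: algebra_simps)
    then show ?thesis unfolding ode'[OF that] hermite_fun_ode[OF n res] w_def by (simp add: algebra_simps)
  qed
  have dc: "(c has_field_derivative 0) (at z)" if z: "z \<in> ball 0 r - {0}" for z
  proof -
    have zb: "z \<in> ball 0 r" "z \<noteq> 0" using z by auto
    let ?w' = "deriv (deriv ?U) z * h z - ?U z * deriv (deriv h) z"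
    have "((\<lambda>z. w z / z ^ (n - 1)) has_field_derivative (?w' * z ^ (n - 1) - w z * (of_nat (n - 1) * z ^ (n - 1 - 1))) / (z ^ (n - 1) * z ^ (n - 1))) (at z)"
      using zb by (auto intro!: derivative_eq_intros dw)
    moreover have "?w' * z ^ (n - 1) - w z * (of_nat (n - 1) * z ^ (n - 1 - 1)) = 0"
    proof -
      have "z * (of_nat (n - 1) * z ^ (n - 1 - 1)) = (of_nat n - 1) * z ^ (n - 1)"
      proof (cases "n - 1")
        case 0 then show ?thesis using n by (cases n) auto
      next
        case (Suc j) then show ?thesis using n by (cases n) auto
      qed
      then have "z * (?w' * z ^ (n - 1) - w z * (of_nat (n - 1) * z ^ (n - 1 - 1))) = (z * ?w') * z ^ (n - 1) - w z * ((of_nat n - 1) * z ^ (n - 1))"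
      proof -
        assume e: "z * (of_nat (n - 1) * z ^ (n - 1 - 1)) = (of_nat n - 1) * z ^ (n - 1)"
        have "z * (A * B - W * D) = (z * A) * B - W * (z * D)" for A B W D :: complex by (simp add: algebra_simps)
        then show ?thesis unfolding e[symmetric] .
      qed
      also have "\<dots> = 0" unfolding zw[OF zb(1)] by simp
      finally show ?thesis using zb by simp
    qed
    ultimately have "((\<lambda>z. w z / z ^ (n - 1)) has_field_derivative 0) (at z)" by simp
    then show ?thesis
      by (rule has_field_derivative_transform_within_open[of _ _ _ "- {0}"]) (use zb wc in auto)
  qed
  have "continuous_on (ball 0 r) c"
    unfolding c_def g_def using h dh by (intro continuous_intros holomorphic_on_imp_continuous_on) auto
  then obtain C where C: "\<And>z. z \<in> ball 0 r \<Longrightarrow> c z = C"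
    using DERIV_zero_connected_constant[of "ball 0 r" "{0}" c] dc by auto
  have "c 0 \<noteq> 0" using p0 h0 n by (simp add: c_def g_def hermite_deriv_def)
  then have C0: "C \<noteq> 0" using C[of 0] r by simp
  obtain r2 where r2: "r2 > 0" "\<And>z. z \<in> ball 0 r2 \<Longrightarrow> poly p z \<noteq> 0"
  proof -
    have "\<forall>\<^sub>F z in nhds 0. poly p z \<noteq> 0"
      using p0 tendsto_imp_eventually_ne[OF isContD[OF poly_isCont[of 0 p]]] by (simp add: eventually_nhds_conv_at)
    then show ?thesis using that by (auto simp: eventually_nhds_metric dist_commute)
  qed
  define r' where "r' = min r r2"
  define H where "H = (\<lambda>z. - h z / (C * (exp (- g z a) * poly p z)))"
  show ?thesis
  proof (rule that[of r' H])
    show "r' > 0" using r r2 by (simp add: r'_def)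
    show "H holomorphic_on ball 0 r'"
      unfolding H_def g_def using C0 r2
      by (intro holomorphic_intros holomorphic_on_subset[OF h]) (auto simp: r'_def)
    fix z :: complex assume z: "z \<in> ball 0 r' - {0}"
    have zb: "z \<in> ball 0 r" "z \<noteq> 0" "poly p z \<noteq> 0" using z r2 by (auto simp: r'_def)
    have Uz: "?U z \<noteq> 0" using zb n by (simp add: hermite_fun_eq_0_iff)
    have "((\<lambda>z. h z / ?U z) has_field_derivative (deriv h z * ?U z - h z * deriv ?U z) / (?U z * ?U z)) (at z)"
      by (rule DERIV_divide[OF hd(1)[OF zb(1)] Ud(1) Uz])
    then have "((\<lambda>z. - (h z / ?U z) / C) has_field_derivative - ((deriv h z * ?U z - h z * deriv ?U z) / (?U z * ?U z)) / C) (at z)"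
      by (intro DERIV_cdivide DERIV_minus)
    also have "- ((deriv h z * ?U z - h z * deriv ?U z) / (?U z * ?U z)) / C = w z / (?U z)^2 / C"
      by (simp add: w_def power2_eq_square minus_divide_left algebra_simps)
    also have "\<dots> = z ^ (n - 1) / (?U z)^2" unfolding wc C[OF zb(1)] using C0 by simp
    finally show "((\<lambda>z. H z / z ^ n) has_field_derivative z ^ (n - 1) / (?U z)^2) (at z)"
      by (rule has_field_derivative_transform_within_open[of _ _ _ UNIV])
         (auto simp: H_def hermite_fun_def field_simps)
  qed
qed

text \<open>
  The absence of logarithms at all zeros of \<open>U\<close> makes reduction of order single-valued.
\<close>

theorem exists_hermite_pair:
  assumes n: "n \<ge> 1" and p: "rsquarefree p" and p0: "poly p 0 \<noteq> 0" and res: "hermite_residual n a p = \<Theta> * p"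
    and r: "r > 0" and h: "h holomorphic_on ball 0 r" and h0: "h 0 \<noteq> 0"
    and T: "open T" "T \<noteq> {}" "T \<subseteq> ball 0 r"
    and ode: "\<And>z. z \<in> T \<Longrightarrow> z * deriv (deriv h) z = (of_nat n - 1) * deriv h z + poly \<Theta> z * h z"
  obtains v where "hermite_pair n a p v (- 1)"
proof -
  let ?U = "hermite_fun n a p"
  \<comment> \<open>The order of the zero of \<open>U\<close> at \<open>s\<close>.\<close>
  define N where "N = (\<lambda>s::complex. if s = 0 then n else 1)"
  define Q where "Q = (\<lambda>s r H V. r > 0 \<and> H holomorphic_on ball s r \<and> isCont V s \<and> (\<forall>z. ?U z = (z - s) ^ N s * V z) \<and>
      (\<forall>z\<in>ball s r - {s}. ((\<lambda>z. H z / (z - s) ^ N s) has_field_derivative z ^ (n - 1) / (?U z)^2) (at z)))"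
  have "\<exists>r H V. Q s r H V"
    if s: "?U s = 0" for s
  proof (cases "s = 0")
    case True
    obtain r' H where "r' > 0" "H holomorphic_on ball 0 r'"
      "\<And>z. z \<in> ball 0 r' - {0} \<Longrightarrow> ((\<lambda>z. H z / z ^ n) has_field_derivative z ^ (n - 1) / (?U z)^2) (at z)"
      by (rule local_primitive_at_zero[OF n p0 res r h h0 T ode]) blast+
    moreover have "isCont (\<lambda>z. exp (- g z a) * poly p z) 0" unfolding g_def by (intro continuous_intros) auto
    moreover have "?U z = z ^ n * (exp (- g z a) * poly p z)" for z by (simp add: hermite_fun_def)
    ultimately show ?thesis unfolding True N_def Q_def by (intro exI[of _ r'] exI[of _ H] exI[of _ "\<lambda>z. exp (- g z a) * poly p z"]) simp
  next
    case False
    then have "poly p s = 0" using s n by (simp add: hermite_fun_eq_0_iff)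
    then obtain r' H V where "r' > 0" "H holomorphic_on ball s r'" "isCont V s"
      "\<And>z. ?U z = (z - s) * V z"
      "\<And>z. z \<in> ball s r' - {s} \<Longrightarrow> ((\<lambda>z. H z / (z - s)) has_field_derivative z ^ (n - 1) / (?U z)^2) (at z)"
      by (rule local_primitive_at_root[OF n p p0 res]) blast+
    then show ?thesis using False unfolding Q_def N_def by (intro exI[of _ r'] exI[of _ H] exI[of _ V]) simp
  qed
  then have "\<forall>s\<in>{s. ?U s = 0}. \<exists>t. Q s (fst t) (fst (snd t)) (snd (snd t))" by simp
  then obtain t where t: "\<And>s. ?U s = 0 \<Longrightarrow> Q s (fst (t s)) (fst (snd (t s))) (snd (snd (t s)))"
    using bchoice[of "{s. ?U s = 0}" "\<lambda>s t. Q s (fst t) (fst (snd t)) (snd (snd t))"] by blast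
  define R H V where "R = (\<lambda>s. fst (t s))" and "H = (\<lambda>s. fst (snd (t s)))" and "V = (\<lambda>s. snd (snd (t s)))"
  have Q: "Q s (R s) (H s) (V s)" if "?U s = 0" for s using t[OF that] by (simp add: R_def H_def V_def)
  have R: "R s > 0" if "?U s = 0" for s using Q[OF that] by (simp add: Q_def)
  have H: "H s holomorphic_on ball s (R s)" if "?U s = 0" for s using Q[OF that] by (simp add: Q_def)
  have V: "isCont (V s) s \<and> (\<forall>z. ?U z = (z - s) ^ N s * V s z)" if "?U s = 0" for s using Q[OF that] by (simp add: Q_def)
  have d: "((\<lambda>z. H s z / (z - s) ^ N s) has_field_derivative z ^ (n - 1) / (?U z)^2) (at z)"
    if "?U s = 0" "z \<in> ball s (R s) - {s}" for s z using Q[OF that(1)] that(2) unfolding Q_def by blast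
  have fin: "finite {z. ?U z = 0}"
  proof -
    have "{z. ?U z = 0} = insert 0 {z. poly p z = 0}" using n by (auto simp: hermite_fun_eq_0_iff)
    moreover have "p \<noteq> 0" using p0 by auto
    ultimately show ?thesis using poly_roots_finite by simp
  qed
  have C: "(\<lambda>z::complex. z ^ (n - 1)) holomorphic_on UNIV" by (intro holomorphic_intros)
  have ord: "\<exists>W. isCont W s \<and> (\<forall>z. ?U z = (z - s) ^ N s * W z)" if "?U s = 0" for s using V[OF that] by blast
  obtain v where v: "v holomorphic_on UNIV" "\<And>z. deriv ?U z * v z - ?U z * deriv v z = - (z ^ (n - 1))"
    by (rule wronskian_partner[OF holomorphic_hermite_fun fin C R H d ord]) blast+
  have "hermite_pair n a p v (- 1)"
    by unfold_locales (use n p0 v in auto)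
  then show ?thesis by (rule that)
qed

section \<open>From Hermite oscillators to pairs\<close>

lemma infinite_slit_plane: "infinite slit_plane"
  using open_slit_plane one_in_slit_plane finite_imp_not_open by blast

lemma of_real_in_slit_plane: "0 < x \<Longrightarrow> of_real x \<in> slit_plane"
proof -
  assume "0 < x"
  then have "Re (of_real x * cis (- pi / 4)) > 0" by (simp add: cos_45)
  then show ?thesis by (auto simp: slit_plane_def complex_nonpos_Reals_iff)
qed

text \<open>
  The equation for the holomorphic factor \<open>y\<close> of \<open>\<psi> = z ^ ((1 - n) / 2) y\<close>.
\<close>

definition reduced_ode :: "nat \<Rightarrow> complex poly \<Rightarrow> complex set \<Rightarrow> (complex \<Rightarrow> complex) \<Rightarrow> bool" where
  "reduced_ode n \<Theta> S y \<longleftrightarrow>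
     (\<forall>z\<in>S. z * deriv (deriv y) z = (of_nat n - 1) * deriv y z + poly \<Theta> z * y z)"

text \<open>
  Together with the equation above: \<open>\<Theta> / z\<close> is the potential without its double pole, whose
  coefficient is \<open>\<theta>\<^sub>0\<^sup>2 - 1/4\<close> for \<open>\<theta>\<^sub>0 = n / 2\<close>.
\<close>

definition has_reduction :: "nat \<Rightarrow> complex poly \<Rightarrow> (complex \<Rightarrow> complex) \<Rightarrow> bool" where
  "has_reduction n \<Theta> W \<longleftrightarrow> (\<forall>z. z \<noteq> 0 \<longrightarrow> W z = poly \<Theta> z / z + (of_nat n^2 - 1) / 4 / z^2)"

lemma solution_iff_reduced_ode:
  assumes y: "y holomorphic_on slit_plane" and W: "has_reduction n \<Theta> W"
  shows "solution W (\<lambda>z. slit_pow z ((1 - of_nat n) / 2) * y z) \<longleftrightarrow> reduced_ode n \<Theta> slit_plane y"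
  unfolding solution_slit_pow_iff[OF y] reduced_ode_def
proof (intro ball_cong refl)
  fix z assume "z \<in> slit_plane"
  then have z: "z \<noteq> 0" using zero_notin_slit_plane by auto
  have e: "(of_nat n - 1) / z * deriv y z + (W z - (of_nat n^2 - 1) / 4 / z^2) * y z =
     ((of_nat n - 1) * deriv y z + poly \<Theta> z * y z) / z"
    using W z by (simp add: has_reduction_def add_divide_distrib)
  show "(deriv (deriv y) z = (of_nat n - 1) / z * deriv y z + (W z - (of_nat n^2 - 1) / 4 / z^2) * y z) \<longleftrightarrow>
     (z * deriv (deriv y) z = (of_nat n - 1) * deriv y z + poly \<Theta> z * y z)"
    unfolding e using z by (simp add: eq_divide_eq mult.commute)
qed

lemma deriv2_cong_open:
  fixes f g :: "complex \<Rightarrow> complex"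
  assumes "open S" "z \<in> S" "\<And>w. w \<in> S \<Longrightarrow> f w = g w"
  shows "f z = g z" and "deriv f z = deriv g z" and "deriv (deriv f) z = deriv (deriv g) z"
proof -
  have ev: "\<forall>\<^sub>F w in nhds w'. w \<in> S" if "w' \<in> S" for w' using assms(1) that eventually_nhds by blast
  have 1: "deriv f w = deriv g w" if "w \<in> S" for w
    by (intro deriv_cong_ev refl) (rule eventually_mono[OF ev[OF that] assms(3)])
  show "f z = g z" using assms by blast
  show "deriv f z = deriv g z" using 1 assms by blast
  show "deriv (deriv f) z = deriv (deriv g) z"
    by (intro deriv_cong_ev refl) (rule eventually_mono[OF ev[OF assms(2)] 1])
qed

lemma solution_cong:
  assumes "\<And>z. z \<in> slit_plane \<Longrightarrow> \<phi> z = \<psi> z" "solution W \<psi>" shows "solution W \<phi>"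
  unfolding solution_def
proof (intro conjI ballI)
  show "\<phi> holomorphic_on slit_plane" using assms by (auto simp: solution_def intro: holomorphic_transform)
  fix z assume z: "z \<in> slit_plane"
  have "deriv (deriv \<phi>) z = deriv (deriv \<psi>) z" by (rule deriv2_cong_open[OF open_slit_plane z assms(1)])
  then show "deriv (deriv \<phi>) z = W z * \<phi> z" using assms z by (simp add: solution_def)
qed

lemma solution_cmult:
  assumes "solution W \<psi>" shows "solution W (\<lambda>z. c * \<psi> z)"
  unfolding solution_def
proof (intro conjI ballI)
  have h: "\<psi> holomorphic_on slit_plane" using assms by (simp add: solution_def)
  then show "(\<lambda>z. c * \<psi> z) holomorphic_on slit_plane" by (intro holomorphic_intros)
  have d: "\<psi> field_differentiable at z" if "z \<in> slit_plane" for z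
    using h open_slit_plane that holomorphic_on_imp_differentiable_at by blast
  have dh: "deriv \<psi> holomorphic_on slit_plane" using h open_slit_plane by (rule holomorphic_deriv)
  fix z assume z: "z \<in> slit_plane"
  have "deriv (deriv (\<lambda>z. c * \<psi> z)) z = deriv (\<lambda>z. c * deriv \<psi> z) z"
    by (rule deriv2_cong_open(2)[OF open_slit_plane z]) (simp add: d)
  also have "\<dots> = c * deriv (deriv \<psi>) z"
    using holomorphic_on_imp_differentiable_at[OF dh open_slit_plane z] by simp
  finally show "deriv (deriv (\<lambda>z. c * \<psi> z)) z = W z * (c * \<psi> z)"
    using assms z by (simp add: solution_def)
qed

text \<open>
  This transfers the property of being a solution from the abstract subdominant solution of an
  oscillator to the explicit function that it is proportional to.
\<close>

lemma solution_of_lin_dep: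
  assumes \<psi>: "solution W \<psi>" "\<exists>z\<in>slit_plane. \<psi> z \<noteq> 0" and \<phi>: "\<exists>z\<in>slit_plane. \<phi> z \<noteq> 0" and l: "\<psi> \<cong>\<^sub>l \<phi>"
  shows "solution W \<phi>"
proof -
  obtain c d where cd: "(c, d) \<noteq> (0, 0)" "\<And>z. z \<in> slit_plane \<Longrightarrow> c * \<psi> z + d * \<phi> z = 0"
    using l by (auto simp: lin_dep_def)
  have "d \<noteq> 0" using cd \<psi>(2) by auto
  then have "\<phi> z = (- c / d) * \<psi> z" if "z \<in> slit_plane" for z
    using cd(2)[OF that] by (simp add: field_simps add_eq_0_iff)
  then show ?thesis by (rule solution_cong[OF _ solution_cmult[OF \<psi>(1)]])
qed

lemma slit_pow_split:
  assumes "z \<noteq> 0"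
  shows "slit_pow z ((of_nat n + 1) / 2) = slit_pow z ((1 - of_nat n) / 2) * z ^ n"
proof -
  have "(of_nat n + 1) / 2 = (1 - of_nat n) / 2 + (of_nat n :: complex)" by (simp add: field_simps)
  then show ?thesis by (simp only: slit_pow_add slit_pow_of_nat[OF assms])
qed

lemma exponential_solution_ode:
  assumes W: "has_reduction n \<Theta> W"
    and \<psi>: "solution W \<psi>" "\<exists>z\<in>slit_plane. \<psi> z \<noteq> 0"
    and l: "\<psi> \<cong>\<^sub>l \<phi>" and \<phi>: "\<And>z. z \<in> slit_plane \<Longrightarrow> \<phi> z = slit_pow z ((of_nat n + 1) / 2) * E z"
    and E: "E holomorphic_on UNIV" "\<exists>z\<in>slit_plane. E z \<noteq> 0"
  shows "reduced_ode n \<Theta> slit_plane (\<lambda>z. z ^ n * E z)"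
proof -
  have "\<exists>z\<in>slit_plane. \<phi> z \<noteq> 0" using E(2) \<phi> by auto
  then have s\<phi>: "solution W \<phi>" by (rule solution_of_lin_dep[OF \<psi> _ l])
  have eqs: "slit_pow z ((1 - of_nat n) / 2) * (z ^ n * E z) = \<phi> z" if "z \<in> slit_plane" for z
  proof -
    have "z \<noteq> 0" using that zero_notin_slit_plane by auto
    then show ?thesis by (simp add: \<phi>[OF that] slit_pow_split)
  qed
  have "solution W (\<lambda>z. slit_pow z ((1 - of_nat n) / 2) * (z ^ n * E z))"
    by (rule solution_cong[OF eqs s\<phi>])
  moreover have "(\<lambda>z. z ^ n * E z) holomorphic_on slit_plane"
    by (intro holomorphic_intros holomorphic_on_subset[OF E(1)]) auto
  ultimately show ?thesis using solution_iff_reduced_ode[OF _ W] by blast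
qed

lemma apparent_ode:
  assumes W: "has_reduction n \<Theta> W" and "apparent W (of_nat n / 2)"
  obtains h r where "r > 0" "h holomorphic_on ball 0 r" "h 0 = 1" "reduced_ode n \<Theta> (slit_plane \<inter> ball 0 r) h"
proof -
  obtain \<psi> h r where \<psi>: "solution W \<psi>" and r: "r > 0" "h holomorphic_on ball 0 r" "h 0 = 1"
    and eq: "\<And>z. z \<in> slit_plane \<inter> ball 0 r \<Longrightarrow> \<psi> z = slit_pow z (1/2 - of_nat n / 2) * h z"
    using assms(2) by (auto simp: apparent_def)
  have e: "(1/2 - of_nat n / 2 :: complex) = (1 - of_nat n) / 2" by (simp add: field_simps)
  define y where "y = (\<lambda>z. \<psi> z / slit_pow z ((1 - of_nat n) / 2))"
  have y: "y holomorphic_on slit_plane"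
    unfolding y_def using \<psi> by (intro holomorphic_intros holomorphic_slit_pow) (auto simp: solution_def)
  have "solution W (\<lambda>z. slit_pow z ((1 - of_nat n) / 2) * y z)"
    by (rule solution_cong[OF _ \<psi>]) (simp add: y_def)
  then have ode: "reduced_ode n \<Theta> slit_plane y" using solution_iff_reduced_ode[OF y W] by blast
  have "reduced_ode n \<Theta> (slit_plane \<inter> ball 0 r) h"
    unfolding reduced_ode_def
  proof
    fix z assume z: "z \<in> slit_plane \<inter> ball 0 r"
    have "open (slit_plane \<inter> ball 0 r)" using open_slit_plane by auto
    note c = deriv2_cong_open[OF this z, of y h]
    have yh: "y w = h w" if "w \<in> slit_plane \<inter> ball 0 r" for w using eq[OF that] by (simp add: y_def e)
    show "z * deriv (deriv h) z = (of_nat n - 1) * deriv h z + poly \<Theta> z * h z"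
    proof -
      have "z * deriv (deriv y) z = (of_nat n - 1) * deriv y z + poly \<Theta> z * y z"
        using ode z unfolding reduced_ode_def by blast
      then show ?thesis by (simp only: c[OF yh])
    qed
  qed
  then show ?thesis using that r by blast
qed

text \<open>
  The coefficient \<open>\<Theta>\<close> of the equation for \<open>y (c z)\<close>; see the next lemmas.
\<close>

definition rot_poly :: "complex \<Rightarrow> complex poly \<Rightarrow> complex poly" where
  "rot_poly c \<Theta> = smult c (pcompose \<Theta> [:0, c:])"

lemma poly_rot_poly: "poly (rot_poly c \<Theta>) z = c * poly \<Theta> (c * z)"
  by (simp add: rot_poly_def poly_pcompose mult.commute)

lemma reduced_ode_rotate:
  assumes S: "open S" and y: "y holomorphic_on S" and ode: "reduced_ode n \<Theta> S y" and c: "c \<noteq> 0"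
  shows "reduced_ode n (rot_poly c \<Theta>) ((\<lambda>z. c * z) -` S) (\<lambda>z. y (c * z))"
  unfolding reduced_ode_def
proof
  fix z assume z: "z \<in> (\<lambda>z. c * z) -` S"
  have o: "open ((\<lambda>z. c * z) -` S)" by (intro open_vimage S continuous_intros)
  have dy: "deriv y holomorphic_on S" using y S by (rule holomorphic_deriv)
  have d: "((\<lambda>z. u (c * z)) has_field_derivative c * deriv u (c * z)) (at z)"
    if "u holomorphic_on S" "c * z \<in> S" for u z
  proof -
    have "(u has_field_derivative deriv u (c * z)) (at (c * z))" using that S holomorphic_derivI by blast
    moreover have "((\<lambda>z. c * z) has_field_derivative c) (at z)" by (auto intro!: derivative_eq_intros)
    ultimately show ?thesis using DERIV_chain2[of u "deriv u (c * z)" "\<lambda>z. c * z" z c UNIV] by (simp add: mult.commute)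
  qed
  have d1: "deriv (\<lambda>z. y (c * z)) w = c * deriv y (c * w)" if "w \<in> (\<lambda>z. c * z) -` S" for w
    using that by (intro DERIV_imp_deriv d[OF y]) auto
  have d2: "deriv (deriv (\<lambda>z. y (c * z))) z = c * (c * deriv (deriv y) (c * z))"
  proof -
    have "deriv (deriv (\<lambda>z. y (c * z))) z = deriv (\<lambda>w. c * deriv y (c * w)) z"
      by (rule deriv2_cong_open(2)[OF o z d1])
    also have "\<dots> = c * (c * deriv (deriv y) (c * z))"
      using z by (intro DERIV_imp_deriv DERIV_cmult d[OF dy]) auto
    finally show ?thesis .
  qed
  have "(c * z) * deriv (deriv y) (c * z) = (of_nat n - 1) * deriv y (c * z) + poly \<Theta> (c * z) * y (c * z)"
    using ode z by (simp add: reduced_ode_def)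
  then have "c * ((c * z) * deriv (deriv y) (c * z)) = c * ((of_nat n - 1) * deriv y (c * z) + poly \<Theta> (c * z) * y (c * z))"
    by simp
  then show "z * deriv (deriv (\<lambda>z. y (c * z))) z = (of_nat n - 1) * deriv (\<lambda>z. y (c * z)) z + poly (rot_poly c \<Theta>) z * y (c * z)"
    unfolding d2 d1[OF z] poly_rot_poly by (simp add: algebra_simps)
qed

lemma has_reduction_I: "has_reduction n (pot_poly m n a b) (V_I m n a b)"
  by (simp add: has_reduction_def V_I_eq)

definition pot_poly_II :: "nat \<Rightarrow> nat \<Rightarrow> complex \<Rightarrow> complex \<Rightarrow> complex poly" where
  "pot_poly_II m n a b = [: - (b + (2 * (1 - of_nat m / 2 - of_nat n) - 1/2) * a), a^2 + of_nat m + 2 * of_nat n, 2 * a, 1 :]"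

lemma has_reduction_II: "has_reduction m (pot_poly_II m n a b) (V_II m n a b)"
  unfolding has_reduction_def
  by (simp add: V_II_def V_def pot_poly_II_def field_simps power2_eq_square)

text \<open>
  The parameter \<open>b\<close> of the potential of type I into which a potential of type II is rotated.
\<close>

definition rot_b :: "nat \<Rightarrow> nat \<Rightarrow> complex \<Rightarrow> complex \<Rightarrow> complex" where
  "rot_b m n a b = - \<i> * (b + (2 * (1 - of_nat m / 2 - of_nat n) - 1/2) * a)
     - (2 * (of_nat n + 1 + of_nat m / 2) - 1/2) * (\<i> * a)"

text \<open>
  Rotation by a right angle turns type II into type I, with the two levels exchanged.
\<close>

lemma rot_pot_poly: "rot_poly (- \<i>) (pot_poly_II m n a b) = pot_poly n m (\<i> * a) (rot_b m n a b)"
  by (simp add: rot_poly_def pot_poly_II_def pot_poly_def rot_b_def pcompose_pCons algebra_simps power2_eq_square)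

lemma rot_b_surj: "\<exists>b. rot_b m n a b = b'"
proof
  show "rot_b m n a (\<i> * (b' + (2 * (of_nat n + 1 + of_nat m / 2) - 1/2) * (\<i> * a)) - (2 * (1 - of_nat m / 2 - of_nat n) - 1/2) * a) = b'"
    by (simp add: rot_b_def algebra_simps)
qed

lemma rot_rot_poly: "rot_poly c (rot_poly d \<Theta>) = smult (c * d) (pcompose \<Theta> [:0, c * d:])"
  by (rule poly_eq_poly_eq_iff[THEN iffD1], rule ext) (simp add: poly_rot_poly poly_pcompose mult_ac)

lemma rot_back: "rot_poly \<i> (rot_poly (- \<i>) \<Theta>) = \<Theta>"
  unfolding rot_rot_poly by simp

lemma hermite_fun_rotate:
  "hermite_fun n (\<i> * a) (pcompose p [:0, - \<i>:]) z = z ^ n * exp (g (- \<i> * z) a) * poly p (- \<i> * z)"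
  by (simp add: hermite_fun_def poly_pcompose g_def power_mult_distrib algebra_simps)

text \<open>
  The explicit solution \<open>\<psi>\<^sub>0\<close> gives \<open>U\<close>, the equation on the slit plane gives an identity of
  polynomials, and the apparent singularity gives \<open>v\<close>.
\<close>

theorem hermite_I_pair:
  assumes n: "n \<ge> 1" and H: "hermite_I m n a b"
  obtains p v where "hermite_pair n a p v (- 1)" "degree p = m - 1"
    "reduced_ode n (pot_poly m n a b) UNIV (hermite_fun n a p)"
proof -
  let ?W = "V_I m n a b" and ?\<Theta> = "pot_poly m n a b"
  obtain \<psi> p where app: "apparent ?W (of_nat n / 2)" and sub: "subdominant_inf ?W 0 \<psi>"
    and l: "\<psi> \<cong>\<^sub>l (\<lambda>z. slit_pow z ((of_nat n + 1) / 2) * exp (- g z a) * poly p z)"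
    and p: "degree p = m - 1" "rsquarefree p" "poly p 0 \<noteq> 0"
    using H unfolding hermite_I_def by blast
  have \<psi>: "solution ?W \<psi>" "\<exists>z\<in>slit_plane. \<psi> z \<noteq> 0" using sub by (auto simp: subdominant_inf_def)
  have pnz: "p \<noteq> 0" using p by auto
  have "\<exists>z\<in>slit_plane. poly p z \<noteq> 0"
    using poly_eq_of_infinite[OF infinite_slit_plane, of p 0] pnz by auto
  then have "reduced_ode n ?\<Theta> slit_plane (\<lambda>z. z ^ n * (exp (- g z a) * poly p z))"
    by (intro exponential_solution_ode[OF has_reduction_I \<psi> l]) (auto simp: g_def intro!: holomorphic_intros)
  moreover have hf: "(\<lambda>z. z ^ n * (exp (- g z a) * poly p z)) = hermite_fun n a p"
    by (rule ext) (simp add: hermite_fun_def)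
  ultimately have ode: "reduced_ode n ?\<Theta> slit_plane (hermite_fun n a p)" by simp
  have res: "hermite_residual n a p = ?\<Theta> * p"
  proof (rule poly_eq_of_infinite[OF infinite_slit_plane])
    fix z assume z: "z \<in> slit_plane"
    then have z0: "z \<noteq> 0" using zero_notin_slit_plane by auto
    have "z * deriv (deriv (hermite_fun n a p)) z = (of_nat n - 1) * deriv (hermite_fun n a p) z + poly ?\<Theta> z * hermite_fun n a p z"
      using ode z unfolding reduced_ode_def by blast
    then show "poly (hermite_residual n a p) z = poly (?\<Theta> * p) z"
      unfolding hermite_fun_ode_iff[OF n z0] by simp
  qed
  obtain h r where h: "r > 0" "h holomorphic_on ball 0 r" "h 0 = 1" "reduced_ode n ?\<Theta> (slit_plane \<inter> ball 0 r) h"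
    by (rule apparent_ode[OF has_reduction_I app])
  obtain v where "hermite_pair n a p v (- 1)"
  proof (rule exists_hermite_pair[OF n p(2,3) res h(1,2)])
    show "open (slit_plane \<inter> ball 0 r)" using open_slit_plane by auto
    show "slit_plane \<inter> ball 0 r \<noteq> {}" using of_real_in_slit_plane[of "r / 2"] h(1) by force
  qed (use h in \<open>auto simp: reduced_ode_def\<close>)
  moreover have "reduced_ode n ?\<Theta> UNIV (hermite_fun n a p)"
    using hermite_fun_ode[OF n res] by (simp add: reduced_ode_def)
  ultimately show ?thesis using that p by blast
qed

text \<open>
  As for type I, after the rotation. The rotated slit plane has a different cut, but the
  identity of polynomials needs infinitely many points only.
\<close>

theorem hermite_II_pair:
  assumes m: "m \<ge> 1" and H: "hermite_II m n a b"
  obtains p v where "hermite_pair m (\<i> * a) p v (- 1)" "degree p = n - 1"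
    "reduced_ode m (rot_poly (- \<i>) (pot_poly_II m n a b)) UNIV (hermite_fun m (\<i> * a) p)"
proof -
  let ?W = "V_II m n a b" and ?\<Theta> = "pot_poly_II m n a b"
  obtain \<psi> p where app: "apparent ?W (of_nat m / 2)" and sub: "subdominant_inf ?W 1 \<psi>"
    and l: "\<psi> \<cong>\<^sub>l (\<lambda>z. slit_pow z ((of_nat m + 1) / 2) * exp (g z a) * poly p z)"
    and p: "degree p = n - 1" "rsquarefree p" "poly p 0 \<noteq> 0"
    using H unfolding hermite_II_def by blast
  define q where "q = pcompose p [:0, - \<i>:]"
  have \<psi>: "solution ?W \<psi>" "\<exists>z\<in>slit_plane. \<psi> z \<noteq> 0" using sub by (auto simp: subdominant_inf_def)
  have pnz: "p \<noteq> 0" using p by auto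
  define S where "S = (\<lambda>z. - \<i> * z) -` slit_plane"
  have oS: "open S" unfolding S_def by (intro open_vimage open_slit_plane continuous_intros)
  have iS: "infinite S"
  proof -
    have "\<i> \<in> S" using one_in_slit_plane by (simp add: S_def)
    then show ?thesis using oS finite_imp_not_open by blast
  qed
  have S0: "z \<noteq> 0" if "z \<in> S" for z using that zero_notin_slit_plane by (auto simp: S_def)
  have "\<exists>z\<in>slit_plane. poly p z \<noteq> 0"
    using poly_eq_of_infinite[OF infinite_slit_plane, of p 0] pnz by auto
  then have o1: "reduced_ode m ?\<Theta> slit_plane (\<lambda>z. z ^ m * (exp (g z a) * poly p z))"
    by (intro exponential_solution_ode[OF has_reduction_II \<psi> l]) (auto simp: g_def intro!: holomorphic_intros)
  have "reduced_ode m (rot_poly (- \<i>) ?\<Theta>) S (\<lambda>z. (- \<i> * z) ^ m * (exp (g (- \<i> * z) a) * poly p (- \<i> * z)))"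
    unfolding S_def
    by (rule reduced_ode_rotate[OF open_slit_plane _ o1]) (auto simp: g_def intro!: holomorphic_intros)
  also have "(\<lambda>z. (- \<i> * z) ^ m * (exp (g (- \<i> * z) a) * poly p (- \<i> * z))) = (\<lambda>z. (- \<i>) ^ m * hermite_fun m (\<i> * a) q z)"
    unfolding q_def by (rule ext) (simp only: hermite_fun_rotate power_mult_distrib mult_ac)
  finally have ode0: "reduced_ode m (rot_poly (- \<i>) ?\<Theta>) S (\<lambda>z. (- \<i>) ^ m * hermite_fun m (\<i> * a) q z)" .
  let ?U = "hermite_fun m (\<i> * a) q"
  have U: "?U holomorphic_on UNIV" by (rule holomorphic_hermite_fun)
  have "deriv ?U holomorphic_on UNIV" using U by (intro holomorphic_deriv) auto
  then have fd: "?U field_differentiable at z" "deriv ?U field_differentiable at z" for z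
    using U holomorphic_on_imp_differentiable_at by blast+
  have d1: "deriv (\<lambda>z. (- \<i>) ^ m * ?U z) = (\<lambda>z. (- \<i>) ^ m * deriv ?U z)"
    by (rule ext) (simp add: fd)
  have res: "hermite_residual m (\<i> * a) q = rot_poly (- \<i>) ?\<Theta> * q"
  proof (rule poly_eq_of_infinite[OF iS])
    fix z assume z: "z \<in> S"
    have "(- \<i>) ^ m * (z * deriv (deriv ?U) z) = (- \<i>) ^ m * ((of_nat m - 1) * deriv ?U z + poly (rot_poly (- \<i>) ?\<Theta>) z * ?U z)"
      using ode0 z unfolding reduced_ode_def d1 by (simp add: fd algebra_simps)
    then have "z * deriv (deriv ?U) z = (of_nat m - 1) * deriv ?U z + poly (rot_poly (- \<i>) ?\<Theta>) z * ?U z" by simp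
    then show "poly (hermite_residual m (\<i> * a) q) z = poly (rot_poly (- \<i>) ?\<Theta> * q) z"
      unfolding hermite_fun_ode_iff[OF m S0[OF z]] by simp
  qed
  obtain h r where h: "r > 0" "h holomorphic_on ball 0 r" "h 0 = 1" "reduced_ode m ?\<Theta> (slit_plane \<inter> ball 0 r) h"
    by (rule apparent_ode[OF has_reduction_II app])
  define T where "T = (\<lambda>z. - \<i> * z) -` (slit_plane \<inter> ball 0 r)"
  have hT: "reduced_ode m (rot_poly (- \<i>) ?\<Theta>) T (\<lambda>z. h (- \<i> * z))"
    unfolding T_def
    by (rule reduced_ode_rotate[OF _ _ h(4)]) (use open_slit_plane h(2) in \<open>auto intro: holomorphic_on_subset\<close>)
  have q0: "poly q 0 \<noteq> 0" using p by (simp add: q_def poly_pcompose)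
  have qsq: "rsquarefree q"
    unfolding rsquarefree_roots
  proof safe
    fix z assume z: "poly q z = 0" "poly (pderiv q) z = 0"
    then have "poly p (- \<i> * z) = 0" "poly (pderiv p) (- \<i> * z) = 0"
      by (auto simp: q_def poly_pcompose pderiv_pcompose pderiv_pCons mult.commute)
    then show False using p(2) unfolding rsquarefree_roots by blast
  qed
  obtain v where "hermite_pair m (\<i> * a) q v (- 1)"
  proof (rule exists_hermite_pair[OF m qsq q0 res h(1)])
    have "h \<circ> (\<lambda>z. - \<i> * z) holomorphic_on ball 0 r"
      by (rule holomorphic_on_compose_gen[OF _ h(2)]) (auto intro!: holomorphic_intros simp: norm_mult)
    then show "(\<lambda>z. h (- \<i> * z)) holomorphic_on ball 0 r" by (simp add: o_def)
    show "open T" unfolding T_def by (intro open_vimage continuous_intros open_Int open_slit_plane open_ball)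
    have "\<i> * of_real (r / 2) \<in> T" using of_real_in_slit_plane[of "r / 2"] h(1) by (simp add: T_def)
    then show "T \<noteq> {}" by auto
    show "T \<subseteq> ball 0 r" by (auto simp: T_def norm_mult)
  qed (use h hT in \<open>auto simp: reduced_ode_def\<close>)
  moreover have "reduced_ode m (rot_poly (- \<i>) ?\<Theta>) UNIV ?U"
    using hermite_fun_ode[OF m res] by (simp add: reduced_ode_def)
  moreover have "degree q = n - 1" using p by (simp add: q_def degree_pcompose)
  ultimately show ?thesis using that by blast
qed

section \<open>Meromorphic functions as quotients with monomial Wronskian\<close>

text \<open>
  Used at the poles of \<open>f\<close>, which are simple as they are not critical.
\<close>

lemma deriv_nonzero_of_simple_zero:
  assumes f: "f holomorphic_on UNIV" and z: "zorder f z = 1" and nz: "\<exists>w. f w \<noteq> 0"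
  shows "deriv f z \<noteq> 0"
proof -
  obtain r where r: "r > 0" "zor_poly f z holomorphic_on cball z r"
    "\<And>w. w \<in> cball z r \<Longrightarrow> f w = zor_poly f z w * (w - z) ^ 1 \<and> zor_poly f z w \<noteq> 0"
    using zorder_exist_zero[OF f open_UNIV connected_UNIV UNIV_I, of z] nz z by auto
  have "zor_poly f z holomorphic_on ball z r" by (rule holomorphic_on_subset[OF r(2)]) auto
  then have d: "(zor_poly f z has_field_derivative deriv (zor_poly f z) z) (at z)"
    using r(1) by (intro holomorphic_derivI[of _ "ball z r"]) auto
  have "((\<lambda>w. zor_poly f z w * (w - z)) has_field_derivative zor_poly f z z) (at z)"
    by (auto intro!: derivative_eq_intros d)
  then have "(f has_field_derivative zor_poly f z z) (at z)"
    by (rule has_field_derivative_transform_within_open[of _ _ _ "ball z r"]) (use r in auto)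
  then have "deriv f z = zor_poly f z z" by (rule DERIV_imp_deriv)
  then show ?thesis using r(3)[of z] r(1) by simp
qed

lemma factor_out_zero:
  assumes f: "f holomorphic_on UNIV" and nz: "\<exists>w. f w \<noteq> 0" and f0: "f 0 = 0"
  obtains F where "F holomorphic_on UNIV" "F 0 \<noteq> 0" "\<And>z. f z = z ^ nat (zorder f 0) * F z" "zorder f 0 > 0"
proof -
  let ?n = "nat (zorder f 0)" and ?g = "zor_poly f 0"
  have "\<exists>w\<in>UNIV. f w \<noteq> 0" using nz by simp
  from zorder_exist_zero[OF f open_UNIV connected_UNIV UNIV_I[of 0] this] f0
  have zo: "zorder f 0 > 0" "\<exists>r>0. ?g holomorphic_on cball 0 r \<and>
    (\<forall>w\<in>cball 0 r. f w = ?g w * (w - 0) ^ ?n \<and> ?g w \<noteq> 0)" by simp_all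
  note pos = zo(1)
  from zo(2) obtain r where r: "r > 0" "?g holomorphic_on cball 0 r"
    "\<And>w. w \<in> cball 0 r \<Longrightarrow> f w = ?g w * (w - 0) ^ ?n \<and> ?g w \<noteq> 0" by blast
  define F where "F = (\<lambda>z. if z = 0 then ?g 0 else f z / z ^ ?n)"
  have 1: "F holomorphic_on ball 0 r"
  proof (rule holomorphic_transform)
    show "?g holomorphic_on ball 0 r" by (rule holomorphic_on_subset[OF r(2)]) auto
    show "?g w = F w" if "w \<in> ball 0 r" for w using that r(3)[of w] by (auto simp: F_def)
  qed
  have 2: "F holomorphic_on - {0}"
  proof (rule holomorphic_transform)
    show "(\<lambda>z. f z / z ^ ?n) holomorphic_on - {0}" using f by (intro holomorphic_intros) (auto intro: holomorphic_on_subset)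
  qed (auto simp: F_def)
  have u: "ball 0 r \<union> - {0} = (UNIV :: complex set)" using r(1) by auto
  have "F holomorphic_on ball 0 r \<union> - {0}" by (intro holomorphic_on_Un 1 2) auto
  then have "F holomorphic_on UNIV" unfolding u .
  moreover have "F 0 \<noteq> 0" using r by (simp add: F_def)
  moreover have "f z = z ^ ?n * F z" for z using f0 pos by (auto simp: F_def)
  ultimately show ?thesis using pos that by blast
qed

text \<open>
  In the Weierstrass factorisation \<open>f = U0 / f2\<close> the Wronskian vanishes only at the critical
  points of \<open>f\<close>, including multiple poles. It is thus \<open>z ^ (n - 1) e\<close> with an entire function
  \<open>e\<close> without zeros, and \<open>e\<close> is the square of an entire function \<open>s\<close>. Dividing numerator and
  denominator by \<open>s\<close> divides the Wronskian by \<open>s\<^sup>2 = e\<close>.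
\<close>

theorem meromorphic_wronskian_form:
  assumes f: "f nicely_meromorphic_on UNIV" and p0: "\<not> is_pole f 0" and f0: "f 0 = 0"
    and crit: "critical_points f \<subseteq> {0}"
  obtains G v where "G holomorphic_on UNIV" "G 0 \<noteq> 0"
    "wronskian_pair (\<lambda>z. z ^ (mu f + 1) * G z) v 1 (mu f + 1)"
    "\<And>z. f z = z ^ (mu f + 1) * G z / v z"
proof -
  obtain h f1 f2 where h: "h holomorphic_on UNIV" "\<And>z. h z \<noteq> 0" and f1: "f1 holomorphic_on UNIV"
    and f2: "f2 holomorphic_on UNIV" and z1: "\<And>z. f1 z = 0 \<longleftrightarrow> \<not> is_pole f z \<and> f z = 0"
    and z2: "\<And>z. f2 z = 0 \<longleftrightarrow> is_pole f z" and o1: "\<And>z. \<not> is_pole f z \<Longrightarrow> zorder f1 z = zorder f z"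
    and o2: "\<And>z. is_pole f z \<Longrightarrow> zorder f2 z = - zorder f z" and feq: "\<And>z. f z = h z * f1 z / f2 z"
    by (rule weierstrass_factorization_meromorphic_UNIV[OF f]) blast
  define n where "n = mu f + 1"
  have nz1: "\<exists>w. f1 w \<noteq> 0"
  proof (rule ccontr)
    assume "\<not> ?thesis"
    then have *: "\<And>w. \<not> is_pole f w \<and> f w = 0" using z1 by blast
    then have "f = (\<lambda>_. 0)" by auto
    then have "deriv f 1 = 0" by simp
    then have "1 \<in> critical_points f" using * by (simp add: critical_points_def)
    then show False using crit by auto
  qed
  have f10: "f1 0 = 0" using z1 p0 f0 by simp
  obtain F where F: "F holomorphic_on UNIV" "F 0 \<noteq> 0" "\<And>z. f1 z = z ^ nat (zorder f1 0) * F z" "zorder f1 0 > 0"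
    by (rule factor_out_zero[OF f1 nz1 f10]) blast
  have n: "nat (zorder f1 0) = n" using F(4) o1[OF p0] by (simp add: n_def mu_def)
  define G0 where "G0 = (\<lambda>z. h z * F z)"
  define U0 where "U0 = (\<lambda>z. z ^ n * G0 z)"
  have G0: "G0 holomorphic_on UNIV" unfolding G0_def by (intro holomorphic_intros h F)
  have U0: "U0 holomorphic_on UNIV" unfolding U0_def by (intro holomorphic_intros G0)
  have U0f: "U0 z = h z * f1 z" for z using F(3)[of z] by (simp add: U0_def G0_def n)
  have f_eq: "f z = U0 z / f2 z" for z using feq[of z] by (simp add: U0f)
  have dG: "(G0 has_field_derivative deriv G0 z) (at z)" and dU: "(U0 has_field_derivative deriv U0 z) (at z)"
    and d2: "(f2 has_field_derivative deriv f2 z) (at z)" for z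
    using G0 U0 f2 by (auto intro: holomorphic_derivI)
  \<comment> \<open>The Wronskian of \<open>U0\<close> and \<open>f2\<close> with \<open>z ^ (n - 1)\<close> factored out.\<close>
  define e where "e = (\<lambda>z. (of_nat n * G0 z + z * deriv G0 z) * f2 z - z * G0 z * deriv f2 z)"
  have w: "deriv U0 z * f2 z - U0 z * deriv f2 z = z ^ (n - 1) * e z" for z
  proof -
    have zn: "z ^ n = z ^ (n - 1) * z" by (simp add: n_def)
    have "(U0 has_field_derivative of_nat n * z ^ (n - 1) * G0 z + z ^ n * deriv G0 z) (at z)"
      unfolding U0_def by (auto intro!: derivative_eq_intros dG)
    then have "deriv U0 z = of_nat n * z ^ (n - 1) * G0 z + z ^ n * deriv G0 z" by (rule DERIV_imp_deriv)
    then show ?thesis unfolding e_def U0_def zn by (simp add: algebra_simps)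
  qed
  have enz: "e z \<noteq> 0" for z
  proof (cases "z = 0")
    case True then show ?thesis using F(2) h(2) z2[of 0] p0 of_nat_neq_0[of "mu f"] by (simp add: e_def G0_def n_def del: of_nat_Suc)
  next
    case False
    then have nc: "z \<notin> critical_points f" using crit by auto
    have "deriv U0 z * f2 z - U0 z * deriv f2 z \<noteq> 0"
    proof (cases "is_pole f z")
      case True
      have "f meromorphic_on {z}" using f by (auto simp: nicely_meromorphic_on_def intro: meromorphic_on_subset)
      then have "isolated_singularity_at f z" by (auto simp: meromorphic_on_altdef)
      then have "zorder f z < 0" using isolated_pole_imp_neg_zorder True by blast
      moreover have "\<not> zorder f z \<le> - 2" using nc True by (simp add: critical_points_def)
      ultimately have "zorder f2 z = 1" using o2[OF True] by simp
      moreover have "\<exists>w. f2 w \<noteq> 0" using z2 p0 by blast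
      ultimately have "deriv f2 z \<noteq> 0" using deriv_nonzero_of_simple_zero[OF f2] by blast
      moreover have "f2 z = 0" "U0 z \<noteq> 0" using z2[of z] z1[of z] True h(2)[of z] by (auto simp: U0f)
      ultimately show ?thesis by simp
    next
      case np: False
      then have f2z: "f2 z \<noteq> 0" using z2 by simp
      have "((\<lambda>z. U0 z / f2 z) has_field_derivative (deriv U0 z * f2 z - U0 z * deriv f2 z) / (f2 z * f2 z)) (at z)"
        using f2z by (auto intro!: derivative_eq_intros dU d2)
      moreover have "(\<lambda>z. U0 z / f2 z) = f" using f_eq by auto
      ultimately have "deriv f z = (deriv U0 z * f2 z - U0 z * deriv f2 z) / (f2 z * f2 z)" by (auto intro: DERIV_imp_deriv)
      moreover have "deriv f z \<noteq> 0" using nc np by (simp add: critical_points_def)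
      ultimately show ?thesis by auto
    qed
    then show ?thesis unfolding w by simp
  qed
  have e: "e holomorphic_on UNIV" unfolding e_def using G0 f2 by (intro holomorphic_intros holomorphic_deriv) auto
  obtain s where s: "s holomorphic_on UNIV" "\<And>z. e z = s z ^ 2"
    by (rule contractible_imp_holomorphic_sqrt[OF e contractible_UNIV enz]) simp
  have snz: "s z \<noteq> 0" for z using s(2)[of z] enz[of z] by auto
  have ds: "(s has_field_derivative deriv s z) (at z)" for z using s(1) by (auto intro: holomorphic_derivI)
  define G where "G = (\<lambda>z. G0 z / s z)"
  define v where "v = (\<lambda>z. f2 z / s z)"
  have G: "G holomorphic_on UNIV" unfolding G_def by (intro holomorphic_intros G0 s) (use snz in auto)
  have v: "v holomorphic_on UNIV" unfolding v_def by (intro holomorphic_intros f2 s) (use snz in auto)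
  have wp: "wronskian_pair (\<lambda>z. z ^ n * G z) v 1 n"
  proof
    show "(\<lambda>z. z ^ n * G z) holomorphic_on UNIV" by (intro holomorphic_intros G)
    show "v holomorphic_on UNIV" by (rule v)
    show "v 0 \<noteq> 0" using z2[of 0] p0 snz by (simp add: v_def)
    show "n \<ge> 1" by (simp add: n_def)
    fix z
    have "(\<lambda>z. z ^ n * G z) = (\<lambda>z. U0 z / s z)" by (auto simp: G_def U0_def)
    moreover have "((\<lambda>z. U0 z / s z) has_field_derivative (deriv U0 z * s z - U0 z * deriv s z) / (s z * s z)) (at z)"
      using snz by (auto intro!: derivative_eq_intros dU ds)
    ultimately have 1: "deriv (\<lambda>z. z ^ n * G z) z = (deriv U0 z * s z - U0 z * deriv s z) / (s z * s z)"
      by (auto intro: DERIV_imp_deriv)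
    have "(v has_field_derivative (deriv f2 z * s z - f2 z * deriv s z) / (s z * s z)) (at z)"
      unfolding v_def using snz by (auto intro!: derivative_eq_intros d2 ds)
    then have 2: "deriv v z = (deriv f2 z * s z - f2 z * deriv s z) / (s z * s z)" by (rule DERIV_imp_deriv)
    have 3: "z ^ n * G z = U0 z / s z" by (simp add: G_def U0_def)
    have "deriv (\<lambda>z. z ^ n * G z) z * v z - z ^ n * G z * deriv v z = (deriv U0 z * f2 z - U0 z * deriv f2 z) / (s z)^2"
      unfolding 1 2 3 using snz[of z] by (simp add: v_def divide_simps power2_eq_square) (simp add: algebra_simps)
    also have "\<dots> = 1 * z ^ (n - 1)" unfolding w s(2) using snz[of z] by simp
    finally show "deriv (\<lambda>z. z ^ n * G z) z * v z - z ^ n * G z * deriv v z = 1 * z ^ (n - 1)" .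
  qed auto
  show ?thesis
  proof (rule that[OF G])
    show "G 0 \<noteq> 0" using F(2) h(2) snz by (simp add: G_def G0_def)
    show "wronskian_pair (\<lambda>z. z ^ (mu f + 1) * G z) v 1 (mu f + 1)" using wp unfolding n_def .
    show "f z = z ^ (mu f + 1) * G z / v z" for z
      unfolding n_def[symmetric] using f_eq[of z] snz[of z] by (simp add: G_def v_def U0_def)
  qed
qed

section \<open>The potential of a Wronskian pair\<close>

context wronskian_pair begin

text \<open>
  The coefficient \<open>\<Theta>\<close> recovered from whichever of the two functions does not vanish; they have
  no common zero.
\<close>

definition potential :: "complex \<Rightarrow> complex" where
  "potential z = (if v z \<noteq> 0 then (z * deriv (deriv v) z - (of_nat n - 1) * deriv v z) / v z
     else (z * deriv (deriv U) z - (of_nat n - 1) * deriv U z) / U z)"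

lemma second_order:
  "(z * deriv (deriv U) z - (of_nat n - 1) * deriv U z) * v z = U z * (z * deriv (deriv v) z - (of_nat n - 1) * deriv v z)"
  by (rule wronskian_second_order[OF U v W n])

lemma potential_ode_v: "z * deriv (deriv v) z = (of_nat n - 1) * deriv v z + potential z * v z"
proof (cases "v z = 0")
  case True
  then have "U z \<noteq> 0" by (rule zero_of_v)
  then have "z * deriv (deriv v) z - (of_nat n - 1) * deriv v z = 0" using second_order[of z] True by simp
  then show ?thesis using True by simp
qed (simp add: potential_def)

lemma potential_ode_U: "z * deriv (deriv U) z = (of_nat n - 1) * deriv U z + potential z * U z"
proof (cases "v z = 0")
  case True
  then have "U z \<noteq> 0" by (rule zero_of_v)
  then show ?thesis using True by (simp add: potential_def)
next
  case False
  have "(z * deriv (deriv U) z - (of_nat n - 1) * deriv U z) * v z = potential z * U z * v z"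
    unfolding second_order using False by (simp add: potential_def)
  then have "z * deriv (deriv U) z - (of_nat n - 1) * deriv U z = potential z * U z" using False by simp
  then show ?thesis by (simp add: algebra_simps)
qed

lemma potential_holomorphic: "potential holomorphic_on UNIV"
proof -
  have hv: "deriv v holomorphic_on S" "deriv (deriv v) holomorphic_on S"
    and hU: "deriv U holomorphic_on S" "deriv (deriv U) holomorphic_on S" for S
    using U v by (auto intro!: holomorphic_deriv holomorphic_on_subset[of _ UNIV S])
  have oU: "open {z. U z \<noteq> 0}"
  proof -
    have "{z. U z \<noteq> 0} = U -` (- {0})" by auto
    then show ?thesis
      using holomorphic_on_imp_continuous_on[OF U] by (simp add: continuous_on_open_vimage open_Compl)
  qed
  have 1: "potential holomorphic_on {z. v z \<noteq> 0}"
  proof (rule holomorphic_transform)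
    show "(\<lambda>z. (z * deriv (deriv v) z - (of_nat n - 1) * deriv v z) / v z) holomorphic_on {z. v z \<noteq> 0}"
      by (intro holomorphic_intros hv) (auto intro: holomorphic_on_subset[OF v])
  qed (simp add: potential_def)
  have 2: "potential holomorphic_on {z. U z \<noteq> 0}"
  proof (rule holomorphic_transform)
    show "(\<lambda>z. (z * deriv (deriv U) z - (of_nat n - 1) * deriv U z) / U z) holomorphic_on {z. U z \<noteq> 0}"
      by (intro holomorphic_intros hU) (auto intro: holomorphic_on_subset[OF U])
    show "(z * deriv (deriv U) z - (of_nat n - 1) * deriv U z) / U z = potential z" if "z \<in> {z. U z \<noteq> 0}" for z
      using potential_ode_U[of z] that by (simp add: field_simps)
  qed
  have u: "{z. v z \<noteq> 0} \<union> {z. U z \<noteq> 0} = UNIV" using zero_of_v(2) by auto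
  have "potential holomorphic_on {z. v z \<noteq> 0} \<union> {z. U z \<noteq> 0}" by (intro holomorphic_on_Un 1 2 open_v oU)
  then show ?thesis unfolding u .
qed

text \<open>
  The Schwarzian determines \<open>\<Theta> / z\<close> up to a double pole, so \<open>\<Theta> - z\<^sup>3\<close> grows at most
  quadratically.
\<close>

lemma potential_cubic:
  assumes "(\<lambda>z. schwarzian quot z - (- 2 * z^2)) \<in> O[at_infinity](\<lambda>z. z)"
  obtains c0 c1 c2 where "\<And>z. potential z = z^3 + c2 * z^2 + c1 * z + c0"
proof -
  obtain C where C: "C > 0" "\<forall>\<^sub>F z in at_infinity. norm (schwarzian quot z - (- 2 * z^2)) \<le> C * norm z"
    using assms by (elim landau_o.bigE)
  then obtain \<rho> where \<rho>: "\<And>z. \<rho> \<le> norm z \<Longrightarrow> norm (schwarzian quot z - (- 2 * z^2)) \<le> C * norm z"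
    unfolding eventually_at_infinity by blast
  define \<kappa> :: complex where "\<kappa> = (of_nat n^2 - 1) / 4"
  define F where "F = (\<lambda>z. potential z - z^3)"
  have F: "F holomorphic_on UNIV" unfolding F_def by (intro holomorphic_intros potential_holomorphic)
  have bnd: "norm (F z) \<le> (C / 2 + norm \<kappa>) * norm z ^ 2" if z: "max \<rho> 1 \<le> norm z" for z
  proof -
    have z0: "z \<noteq> 0" using z by auto
    have "isCont potential z"
      using holomorphic_on_imp_continuous_on[OF potential_holomorphic] continuous_on_eq_continuous_at[OF open_UNIV] by auto
    then have "schwarzian quot z = - 2 * (potential z / z + \<kappa> / z^2)"
      unfolding \<kappa>_def by (rule schwarzian_quot[OF z0 _ potential_ode_v])
    then have "F z = - (z / 2) * (schwarzian quot z - (- 2 * z^2)) - \<kappa> / z"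
      using z0 by (simp add: F_def field_simps power2_eq_square power3_eq_cube)
    then have "norm (F z) \<le> norm (z / 2) * norm (schwarzian quot z - (- 2 * z^2)) + norm (\<kappa> / z)"
      using norm_triangle_ineq4[of "- (z / 2) * (schwarzian quot z - (- 2 * z^2))" "\<kappa> / z"] by (simp only: norm_mult norm_minus_cancel)
    also have "\<dots> \<le> norm (z / 2) * (C * norm z) + norm \<kappa> * norm z ^ 2"
    proof (intro add_mono mult_left_mono \<rho>)
      have z1: "1 \<le> norm z" using z by simp
      have "norm \<kappa> / norm z \<le> norm \<kappa> / 1" using z1 by (intro divide_left_mono) auto
      moreover have "norm \<kappa> * 1 \<le> norm \<kappa> * norm z ^ 2" using z1 by (intro mult_left_mono one_le_power) auto
      ultimately show "norm (\<kappa> / z) \<le> norm \<kappa> * norm z ^ 2" by (simp add: norm_divide)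
    qed (use z in auto)
    finally show ?thesis by (simp add: norm_divide algebra_simps power2_eq_square)
  qed
  have L: "F z = (\<Sum>k\<le>2. (deriv^^k) F 0 / fact k * z ^ k)" for z
    by (rule Liouville_polynomial[where A = "max \<rho> 1" and B = "C / 2 + norm \<kappa>" and n = 2, OF F bnd])
  show ?thesis
  proof (rule that)
    fix z
    have s: "{..2::nat} = {0, 1, 2}" by auto
    have "(\<Sum>k\<le>2. (deriv^^k) F 0 / fact k * z ^ k) = (deriv^^0) F 0 / fact 0 * z ^ 0 + (deriv^^1) F 0 / fact 1 * z ^ 1 + (deriv^^2) F 0 / fact 2 * z^2"
      unfolding s by (simp add: add.assoc)
    with L[of z] show "potential z = z^3 + (deriv^^2) F 0 / fact 2 * z^2 + deriv F 0 * z + F 0"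
      by (simp add: F_def diff_eq_eq add_ac)
  qed
qed

end

lemma subsector_0I:
  assumes z: "z \<noteq> 0" and \<delta>: "0 < \<delta>" "\<delta> < pi" and c: "cos \<delta> * norm z \<le> Re z"
  shows "z \<in> subsector 0 \<delta>"
proof -
  have zr: "z = rcis (norm z) (Arg z)" by (simp add: rcis_cmod_Arg)
  have "Re z = norm z * cos (Arg z)" by (subst zr) simp
  then have "cos \<delta> \<le> cos (Arg z)" using c z by (simp add: mult.commute)
  then have "cos \<delta> \<le> cos \<bar>Arg z\<bar>" by simp
  moreover have "\<bar>Arg z\<bar> \<le> pi" using Arg_bounded[of z] by auto
  ultimately have "\<bar>Arg z\<bar> \<le> \<delta>" using cos_monotone_0_pi[of \<delta> "\<bar>Arg z\<bar>"] \<delta> by linarith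
  then show ?thesis unfolding subsector_def using zr z by (intro CollectI exI[of _ "norm z"] exI[of _ "Arg z"]) auto
qed

lemma subsector_2I:
  assumes "- z \<in> subsector 0 \<delta>" shows "z \<in> subsector 2 \<delta>"
proof -
  obtain r t where rt: "- z = rcis r t" "r > 0" "\<bar>t\<bar> \<le> \<delta>" using assms by (auto simp: subsector_def)
  have "rcis r (t + pi) = - rcis r t" by (simp add: rcis_def cis_mult[symmetric])
  then have "z = rcis r (t + pi)" using rt(1) by (metis minus_minus)
  then show ?thesis unfolding subsector_def using rt by (intro CollectI exI[of _ r] exI[of _ "t + pi"]) auto
qed

text \<open>
  A ray on which \<open>exp (w\<^sup>2)\<close> grows eventually stays in a closed subsector of one of the sectors
  around the real axis, also after a shift of its origin.
\<close>

lemma ray_in_even_sector: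
  assumes e: "norm e = 1" and c: "0 < Re (e^2)"
  obtains k \<delta> where "k \<in> {0, 2 :: int}" "0 < \<delta>" "\<delta> < pi / 4"
    "filterlim (\<lambda>r. of_real r * e - a) (at_inf_in (subsector k \<delta>)) at_top"
proof -
  define \<sigma> :: real where "\<sigma> = (if 0 \<le> Re e then 1 else - 1)"
  define x where "x = \<bar>Re e\<bar>"
  have x\<sigma>: "\<sigma> * Re e = x" "\<sigma> = 1 \<or> \<sigma> = - 1" by (auto simp: \<sigma>_def x_def)
  have "(Re e)^2 + (Im e)^2 = 1" using e cmod_power2[of e] by simp
  moreover have "Re (e^2) = (Re e)^2 - (Im e)^2" by (simp add: power2_eq_square)
  ultimately have "x^2 > 1 / 2" using c by (simp add: x_def)
  then have "(sqrt 2 / 2)^2 < x^2" by (simp add: power_divide)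
  then have x1: "sqrt 2 / 2 < x" by (rule power_less_imp_less_base) (simp add: x_def)
  have x2: "x \<le> 1" using abs_Re_le_cmod[of e] e by (simp add: x_def)
  have s2: "sqrt 2 / 2 < 1" using real_sqrt_less_mono[of 2 4] by simp
  \<comment> \<open>The cosine of \<open>\<delta>\<close>, halfway between \<open>cos (pi / 4)\<close> and the cosine \<open>x\<close> of the angle of the
    ray with the real axis.\<close>
  define q where "q = (sqrt 2 / 2 + x) / 2"
  have q: "sqrt 2 / 2 < q" "q < x" "q < 1" using x1 x2 s2 by (auto simp: q_def field_simps)
  have q0: "0 < q" using q(1) real_sqrt_gt_zero[of 2] by linarith
  define \<delta> where "\<delta> = arccos q"
  have cd: "cos \<delta> = q" using q q0 by (simp add: \<delta>_def)
  have \<delta>: "0 \<le> \<delta>" "\<delta> \<le> pi" using q q0 by (auto simp: \<delta>_def intro!: arccos_lbound arccos_ubound)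
  have \<delta>0: "0 < \<delta>" using \<delta> cd q by (cases "\<delta> = 0") auto
  have \<delta>4: "\<delta> < pi / 4"
  proof (rule ccontr)
    assume "\<not> ?thesis"
    then have "cos \<delta> \<le> cos (pi / 4)" using \<delta> by (intro cos_monotone_0_pi_le) auto
    then show False using cd q by (simp add: cos_45)
  qed
  define k :: int where "k = (if \<sigma> = 1 then 0 else 2)"
  have nr: "norm (of_real r * e) = r" if "0 \<le> r" for r using that e by (simp add: norm_mult)
  have inf: "filterlim (\<lambda>r. of_real r * e - a) at_infinity at_top"
    unfolding filterlim_at_infinity_conv_norm_at_top
  proof (rule filterlim_at_top_mono)
    show "filterlim (\<lambda>r. r - norm a) at_top at_top" by real_asymp
    show "\<forall>\<^sub>F r in at_top. r - norm a \<le> norm (of_real r * e - a)"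
      using eventually_ge_at_top[of 0]
    proof eventually_elim
      case (elim r) then show ?case using norm_triangle_ineq2[of "of_real r * e" a] nr[of r] by linarith
    qed
  qed
  have "\<forall>\<^sub>F r in at_top. of_real r * e - a \<in> subsector k \<delta>"
    using eventually_ge_at_top[of "norm a + 1"] eventually_ge_at_top[of "2 * norm a / (x - q)"]
  proof eventually_elim
    case (elim r)
    let ?z = "of_real r * e - a"
    have "0 < x - q" using q by simp
    then have r: "2 * norm a \<le> r * (x - q)" using elim(2) by (simp add: field_simps)
    have r0: "0 \<le> r" using elim(1) norm_ge_zero[of a] by linarith
    have z0: "?z \<noteq> 0" using norm_triangle_ineq2[of "of_real r * e" a] nr[OF r0] elim(1) by auto
    have "norm ?z \<le> r + norm a" using norm_triangle_ineq4[of "of_real r * e" a] nr[OF r0] by simp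
    then have "q * norm ?z \<le> q * (r + norm a)" using q0 by (intro mult_left_mono) auto
    also have "\<dots> \<le> q * r + norm a" using q(3) q0 mult_right_mono[of q 1 "norm a"] by (simp add: algebra_simps)
    also have "\<dots> \<le> r * x - norm a" using r by (simp add: algebra_simps)
    also have "\<dots> \<le> \<sigma> * Re ?z"
    proof -
      have "\<sigma> * Re ?z = r * (\<sigma> * Re e) - \<sigma> * Re a" by (simp add: algebra_simps)
      moreover have "\<sigma> * Re a \<le> norm a" using abs_Re_le_cmod[of a] x\<sigma>(2) by auto
      ultimately show ?thesis unfolding x\<sigma>(1) by linarith
    qed
    finally have main: "cos \<delta> * norm ?z \<le> \<sigma> * Re ?z" unfolding cd .
    show ?case
    proof (cases "\<sigma> = 1")
      case True
      have "?z \<in> subsector 0 \<delta>" by (rule subsector_0I) (use z0 \<delta>0 \<delta>4 main True in auto)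
      then show ?thesis by (simp add: k_def True)
    next
      case False
      then have s: "\<sigma> = - 1" using x\<sigma>(2) by simp
      have "- ?z \<in> subsector 0 \<delta>"
      proof (rule subsector_0I)
        show "cos \<delta> * norm (- ?z) \<le> Re (- ?z)" using main unfolding s norm_minus_cancel by simp
      qed (use z0 \<delta>0 \<delta>4 in auto)
      then have "?z \<in> subsector 2 \<delta>" by (rule subsector_2I)
      then show ?thesis by (simp add: k_def s)
    qed
  qed
  then have "filterlim (\<lambda>r. of_real r * e - a) (at_inf_in (subsector k \<delta>)) at_top"
    unfolding at_inf_in_def filterlim_inf filterlim_principal using inf by blast
  then show ?thesis using that[of k \<delta>] \<delta>0 \<delta>4 by (simp add: k_def)
qed

section \<open>From the family of functions to pairs\<close>

text \<open>
  Comparing the orders of vanishing at 0 in both directions identifies the exponents.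
\<close>

lemma order_at_0_unique:
  fixes A B :: "complex \<Rightarrow> complex"
  assumes "isCont A 0" "isCont B 0" and ne: "A 0 \<noteq> 0" and eq: "\<And>z. z ^ m * A z = z ^ n * B z"
  shows "n \<le> m"
proof (rule ccontr)
  assume "\<not> n \<le> m"
  then obtain d where d: "n = m + Suc d" using less_imp_Suc_add[of m n] by auto
  have *: "A z = z ^ Suc d * B z" if "z \<noteq> 0" for z
    using eq[of z] that by (simp add: d power_add)
  have "((\<lambda>z. z ^ Suc d * B z) \<longlongrightarrow> 0 ^ Suc d * B 0) (at 0)"
    using assms(2) by (intro tendsto_intros) (auto simp: isCont_def)
  moreover have "\<forall>\<^sub>F z in at 0. z ^ Suc d * B z = A z"
    using * by (auto simp: eventually_at_filter)
  ultimately have "(A \<longlongrightarrow> 0 ^ Suc d * B 0) (at 0)" by (rule Lim_transform_eventually)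
  moreover have "(A \<longlongrightarrow> A 0) (at 0)" using assms(1) by (simp add: isCont_def)
  ultimately have "A 0 = 0 ^ Suc d * B 0" by (rule tendsto_unique[OF at_neq_bot, rotated])
  then show False using ne by simp
qed

context wronskian_pair begin

text \<open>
  Suppose that \<open>U\<close> is exponentially large along the ray. Then the derivative
  \<open>- k z ^ (n - 1) / U\<^sup>2\<close> of \<open>v / U\<close> is integrable along it, and \<open>v / U\<close> is bounded. But \<open>U / v\<close>
  tends to 0 along the ray. The two are compatible only where \<open>v\<close> vanishes and the quotient has
  the default value 0. So \<open>v\<close> would vanish on the whole end of the ray, although its zeros are
  isolated.
\<close>

lemma small_on_even_ray:
  assumes e: "norm e = 1" and c: "0 < Re (e^2)" and K: "0 < K"
    and av: "asymptotic_value quot 0 0" "asymptotic_value quot 2 0"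
  shows "\<exists>r\<ge>r1. norm (U (of_real r * e - a))^2 * r ^ N < K * exp (Re (e^2) * r^2)"
proof (rule ccontr)
  assume "\<not> ?thesis"
  then have big: "K * exp (Re (e^2) * r^2) \<le> norm (U (of_real r * e - a))^2 * r ^ N" if "r1 \<le> r" for r
    using that by (metis not_le)
  define c where "c = Re (e^2)"
  have c0: "0 < c" using assms(2) by (simp add: c_def)
  define Z where "Z = (\<lambda>r::real. of_real r * e - a)"
  \<comment> \<open>With this factor, \<open>d r ^ (n + N + 2) \<le> exp r\<close> yields the bound \<open>1 / r\<^sup>2\<close> for the
    derivative.\<close>
  define d where "d = 2 ^ n * norm k / K"
  have d0: "0 < d" using K k by (simp add: d_def)
  have "((\<lambda>x. x ^ (n + N + 2) / exp x) \<longlongrightarrow> (0::real)) at_top" by (rule tendsto_power_div_exp_0)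
  then have "\<forall>\<^sub>F x in at_top. x ^ (n + N + 2) / exp x < 1 / d"
    using d0 by (intro order_tendstoD) auto
  then obtain \<rho> where \<rho>: "\<And>x. \<rho> \<le> x \<Longrightarrow> x ^ (n + N + 2) / exp x < 1 / d"
    unfolding eventually_at_top_linorder by blast
  define r2 where "r2 = Max {r1, \<rho>, 1 / c, norm a + 1}"
  have r2: "r1 \<le> r2" "\<rho> \<le> r2" "1 / c \<le> r2" "norm a + 1 \<le> r2" by (auto simp: r2_def)
  have r21: "1 \<le> r2" using r2(4) norm_ge_zero[of a] by linarith
  have Unz: "U (Z r) \<noteq> 0" if "r1 \<le> r" "0 < r" for r
  proof -
    have "0 < K * exp (Re (e^2) * r^2)" using K by simp
    also have "\<dots> \<le> norm (U (Z r))^2 * r ^ N" using big[OF that(1)] by (simp add: Z_def)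
    finally show ?thesis by auto
  qed
  have bnd: "norm (k * Z r ^ (n - 1) / (U (Z r))^2) \<le> 1 / r^2" if r: "r2 \<le> r" for r
  proof -
    have r1: "1 \<le> r" "r1 \<le> r" "\<rho> \<le> r" "norm a \<le> r" "1 / c \<le> r" using r r2 r21 by auto
    have "norm (Z r) \<le> 2 * r" using norm_triangle_ineq4[of "of_real r * e" a] r1 e by (simp add: Z_def norm_mult)
    then have "norm (Z r) ^ (n - 1) \<le> (2 * r) ^ (n - 1)" by (intro power_mono) auto
    also have "\<dots> \<le> (2 * r) ^ n" using r1 by (intro power_increasing) auto
    finally have z: "norm (k * Z r ^ (n - 1)) \<le> norm k * (2 * r) ^ n"
      by (simp add: norm_mult norm_power mult_left_mono)
    have "1 \<le> c * r" using r1(5) c0 by (simp add: field_simps)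
    then have "1 * r \<le> c * r * r" using r1 by (intro mult_right_mono) auto
    then have "exp r \<le> exp (c * r^2)" by (simp add: power2_eq_square)
    then have "K * exp r \<le> K * exp (c * r^2)" using K by simp
    also have "\<dots> \<le> norm (U (Z r))^2 * r ^ N" using big[OF r1(2)] by (simp add: Z_def c_def)
    finally have u: "K * exp r \<le> norm (U (Z r))^2 * r ^ N" .
    have h: "d * r ^ (n + N + 2) \<le> exp r" using \<rho>[OF r1(3)] d0 by (simp add: field_simps)
    have "norm k * (2 * r) ^ n * (r^2 * r ^ N) = K * (d * r ^ (n + N + 2))"
      using K by (simp add: d_def power_mult_distrib power_add power2_eq_square)
    also have "\<dots> \<le> K * exp r" using h K by (intro mult_left_mono) auto
    also note u
    finally have "norm k * (2 * r) ^ n * r^2 * r ^ N \<le> norm (U (Z r))^2 * r ^ N" by (simp add: mult.assoc)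
    then have "norm k * (2 * r) ^ n * r^2 \<le> norm (U (Z r))^2" using r1 by (simp add: mult_le_cancel_right)
    then have "norm (k * Z r ^ (n - 1)) * r^2 \<le> norm (U (Z r))^2"
      using mult_right_mono[OF z, of "r^2"] by simp
    moreover have "0 < norm (U (Z r))^2" using Unz[OF r1(2)] r1 by simp
    ultimately show ?thesis using r1 by (simp add: norm_divide norm_power divide_simps)
  qed
  define R where "R = (\<lambda>z. v z / U z)"
  have dR: "(R has_field_derivative - (k * z ^ (n - 1) / (U z)^2)) (at z)" if "U z \<noteq> 0" for z
  proof -
    have "(R has_field_derivative (deriv v z * U z - v z * deriv U z) / (U z * U z)) (at z)"
      unfolding R_def using that by (auto intro!: derivative_eq_intros pair_derivatives)
    also have "(deriv v z * U z - v z * deriv U z) / (U z * U z) = - (k * z ^ (n - 1) / (U z)^2)"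
      unfolding W[symmetric] by (simp add: power2_eq_square minus_divide_left algebra_simps)
    finally show ?thesis .
  qed
  define B where "B = norm (R (Z r2)) + 1"
  have B0: "0 < B" using norm_ge_zero[of "R (Z r2)"] by (simp only: B_def)
  have RB: "norm (R (Z r)) \<le> B" if r: "r2 \<le> r" for r
  proof -
    have Zu: "Z r2 + of_real u * e = Z (r2 + u)" for u by (simp add: Z_def algebra_simps)
    have "norm (R (Z r2 + of_real (r - r2) * e) - R (Z r2)) \<le> - 1 / (r2 + (r - r2)) - (- 1 / (r2 + 0))"
    proof (rule norm_increment_le[where F' = "\<lambda>z. - (k * z ^ (n - 1) / (U z)^2)" and \<phi>' = "\<lambda>u. 1 / (r2 + u)^2"])
      show "0 \<le> r - r2" using r by simp
      show "(R has_field_derivative - (k * (Z r2 + of_real u * e) ^ (n - 1) / (U (Z r2 + of_real u * e))^2)) (at (Z r2 + of_real u * e))"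
        if "0 \<le> u" for u
        unfolding Zu by (rule dR[OF Unz]) (use that r2 r21 in auto)
      show "((\<lambda>u. - 1 / (r2 + u)) has_real_derivative 1 / (r2 + u)^2) (at u)" if "0 \<le> u" for u
        using that r21 by (auto intro!: derivative_eq_intros simp: power2_eq_square)
      show "norm (- (k * (Z r2 + of_real u * e) ^ (n - 1) / (U (Z r2 + of_real u * e))^2)) * norm e \<le> 1 / (r2 + u)^2" if "0 \<le> u" for u
        unfolding Zu using bnd[of "r2 + u"] that e by simp
    qed
    also have "\<dots> \<le> 1 / r2" using r r21 by (simp add: divide_simps)
    also have "\<dots> \<le> 1" using r21 by simp
    finally have "norm (R (Z r) - R (Z r2)) \<le> 1" unfolding Zu by simp
    then show ?thesis using norm_triangle_ineq2[of "R (Z r)" "R (Z r2)"] unfolding B_def by linarith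
  qed
  obtain \<kappa> \<delta> where \<kappa>: "\<kappa> \<in> {0, 2 :: int}" "0 < \<delta>" "\<delta> < pi / 4" and fl: "filterlim Z (at_inf_in (subsector \<kappa> \<delta>)) at_top"
    unfolding Z_def by (rule ray_in_even_sector[OF e assms(2)])
  have "(quot \<longlongrightarrow> 0) (at_inf_in (subsector \<kappa> \<delta>))" using av \<kappa> by (auto simp: asymptotic_value_def)
  from filterlim_compose[OF this fl] have lim: "((\<lambda>r. quot (Z r)) \<longlongrightarrow> 0) at_top" .
  have "\<forall>\<^sub>F r in at_top. norm (quot (Z r)) < 1 / B"
    using tendsto_norm[OF lim] B0 by (intro order_tendstoD[of _ "norm (0::complex)"]) auto
  then obtain r3 where r3: "\<And>r. r3 \<le> r \<Longrightarrow> norm (quot (Z r)) < 1 / B"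
    unfolding eventually_at_top_linorder by blast
  have vz: "v (Z r) = 0" if r: "r2 \<le> r" "r3 \<le> r" for r
  proof (rule ccontr)
    assume vn: "v (Z r) \<noteq> 0"
    have un: "U (Z r) \<noteq> 0" by (rule Unz) (use r r2 r21 in auto)
    have "norm (quot (Z r)) * norm (R (Z r)) = norm (quot (Z r) * R (Z r))" by (simp add: norm_mult)
    also have "quot (Z r) * R (Z r) = 1" using vn un by (simp add: quot_def R_def)
    finally have "1 = norm (quot (Z r)) * norm (R (Z r))" by simp
    also have "\<dots> \<le> norm (quot (Z r)) * B" by (intro mult_left_mono RB r) auto
    also have "\<dots> < 1" using r3[OF r(2)] B0 by (simp add: field_simps)
    finally show False by simp
  qed
  define r4 where "r4 = max r2 r3 + 1"
  have e0: "e \<noteq> 0" using e by auto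
  have "filterlim Z (at (Z r4)) (at r4)"
    unfolding filterlim_at
  proof
    show "\<forall>\<^sub>F r in at r4. Z r \<in> UNIV \<and> Z r \<noteq> Z r4"
      using e0 by (auto simp: Z_def eventually_at_filter)
    show "(Z \<longlongrightarrow> Z r4) (at r4)" unfolding Z_def by (intro tendsto_intros)
  qed
  from eventually_compose_filterlim[OF eventually_v_nonzero this]
  have "\<forall>\<^sub>F r in at r4. v (Z r) \<noteq> 0" .
  moreover have "\<forall>\<^sub>F r in at r4. r \<in> {max r2 r3<..}"
    by (rule eventually_at_in_open') (auto simp: r4_def)
  ultimately have "\<forall>\<^sub>F r in at r4. False"
    by eventually_elim (use vz in auto)
  then show False by simp
qed

text \<open>
  The shift \<open>z = w - a\<close> with \<open>a = c2 / 2\<close> completes the square in the leading terms of the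
  equation and makes it a perturbed harmonic oscillator, of which \<open>U\<close> is a recessive solution.
\<close>

theorem quasi_polynomial:
  assumes av: "asymptotic_value quot 0 0" "asymptotic_value quot 2 0"
    and cubic: "\<And>z. potential z = z^3 + c2 * z^2 + c1 * z + c0"
    and G: "G holomorphic_on UNIV" "G 0 \<noteq> 0" "U = (\<lambda>z. z ^ n * G z)"
  obtains p where "poly p 0 \<noteq> 0" "U = hermite_fun n (c2 / 2) p"
proof -
  define a where "a = c2 / 2"
  define Y where "Y = (\<lambda>w. U (w - a))"
  define \<alpha> where "\<alpha> = (\<lambda>w. (of_nat n - 1) / (w - a))"
  define \<beta> where "\<beta> = (\<lambda>w. potential (w - a) / (w - a))"
  define D where "D = 2 * real n + norm c1 + norm a^2 + norm c0"
  define r0 where "r0 = 2 * norm a + 2"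
  have dY: "deriv Y = (\<lambda>w. deriv U (w - a))"
  proof
    fix w
    have "(Y has_field_derivative deriv U (w - a) * 1) (at w)"
      unfolding Y_def by (rule DERIV_chain2[OF pair_derivatives(1)]) (auto intro!: derivative_eq_intros)
    then show "deriv Y w = deriv U (w - a)" by (simp add: DERIV_imp_deriv)
  qed
  have ddY: "deriv (deriv Y) w = deriv (deriv U) (w - a)" for w
  proof -
    have "(deriv Y has_field_derivative deriv (deriv U) (w - a) * 1) (at w)"
      unfolding dY by (rule DERIV_chain2[OF pair_derivatives(4)]) (auto intro!: derivative_eq_intros)
    then show ?thesis by (simp add: DERIV_imp_deriv)
  qed
  have far: "norm w / 2 \<le> norm (w - a)" "1 \<le> norm (w - a)" "w - a \<noteq> 0" if "r0 \<le> norm w" for w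
  proof -
    show 1: "norm w / 2 \<le> norm (w - a)" "1 \<le> norm (w - a)"
      using norm_triangle_ineq2[of w a] that norm_ge_zero[of a] unfolding r0_def by linarith+
    show "w - a \<noteq> 0" using 1(2) by auto
  qed
  interpret PO: perturbed_oscillator Y \<alpha> \<beta> D r0
  proof
    have "(\<lambda>w. w - a) holomorphic_on UNIV" by (intro holomorphic_intros)
    from holomorphic_on_compose_gen[OF this U] show "Y holomorphic_on UNIV"
      unfolding Y_def by (simp add: o_def)
    show "1 \<le> r0" by (simp add: r0_def)
    show "0 \<le> D" by (simp add: D_def)
    fix w :: complex assume w: "r0 \<le> norm w"
    show "deriv (deriv Y) w = \<alpha> w * deriv Y w + \<beta> w * Y w"
    proof -
      have "(w - a) * deriv (deriv Y) w = (of_nat n - 1) * deriv Y w + potential (w - a) * Y w"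
        using potential_ode_U[of "w - a"] unfolding ddY unfolding dY by (simp add: Y_def)
      then have "deriv (deriv Y) w = ((of_nat n - 1) * deriv Y w + potential (w - a) * Y w) / (w - a)"
        using far(3)[OF w] by (simp add: eq_divide_eq mult.commute)
      then show ?thesis by (simp add: \<alpha>_def \<beta>_def add_divide_distrib)
    qed
    have w0: "0 < norm w" using w norm_ge_zero[of a] unfolding r0_def by linarith
    show "norm (\<alpha> w) \<le> D / norm w"
    proof -
      have "(of_nat n - 1 :: complex) = of_nat (n - 1)" using n by (simp add: of_nat_diff)
      then have "norm (\<alpha> w) = real (n - 1) / norm (w - a)" by (simp add: \<alpha>_def norm_divide)
      also have "\<dots> \<le> real n / (norm w / 2)" using far(1)[OF w] w0 by (intro frac_le) auto
      also have "\<dots> = 2 * real n / norm w" by simp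
      also have "\<dots> \<le> D / norm w" using w0 by (intro divide_right_mono) (auto simp: D_def)
      finally show ?thesis .
    qed
    show "norm (\<beta> w - w^2) \<le> D"
    proof -
      have c2: "c2 = 2 * a" by (simp add: a_def)
      have "\<beta> w - w^2 = c1 - a^2 + c0 / (w - a)"
        unfolding \<beta>_def cubic using far(3)[OF w] by (simp add: c2 field_simps power2_eq_square power3_eq_cube)
      also have "norm \<dots> \<le> norm c1 + norm a^2 + norm c0"
      proof (rule order_trans[OF norm_triangle_ineq] , rule add_mono)
        show "norm (c1 - a^2) \<le> norm c1 + norm a^2" using norm_triangle_ineq4[of c1 "a^2"] by (simp add: norm_power)
        have "norm c0 / norm (w - a) \<le> norm c0 / 1" using far(2)[OF w] by (intro divide_left_mono) auto
        then show "norm (c0 / (w - a)) \<le> norm c0" by (simp add: norm_divide)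
      qed
      also have "\<dots> \<le> D" by (simp add: D_def)
      finally show ?thesis .
    qed
  qed
  obtain P where P: "\<And>w. Y w = exp (- (w^2) / 2) * poly P w"
  proof (rule PO.recessive_imp_polynomial)
    show "Y w \<noteq> 0 \<or> deriv Y w \<noteq> 0" if "r0 \<le> norm w" for w
      using W[of "w - a"] far(3)[OF that] k unfolding dY unfolding Y_def by auto
    show "\<exists>r\<ge>r1. norm (Y (of_real r * e))^2 * r ^ N < K * exp (Re (e^2) * r^2)"
      if "norm e = 1" "0 < Re (e^2)" "0 < K" for e K N r1
      unfolding Y_def by (rule small_on_even_ray[OF that av])
  qed blast
  define q where "q = smult (exp (- (a^2) / 2)) (pcompose P [:a, 1:])"
  have Uq: "U z = exp (- g z a) * poly q z" for z
  proof -
    have "U z = exp (- ((z + a)^2) / 2) * poly P (z + a)" using P[of "z + a"] by (simp add: Y_def)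
    also have "exp (- ((z + a)^2) / 2) = exp (- g z a) * exp (- (a^2) / 2)"
      unfolding exp_add[symmetric] by (rule arg_cong[where f = exp]) (simp add: g_def power2_eq_square field_simps)
    finally show ?thesis by (simp add: q_def poly_pcompose add.commute)
  qed
  have "q \<noteq> 0"
  proof
    assume "q = 0"
    then have "U = (\<lambda>_. 0)" using Uq by auto
    then have "deriv U 1 = 0" "U 1 = 0" by simp_all
    then show False using W[of 1] k by simp
  qed
  then obtain p where p: "q = [:- 0, 1:] ^ order 0 q * p" "\<not> [:- 0, 1:] dvd p"
    using order_decomp[of q 0] by blast
  define m where "m = order 0 q"
  have p0: "poly p 0 \<noteq> 0" using p(2) by (simp add: poly_eq_0_iff_dvd)
  have qm: "poly q z = z ^ m * poly p z" for z by (subst p(1)) (simp add: m_def)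
  define A where "A = (\<lambda>z. exp (- g z a) * poly p z)"
  have eq: "z ^ m * A z = z ^ n * G z" for z
    using Uq[of z] unfolding G(3) qm by (simp add: A_def)
  have cA: "isCont A 0" unfolding A_def g_def by (intro continuous_intros) auto
  have cG: "isCont G 0"
    using holomorphic_on_imp_continuous_on[OF G(1)] continuous_on_eq_continuous_at[OF open_UNIV] by auto
  have A0: "A 0 \<noteq> 0" using p0 by (simp add: A_def)
  have "n \<le> m" by (rule order_at_0_unique[OF cA cG A0 eq])
  moreover have "m \<le> n" by (rule order_at_0_unique[OF cG cA G(2) eq[symmetric]])
  ultimately have mn: "m = n" by simp
  have "U = hermite_fun n (c2 / 2) p"
    by (rule ext) (simp add: Uq qm hermite_fun_def mn a_def[symmetric])
  with p0 show ?thesis by (rule that)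
qed

end

theorem F1_imp_hermite_pair:
  assumes f: "f \<in> F1"
  obtains a p v where "hermite_pair (mu f + 1) a p v 1" "f = (\<lambda>z. hermite_fun (mu f + 1) a p z / v z)"
proof -
  define n where "n = mu f + 1"
  have F: "f nicely_meromorphic_on UNIV" "\<not> is_pole f 0" "f 0 = 0" "critical_points f \<subseteq> {0}"
    "(\<lambda>z. schwarzian f z - (- 2 * z^2)) \<in> O[at_infinity](\<lambda>z. z)"
    "asymptotic_value f 0 0" "asymptotic_value f 2 0"
    using f unfolding F1_def by auto
  obtain G v where G: "G holomorphic_on UNIV" "G 0 \<noteq> 0"
    and wp: "wronskian_pair (\<lambda>z. z ^ n * G z) v 1 n" and fe: "\<And>z. f z = z ^ n * G z / v z"
    using meromorphic_wronskian_form[OF F(1-4)] unfolding n_def by blast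
  interpret wronskian_pair "\<lambda>z. z ^ n * G z" v 1 n by (rule wp)
  have fq: "f = quot" by (rule ext) (simp only: fe quot_def)
  obtain c0 c1 c2 where cubic: "\<And>z. potential z = z^3 + c2 * z^2 + c1 * z + c0"
  proof (rule potential_cubic[OF F(5)[unfolded fq]])
    fix c0 c1 c2 assume "\<And>z. potential z = z^3 + c2 * z^2 + c1 * z + c0"
    then show thesis by (rule that)
  qed
  obtain p where p: "poly p 0 \<noteq> 0" "(\<lambda>z. z ^ n * G z) = hermite_fun n (c2 / 2) p"
    by (rule quasi_polynomial[OF F(6,7)[unfolded fq] cubic G refl])
  show ?thesis
  proof (rule that[folded n_def])
    show "hermite_pair n (c2 / 2) p v 1"
    proof
      show "1 \<le> n" by (simp add: n_def)
      show "deriv (hermite_fun n (c2 / 2) p) z * v z - hermite_fun n (c2 / 2) p z * deriv v z = 1 * z ^ (n - 1)" for z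
        using W[of z] unfolding p(2)[symmetric] .
    qed (use p(1) v in auto)
    show "f = (\<lambda>z. hermite_fun n (c2 / 2) p z / v z)"
      unfolding p(2)[symmetric] using fe by blast
  qed
qed

section \<open>From pairs to Hermite oscillators\<close>

lemma reduced_ode_subset: "reduced_ode n \<Theta> T y \<Longrightarrow> S \<subseteq> T \<Longrightarrow> reduced_ode n \<Theta> S y"
  by (auto simp: reduced_ode_def)

text \<open>
  The substitution that removes the branching, read backwards.
\<close>

lemma solution_of_reduced_ode:
  assumes "has_reduction n \<Theta> W" "y holomorphic_on UNIV" "reduced_ode n \<Theta> UNIV y"
  shows "solution W (\<lambda>z. slit_pow z ((1 - of_nat n) / 2) * y z)"
  using solution_iff_reduced_ode[OF _ assms(1), of y] assms(2,3) reduced_ode_subset[of n \<Theta> UNIV y slit_plane]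
  by (auto intro: holomorphic_on_subset)

text \<open>
  An entire solution \<open>y\<close> with \<open>y 0 \<noteq> 0\<close> corresponds to the dominant Frobenius solution, without
  a logarithm.
\<close>

lemma apparent_of_reduced_ode:
  assumes W: "has_reduction n \<Theta> W" and y: "y holomorphic_on UNIV" "reduced_ode n \<Theta> UNIV y" and y0: "y 0 \<noteq> 0"
  shows "apparent W (of_nat n / 2)"
proof -
  have e: "(1/2 - of_nat n / 2 :: complex) = (1 - of_nat n) / 2" by (simp add: field_simps)
  have s: "solution W (\<lambda>z. inverse (y 0) * (slit_pow z ((1 - of_nat n) / 2) * y z))"
    by (intro solution_cmult solution_of_reduced_ode[OF W y])
  show ?thesis unfolding apparent_def
    by (intro exI[of _ "\<lambda>z. inverse (y 0) * (slit_pow z ((1 - of_nat n) / 2) * y z)"]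
          exI[of _ "\<lambda>z. inverse (y 0) * y z"] exI[of _ 1] conjI s)
       (use y y0 in \<open>auto simp: e intro!: holomorphic_intros intro: holomorphic_on_subset\<close>)
qed

lemma exponential_solution:
  assumes W: "has_reduction n \<Theta> W" and E: "E holomorphic_on UNIV" and ode: "reduced_ode n \<Theta> UNIV (\<lambda>z. z ^ n * E z)"
  shows "solution W (\<lambda>z. slit_pow z ((of_nat n + 1) / 2) * E z)"
proof (rule solution_cong)
  show "solution W (\<lambda>z. slit_pow z ((1 - of_nat n) / 2) * (z ^ n * E z))"
    by (rule solution_of_reduced_ode[OF W _ ode]) (intro holomorphic_intros E)
  show "slit_pow z ((of_nat n + 1) / 2) * E z = slit_pow z ((1 - of_nat n) / 2) * (z ^ n * E z)" if "z \<in> slit_plane" for z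
  proof -
    have "z \<noteq> 0" using that zero_notin_slit_plane by auto
    then show ?thesis by (simp add: slit_pow_split)
  qed
qed

lemma subdominant_zero_exponential:
  assumes W: "has_reduction n \<Theta> W" and E: "E holomorphic_on UNIV" and ode: "reduced_ode n \<Theta> UNIV (\<lambda>z. z ^ n * E z)"
    and E0: "E 0 \<noteq> 0"
  shows "subdominant_zero W (of_nat n / 2) (\<lambda>z. inverse (E 0) * (slit_pow z ((of_nat n + 1) / 2) * E z))"
  unfolding subdominant_zero_def
proof
  show "solution W (\<lambda>z. inverse (E 0) * (slit_pow z ((of_nat n + 1) / 2) * E z))"
    by (intro solution_cmult exponential_solution[OF W E ode])
  have e: "(1/2 + of_nat n / 2 :: complex) = (of_nat n + 1) / 2" by (simp add: field_simps)
  have "isCont E 0"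
    using holomorphic_on_imp_continuous_on[OF E] continuous_on_eq_continuous_at[OF open_UNIV] by auto
  then have "((\<lambda>z. inverse (E 0) * E z) \<longlongrightarrow> inverse (E 0) * E 0) (at 0 within slit_plane)"
    by (intro tendsto_intros) (auto simp: isCont_def intro: tendsto_within_subset)
  then show "((\<lambda>z. inverse (E 0) * (slit_pow z ((of_nat n + 1) / 2) * E z) / slit_pow z (1/2 + of_nat n / 2)) \<longlongrightarrow> 1) (at 0 within slit_plane)"
    using E0 by (simp add: e)
qed

lemma ratio_of_entire_solutions:
  assumes W: "has_reduction n \<Theta> W" and U: "U holomorphic_on UNIV" "reduced_ode n \<Theta> UNIV U"
    and v: "v holomorphic_on UNIV" "reduced_ode n \<Theta> UNIV v"
    and ind: "\<And>c d. (\<And>z. z \<in> slit_plane \<Longrightarrow> c * U z + d * v z = 0) \<Longrightarrow> c = 0 \<and> d = 0"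
  shows "ratio_of_solutions W (\<lambda>z. U z / v z)"
proof -
  let ?s = "\<lambda>z. slit_pow z ((1 - of_nat n) / 2)"
  have "\<not> (\<lambda>z. ?s z * U z) \<cong>\<^sub>l (\<lambda>z. ?s z * v z)"
  proof
    assume "(\<lambda>z. ?s z * U z) \<cong>\<^sub>l (\<lambda>z. ?s z * v z)"
    then obtain c d where cd: "(c, d) \<noteq> (0, 0)" "\<And>z. z \<in> slit_plane \<Longrightarrow> c * (?s z * U z) + d * (?s z * v z) = 0"
      by (auto simp: lin_dep_def)
    have "c * U z + d * v z = 0" if "z \<in> slit_plane" for z
    proof -
      have "?s z * (c * U z + d * v z) = 0" using cd(2)[OF that] by (simp add: algebra_simps)
      then show ?thesis by simp
    qed
    then show False using ind[of c d] cd(1) by auto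
  qed
  then show ?thesis
    unfolding ratio_of_solutions_def
    using solution_of_reduced_ode[OF W U] solution_of_reduced_ode[OF W v]
    by (intro exI[of _ "\<lambda>z. ?s z * U z"] exI[of _ "\<lambda>z. ?s z * v z"]) auto
qed

text \<open>
  The quadratic decay of the exponential absorbs the polynomial, the power and the linear term,
  and still leaves a factor \<open>exp (- |z|)\<close>.
\<close>

lemma exponential_decay:
  assumes S: "\<And>z. z \<in> S \<Longrightarrow> z \<noteq> 0" and c: "c > 0"
    and \<phi>: "\<And>z. z \<in> S \<Longrightarrow> Re (\<phi> z) \<le> \<alpha> * norm z - c * norm z^2"
  shows "(\<lambda>z. slit_pow z ((of_nat n + 1) / 2) * exp (\<phi> z) * poly p z) \<in> O[at_inf_in S](\<lambda>z. of_real (exp (- 1 * norm z)))"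
proof -
  have "((\<lambda>z. norm (poly p z / z ^ degree p)) \<longlongrightarrow> norm (lead_coeff p)) at_infinity"
    by (intro tendsto_norm poly_divide_tendsto_aux)
  then have "\<forall>\<^sub>F z in at_infinity. norm (poly p z / z ^ degree p) < norm (lead_coeff p) + 1"
    by (rule order_tendstoD) simp
  then obtain \<rho> where \<rho>: "\<And>z. \<rho> \<le> norm z \<Longrightarrow> norm (poly p z / z ^ degree p) < norm (lead_coeff p) + 1"
    unfolding eventually_at_infinity by auto
  define B where "B = norm (lead_coeff p) + 1"
  define N where "N = n + 1 + degree p"
  define \<rho>1 where "\<rho>1 = Max {\<rho>, 1, (real N + \<alpha> + 1) / c}"
  have \<rho>1: "\<rho> \<le> \<rho>1" "1 \<le> \<rho>1" "(real N + \<alpha> + 1) / c \<le> \<rho>1" by (auto simp: \<rho>1_def)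
  show ?thesis
  proof (rule bigoI)
    show "\<forall>\<^sub>F z in at_inf_in S. norm (slit_pow z ((of_nat n + 1) / 2) * exp (\<phi> z) * poly p z) \<le> B * norm (of_real (exp (- 1 * norm z)) :: complex)"
      unfolding eventually_at_inf_in
    proof (intro exI[of _ \<rho>1] ballI impI)
      fix z assume z: "z \<in> S" "\<rho>1 \<le> norm z"
      define r where "r = norm z"
      have r: "\<rho> \<le> r" "1 \<le> r" "(real N + \<alpha> + 1) / c \<le> r" using z \<rho>1 by (auto simp: r_def)
      have z0: "z \<noteq> 0" by (rule S[OF z(1)])
      have 1: "norm (slit_pow z ((of_nat n + 1) / 2)) \<le> r ^ (n + 1)"
      proof -
        have "((of_nat n + 1) / 2 :: complex) = of_real ((real n + 1) / 2)" by simp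
        then have "norm (slit_pow z ((of_nat n + 1) / 2)) = r powr ((real n + 1) / 2)"
          using norm_slit_pow[OF z0] by (simp only: r_def)
        also have "\<dots> \<le> r powr (real (n + 1))" using r by (intro powr_mono) auto
        finally show ?thesis using r by (simp add: powr_realpow del: of_nat_add of_nat_Suc)
      qed
      have 2: "norm (poly p z) \<le> B * r ^ degree p"
        using \<rho>[of z] r z0 by (simp add: B_def r_def norm_divide norm_power field_simps)
      have 3: "norm (exp (\<phi> z)) \<le> exp (\<alpha> * r - c * r^2)" using \<phi>[OF z(1)] by (simp add: r_def)
      have B0: "B \<ge> 0" by (simp add: B_def)
      have "norm (slit_pow z ((of_nat n + 1) / 2) * exp (\<phi> z) * poly p z) \<le> r ^ (n + 1) * exp (\<alpha> * r - c * r^2) * (B * r ^ degree p)"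
        unfolding norm_mult using r B0 by (intro mult_mono 1 2 3) auto
      also have "\<dots> = B * (r ^ N * exp (\<alpha> * r - c * r^2))" by (simp add: N_def power_add)
      also have "\<dots> \<le> B * exp (- r)"
      proof (intro mult_left_mono B0)
        have "r \<le> exp r" using exp_ge_add_one_self[of r] by linarith
        then have "r ^ N \<le> exp r ^ N" using r by (intro power_mono) auto
        then have "r ^ N * exp (\<alpha> * r - c * r^2) \<le> exp (real N * r) * exp (\<alpha> * r - c * r^2)"
          by (simp add: exp_of_nat_mult)
        also have "\<dots> = exp ((real N + \<alpha> + 1) * r - c * r^2 - r)"
          by (simp add: exp_add[symmetric] algebra_simps)
        also have "\<dots> \<le> exp (- r)"
        proof -
          have "real N + \<alpha> + 1 \<le> c * r" using r(3) c by (simp add: field_simps)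
          then have "(real N + \<alpha> + 1) * r \<le> c * r * r" using r by (intro mult_right_mono) auto
          then show ?thesis by (simp add: power2_eq_square)
        qed
        finally show "r ^ N * exp (\<alpha> * r - c * r^2) \<le> exp (- r)" .
      qed
      finally show "norm (slit_pow z ((of_nat n + 1) / 2) * exp (\<phi> z) * poly p z) \<le> B * norm (of_real (exp (- 1 * norm z)) :: complex)"
        by (simp add: r_def)
    qed
  qed
qed

text \<open>
  The sector \<open>\<Omega>\<^sub>3\<close> of the oscillators is the sector \<open>\<Omega>\<^sub>-\<^sub>1\<close> of the meromorphic functions.
\<close>

lemma subsector_3: "subsector 3 \<delta> = subsector (-1) \<delta>"
proof -
  have "subsector (-1) \<delta> \<subseteq> subsector 3 \<delta>"
  proof
    fix z assume "z \<in> subsector (-1) \<delta>"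
    then obtain r t where "z = rcis r t" "r > 0" "\<bar>t - of_int (-1) * pi / 2\<bar> \<le> \<delta>" by (auto simp: subsector_def)
    moreover have "rcis r (t + 2 * pi) = rcis r t" by (simp add: rcis_def cis_mult[symmetric])
    ultimately show "z \<in> subsector 3 \<delta>" unfolding subsector_def by (intro CollectI exI[of _ r] exI[of _ "t + 2 * pi"]) (auto simp: field_simps)
  qed
  moreover have "subsector 3 \<delta> \<subseteq> subsector (-1) \<delta>"
  proof
    fix z assume "z \<in> subsector 3 \<delta>"
    then obtain r t where "z = rcis r t" "r > 0" "\<bar>t - of_int 3 * pi / 2\<bar> \<le> \<delta>" by (auto simp: subsector_def)
    moreover have "rcis r (t - 2 * pi) = rcis r t" by (simp add: rcis_def cis_divide[symmetric])
    ultimately show "z \<in> subsector (-1) \<delta>" unfolding subsector_def by (intro CollectI exI[of _ r] exI[of _ "t - 2 * pi"]) (auto simp: field_simps)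
  qed
  ultimately show ?thesis by blast
qed

lemma subsector_nonzero: "z \<in> subsector k \<delta> \<Longrightarrow> z \<noteq> 0"
  by (auto simp: subsector_def)

lemma Re_g: "\<bar>Re (g z a) - Re (z^2) / 2\<bar> \<le> norm a * norm z"
  using abs_Re_le_cmod[of "a * z"] by (simp add: g_def norm_mult)

lemma subdominant_even:
  assumes k: "k \<in> {0, 2}" and s: "solution W (\<lambda>z. slit_pow z ((of_nat n + 1) / 2) * exp (- g z a) * poly p z)"
    and p: "p \<noteq> 0"
  shows "subdominant_inf W k (\<lambda>z. slit_pow z ((of_nat n + 1) / 2) * exp (- g z a) * poly p z)"
  unfolding subdominant_inf_def
proof (intro conjI s allI impI)
  show "\<exists>z\<in>slit_plane. slit_pow z ((of_nat n + 1) / 2) * exp (- g z a) * poly p z \<noteq> 0"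
    using poly_eq_of_infinite[OF infinite_slit_plane, of p 0] p by auto
  fix \<delta> :: real assume \<delta>: "0 < \<delta> \<and> \<delta> < pi / 4"
  have "(\<lambda>z. slit_pow z ((of_nat n + 1) / 2) * exp (- g z a) * poly p z) \<in> O[at_inf_in (subsector k \<delta>)](\<lambda>z. of_real (exp (- 1 * norm z)))"
  proof (rule exponential_decay[where c = "cos (2 * \<delta>) / 2" and \<alpha> = "norm a"])
    show "cos (2 * \<delta>) / 2 > 0" using cos_double_pos \<delta> by simp
    show "Re (- g z a) \<le> norm a * norm z - cos (2 * \<delta>) / 2 * norm z^2" if "z \<in> subsector k \<delta>" for z
      using subsector_Re_square(1)[OF that _ _ k] \<delta> Re_g[of z a] by (simp add: abs_le_iff)
  qed (use subsector_nonzero in blast)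
  then show "\<exists>c>0. (\<lambda>z. slit_pow z ((of_nat n + 1) / 2) * exp (- g z a) * poly p z) \<in> O[at_inf_in (subsector k \<delta>)](\<lambda>z. of_real (exp (- c * norm z)))"
    by (intro exI[of _ 1]) simp
qed

lemma subdominant_odd:
  assumes k: "k \<in> {1, 3}" and s: "solution W (\<lambda>z. slit_pow z ((of_nat n + 1) / 2) * exp (g z a) * poly p z)"
    and p: "p \<noteq> 0"
  shows "subdominant_inf W k (\<lambda>z. slit_pow z ((of_nat n + 1) / 2) * exp (g z a) * poly p z)"
  unfolding subdominant_inf_def
proof (intro conjI s allI impI)
  show "\<exists>z\<in>slit_plane. slit_pow z ((of_nat n + 1) / 2) * exp (g z a) * poly p z \<noteq> 0"
    using poly_eq_of_infinite[OF infinite_slit_plane, of p 0] p by auto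
  fix \<delta> :: real assume \<delta>: "0 < \<delta> \<and> \<delta> < pi / 4"
  have sq: "Re (z^2) \<le> - cos (2 * \<delta>) * norm z^2" if "z \<in> subsector k \<delta>" for z
    using subsector_Re_square(2)[of z 1 \<delta>] subsector_Re_square(2)[of z "-1" \<delta>] that k \<delta> subsector_3 by auto
  have "(\<lambda>z. slit_pow z ((of_nat n + 1) / 2) * exp (g z a) * poly p z) \<in> O[at_inf_in (subsector k \<delta>)](\<lambda>z. of_real (exp (- 1 * norm z)))"
  proof (rule exponential_decay[where c = "cos (2 * \<delta>) / 2" and \<alpha> = "norm a"])
    show "cos (2 * \<delta>) / 2 > 0" using cos_double_pos \<delta> by simp
    show "Re (g z a) \<le> norm a * norm z - cos (2 * \<delta>) / 2 * norm z^2" if "z \<in> subsector k \<delta>" for z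
      using sq[OF that] Re_g[of z a] by (simp add: abs_le_iff)
  qed (use subsector_nonzero in blast)
  then show "\<exists>c>0. (\<lambda>z. slit_pow z ((of_nat n + 1) / 2) * exp (g z a) * poly p z) \<in> O[at_inf_in (subsector k \<delta>)](\<lambda>z. of_real (exp (- c * norm z)))"
    by (intro exI[of _ 1]) simp
qed

lemma lin_dep_cmult: "\<psi> \<cong>\<^sub>l (\<lambda>z. c * \<psi> z)" if "c \<noteq> 0"
  unfolding lin_dep_def using that by (intro exI[of _ c] exI[of _ "-1"]) auto

lemma lin_dep_refl: "\<psi> \<cong>\<^sub>l \<psi>"
  unfolding lin_dep_def by (intro exI[of _ 1] exI[of _ "-1"]) auto

context hermite_pair begin

lemma independent:
  assumes "\<And>z. z \<in> slit_plane \<Longrightarrow> c * U z + d * v z = 0"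
  shows "c = 0 \<and> d = 0"
proof -
  have h: "(\<lambda>z. c * U z + d * v z) holomorphic_on UNIV" using U v by (intro holomorphic_intros)
  have z: "c * U z + d * v z = 0" for z
    by (rule analytic_continuation_open[of slit_plane UNIV "\<lambda>z. c * U z + d * v z" "\<lambda>_. 0"])
       (use open_slit_plane one_in_slit_plane h assms in auto)
  have "U 0 = 0" using n by (simp add: hermite_fun_def)
  then have d: "d = 0" using z[of 0] v0 by simp
  then have "c * U z = 0" for z using z[of z] by simp
  moreover obtain z where "U z \<noteq> 0"
    using finite_zeros infinite_UNIV_char_0 by (metis (mono_tags) UNIV_eq_I mem_Collect_eq)
  ultimately show ?thesis using d by (metis mult_eq_0_iff)
qed

theorem hermite_I_of_reduced_ode:
  assumes ode: "reduced_ode n (pot_poly m n a b) UNIV U" and m: "m = degree p + 1"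
  shows "hermite_I m n a b" "ratio_of_solutions (V_I m n a b) quot"
proof -
  let ?W = "V_I m n a b" and ?\<Theta> = "pot_poly m n a b"
  have odev: "reduced_ode n ?\<Theta> UNIV v"
    using ode_v ode by (simp add: reduced_ode_def)
  define E where "E = (\<lambda>z. exp (- g z a) * poly p z)"
  have E: "E holomorphic_on UNIV" unfolding E_def g_def by (intro holomorphic_intros) auto
  have UE: "U = (\<lambda>z. z ^ n * E z)" by (rule ext) (simp add: E_def hermite_fun_def)
  have odeE: "reduced_ode n ?\<Theta> UNIV (\<lambda>z. z ^ n * E z)" using ode unfolding UE .
  have E0: "E 0 \<noteq> 0" using p0 by (simp add: E_def)
  define \<psi> where "\<psi> = (\<lambda>z. slit_pow z ((of_nat n + 1) / 2) * exp (- g z a) * poly p z)"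
  have \<psi>E: "\<psi> = (\<lambda>z. slit_pow z ((of_nat n + 1) / 2) * E z)" by (rule ext) (simp add: \<psi>_def E_def)
  have s: "solution ?W \<psi>" unfolding \<psi>E by (rule exponential_solution[OF has_reduction_I E odeE])
  show "hermite_I m n a b"
    unfolding hermite_I_def
  proof (intro conjI exI)
    show "apparent ?W (of_nat n / 2)" by (rule apparent_of_reduced_ode[OF has_reduction_I v odev v0])
    show "subdominant_inf ?W 0 \<psi>" "subdominant_inf ?W 2 \<psi>"
      using subdominant_even[OF _ s[unfolded \<psi>_def] pnz] by (auto simp: \<psi>_def)
    show "subdominant_zero ?W (of_nat n / 2) (\<lambda>z. inverse (E 0) * \<psi> z)"
      unfolding \<psi>E by (rule subdominant_zero_exponential[OF has_reduction_I E odeE E0])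
    show "\<psi> \<cong>\<^sub>l (\<lambda>z. inverse (E 0) * \<psi> z)" using E0 by (intro lin_dep_cmult) simp
    show "\<psi> \<cong>\<^sub>l \<psi>" by (rule lin_dep_refl)
    show "\<psi> \<cong>\<^sub>l (\<lambda>z. slit_pow z ((of_nat n + 1) / 2) * exp (- g z a) * poly p z)" unfolding \<psi>_def by (rule lin_dep_refl)
  qed (use m rsquarefree p0 in auto)
  have "ratio_of_solutions ?W (\<lambda>z. U z / v z)"
    by (rule ratio_of_entire_solutions[OF has_reduction_I U ode v odev independent])
  then show "ratio_of_solutions ?W quot" by (simp add: quot_def[abs_def])
qed

text \<open>
  The functions \<open>U (i z)\<close> and \<open>v (i z)\<close> play the roles of \<open>U\<close> and \<open>v\<close> for the rotated equation.
\<close>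

theorem hermite_II_of_reduced_ode:
  assumes ode: "reduced_ode n (rot_poly (- \<i>) (pot_poly_II n m' a' b)) UNIV U" and a: "a = \<i> * a'"
  shows "m' = degree p + 1 \<Longrightarrow> hermite_II n m' a' b" "ratio_of_solutions (V_II n m' a' b) (\<lambda>z. quot (\<i> * z))"
proof -
  let ?W = "V_II n m' a' b" and ?\<Theta> = "pot_poly_II n m' a' b"
  have odev: "reduced_ode n (rot_poly (- \<i>) ?\<Theta>) UNIV v"
    using ode_v ode by (simp add: reduced_ode_def)
  define U' v' where "U' = (\<lambda>z. U (\<i> * z))" and "v' = (\<lambda>z. v (\<i> * z))"
  have vim: "(\<lambda>z. \<i> * z) -` UNIV = (UNIV :: complex set)" by simp
  have odeU': "reduced_ode n ?\<Theta> UNIV U'"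
    using reduced_ode_rotate[OF open_UNIV U ode, of \<i>] unfolding U'_def rot_back vim by simp
  have odev': "reduced_ode n ?\<Theta> UNIV v'"
    using reduced_ode_rotate[OF open_UNIV v odev, of \<i>] unfolding v'_def rot_back vim by simp
  have hol: "U' holomorphic_on UNIV" "v' holomorphic_on UNIV"
    using holomorphic_on_compose_gen[of "\<lambda>z. \<i> * z" UNIV U UNIV] holomorphic_on_compose_gen[of "\<lambda>z. \<i> * z" UNIV v UNIV] U v
    unfolding U'_def v'_def o_def by (auto intro!: holomorphic_intros)
  have v'0: "v' 0 \<noteq> 0" using v0 by (simp add: v'_def)
  define q where "q = smult (\<i> ^ n) (pcompose p [:0, \<i>:])"
  define E where "E = (\<lambda>z. exp (g z a') * poly q z)"
  have E: "E holomorphic_on UNIV" unfolding E_def g_def by (intro holomorphic_intros) auto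
  have UE: "U' = (\<lambda>z. z ^ n * E z)"
  proof
    fix z
    have "- g (\<i> * z) a = g z a'" by (simp add: g_def a power_mult_distrib algebra_simps)
    then show "U' z = z ^ n * E z"
      by (simp add: U'_def E_def q_def hermite_fun_def poly_pcompose power_mult_distrib mult_ac)
  qed
  have odeE: "reduced_ode n ?\<Theta> UNIV (\<lambda>z. z ^ n * E z)" using odeU' unfolding UE .
  have q0: "poly q 0 \<noteq> 0" using p0 by (simp add: q_def poly_pcompose)
  then have E0: "E 0 \<noteq> 0" by (simp add: E_def)
  have qnz: "q \<noteq> 0" using q0 by auto
  have dq: "degree q = degree p" by (simp add: q_def degree_pcompose)
  have qsq: "rsquarefree q"
    unfolding rsquarefree_roots
  proof safe
    fix z assume z: "poly q z = 0" "poly (pderiv q) z = 0"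
    then have "poly p (\<i> * z) = 0" "poly (pderiv p) (\<i> * z) = 0"
      by (auto simp: q_def poly_pcompose pderiv_pcompose pderiv_pCons pderiv_smult mult.commute)
    then show False using rsquarefree unfolding rsquarefree_roots by blast
  qed
  define \<psi> where "\<psi> = (\<lambda>z. slit_pow z ((of_nat n + 1) / 2) * exp (g z a') * poly q z)"
  have \<psi>E: "\<psi> = (\<lambda>z. slit_pow z ((of_nat n + 1) / 2) * E z)" by (rule ext) (simp add: \<psi>_def E_def)
  have s: "solution ?W \<psi>" unfolding \<psi>E by (rule exponential_solution[OF has_reduction_II E odeE])
  show "hermite_II n m' a' b" if m': "m' = degree p + 1"
    unfolding hermite_II_def
  proof (intro conjI exI)
    show "apparent ?W (of_nat n / 2)" by (rule apparent_of_reduced_ode[OF has_reduction_II hol(2) odev' v'0])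
    show "subdominant_inf ?W 1 \<psi>" "subdominant_inf ?W 3 \<psi>"
      using subdominant_odd[OF _ s[unfolded \<psi>_def] qnz] by (auto simp: \<psi>_def)
    show "subdominant_zero ?W (of_nat n / 2) (\<lambda>z. inverse (E 0) * \<psi> z)"
      unfolding \<psi>E by (rule subdominant_zero_exponential[OF has_reduction_II E odeE E0])
    show "\<psi> \<cong>\<^sub>l (\<lambda>z. inverse (E 0) * \<psi> z)" using E0 by (intro lin_dep_cmult) simp
    show "\<psi> \<cong>\<^sub>l \<psi>" by (rule lin_dep_refl)
    show "\<psi> \<cong>\<^sub>l (\<lambda>z. slit_pow z ((of_nat n + 1) / 2) * exp (g z a') * poly q z)" unfolding \<psi>_def by (rule lin_dep_refl)
  qed (use m' dq qsq q0 in auto)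
  have "ratio_of_solutions ?W (\<lambda>z. U' z / v' z)"
  proof (rule ratio_of_entire_solutions[OF has_reduction_II hol(1) odeU' hol(2) odev'])
    fix c d assume cd: "\<And>z. z \<in> slit_plane \<Longrightarrow> c * U' z + d * v' z = 0"
    have h: "(\<lambda>z. c * U' z + d * v' z) holomorphic_on UNIV" using hol by (intro holomorphic_intros)
    have all: "c * U' z + d * v' z = 0" for z
      by (rule analytic_continuation_open[of slit_plane UNIV "\<lambda>z. c * U' z + d * v' z" "\<lambda>_. 0"])
         (use open_slit_plane one_in_slit_plane h cd in auto)
    show "c = 0 \<and> d = 0"
    proof (rule independent)
      fix z show "c * U z + d * v z = 0" using all[of "- \<i> * z"] by (simp add: U'_def v'_def)
    qed
  qed
  then show "ratio_of_solutions ?W (\<lambda>z. quot (\<i> * z))" by (simp add: quot_def U'_def v'_def)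
qed

end

section \<open>The correspondence\<close>

context hermite_pair begin

lemma reduced_ode_U: "hermite_residual n a p = pot_poly m n a b * p \<Longrightarrow> reduced_ode n (pot_poly m n a b) UNIV U"
  using hermite_fun_ode[OF n] by (simp add: reduced_ode_def)

lemma hermite_I_of_pair:
  obtains b where "hermite_I (degree p + 1) n a b" "ratio_of_solutions (V_I (degree p + 1) n a b) quot"
    "\<forall>z. z \<noteq> 0 \<longrightarrow> - (1/2) * schwarzian quot z = V_I (degree p + 1) n a b z"
proof -
  obtain b where b: "hermite_residual n a p = pot_poly (degree p + 1) n a b * p" by (rule residual_eq)
  show ?thesis
  proof (rule that)
    show "hermite_I (degree p + 1) n a b" "ratio_of_solutions (V_I (degree p + 1) n a b) quot"
      using hermite_I_of_reduced_ode[OF reduced_ode_U[OF b] refl] by auto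
    show "\<forall>z. z \<noteq> 0 \<longrightarrow> - (1/2) * schwarzian quot z = V_I (degree p + 1) n a b z"
      using schwarzian_hermite[OF b] by simp
  qed
qed

text \<open>
  The parameters of type II are obtained from those of type I by inverting the rotation.
\<close>

lemma hermite_II_of_pair:
  obtains a' b where "hermite_II n (degree p + 1) a' b"
    "ratio_of_solutions (V_II n (degree p + 1) a' b) (\<lambda>z. quot (\<i> * z))"
    "\<forall>z. z \<noteq> 0 \<longrightarrow> (1/2) * schwarzian quot (\<i> * z) = V_II n (degree p + 1) a' b z"
proof -
  let ?m = "degree p + 1"
  obtain bI where bI: "hermite_residual n a p = pot_poly ?m n a bI * p" by (rule residual_eq)
  define a' where "a' = - \<i> * a"
  have a: "a = \<i> * a'" by (simp add: a'_def)
  obtain b where b: "rot_b n ?m a' b = bI" using rot_b_surj by blast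
  have rot: "rot_poly (- \<i>) (pot_poly_II n ?m a' b) = pot_poly ?m n a bI"
    unfolding rot_pot_poly b a[symmetric] by (rule refl)
  have ode: "reduced_ode n (rot_poly (- \<i>) (pot_poly_II n ?m a' b)) UNIV U"
    unfolding rot by (rule reduced_ode_U[OF bI])
  show ?thesis
  proof (rule that)
    show "hermite_II n ?m a' b" by (rule hermite_II_of_reduced_ode(1)[OF ode a refl])
    show "ratio_of_solutions (V_II n ?m a' b) (\<lambda>z. quot (\<i> * z))" by (rule hermite_II_of_reduced_ode(2)[OF ode a])
    show "\<forall>z. z \<noteq> 0 \<longrightarrow> (1/2) * schwarzian quot (\<i> * z) = V_II n ?m a' b z"
    proof (intro allI impI)
      fix z :: complex assume z: "z \<noteq> 0"
      have "poly (pot_poly ?m n a bI) (\<i> * z) = - \<i> * poly (pot_poly_II n ?m a' b) z"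
        unfolding rot[symmetric] poly_rot_poly by simp
      moreover have "V_I ?m n a bI (\<i> * z) = poly (pot_poly ?m n a bI) (\<i> * z) / (\<i> * z) + (of_nat n^2 - 1) / 4 / (\<i> * z)^2"
        using has_reduction_I[of n ?m a bI] z unfolding has_reduction_def by simp
      moreover have "V_II n ?m a' b z = poly (pot_poly_II n ?m a' b) z / z + (of_nat n^2 - 1) / 4 / z^2"
        using has_reduction_II[of n ?m a' b] z unfolding has_reduction_def by simp
      ultimately have "V_I ?m n a bI (\<i> * z) = - V_II n ?m a' b z"
        by (simp add: power_mult_distrib)
      then show "(1/2) * schwarzian quot (\<i> * z) = V_II n ?m a' b z"
        using schwarzian_hermite[OF bI, of "\<i> * z"] z by simp
    qed
  qed
qed

end

theorem theorem3p3:
  "(\<forall>m n a b. m \<ge> 1 \<and> n \<ge> 1 \<and> hermite_I m n a b \<longrightarrow>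
      (\<exists>f. ratio_of_solutions (V_I m n a b) f \<and> f \<in> F1 \<and>
           finite (other_zeros f) \<and> m = N0 f + 1 \<and> n = mu f + 1)) \<and>
   (\<forall>m n a b. m \<ge> 1 \<and> n \<ge> 1 \<and> hermite_II m n a b \<longrightarrow>
      (\<exists>h f. ratio_of_solutions (V_II m n a b) h \<and> f = (\<lambda>z. h (- \<i> * z)) \<and> f \<in> F1 \<and>
           finite (other_zeros f) \<and> m = mu f + 1 \<and> n = N0 f + 1)) \<and>
   (\<forall>f\<in>F1.
      finite (other_zeros f) \<and>
      (\<exists>a b. hermite_I (N0 f + 1) (mu f + 1) a b \<and>
         (\<forall>z. z \<noteq> 0 \<longrightarrow> - (1/2) * schwarzian f z = V_I (N0 f + 1) (mu f + 1) a b z) \<and>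
         ratio_of_solutions (V_I (N0 f + 1) (mu f + 1) a b) f) \<and>
      (\<exists>a b. hermite_II (mu f + 1) (N0 f + 1) a b \<and>
         (\<forall>z. z \<noteq> 0 \<longrightarrow> (1/2) * schwarzian f (\<i> * z) = V_II (mu f + 1) (N0 f + 1) a b z) \<and>
         ratio_of_solutions (V_II (mu f + 1) (N0 f + 1) a b) (\<lambda>z. f (\<i> * z))))"
proof (intro conjI allI impI ballI; (elim conjE)?)
  fix m n :: nat and a b :: complex
  assume m1: "m \<ge> 1" and n1: "n \<ge> 1" and H: "hermite_I m n a b"
  obtain p v where p: "hermite_pair n a p v (-1)" "degree p = m - 1" "reduced_ode n (pot_poly m n a b) UNIV (hermite_fun n a p)"
    by (rule hermite_I_pair[OF n1 H])
  obtain s t where s: "hermite_pair n a p (\<lambda>z. s * v z + t * hermite_fun n a p z) (s * (-1))"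
    "(\<lambda>z. hermite_fun n a p z / (s * v z + t * hermite_fun n a p z)) \<in> F1"
    by (rule hermite_pair_normalise[OF p(1)])
  interpret hermite_pair n a p "\<lambda>z. s * v z + t * hermite_fun n a p z" "s * (-1)" by (rule s(1))
  have m': "m = degree p + 1" using p(2) m1 by simp
  have "quot \<in> F1" using s(2) by (simp add: quot_def[abs_def])
  moreover have "ratio_of_solutions (V_I m n a b) quot" by (rule hermite_I_of_reduced_ode(2)[OF p(3) m'])
  moreover have "m = N0 quot + 1" "finite (other_zeros quot)" using N0_quot m' by simp_all
  ultimately show "\<exists>f. ratio_of_solutions (V_I m n a b) f \<and> f \<in> F1 \<and>
           finite (other_zeros f) \<and> m = N0 f + 1 \<and> n = mu f + 1"
    using mu_quot by metis
next
  fix m n :: nat and a b :: complex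
  assume m1: "m \<ge> 1" and n1: "n \<ge> 1" and H: "hermite_II m n a b"
  obtain p v where p: "hermite_pair m (\<i> * a) p v (-1)" "degree p = n - 1"
    "reduced_ode m (rot_poly (- \<i>) (pot_poly_II m n a b)) UNIV (hermite_fun m (\<i> * a) p)"
    by (rule hermite_II_pair[OF m1 H])
  obtain s t where s: "hermite_pair m (\<i> * a) p (\<lambda>z. s * v z + t * hermite_fun m (\<i> * a) p z) (s * (-1))"
    "(\<lambda>z. hermite_fun m (\<i> * a) p z / (s * v z + t * hermite_fun m (\<i> * a) p z)) \<in> F1"
    by (rule hermite_pair_normalise[OF p(1)])
  interpret hermite_pair m "\<i> * a" p "\<lambda>z. s * v z + t * hermite_fun m (\<i> * a) p z" "s * (-1)" by (rule s(1))
  have "quot \<in> F1" using s(2) by (simp add: quot_def[abs_def])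
  moreover have "ratio_of_solutions (V_II m n a b) (\<lambda>z. quot (\<i> * z))"
    by (rule hermite_II_of_reduced_ode(2)[OF p(3) refl])
  moreover have "n = degree p + 1" using p(2) n1 by simp
  then have "n = N0 quot + 1" "finite (other_zeros quot)" using N0_quot by simp_all
  moreover have "quot = (\<lambda>z. (\<lambda>z. quot (\<i> * z)) (- \<i> * z))" by (rule ext) (simp add: mult.assoc[symmetric])
  ultimately show "\<exists>h f. ratio_of_solutions (V_II m n a b) h \<and> f = (\<lambda>z. h (- \<i> * z)) \<and> f \<in> F1 \<and>
           finite (other_zeros f) \<and> m = mu f + 1 \<and> n = N0 f + 1"
    using mu_quot[symmetric] by blast
next
  fix f assume f: "f \<in> F1"
  define n where "n = mu f + 1"
  obtain a p v where hp: "hermite_pair n a p v 1" and fe: "f = (\<lambda>z. hermite_fun n a p z / v z)"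
    using F1_imp_hermite_pair[OF f] unfolding n_def by blast
  interpret hermite_pair n a p v 1 by (rule hp)
  have fq: "f = quot" unfolding fe by (rule ext) (simp only: quot_def)
  have N: "degree p + 1 = N0 f + 1" and fin: "finite (other_zeros f)" using N0_quot fq by simp_all
  show "finite (other_zeros f)" by (rule fin)
  obtain b where "hermite_I (degree p + 1) n a b" "ratio_of_solutions (V_I (degree p + 1) n a b) quot"
    "\<forall>z. z \<noteq> 0 \<longrightarrow> - (1/2) * schwarzian quot z = V_I (degree p + 1) n a b z"
    by (rule hermite_I_of_pair)
  then show "\<exists>a b. hermite_I (N0 f + 1) (mu f + 1) a b \<and>
         (\<forall>z. z \<noteq> 0 \<longrightarrow> - (1/2) * schwarzian f z = V_I (N0 f + 1) (mu f + 1) a b z) \<and>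
         ratio_of_solutions (V_I (N0 f + 1) (mu f + 1) a b) f"
    unfolding N n_def[symmetric] fq[symmetric] by blast
  obtain a' b where "hermite_II n (degree p + 1) a' b"
    "ratio_of_solutions (V_II n (degree p + 1) a' b) (\<lambda>z. quot (\<i> * z))"
    "\<forall>z. z \<noteq> 0 \<longrightarrow> (1/2) * schwarzian quot (\<i> * z) = V_II n (degree p + 1) a' b z"
    by (rule hermite_II_of_pair)
  then show "\<exists>a b. hermite_II (mu f + 1) (N0 f + 1) a b \<and>
         (\<forall>z. z \<noteq> 0 \<longrightarrow> (1/2) * schwarzian f (\<i> * z) = V_II (mu f + 1) (N0 f + 1) a b z) \<and>
         ratio_of_solutions (V_II (mu f + 1) (N0 f + 1) a b) (\<lambda>z. f (\<i> * z))"
    unfolding N n_def[symmetric] fq[symmetric] by blast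
qed

end
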